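(* Let $\delta\in\mathbb C$ with $\Re\,\delta>-1/2$ and $\beta>0$. If $(\gamma_0,\dots,\gamma_{n-1})$ is $\eta^{(n)}_{\delta,\beta}$ distributed, then $$\Xi^{(0)}(\gamma_0)\,\Xi^{(1)}(\gamma_1)\cdots\Xi^{(n-1)}(\gamma_{n-1})$$ is a matrix model for the circular Jacobi ensemble, i.e. the density of its eigenvalues $(e^{\mathrm i\theta_1},\dots,e^{\mathrm i\theta_n})$ (in terms of the arguments $(\theta_1,\dots,\theta_n)$) is $h^{(n)}_{\delta,\beta}$.
   Context: $\mathbb D=\{|z|<1\}$, $\mathbb T=\{|z|=1\}$, $\beta'=\beta/2$; complex powers use the principal logarithm. $h^{(n)}_{\delta,\beta}$ is the probability density on $(0,2\pi)^n$ given by $$h^{(n)}_{\delta,\beta}(\theta_1,\dots,\theta_n)=c^{(n)}_{\delta,\beta}\prod_{1\le k<l\le n}|e^{\mathrm i\theta_k}-e^{\mathrm i\theta_l}|^\beta\prod_{j=1}^n(1-e^{-\mathrm i\theta_j})^{\delta}(1-e^{\mathrm i\theta_j})^{\bar\delta},$$ $c^{(n)}_{\delta,\beta}$ being the normalizing constant (the eigenvalues are taken in exchangeable random order). $\eta^{(n)}_{\delta,\beta}$ is the law on $\mathbb D^{n-1}\times\mathbb T$ under which the coordinates $\gamma_0,\dots,\gamma_{n-1}$ are independent; for $0\le k\le n-2$, $\gamma_k$ has density proportional to $(1-|z|^2)^{\beta'(n-k-1)-1}(1-z)^{\bar\delta}(1-\bar z)^{\delta}\mathbf 1_{\mathbb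 D}(z)$ with respect to Lebesgue measure $d^2z$ on $\mathbb C$; and $\gamma_{n-1}$ has density $\frac{\Gamma(1+\delta)\Gamma(1+\bar\delta)}{\Gamma(1+\delta+\bar\delta)}(1-\zeta)^{\bar\delta}(1-\bar\zeta)^{\delta}$ with respect to normalized Haar measure on $\mathbb T$. For $0\le k\le n-2$ and $\gamma\in\mathbb D$, $\Xi^{(k)}(\gamma)=\mathrm{Id}_k\oplus\Xi(\gamma)\oplus\mathrm{Id}_{n-k-2}$ with $$\Xi(\gamma)=\begin{pmatrix}\gamma&\rho e^{\mathrm i\varphi}\\ \rho&-\bar\gamma e^{\mathrm i\varphi}\end{pmatrix},\qquad\rho=\sqrt{1-|\gamma|^2},\quad e^{\mathrm i\varphi}=\frac{1-\gamma}{1-\bar\gamma},$$ and $\Xi^{(n-1)}(\gamma)=\mathrm{Id}_{n-1}\oplus(\gamma)$ for $\gamma\in\mathbb T$. *)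

theory Defs
  imports
    "HOL-Probability.Probability"
    "HOL-Combinatorics.Permutations"
    "Jordan_Normal_Form.Char_Poly"
begin

(* The two complex powers are conjugate to each other (principal branch, z = 1 being a null
   set), so their product is a nonnegative real number; Re only changes its type. *)
definition jacobi_weight :: "complex \<Rightarrow> complex \<Rightarrow> real" where
  "jacobi_weight \<delta> z = Re ((1 - z) powr cnj \<delta> * (1 - cnj z) powr \<delta>)"

(* Both normalizations by a Bochner integral below would yield the zero function if the weight
   were not integrable; for Re \<delta> > -1/2 and \<beta> > 0 the integrals are finite and positive. *)
definition circ_jacobi_weight :: "nat \<Rightarrow> complex \<Rightarrow> real \<Rightarrow> (nat \<Rightarrow> real) \<Rightarrow> real" where
  "circ_jacobi_weight n \<delta> \<beta> \<theta> =
     (if \<forall>j<n. 0 < \<theta> j \<and> \<theta> j < 2 * pi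
      then (\<Prod>k<n. \<Prod>l\<in>{k<..<n}. cmod (cis (\<theta> k) - cis (\<theta> l)) powr \<beta>) *
           (\<Prod>j<n. jacobi_weight \<delta> (cis (\<theta> j)))
      else 0)"

definition circ_jacobi_density :: "nat \<Rightarrow> complex \<Rightarrow> real \<Rightarrow> (nat \<Rightarrow> real) \<Rightarrow> real" where
  "circ_jacobi_density n \<delta> \<beta> \<theta> =
     circ_jacobi_weight n \<delta> \<beta> \<theta> /
     (\<integral>\<phi>. circ_jacobi_weight n \<delta> \<beta> \<phi> \<partial>(\<Pi>\<^sub>M j\<in>{..<n}. lborel))"

abbreviation lebesgue_disc :: "complex measure" where
  "lebesgue_disc \<equiv> restrict_space lborel (ball 0 1)"

definition haar_circle :: "complex measure" where
  "haar_circle = distr (uniform_measure lborel {0..<2 * pi}) (restrict_space borel (sphere 0 1)) cis"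

definition disc_weight :: "nat \<Rightarrow> complex \<Rightarrow> real \<Rightarrow> nat \<Rightarrow> complex \<Rightarrow> real" where
  "disc_weight n \<delta> \<beta> k z =
     (1 - (cmod z)\<^sup>2) powr (\<beta> / 2 * real (n - k - 1) - 1) * jacobi_weight \<delta> z"

definition disc_law :: "nat \<Rightarrow> complex \<Rightarrow> real \<Rightarrow> nat \<Rightarrow> complex measure" where
  "disc_law n \<delta> \<beta> k = density lebesgue_disc
     (\<lambda>z. ennreal (disc_weight n \<delta> \<beta> k z / (\<integral>w. disc_weight n \<delta> \<beta> k w \<partial>lebesgue_disc)))"

(* The Gamma quotient is a positive real number when Re \<delta> > -1/2. *)
definition circle_law :: "complex \<Rightarrow> complex measure" where
  "circle_law \<delta> = density haar_circle
     (\<lambda>z. ennreal (Re (Gamma (1 + \<delta>) * Gamma (1 + cnj \<delta>) / Gamma (1 + \<delta> + cnj \<delta>)) *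
                   jacobi_weight \<delta> z))"

definition eta_law :: "nat \<Rightarrow> complex \<Rightarrow> real \<Rightarrow> (nat \<Rightarrow> complex) measure" where
  "eta_law n \<delta> \<beta> =
     (\<Pi>\<^sub>M k\<in>{..<n}. if k = n - 1 then circle_law \<delta> else disc_law n \<delta> \<beta> k)"

definition Xi :: "complex \<Rightarrow> complex mat" where
  "Xi \<gamma> = (let \<rho> = complex_of_real (sqrt (1 - (cmod \<gamma>)\<^sup>2)); e = (1 - \<gamma>) / (1 - cnj \<gamma>)
           in mat_of_rows_list 2 [[\<gamma>, \<rho> * e], [\<rho>, - cnj \<gamma> * e]])"

definition Xi_embed :: "nat \<Rightarrow> nat \<Rightarrow> complex \<Rightarrow> complex mat" where
  "Xi_embed n k \<gamma> =
     (if k = n - 1 then diag_block_mat [1\<^sub>m (n - 1), mat_of_rows_list 1 [[\<gamma>]]]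
      else diag_block_mat [1\<^sub>m k, Xi \<gamma>, 1\<^sub>m (n - k - 2)])"

definition Xi_product :: "nat \<Rightarrow> (nat \<Rightarrow> complex) \<Rightarrow> complex mat" where
  "Xi_product n \<gamma> = foldr (*) (map (\<lambda>k. Xi_embed n k (\<gamma> k)) [0..<n]) (1\<^sub>m n)"

(* Arguments in [0, 2 pi) of the eigenvalues, listed with algebraic multiplicity. *)
definition eigenangles :: "complex mat \<Rightarrow> real list" where
  "eigenangles A = sorted_list_of_multiset (image_mset Arg2pi (proots (char_poly A)))"

(* Exchangeable random order: the sorted eigenangles of the random matrix A on M are rearranged
   by a uniformly distributed permutation that is independent of M. *)
definition has_eigenangle_density ::
    "nat \<Rightarrow> 'a measure \<Rightarrow> ('a \<Rightarrow> complex mat) \<Rightarrow> ((nat \<Rightarrow> real) \<Rightarrow> real) \<Rightarrow> bool" where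
  "has_eigenangle_density n M A f \<longleftrightarrow>
     distributed (M \<Otimes>\<^sub>M uniform_count_measure {\<sigma>. \<sigma> permutes {..<n}}) (\<Pi>\<^sub>M j\<in>{..<n}. lborel)
       (\<lambda>(\<omega>, \<sigma>). \<lambda>j\<in>{..<n}. eigenangles (A \<omega>) ! \<sigma> j) (\<lambda>\<theta>. ennreal (f \<theta>))"

end

theory Submission
  imports Defs "HOL-Complex_Analysis.Cauchy_Integral_Theorem"
begin

text \<open>
The matrix product is built one block at a time: if \<open>V\<close> is the product of the last \<open>m\<close> blocks,
then the next matrix is \<open>U = \<Xi>(\<gamma>) (1 \<oplus> V)\<close>. Let \<open>p\<close> and \<open>q\<close> be \<open>det (z - U)\<close> and the
\<open>(0,0)\<close> cofactor of \<open>z - U\<close>. The pair \<open>(p, q)\<close> is a linear function of the same pair for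
\<open>V\<close> (lemma \<open>shift_pair_step\<close>), which is a form of the Szego recursion. Since \<open>q / p\<close> is the
\<open>(0,0)\<close> entry of the resolvent, it equals \<open>\<Sum> w\<^sub>j / (z - z\<^sub>j)\<close>, where \<open>z\<^sub>j\<close> are the eigenvalues
of \<open>U\<close> and \<open>w\<^sub>j\<close> the masses of the spectral measure of the first basis vector. So a step is a map
from (eigenvalues, weights, coefficient) of size \<open>m\<close> to (eigenvalues, weights) of size \<open>m + 1\<close>.

The theorem is the marginal of a stronger statement, which is proved by induction on the size:
the eigenvalues have the circular Jacobi density, and the weights are independent of them with a
Dirichlet law of parameter \<open>\<beta> / 2\<close>. It is convenient to multiply the weights by an independent
positive scale \<open>c\<close> with density \<open>c\<close> to the power \<open>\<beta> n / 2 - 1\<close>; the scaled weights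
\<open>y\<^sub>j = c w\<^sub>j\<close> then have the product density \<open>\<Prod> y\<^sub>j\<close> to the power \<open>\<beta> / 2 - 1\<close> on the whole
orthant, and no integral over a simplex is needed. This is lemma \<open>level_law_line_integral\<close>.

For the induction step everything is moved to the real line by the Cayley transform
\<open>z = (x - \<i>) / (x + \<i>)\<close>, and the coefficient \<open>\<gamma>\<close> in the disc becomes a point \<open>a + \<i> b\<close> of the
upper half-plane. If \<open>l\<^sub>j\<close> are the old eigenvalues, \<open>x\<^sub>k\<close> the new ones and \<open>y\<^sub>j\<close> the old weights
times \<open>b\<close>, a step reads
\<open>X + a + \<Sum> y\<^sub>j (1 + l\<^sub>j X) / (l\<^sub>j - X) = \<Prod> (X - x\<^sub>k) / \<Prod> (X - l\<^sub>j)\<close>,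
and the new weights are the coefficients in the partial fraction expansion of
\<open>\<Prod> (X - l\<^sub>j) / \<Prod> (X - x\<^sub>k)\<close>. In particular \<open>x\<close> and \<open>l\<close> strictly interlace. The joint density of
\<open>(l, x)\<close> can be computed in two ways. Starting from \<open>l\<close>, the variables \<open>(y, a)\<close> are exchanged
for \<open>x\<close>, with Jacobian a quotient of Vandermonde products (lemma \<open>nn_integral_bordered_roots\<close>);
starting from \<open>x\<close>, the scaled new weights are exchanged for \<open>l\<close> and the scale, again with a
quotient of Vandermonde products (lemma \<open>nn_integral_stieltjes_roots\<close>, the change of variables
behind the Dixon-Anderson integral). Both computations give the same density \<open>step_weight\<close>,
which is the induction step (lemma \<open>line_integral_step\<close>). The exponents of the disc densities are
exactly those that make the powers of \<open>1 + l\<^sub>j\<^sup>2\<close> cancel. The factor with \<open>\<delta>\<close> comes along because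
\<open>1 - \<gamma> = \<Prod> (1 - z\<^sub>k) / \<Prod> (1 - z'\<^sub>j)\<close> for the new eigenvalues \<open>z\<close> and the old ones \<open>z'\<close>, and
interlacing keeps the arguments in the range where principal logarithms add up
(lemma \<open>jacobi_weight_multiplicative\<close>).

No normalising constant is ever evaluated: all identities are between integrals of nonnegative
functions and hold up to a factor, which is determined at the end by the total mass \<open>1\<close>.
The changes of variables are obtained from Fubini and substitutions in one real variable, by
moving one root at a time.
The random polynomials enter through their values at \<open>2, 3, 4, \<dots>\<close>, which determine them, and the
ordered eigenangles are Borel functions of these values (lemma \<open>seq_angle_measurable\<close>). Finally
the density on increasing sequences is symmetrised over the random order
(lemma \<open>nn_integral_symmetrize\<close>).
\<close>

section \<open>Substitution in one real variable\<close>

text \<open>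
On compact subintervals this is the substitution rule for continuously differentiable monotone
functions; monotone convergence extends it to open, possibly unbounded intervals.
\<close>
lemma nn_integral_subst_incr:
  fixes f :: "real \<Rightarrow> ennreal" and g g' :: "real \<Rightarrow> real" and l u :: ereal
  assumes [measurable]: "f \<in> borel_measurable borel"
    and lu: "l < u"
    and deriv: "\<And>x. x \<in> einterval l u \<Longrightarrow> (g has_real_derivative g' x) (at x)"
    and cont: "continuous_on (einterval l u) g'"
    and nonneg: "\<And>x. x \<in> einterval l u \<Longrightarrow> 0 \<le> g' x"
    and img: "g ` einterval l u = S"
  shows "(\<integral>\<^sup>+x. f x * indicator S x \<partial>lborel) =
         (\<integral>\<^sup>+x. f (g x) * ennreal (g' x) * indicator (einterval l u) x \<partial>lborel)"
proof -
  obtain b a :: "nat \<Rightarrow> real" where ab: "einterval l u = (\<Union>i. {a i..b i})"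
    "incseq b" "decseq a" "\<And>i. a i < b i"
    by (rule einterval_Icc_approximation[OF lu], rule that) assumption+
  have inI: "x \<in> einterval l u" if "x \<in> {a i..b i}" for x i
    using ab(1) that by auto
  have contg: "continuous_on {a i..b i} g" for i
    by (intro continuous_at_imp_continuous_on ballI DERIV_isCont[OF deriv] inI)
  have mono: "g x \<le> g y" if "x \<in> {a i..b i}" "y \<in> {a i..b i}" "x \<le> y" for x y i
  proof (rule DERIV_nonneg_imp_nondecreasing[OF \<open>x \<le> y\<close>])
    fix t assume "x \<le> t" "t \<le> y"
    then have "t \<in> einterval l u" using that by (intro inI[of _ i]) auto
    then show "\<exists>d. (g has_real_derivative d) (at t) \<and> 0 \<le> d" using deriv nonneg by blast
  qed
  have im: "g ` {a i..b i} = {g (a i)..g (b i)}" for i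
  proof (intro equalityI subsetI)
    fix y assume "y \<in> {g (a i)..g (b i)}"
    then show "y \<in> g ` {a i..b i}"
      using IVT'[of g "a i" y "b i"] contg[of i] ab(4)[of i] by force
  next
    fix y assume "y \<in> g ` {a i..b i}"
    then obtain x where "x \<in> {a i..b i}" "y = g x" by auto
    then show "y \<in> {g (a i)..g (b i)}"
      using mono[of "a i" i x] mono[of x i "b i"] ab(4)[of i] by auto
  qed
  have S: "S = (\<Union>i. {g (a i)..g (b i)})"
    unfolding img[symmetric] ab(1) image_UN im ..
  have inc1: "incseq (\<lambda>i. {a i..b i})"
    using ab(2,3) by (auto simp: incseq_def decseq_def)
  have inc2: "incseq (\<lambda>i. {g (a i)..g (b i)})"
    using inc1 unfolding incseq_def im[symmetric] by (intro allI impI image_mono) blast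
  have incind: "incseq (\<lambda>i x. h x * indicator (A i) x)" if "incseq A"
    for h :: "real \<Rightarrow> ennreal" and A
    unfolding incseq_def le_fun_def
  proof (intro allI impI mult_left_mono)
    fix m n :: nat and x assume "m \<le> n"
    then have "A m \<subseteq> A n" using that by (auto simp: incseq_def)
    then show "indicator (A m) x \<le> (indicator (A n) x :: ennreal)" by (auto simp: indicator_def)
  qed simp
  have ind: "indicator (\<Union>i. A i) x = (SUP i. indicator (A i) x :: ennreal)"
    for A :: "nat \<Rightarrow> real set" and x
  proof (cases "x \<in> (\<Union>i. A i)")
    case True
    then obtain i where "x \<in> A i" by auto
    then have "1 \<le> (SUP i. indicator (A i) x :: ennreal)"
      by (intro SUP_upper2[of i]) auto
    moreover have "(SUP i. indicator (A i) x :: ennreal) \<le> 1"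
      by (intro SUP_least) (auto split: split_indicator)
    ultimately have "(SUP i. indicator (A i) x :: ennreal) = 1" by (rule antisym[rotated])
    then show ?thesis using True by simp
  qed auto
  have "(\<integral>\<^sup>+x. f x * indicator S x \<partial>lborel) = (\<integral>\<^sup>+x. (SUP i. f x * indicator {g (a i)..g (b i)} x) \<partial>lborel)"
    unfolding S ind by (simp add: SUP_mult_left_ennreal)
  also have "\<dots> = (SUP i. \<integral>\<^sup>+x. f x * indicator {g (a i)..g (b i)} x \<partial>lborel)"
    by (intro nn_integral_monotone_convergence_SUP incind inc2) simp
  also have "\<dots> = (SUP i. \<integral>\<^sup>+x. f (g x) * ennreal (g' x) * indicator {a i..b i} x \<partial>lborel)"
  proof (intro SUP_cong refl nn_integral_substitution_aux)
    fix i
    show "continuous_on {a i..b i} g'"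
      by (rule continuous_on_subset[OF cont]) (use inI in blast)
  qed (use deriv nonneg inI ab(4) in simp_all)
  also have "\<dots> = (\<integral>\<^sup>+x. (SUP i. f (g x) * ennreal (g' x) * indicator {a i..b i} x) \<partial>lborel)"
  proof (rule nn_integral_monotone_convergence_SUP[symmetric])
    show "incseq (\<lambda>i x. f (g x) * ennreal (g' x) * indicator {a i..b i} x)"
      by (intro incind inc1)
  next
    fix i
    have "set_borel_measurable borel {a i..b i} g" "set_borel_measurable borel {a i..b i} g'"
      unfolding set_borel_measurable_def using inI
      by (intro borel_measurable_continuous_on_indicator contg continuous_on_subset[OF cont] subsetI; simp)+
    then have [measurable]: "(\<lambda>x. indicator {a i..b i} x * g x) \<in> borel_measurable borel"
      "(\<lambda>x. indicator {a i..b i} x * g' x) \<in> borel_measurable borel"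
      by (simp_all add: set_borel_measurable_def)
    have "(\<lambda>x. f (g x) * ennreal (g' x) * indicator {a i..b i} x) =
      (\<lambda>x. f (indicator {a i..b i} x * g x) * ennreal (indicator {a i..b i} x * g' x) * indicator {a i..b i} x)"
      by (auto simp: fun_eq_iff split: split_indicator)
    also have "\<dots> \<in> borel_measurable lborel" by measurable
    finally show "(\<lambda>x. f (g x) * ennreal (g' x) * indicator {a i..b i} x) \<in> borel_measurable lborel" .
  qed
  also have "\<dots> = (\<integral>\<^sup>+x. f (g x) * ennreal (g' x) * indicator (einterval l u) x \<partial>lborel)"
    unfolding ab(1) ind by (simp add: SUP_mult_left_ennreal)
  finally show ?thesis .
qed

text \<open>
Apply the increasing case to \<open>- g\<close>. The image is an interval, hence Borel.
\<close>
lemma nn_integral_subst_decr: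
  fixes f :: "real \<Rightarrow> ennreal" and g g' :: "real \<Rightarrow> real" and l u :: ereal
  assumes [measurable]: "f \<in> borel_measurable borel"
    and lu: "l < u"
    and deriv: "\<And>x. x \<in> einterval l u \<Longrightarrow> (g has_real_derivative - g' x) (at x)"
    and cont: "continuous_on (einterval l u) g'"
    and nonneg: "\<And>x. x \<in> einterval l u \<Longrightarrow> 0 \<le> g' x"
    and img: "g ` einterval l u = S"
  shows "(\<integral>\<^sup>+x. f x * indicator S x \<partial>lborel) =
         (\<integral>\<^sup>+x. f (g x) * ennreal (g' x) * indicator (einterval l u) x \<partial>lborel)"
proof -
  have "is_interval (einterval l u)"
    unfolding is_interval_1
  proof (intro ballI allI impI)
    fix a b x assume "a \<in> einterval l u" "b \<in> einterval l u" "a \<le> x \<and> x \<le> b"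
    then show "x \<in> einterval l u"
      using less_le_trans[of l "ereal a" "ereal x"] le_less_trans[of "ereal x" "ereal b" u]
      by (simp add: einterval_def)
  qed
  then have "connected (g ` einterval l u)"
    by (intro connected_continuous_image continuous_at_imp_continuous_on ballI DERIV_isCont[OF deriv])
       (auto simp: is_interval_connected)
  then have S: "S \<in> sets borel"
    using img real_interval_borel_measurable[of S] by (simp add: is_interval_connected_1)
  then have [measurable]: "(\<lambda>x. indicator S x :: ennreal) \<in> borel_measurable borel" by auto
  have ind: "indicator S (- x) = (indicator (uminus ` S) x :: ennreal)" for x
  proof -
    have "- x \<in> S \<longleftrightarrow> x \<in> uminus ` S" by force
    then show ?thesis by (simp add: indicator_def)
  qed
  have "(\<integral>\<^sup>+x. f x * indicator S x \<partial>lborel) = (\<integral>\<^sup>+x. f (- x) * indicator S (- x) \<partial>lborel)"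
    using nn_integral_real_affine[of "\<lambda>x. f x * indicator S x" "-1" 0] by simp
  also have "\<dots> = (\<integral>\<^sup>+x. f (- x) * indicator (uminus ` S) x \<partial>lborel)"
    unfolding ind ..
  also have "\<dots> = (\<integral>\<^sup>+x. f (- (- g x)) * ennreal (g' x) * indicator (einterval l u) x \<partial>lborel)"
  proof (rule nn_integral_subst_incr[where f="\<lambda>x. f (-x)" and g="\<lambda>x. - g x", OF _ lu _ cont nonneg])
    show "((\<lambda>x. - g x) has_real_derivative g' x) (at x)" if "x \<in> einterval l u" for x
      using DERIV_minus[OF deriv[OF that]] by simp
    show "(\<lambda>x. - g x) ` einterval l u = uminus ` S"
      unfolding img[symmetric] image_image ..
  qed auto
  finally show ?thesis by simp
qed

section \<open>Lebesgue measure on finite real sequences\<close>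

text \<open>
A real sequence of length \<open>m\<close> is a function on \<open>{..<m}\<close>, extended by \<^term>\<open>undefined\<close>. A carrier of this
kind, rather than a type of fixed dimension, allows induction on \<open>m\<close>.
\<close>
abbreviation lebesgue_pow :: "nat \<Rightarrow> (nat \<Rightarrow> real) measure" where
  "lebesgue_pow m \<equiv> \<Pi>\<^sub>M j\<in>{..<m}. lborel"

section \<open>Lebesgue measure on finite real sequences\<close>

text \<open>
A real sequence of length \<open>m\<close> is a function on \<open>{..<m}\<close>, extended by \<^term>\<open>undefined\<close>. A carrier of this
kind, rather than a type of fixed dimension, allows induction on \<open>m\<close>.
\<close>
interpretation lebesgue_pow: product_sigma_finite "\<lambda>_::nat. lborel :: real measure"
  by standard

lemma sigma_finite_lebesgue_pow: "sigma_finite_measure (lebesgue_pow m)"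
  by (rule lebesgue_pow.sigma_finite) simp

lemma measurable_into_PiM:
  assumes "\<And>i. i \<in> I \<Longrightarrow> (\<lambda>x. h x i) \<in> measurable M (N i)"
    and "\<And>x i. x \<in> space M \<Longrightarrow> i \<notin> I \<Longrightarrow> h x i = undefined"
  shows "h \<in> measurable M (PiM I N)"
  by (rule measurable_PiM_single')
     (use assms in \<open>auto simp: space_PiM PiE_def extensional_def dest: measurable_space\<close>)

text \<open>
Appending a last coordinate; together with \<open>nn_integral_lebesgue_pow_Suc\<close> this is how all inductions
on the dimension proceed.
\<close>
lemma measurable_fun_upd_lebesgue_pow [measurable (raw)]:
  assumes [measurable]: "f \<in> measurable M (lebesgue_pow m)" "g \<in> borel_measurable M"
  shows "(\<lambda>x. (f x)(m := g x)) \<in> measurable M (lebesgue_pow (Suc m))"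
  unfolding lessThan_Suc by (rule measurable_fun_upd[where J="{..<m}"]) auto

lemma nn_integral_lebesgue_pow_Suc:
  assumes "f \<in> borel_measurable (lebesgue_pow (Suc m))"
  shows "(\<integral>\<^sup>+x. f x \<partial>lebesgue_pow (Suc m)) = (\<integral>\<^sup>+x. \<integral>\<^sup>+t. f (x(m := t)) \<partial>lborel \<partial>lebesgue_pow m)"
  using assms unfolding lessThan_Suc by (subst lebesgue_pow.product_nn_integral_insert) auto

lemma nn_integral_lebesgue_pow_Suc_rev:
  assumes "f \<in> borel_measurable (lebesgue_pow (Suc m))"
  shows "(\<integral>\<^sup>+x. f x \<partial>lebesgue_pow (Suc m)) = (\<integral>\<^sup>+t. \<integral>\<^sup>+x. f (x(m := t)) \<partial>lebesgue_pow m \<partial>lborel)"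
  using assms unfolding lessThan_Suc by (subst lebesgue_pow.product_nn_integral_insert_rev) auto

lemma nn_integral_swap:
  assumes "sigma_finite_measure M" "sigma_finite_measure N"
    and "(\<lambda>(x, y). f x y) \<in> borel_measurable (M \<Otimes>\<^sub>M N)"
  shows "(\<integral>\<^sup>+x. \<integral>\<^sup>+y. f x y \<partial>N \<partial>M) = (\<integral>\<^sup>+y. \<integral>\<^sup>+x. f x y \<partial>M \<partial>N)"
proof -
  interpret pair_sigma_finite M N using assms by (simp add: pair_sigma_finite_def)
  show ?thesis using Fubini'[of f] assms(3) by simp
qed

lemma nn_integral_lebesgue_pow_scale:
  assumes [measurable]: "F \<in> borel_measurable (lebesgue_pow m)" and "\<And>j. j < m \<Longrightarrow> 0 < c j"
  shows "(\<integral>\<^sup>+w. F w \<partial>lebesgue_pow m) =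
         (\<integral>\<^sup>+v. F (\<lambda>j\<in>{..<m}. c j * v j) * ennreal (\<Prod>j<m. c j) \<partial>lebesgue_pow m)"
  using assms
proof (induction m arbitrary: F)
  case 0
  show ?case by (simp add: PiM_empty nn_integral_count_space_finite)
next
  case (Suc m)
  note [measurable] = Suc.prems(1)
  let ?P = "\<Prod>j<m. c j"
  have P: "0 \<le> ?P" "0 < c m" using Suc.prems(2) by (auto intro!: prod_nonneg simp: less_imp_le)
  have "(\<integral>\<^sup>+w. F w \<partial>lebesgue_pow (Suc m)) = (\<integral>\<^sup>+w. \<integral>\<^sup>+t. F (w(m := t)) \<partial>lborel \<partial>lebesgue_pow m)"
    by (rule nn_integral_lebesgue_pow_Suc) fact
  also have "\<dots> = (\<integral>\<^sup>+w. \<integral>\<^sup>+t. F (w(m := c m * t)) * ennreal (c m) \<partial>lborel \<partial>lebesgue_pow m)"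
  proof (rule nn_integral_cong)
    fix w assume "w \<in> space (lebesgue_pow m)"
    then have [measurable]: "(\<lambda>t. F (w(m := t))) \<in> borel_measurable borel"
      by measurable
    show "(\<integral>\<^sup>+t. F (w(m := t)) \<partial>lborel) = (\<integral>\<^sup>+t. F (w(m := c m * t)) * ennreal (c m) \<partial>lborel)"
      using P(2) nn_integral_real_affine[of "\<lambda>t. F (w(m := t))" "c m" 0]
      by (simp add: nn_integral_cmult mult.commute nn_integral_multc)
  qed
  also have "\<dots> = (\<integral>\<^sup>+v. (\<integral>\<^sup>+t. F ((\<lambda>j\<in>{..<m}. c j * v j)(m := c m * t)) * ennreal (c m) \<partial>lborel) * ennreal ?P \<partial>lebesgue_pow m)"
    by (rule Suc.IH, measurable) (simp add: Suc.prems(2))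
  also have "\<dots> = (\<integral>\<^sup>+v. (\<integral>\<^sup>+t. F ((\<lambda>j\<in>{..<m}. c j * v j)(m := c m * t)) * ennreal (\<Prod>j<Suc m. c j) \<partial>lborel) \<partial>lebesgue_pow m)"
  proof (rule nn_integral_cong)
    fix v assume [measurable]: "v \<in> space (lebesgue_pow m)"
    have [measurable]: "(\<lambda>j\<in>{..<m}. c j * v j) \<in> space (lebesgue_pow m)"
      by (simp add: space_PiM)
    have "ennreal (\<Prod>j<Suc m. c j) = ennreal (c m) * ennreal ?P"
      using P by (simp add: ennreal_mult mult.commute)
    then show "(\<integral>\<^sup>+t. F ((\<lambda>j\<in>{..<m}. c j * v j)(m := c m * t)) * ennreal (c m) \<partial>lborel) * ennreal ?P =
      (\<integral>\<^sup>+t. F ((\<lambda>j\<in>{..<m}. c j * v j)(m := c m * t)) * ennreal (\<Prod>j<Suc m. c j) \<partial>lborel)"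
      by (subst nn_integral_multc[symmetric], measurable) (simp add: mult.assoc)
  qed
  also have "\<dots> = (\<integral>\<^sup>+v. F (\<lambda>j\<in>{..<Suc m}. c j * v j) * ennreal (\<Prod>j<Suc m. c j) \<partial>lebesgue_pow (Suc m))"
  proof (subst nn_integral_lebesgue_pow_Suc)
    have "(\<lambda>j\<in>{..<m}. c j * v j)(m := c m * t) = (\<lambda>j\<in>{..<Suc m}. c j * (v(m := t)) j)" for v t
      by (auto simp: fun_eq_iff)
    then show "(\<integral>\<^sup>+v. (\<integral>\<^sup>+t. F ((\<lambda>j\<in>{..<m}. c j * v j)(m := c m * t)) * ennreal (\<Prod>j<Suc m. c j) \<partial>lborel) \<partial>lebesgue_pow m) =
       (\<integral>\<^sup>+v. \<integral>\<^sup>+t. F (\<lambda>j\<in>{..<Suc m}. c j * (v(m := t)) j) * ennreal (\<Prod>j<Suc m. c j) \<partial>lborel \<partial>lebesgue_pow m)"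
      by simp
  next
    have [measurable]: "(\<lambda>v. \<lambda>j\<in>{..<Suc m}. c j * v j) \<in> measurable (lebesgue_pow (Suc m)) (lebesgue_pow (Suc m))"
      by (rule measurable_restrict) simp
    show "(\<lambda>v. F (\<lambda>j\<in>{..<Suc m}. c j * v j) * ennreal (\<Prod>j<Suc m. c j)) \<in> borel_measurable (lebesgue_pow (Suc m))"
      by measurable
  qed
  finally show ?case .
qed

section \<open>Partial fractions with real roots and poles\<close>

text \<open>
The residue at the pole \<open>a\<^sub>j\<close> of \<open>\<Prod>k<m. (x - r\<^sub>k) / (x - a\<^sub>k)\<close>.
\<close>
definition residue_at :: "nat \<Rightarrow> (nat \<Rightarrow> 'a::field) \<Rightarrow> (nat \<Rightarrow> 'a) \<Rightarrow> nat \<Rightarrow> 'a" where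
  "residue_at m r a j = (\<Prod>k<m. a j - r k) / (\<Prod>k\<in>{..<m}-{j}. a j - a k)"

lemma residue_at_Suc:
  assumes "j < m"
  shows "residue_at (Suc m) r a j = residue_at m r a j * ((a j - r m) / (a j - a m))"
proof -
  have "{..<Suc m} - {j} = insert m ({..<m} - {j})" using assms by auto
  then show ?thesis by (simp add: residue_at_def)
qed

lemma residue_at_last:
  "residue_at (Suc m) r a m = (a m - r m) * ((\<Prod>k<m. a m - r k) / (\<Prod>k<m. a m - a k))"
proof -
  have "{..<Suc m} - {m} = {..<m}" by auto
  then show ?thesis by (simp add: residue_at_def)
qed

lemma residue_at_cong:
  "(\<And>k. k < m \<Longrightarrow> r k = r' k) \<Longrightarrow> residue_at m r a j = residue_at m r' a j"
  by (simp add: residue_at_def)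

lemma partial_fraction_two:
  fixes x t u v :: "'a::field"
  assumes "x \<noteq> u" "x \<noteq> v" "u \<noteq> v"
  shows "(x - t) / ((x - u) * (x - v)) = (u - t) / (u - v) / (x - u) + (v - t) / (v - u) / (x - v)"
proof -
  have ne: "x - u \<noteq> 0" "x - v \<noteq> 0" "v - u \<noteq> 0" using assms by auto
  have neg: "(u - t) / (u - v) = (t - u) / (v - u)" using minus_divide_divide[of "u - t" "u - v"] by (simp only: minus_diff_eq)
  have "(x - t) * (v - u) = (t - u) * (x - v) + (v - t) * (x - u)"
    by (simp add: algebra_simps)
  then have "(x - t) = ((t - u) * (x - v) + (v - t) * (x - u)) / (v - u)"
    using ne by (simp add: eq_divide_eq)
  then show ?thesis unfolding neg using ne
    by (simp add: add_divide_distrib mult_ac)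
qed

text \<open>
Multiplying by one more factor \<open>(x - r\<^sub>m) / (x - a\<^sub>m)\<close> splits every old term \<open>1 / (x - a\<^sub>j)\<close> by
\<open>partial_fraction_two\<close>. The contributions at the new pole add up to the old function evaluated at
\<open>a\<^sub>m\<close>, so the induction hypothesis is used twice, at \<open>x\<close> and at \<open>a\<^sub>m\<close>.
\<close>
lemma partial_fractions:
  fixes a r :: "nat \<Rightarrow> 'a::field"
  assumes "inj_on a {..<m}" and "\<And>j. j < m \<Longrightarrow> x \<noteq> a j"
  shows "(\<Prod>k<m. x - r k) / (\<Prod>k<m. x - a k) = 1 + (\<Sum>j<m. residue_at m r a j / (x - a j))"
  using assms
proof (induction m arbitrary: x)
  case (Suc m)
  have inj: "inj_on a {..<m}" using Suc.prems(1) by (rule inj_on_subset) auto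
  have am: "a m \<noteq> a j" if "j < m" for j
    using inj_onD[OF Suc.prems(1), of m j] that by auto
  let ?\<rho> = "residue_at m r a"
  have x: "x \<noteq> a m" "\<And>j. j < m \<Longrightarrow> x \<noteq> a j" using Suc.prems(2) by auto
  have IHx: "(\<Prod>k<m. x - r k) / (\<Prod>k<m. x - a k) = 1 + (\<Sum>j<m. ?\<rho> j / (x - a j))"
    by (rule Suc.IH[OF inj x(2)])
  have IHa: "(\<Prod>k<m. a m - r k) / (\<Prod>k<m. a m - a k) = 1 + (\<Sum>j<m. ?\<rho> j / (a m - a j))"
    by (rule Suc.IH[OF inj am])
  have "(\<Prod>k<Suc m. x - r k) / (\<Prod>k<Suc m. x - a k) =
      (1 + (\<Sum>j<m. ?\<rho> j / (x - a j))) * ((x - r m) / (x - a m))"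
    unfolding IHx[symmetric] by simp
  also have "\<dots> = (x - r m) / (x - a m) + (\<Sum>j<m. ?\<rho> j / (x - a j) * ((x - r m) / (x - a m)))"
    by (simp only: distrib_right sum_distrib_right mult_1_left)
  also have "(\<Sum>j<m. ?\<rho> j / (x - a j) * ((x - r m) / (x - a m))) =
    (\<Sum>j<m. ?\<rho> j * ((a j - r m) / (a j - a m)) / (x - a j) + ?\<rho> j / (a m - a j) * ((a m - r m) / (x - a m)))"
  proof (rule sum.cong[OF refl])
    fix j assume "j \<in> {..<m}"
    then have "?\<rho> j * ((x - r m) / ((x - a j) * (x - a m))) = ?\<rho> j * ((a j - r m) / (a j - a m) / (x - a j) + (a m - r m) / (a m - a j) / (x - a m))"
      using x am by (subst partial_fraction_two) (auto simp: eq_commute[of "a j"])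
    then show "?\<rho> j / (x - a j) * ((x - r m) / (x - a m)) = ?\<rho> j * ((a j - r m) / (a j - a m)) / (x - a j) + ?\<rho> j / (a m - a j) * ((a m - r m) / (x - a m))"
      by (simp add: distrib_left)
  qed
  also have "\<dots> = (\<Sum>j<m. residue_at (Suc m) r a j / (x - a j)) + (\<Sum>j<m. ?\<rho> j / (a m - a j)) * ((a m - r m) / (x - a m))"
    by (simp only: sum.distrib sum_distrib_right) (simp add: residue_at_Suc)
  also have "(\<Sum>j<m. ?\<rho> j / (a m - a j)) = (\<Prod>k<m. a m - r k) / (\<Prod>k<m. a m - a k) - 1"
    unfolding IHa by simp
  also have "(x - r m) / (x - a m) = 1 + (a m - r m) / (x - a m)"
    using x by (simp add: field_simps)
  finally show ?case
    by (simp add: residue_at_last algebra_simps)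
qed simp

section \<open>From residues to interlacing roots\<close>

text \<open>
The bounded quantifier over the set \<open>{..<m}\<close> is the form that the measurability prover handles.
\<close>
abbreviation all_pos :: "nat \<Rightarrow> (nat \<Rightarrow> real) \<Rightarrow> bool" where
  "all_pos m w \<equiv> \<forall>j\<in>{..<m}. 0 < w j"

text \<open>
\<open>r\<^sub>0 < a\<^sub>0 < r\<^sub>1 < a\<^sub>1 < \<dots> < r\<^sub>m\<^sub>-\<^sub>1 < a\<^sub>m\<^sub>-\<^sub>1\<close>: the position of the zeros \<open>r\<close> of
\<open>1 + \<Sum> w\<^sub>j / (x - a\<^sub>j)\<close> with positive \<open>w\<close>.
\<close>
definition interlaces :: "nat \<Rightarrow> (nat \<Rightarrow> real) \<Rightarrow> (nat \<Rightarrow> real) \<Rightarrow> bool" where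
  "interlaces m r a \<longleftrightarrow> (\<forall>j\<in>{..<m}. r j < a j \<and> (0 < j \<longrightarrow> a (j - 1) < r j))"

definition vandermonde :: "nat \<Rightarrow> (nat \<Rightarrow> real) \<Rightarrow> real" where
  "vandermonde m a = (\<Prod>l<m. \<Prod>k<l. a l - a k)"

lemma vandermonde_Suc: "vandermonde (Suc m) a = vandermonde m a * (\<Prod>k<m. a m - a k)"
  by (simp add: vandermonde_def)

lemma vandermonde_cong: "(\<And>k. k < m \<Longrightarrow> a k = b k) \<Longrightarrow> vandermonde m a = vandermonde m b"
  unfolding vandermonde_def by (intro prod.cong refl) auto

lemma vandermonde_pos: "strict_mono_on {..<m} a \<Longrightarrow> 0 < vandermonde m a"
  unfolding vandermonde_def by (intro prod_pos) (auto simp: strict_mono_on_def)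

text \<open>
The interval between the two largest poles, in which the largest root lies; for a single pole it
is unbounded below.
\<close>
definition top_gap :: "nat \<Rightarrow> (nat \<Rightarrow> real) \<Rightarrow> real set" where
  "top_gap m a = einterval (if m = 0 then - \<infinity> else ereal (a (m - 1))) (ereal (a m))"

lemma mem_top_gap: "t \<in> top_gap m a \<longleftrightarrow> t < a m \<and> (0 < m \<longrightarrow> a (m - 1) < t)"
  by (auto simp: top_gap_def einterval_def)

lemma top_gap_gt: "strict_mono_on {..<Suc m} a \<Longrightarrow> t \<in> top_gap m a \<Longrightarrow> j < m \<Longrightarrow> a j < t"
  by (rule le_less_trans[OF strict_mono_on_leD[of "{..<Suc m}" a j "m - 1"]]) (auto simp: mem_top_gap)

text \<open>
With the other residues \<open>w\<close> fixed, the largest root \<open>t\<close> and the last residue \<open>u\<close> determine each other through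
\<open>u = (a\<^sub>m - t) (1 + \<Sum>j<m. w\<^sub>j / (t - a\<^sub>j))\<close>: the vanishing of \<open>1 + \<Sum>j<m. w\<^sub>j / (x - a\<^sub>j) + u / (x - a\<^sub>m)\<close> at
\<open>x = t\<close>. The right-hand side decreases from \<open>\<infinity>\<close> to \<open>0\<close> on the gap.
\<close>
lemma nn_integral_subst_top_root:
  fixes a w :: "nat \<Rightarrow> real" and f :: "real \<Rightarrow> ennreal"
  assumes f [measurable]: "f \<in> borel_measurable borel"
    and a: "strict_mono_on {..<Suc m} a" and w: "all_pos m w"
  shows "(\<integral>\<^sup>+u. f u * indicator {0<..} u \<partial>lborel) =
    (\<integral>\<^sup>+t. f ((a m - t) * (1 + (\<Sum>j<m. w j / (t - a j)))) *
        ennreal (1 + (\<Sum>j<m. w j * (a m - a j) / (t - a j)\<^sup>2)) * indicator (top_gap m a) t \<partial>lborel)"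
  unfolding top_gap_def
proof (rule nn_integral_subst_decr[OF f], unfold top_gap_def[symmetric])
  have am: "a j < a m" if "j < m" for j using a that by (auto simp: strict_mono_on_def)
  have I: "t < a m" "\<And>j. j < m \<Longrightarrow> a j < t" if "t \<in> top_gap m a" for t
    using that top_gap_gt[OF a] by (auto simp: mem_top_gap)
  show "(if m = 0 then - \<infinity> else ereal (a (m - 1))) < ereal (a m)"
    using am[of "m - 1"] by auto
  {
  fix t assume t: "t \<in> top_gap m a"
  have summand: "((\<lambda>t. (a m - t) * (w j / (t - a j))) has_real_derivative - (w j * (a m - a j) / (t - a j)\<^sup>2)) (at t)"
    if "j < m" for j
    using I(2)[OF t that]
    by (auto intro!: derivative_eq_intros simp: divide_simps power2_eq_square) (simp add: algebra_simps)?
  have "((\<lambda>t. (a m - t) + (\<Sum>j<m. (a m - t) * (w j / (t - a j)))) has_real_derivative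
      - 1 + (\<Sum>j<m. - (w j * (a m - a j) / (t - a j)\<^sup>2))) (at t)"
    by (intro DERIV_add DERIV_sum summand) (auto intro!: derivative_eq_intros)
  then show "((\<lambda>t. (a m - t) * (1 + (\<Sum>j<m. w j / (t - a j)))) has_real_derivative
      - (1 + (\<Sum>j<m. w j * (a m - a j) / (t - a j)\<^sup>2))) (at t)"
    by (simp add: distrib_left sum_distrib_left sum_negf)
  show "0 \<le> 1 + (\<Sum>j<m. w j * (a m - a j) / (t - a j)\<^sup>2)"
    using w am by (intro add_nonneg_nonneg sum_nonneg divide_nonneg_nonneg mult_nonneg_nonneg) (auto simp: less_imp_le)
  }
  show "continuous_on (top_gap m a) (\<lambda>t. 1 + (\<Sum>j<m. w j * (a m - a j) / (t - a j)\<^sup>2))"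
    by (intro continuous_intros) (use I in force)
  have cont: "continuous_on {s..a m} (\<lambda>t. (a m - t) * (1 + (\<Sum>j<m. w j / (t - a j))))" if "s \<in> top_gap m a" for s
    by (intro continuous_intros) (use I(2)[OF that] in force)
  show "(\<lambda>t. (a m - t) * (1 + (\<Sum>j<m. w j / (t - a j)))) ` top_gap m a = {0<..}"
  proof (intro equalityI subsetI)
    fix y assume "y \<in> (\<lambda>t. (a m - t) * (1 + (\<Sum>j<m. w j / (t - a j)))) ` top_gap m a"
    then obtain t where t: "t \<in> top_gap m a" "y = (a m - t) * (1 + (\<Sum>j<m. w j / (t - a j)))" by auto
    have "0 \<le> (\<Sum>j<m. w j / (t - a j))"
      using I(2)[OF t(1)] w by (intro sum_nonneg divide_nonneg_nonneg) (auto simp: less_imp_le)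
    then show "y \<in> {0<..}" using I(1)[OF t(1)] t(2) by auto
  next
    fix y :: real assume "y \<in> {0<..}"
    then have y: "0 < y" by simp
    have "\<exists>s\<in>top_gap m a. y \<le> (a m - s) * (1 + (\<Sum>j<m. w j / (s - a j)))"
    proof (cases m)
      case 0
      then show ?thesis using y by (intro bexI[of _ "a m - y"]) (auto simp: mem_top_gap)
    next
      case (Suc l)
      \<comment> \<open>The point at which the term of the pole next to the gap alone reaches the value \<open>y\<close>.\<close>
      define s where "s = (a m * w l + y * a l) / (w l + y)"
      have wl: "0 < w l" and al: "a l < a m" using w Suc am[of l] by auto
      define K where "K = (a m - a l) / (w l + y)"
      have K: "0 < K" using wl y al by (simp add: K_def)
      have s1: "a m - s = y * K" "s - a l = w l * K"
        unfolding s_def K_def using wl y by (auto simp: field_simps)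
      then have s2: "0 < a m - s" "0 < s - a l" using wl y K by auto
      then have sJ: "s \<in> top_gap m a" by (simp add: mem_top_gap Suc)
      have "(a m - s) * (w l / (s - a l)) = y"
        unfolding s1 using wl K by simp
      moreover have "(a m - s) * (w l / (s - a l)) \<le> (a m - s) * (1 + (\<Sum>j<m. w j / (s - a j)))"
      proof (intro mult_left_mono)
        have "w l / (s - a l) \<le> (\<Sum>j<m. w j / (s - a j))"
          by (rule member_le_sum) (use Suc w I(2)[OF sJ] in \<open>auto intro!: divide_nonneg_nonneg simp: less_imp_le\<close>)
        then show "w l / (s - a l) \<le> 1 + (\<Sum>j<m. w j / (s - a j))" by simp
      qed (use s2 in simp)
      ultimately show ?thesis using sJ by auto
    qed
    then obtain s where s: "s \<in> top_gap m a" "y \<le> (a m - s) * (1 + (\<Sum>j<m. w j / (s - a j)))" by auto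
    obtain t where t: "s \<le> t" "t \<le> a m" "(a m - t) * (1 + (\<Sum>j<m. w j / (t - a j))) = y"
      using IVT2'[of "\<lambda>t. (a m - t) * (1 + (\<Sum>j<m. w j / (t - a j)))" "a m" y s] s(2) y cont[OF s(1)] I(1)[OF s(1)]
      by auto
    have "t \<noteq> a m" using t(3) y by auto
    then have "t \<in> top_gap m a" using s(1) t(1,2) by (auto simp: mem_top_gap less_le_trans split: if_splits)
    then show "y \<in> (\<lambda>t. (a m - t) * (1 + (\<Sum>j<m. w j / (t - a j)))) ` top_gap m a" using t(3) by force
  qed
qed

lemma interlaces_Suc_upd:
  "interlaces (Suc m) (r(m := t)) a \<longleftrightarrow> interlaces m r a \<and> t \<in> top_gap m a"
proof -
  have "(\<forall>j\<in>{..<m}. (r(m := t)) j < a j \<and> (0 < j \<longrightarrow> a (j - 1) < (r(m := t)) j)) \<longleftrightarrow>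
        (\<forall>j\<in>{..<m}. r j < a j \<and> (0 < j \<longrightarrow> a (j - 1) < r j))"
    by (intro ball_cong refl) auto
  then show ?thesis
    unfolding interlaces_def lessThan_Suc ball_insert mem_top_gap by auto
qed

lemma interlaces_measurable [measurable]:
  assumes [measurable]: "\<And>j. j < m \<Longrightarrow> (\<lambda>x. r x j) \<in> borel_measurable M" "\<And>j. j < m \<Longrightarrow> (\<lambda>x. a x j) \<in> borel_measurable M"
  shows "Measurable.pred M (\<lambda>x. interlaces m (r x) (a x))"
proof -
  have [measurable]: "(\<lambda>x. a x (j - 1)) \<in> borel_measurable M" if "j \<in> {..<m}" for j
    using that assms(2)[of "j - 1"] by auto
  show ?thesis unfolding interlaces_def by measurable
qed

lemma vandermonde_measurable [measurable (raw)]: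
  assumes [measurable]: "\<And>j. j < m \<Longrightarrow> (\<lambda>x. r x j) \<in> borel_measurable M"
  shows "(\<lambda>x. vandermonde m (r x)) \<in> borel_measurable M"
  unfolding vandermonde_def
  by (intro borel_measurable_prod borel_measurable_diff assms) auto

lemma residue_at_measurable [measurable (raw)]:
  fixes r :: "_ \<Rightarrow> nat \<Rightarrow> real"
  assumes [measurable]: "\<And>j. j < m \<Longrightarrow> (\<lambda>x. r x j) \<in> borel_measurable M" "\<And>j. j < m \<Longrightarrow> (\<lambda>x. a x j) \<in> borel_measurable M"
    and "j < m"
  shows "(\<lambda>x. residue_at m (r x) (a x) j) \<in> borel_measurable M"
  unfolding residue_at_def
  by (intro borel_measurable_divide borel_measurable_prod borel_measurable_diff assms) auto

text \<open>
Change of variables between positive residues \<open>w\<close> of \<open>1 + \<Sum> w\<^sub>j / (x - a\<^sub>j)\<close> and its zeros \<open>r\<close>; the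
Jacobian is the quotient of the Vandermonde products. In the induction step the last residue is
exchanged for the largest root \<open>t\<close>. Once \<open>t\<close> is known, dividing the function by
\<open>(x - t) / (x - a\<^sub>m)\<close> leaves a function of the same kind with one pole less, whose residues are those
of the old function divided by \<open>c\<^sub>j = (t - a\<^sub>j) / (a\<^sub>m - a\<^sub>j)\<close>; after this rescaling the induction
hypothesis applies.
\<close>
lemma nn_integral_residue_roots:
  assumes [measurable]: "F \<in> borel_measurable (lebesgue_pow m)" and a: "strict_mono_on {..<m} a"
  shows "(\<integral>\<^sup>+w. (if all_pos m w then F w else 0) \<partial>lebesgue_pow m) =
    (\<integral>\<^sup>+r. (if interlaces m r a then F (\<lambda>j\<in>{..<m}. residue_at m r a j) *
        ennreal (vandermonde m r / vandermonde m a) else 0) \<partial>lebesgue_pow m)"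
  using assms
proof (induction m arbitrary: F)
  case 0
  show ?case by (simp add: PiM_empty nn_integral_count_space_finite interlaces_def vandermonde_def restrict_def)
next
  case (Suc m)
  note [measurable] = Suc.prems(1)
  note a = Suc.prems(2)
  have am: "strict_mono_on {..<m} a" using a by (rule monotone_on_subset) auto
  have alt: "a j < a m" if "j < m" for j using a that by (auto simp: strict_mono_on_def)
  have inj: "inj_on a {..<m}" by (rule strict_mono_on_imp_inj_on[OF am])
  have [measurable]: "top_gap m a \<in> sets borel" by (simp add: top_gap_def)
  define \<phi> where "\<phi> w t = (a m - t) * (1 + (\<Sum>j<m. w j / (t - a j)))" for w :: "nat \<Rightarrow> real" and t
  define \<phi>' where "\<phi>' w t = 1 + (\<Sum>j<m. w j * (a m - a j) / (t - a j)\<^sup>2)" for w :: "nat \<Rightarrow> real" and t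
  have [measurable]: "(\<lambda>x. \<phi> (f x) (g x)) \<in> borel_measurable N" "(\<lambda>x. \<phi>' (f x) (g x)) \<in> borel_measurable N"
    if f: "f \<in> measurable N (lebesgue_pow m)" and [measurable]: "g \<in> borel_measurable N" for f g and N :: "'x measure"
  proof -
    have [measurable]: "(\<lambda>x. f x j) \<in> borel_measurable N" if "j \<in> {..<m}" for j
      using measurable_compose[OF f measurable_component_singleton[OF that]] by simp
    show "(\<lambda>x. \<phi> (f x) (g x)) \<in> borel_measurable N" unfolding \<phi>_def by measurable
    show "(\<lambda>x. \<phi>' (f x) (g x)) \<in> borel_measurable N" unfolding \<phi>'_def by measurable
  qed
  define c where "c t j = (t - a j) / (a m - a j)" for t j
  let ?P = "\<lambda>t. \<Prod>j<m. c t j"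
  have "(\<integral>\<^sup>+w. (if all_pos (Suc m) w then F w else 0) \<partial>lebesgue_pow (Suc m)) =
    (\<integral>\<^sup>+w. \<integral>\<^sup>+u. (if all_pos (Suc m) (w(m := u)) then F (w(m := u)) else 0) \<partial>lborel \<partial>lebesgue_pow m)"
    by (rule nn_integral_lebesgue_pow_Suc) measurable
  also have "\<dots> = (\<integral>\<^sup>+w. \<integral>\<^sup>+t. (if all_pos m w then F (w(m := \<phi> w t)) * ennreal (\<phi>' w t) * indicator (top_gap m a) t else 0) \<partial>lborel \<partial>lebesgue_pow m)"
  proof (rule nn_integral_cong)
    fix w assume [measurable]: "w \<in> space (lebesgue_pow m)"
    show "(\<integral>\<^sup>+u. (if all_pos (Suc m) (w(m := u)) then F (w(m := u)) else 0) \<partial>lborel) =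
      (\<integral>\<^sup>+t. (if all_pos m w then F (w(m := \<phi> w t)) * ennreal (\<phi>' w t) * indicator (top_gap m a) t else 0) \<partial>lborel)"
    proof (cases "all_pos m w")
      case True
      then have "(if all_pos (Suc m) (w(m := u)) then F (w(m := u)) else 0) = F (w(m := u)) * indicator {0<..} u" for u
        by (auto simp: less_Suc_eq)
      then show ?thesis
        using nn_integral_subst_top_root[of "\<lambda>u. F (w(m := u))", OF _ a True] True
        by (simp add: \<phi>_def \<phi>'_def)
    next
      case False
      then have "\<not> all_pos (Suc m) (w(m := u))" for u by (auto simp: less_Suc_eq)
      then show ?thesis using False by (simp only: if_False)
    qed
  qed
  also have "\<dots> = (\<integral>\<^sup>+t. \<integral>\<^sup>+w. (if all_pos m w then F (w(m := \<phi> w t)) * ennreal (\<phi>' w t) * indicator (top_gap m a) t else 0) \<partial>lebesgue_pow m \<partial>lborel)"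
    by (rule nn_integral_swap[OF sigma_finite_lebesgue_pow sigma_finite_lborel]) measurable
  also have "\<dots> = (\<integral>\<^sup>+t. \<integral>\<^sup>+r. (if interlaces (Suc m) (r(m := t)) a then F (\<lambda>j\<in>{..<Suc m}. residue_at (Suc m) (r(m := t)) a j) *
        ennreal (vandermonde (Suc m) (r(m := t)) / vandermonde (Suc m) a) else 0) \<partial>lebesgue_pow m \<partial>lborel)"
  proof (rule nn_integral_cong)
    fix t :: real
    show "(\<integral>\<^sup>+w. (if all_pos m w then F (w(m := \<phi> w t)) * ennreal (\<phi>' w t) * indicator (top_gap m a) t else 0) \<partial>lebesgue_pow m) =
      (\<integral>\<^sup>+r. (if interlaces (Suc m) (r(m := t)) a then F (\<lambda>j\<in>{..<Suc m}. residue_at (Suc m) (r(m := t)) a j) *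
        ennreal (vandermonde (Suc m) (r(m := t)) / vandermonde (Suc m) a) else 0) \<partial>lebesgue_pow m)"
    proof (cases "t \<in> top_gap m a")
      case False
      then have "\<not> interlaces (Suc m) (r(m := t)) a" for r by (simp add: interlaces_Suc_upd)
      then show ?thesis using False by (simp cong: if_cong)
    next
      case True
      have ta: "a j < t" "c t j > 0" if "j < m" for j
        using top_gap_gt[OF a True that] alt[OF that] by (auto simp: c_def)
      have tm: "t < a m" using True by (simp add: mem_top_gap)
      define G where "G v = F ((\<lambda>j\<in>{..<m}. c t j * v j)(m := \<phi> (\<lambda>j\<in>{..<m}. c t j * v j) t)) *
         ennreal (\<phi>' (\<lambda>j\<in>{..<m}. c t j * v j) t) * ennreal (?P t)" for v
      have [measurable]: "(\<lambda>v. \<lambda>j\<in>{..<m}. c t j * v j) \<in> measurable (lebesgue_pow m) (lebesgue_pow m)"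
        by (rule measurable_restrict) simp
      have [measurable]: "G \<in> borel_measurable (lebesgue_pow m)"
        unfolding G_def by measurable
      have "(\<integral>\<^sup>+w. (if all_pos m w then F (w(m := \<phi> w t)) * ennreal (\<phi>' w t) * indicator (top_gap m a) t else 0) \<partial>lebesgue_pow m) =
        (\<integral>\<^sup>+w. (if all_pos m w then F (w(m := \<phi> w t)) * ennreal (\<phi>' w t) else 0) \<partial>lebesgue_pow m)"
        by (rule nn_integral_cong) (simp only: indicator_simps(1)[OF True] mult_1_right)
      also have "\<dots> = (\<integral>\<^sup>+v. (if all_pos m (\<lambda>j\<in>{..<m}. c t j * v j) then
           F ((\<lambda>j\<in>{..<m}. c t j * v j)(m := \<phi> (\<lambda>j\<in>{..<m}. c t j * v j) t)) * ennreal (\<phi>' (\<lambda>j\<in>{..<m}. c t j * v j) t) else 0) * ennreal (?P t) \<partial>lebesgue_pow m)"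
        by (rule nn_integral_lebesgue_pow_scale, measurable) (rule ta)
      also have "\<dots> = (\<integral>\<^sup>+v. (if all_pos m v then G v else 0) \<partial>lebesgue_pow m)"
      proof (rule nn_integral_cong)
        fix v :: "nat \<Rightarrow> real"
        have "all_pos m (\<lambda>j\<in>{..<m}. c t j * v j) \<longleftrightarrow> all_pos m v"
          using ta by (intro ball_cong refl) (simp add: zero_less_mult_iff order_less_not_sym)
        then show "(if all_pos m (\<lambda>j\<in>{..<m}. c t j * v j) then
           F ((\<lambda>j\<in>{..<m}. c t j * v j)(m := \<phi> (\<lambda>j\<in>{..<m}. c t j * v j) t)) * ennreal (\<phi>' (\<lambda>j\<in>{..<m}. c t j * v j) t) else 0) * ennreal (?P t) =
           (if all_pos m v then G v else 0)"
          by (simp only: G_def if_distrib[of "\<lambda>x. x * ennreal (?P t)"] mult_zero_left)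
      qed
      also have "\<dots> = (\<integral>\<^sup>+r. (if interlaces m r a then G (\<lambda>j\<in>{..<m}. residue_at m r a j) *
        ennreal (vandermonde m r / vandermonde m a) else 0) \<partial>lebesgue_pow m)"
        by (rule Suc.IH[OF _ am]) measurable
      also have "\<dots> = (\<integral>\<^sup>+r. (if interlaces (Suc m) (r(m := t)) a then F (\<lambda>j\<in>{..<Suc m}. residue_at (Suc m) (r(m := t)) a j) *
        ennreal (vandermonde (Suc m) (r(m := t)) / vandermonde (Suc m) a) else 0) \<partial>lebesgue_pow m)"
      proof (rule nn_integral_cong)
        fix r :: "nat \<Rightarrow> real"
        show "(if interlaces m r a then G (\<lambda>j\<in>{..<m}. residue_at m r a j) * ennreal (vandermonde m r / vandermonde m a) else 0) =
          (if interlaces (Suc m) (r(m := t)) a then F (\<lambda>j\<in>{..<Suc m}. residue_at (Suc m) (r(m := t)) a j) *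
            ennreal (vandermonde (Suc m) (r(m := t)) / vandermonde (Suc m) a) else 0)"
        proof (cases "interlaces m r a")
          case False
          then show ?thesis by (simp add: interlaces_Suc_upd)
        next
          case il: True
          let ?r = "r(m := t)" and ?\<rho> = "residue_at m r a"
          let ?v = "\<lambda>j\<in>{..<m}. ?\<rho> j" let ?w = "\<lambda>j\<in>{..<m}. c t j * ?v j"
          have res: "residue_at m ?r a j = ?\<rho> j" for j by (rule residue_at_cong) auto
          have pft: "(\<Prod>k<m. t - r k) / (\<Prod>k<m. t - a k) = 1 + (\<Sum>j<m. ?\<rho> j / (t - a j))"
            by (rule partial_fractions[OF inj]) (use ta in force)
          have pfa: "(\<Prod>k<m. a m - r k) / (\<Prod>k<m. a m - a k) = 1 + (\<Sum>j<m. ?\<rho> j / (a m - a j))"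
            by (rule partial_fractions[OF inj]) (use alt in force)
          \<comment> \<open>The factor \<open>c\<close> moves the point of evaluation from \<open>t\<close> to the last pole.\<close>
          have "\<phi> ?w t = (a m - t) * (1 + (\<Sum>j<m. ?\<rho> j / (a m - a j)))"
            unfolding \<phi>_def by (intro arg_cong2[of _ _ _ _ times] arg_cong2[of _ _ _ _ plus] sum.cong refl)
              (use ta in \<open>force simp: c_def\<close>)
          then have wm: "\<phi> ?w t = residue_at (Suc m) ?r a m"
            unfolding residue_at_last pfa[symmetric] by simp
          have wj: "?w j = residue_at (Suc m) ?r a j" if "j < m" for j
          proof -
            have "c t j = (a j - t) / (a j - a m)"
              using minus_divide_divide[of "a j - t" "a j - a m"] by (simp add: c_def)
            then show ?thesis using that by (simp add: residue_at_Suc res mult.commute del: times_divide_eq_right)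
          qed
          have w: "?w(m := \<phi> ?w t) = (\<lambda>j\<in>{..<Suc m}. residue_at (Suc m) ?r a j)"
            unfolding wm using wj by (auto simp: fun_eq_iff less_Suc_eq)
          have "\<phi>' ?w t = 1 + (\<Sum>j<m. ?\<rho> j / (t - a j))"
            unfolding \<phi>'_def
          proof (intro arg_cong2[of _ _ _ _ plus] sum.cong refl)
            fix j assume "j \<in> {..<m}"
            then show "?w j * (a m - a j) / (t - a j)\<^sup>2 = ?\<rho> j / (t - a j)"
              using ta(1)[of j] alt[of j] by (simp add: c_def power2_eq_square)
          qed
          then have p: "\<phi>' ?w t = (\<Prod>k<m. t - r k) / (\<Prod>k<m. t - a k)" using pft by simp
          have rt: "r k < t" if "k < m" for k
            using il that ta(1)[of k] by (auto simp: interlaces_def intro: less_trans)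
          have pos: "0 < (\<Prod>k<m. t - r k)" "0 < (\<Prod>k<m. t - a k)" "0 < ?P t"
            by (intro prod_pos; use rt ta in force)+
          have "?P t = (\<Prod>k<m. t - a k) / (\<Prod>k<m. a m - a k)"
            by (simp add: c_def prod_dividef)
          moreover have cancel: "(A / B) * (B / C) = A / C" if "B \<noteq> 0" for A B C :: real
            using that by simp
          ultimately have jac: "\<phi>' ?w t * ?P t = (\<Prod>k<m. t - r k) / (\<Prod>k<m. a m - a k)"
            unfolding p using cancel[OF less_imp_neq[OF pos(2), symmetric]] by (simp only:)
          have "vandermonde m ?r = vandermonde m r" by (rule vandermonde_cong) auto
          then have vd: "vandermonde (Suc m) ?r / vandermonde (Suc m) a = \<phi>' ?w t * ?P t * (vandermonde m r / vandermonde m a)"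
            unfolding jac vandermonde_Suc by (simp add: mult.commute)
          have "0 \<le> \<phi>' ?w t" unfolding p using pos by simp
          then have "G ?v * ennreal (vandermonde m r / vandermonde m a) =
            F (\<lambda>j\<in>{..<Suc m}. residue_at (Suc m) ?r a j) * ennreal (vandermonde (Suc m) ?r / vandermonde (Suc m) a)"
            unfolding G_def w vd using pos by (simp only: ennreal_mult' mult_nonneg_nonneg less_imp_le mult.assoc)
          then show ?thesis using il True by (simp add: interlaces_Suc_upd)
        qed
      qed
      finally show ?thesis .
    qed
  qed
  also have "\<dots> = (\<integral>\<^sup>+r. (if interlaces (Suc m) r a then F (\<lambda>j\<in>{..<Suc m}. residue_at (Suc m) r a j) *
        ennreal (vandermonde (Suc m) r / vandermonde (Suc m) a) else 0) \<partial>lebesgue_pow (Suc m))"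
  proof (rule nn_integral_lebesgue_pow_Suc_rev[symmetric])
    have [measurable]: "(\<lambda>r. \<lambda>j\<in>{..<Suc m}. residue_at (Suc m) r a j) \<in> measurable (lebesgue_pow (Suc m)) (lebesgue_pow (Suc m))"
      by (rule measurable_restrict) (auto intro!: residue_at_measurable)
    show "(\<lambda>r. if interlaces (Suc m) r a then F (\<lambda>j\<in>{..<Suc m}. residue_at (Suc m) r a j) *
        ennreal (vandermonde (Suc m) r / vandermonde (Suc m) a) else 0) \<in> borel_measurable (lebesgue_pow (Suc m))"
      by measurable
  qed
  finally show ?case .
qed

section \<open>Roots of a bordered rational function\<close>

text \<open>
\<open>x\<^sub>0 < r\<^sub>0 < x\<^sub>1 < r\<^sub>1 < \<dots> < r\<^sub>m\<^sub>-\<^sub>1 < x\<^sub>m\<close>: the eigenvalues of two consecutive levels, on the line.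
\<close>
definition strictly_between :: "nat \<Rightarrow> (nat \<Rightarrow> real) \<Rightarrow> (nat \<Rightarrow> real) \<Rightarrow> bool" where
  "strictly_between m r x \<longleftrightarrow> (\<forall>j\<in>{..<m}. x j < r j \<and> r j < x (Suc j))"

lemma strictly_between_measurable [measurable]:
  assumes [measurable]: "\<And>j. j < m \<Longrightarrow> (\<lambda>x. r x j) \<in> borel_measurable M" "\<And>j. j < Suc m \<Longrightarrow> (\<lambda>x. a x j) \<in> borel_measurable M"
  shows "Measurable.pred M (\<lambda>x. strictly_between m (r x) (a x))"
proof -
  have [measurable]: "(\<lambda>x. r x j) \<in> borel_measurable M" "(\<lambda>x. a x j) \<in> borel_measurable M" "(\<lambda>x. a x (Suc j)) \<in> borel_measurable M" if "j \<in> {..<m}" for j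
    using that assms(1)[of j] assms(2)[of j] assms(2)[of "Suc j"] by auto
  show ?thesis unfolding strictly_between_def by measurable
qed

lemma measurable_coordinate:
  assumes "f \<in> measurable N (lebesgue_pow m)" "j \<in> {..<m}"
  shows "(\<lambda>x. f x j) \<in> borel_measurable N"
  using measurable_compose[OF assms(1) measurable_component_singleton[OF assms(2)]] by simp

lemma strictly_between_last:
  assumes "0 < m"
  shows "strictly_between m a x \<longleftrightarrow> interlaces m x a \<and> a (m - 1) < x m"
proof
  assume *: "strictly_between m a x"
  have "a (j - 1) < x j" if "0 < j" "j \<le> m" for j
  proof -
    have "j - 1 \<in> {..<m}" using that by auto
    then have "a (j - 1) < x (Suc (j - 1))" using * unfolding strictly_between_def by blast
    then show ?thesis using that by simp
  qed
  then show "interlaces m x a \<and> a (m - 1) < x m"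
    using * assms by (auto simp: strictly_between_def interlaces_def)
next
  assume *: "interlaces m x a \<and> a (m - 1) < x m"
  show "strictly_between m a x"
    unfolding strictly_between_def
  proof
    fix j assume j: "j \<in> {..<m}"
    then have "a j < x (Suc j)"
      using * bspec[of "{..<m}" _ "Suc j"] unfolding interlaces_def
      by (cases "Suc j = m") (auto simp: less_Suc_eq)
    then show "x j < a j \<and> a j < x (Suc j)" using * j by (auto simp: interlaces_def)
  qed
qed

text \<open>
For fixed \<open>w\<close> the shift \<open>s\<close> and the largest zero \<open>t\<close> of \<open>x - s - \<Sum> w\<^sub>j / (x - a\<^sub>j)\<close> determine each
other, and \<open>s\<close> increases from \<open>-\<infinity>\<close> to \<open>\<infinity>\<close> as \<open>t\<close> runs over the half-line to the right of all poles.
\<close>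
lemma nn_integral_subst_largest_root:
  fixes a w :: "nat \<Rightarrow> real" and f :: "real \<Rightarrow> ennreal"
  assumes f [measurable]: "f \<in> borel_measurable borel"
    and m: "0 < m" and a: "strict_mono_on {..<m} a" and w: "all_pos m w"
  shows "(\<integral>\<^sup>+s. f s \<partial>lborel) =
    (\<integral>\<^sup>+t. f (t - (\<Sum>j<m. w j / (t - a j))) *
        ennreal (1 + (\<Sum>j<m. w j / (t - a j)\<^sup>2)) * indicator {a (m - 1)<..} t \<partial>lborel)"
proof -
  let ?J = "einterval (ereal (a (m - 1))) \<infinity>"
  let ?g = "\<lambda>t. t - (\<Sum>j<m. w j / (t - a j))"
  have am: "a j \<le> a (m - 1)" if "j < m" for j
    by (rule strict_mono_on_leD[OF a]) (use that in auto)
  have I: "a j < t" if "t \<in> ?J" "j < m" for t j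
    using that(1) am[OF that(2)] by simp
  have "(\<integral>\<^sup>+s. f s * indicator UNIV s \<partial>lborel) = (\<integral>\<^sup>+t. f (?g t) * ennreal (1 + (\<Sum>j<m. w j / (t - a j)\<^sup>2)) * indicator ?J t \<partial>lborel)"
  proof (rule nn_integral_subst_incr[OF f])
    fix t assume t: "t \<in> ?J"
    have summand: "((\<lambda>t. w j / (t - a j)) has_real_derivative - (w j / (t - a j)\<^sup>2)) (at t)" if "j < m" for j
      using I[OF t that] by (auto intro!: derivative_eq_intros simp: divide_simps power2_eq_square)
    have "(?g has_real_derivative 1 - (\<Sum>j<m. - (w j / (t - a j)\<^sup>2))) (at t)"
      by (intro DERIV_diff DERIV_sum summand) (auto intro!: derivative_eq_intros)
    then show "(?g has_real_derivative 1 + (\<Sum>j<m. w j / (t - a j)\<^sup>2)) (at t)"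
      by (simp add: sum_negf)
    show "0 \<le> 1 + (\<Sum>j<m. w j / (t - a j)\<^sup>2)"
      using w by (intro add_nonneg_nonneg sum_nonneg divide_nonneg_nonneg) (auto simp: less_imp_le)
  next
    show "continuous_on ?J (\<lambda>t. 1 + (\<Sum>j<m. w j / (t - a j)\<^sup>2))"
      by (intro continuous_intros) (use I in force)
    have cont: "continuous_on {s..s'} ?g" if "s \<in> ?J" for s s'
    proof -
      have "t \<in> ?J" if "t \<in> {s..s'}" for t using that \<open>s \<in> ?J\<close> by simp
      then show ?thesis by (intro continuous_intros) (use I in force)
    qed
    have "\<exists>t\<in>?J. ?g t = y" for y
    proof -
      let ?w = "w (m - 1)" and ?a = "a (m - 1)"
      have w1: "0 < ?w" using w m by auto
      \<comment> \<open>So close to the last pole that its term alone pushes the function below \<open>y\<close>.\<close>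
      define \<epsilon> where "\<epsilon> = min 1 (?w / (\<bar>y\<bar> + \<bar>?a\<bar> + 1))"
      have \<epsilon>: "0 < \<epsilon>" "\<epsilon> \<le> 1" "\<epsilon> \<le> ?w / (\<bar>y\<bar> + \<bar>?a\<bar> + 1)" using w1 by (auto simp: \<epsilon>_def)
      have pos: "0 < \<bar>y\<bar> + \<bar>?a\<bar> + 1" by (simp add: add_nonneg_pos)
      have sJ: "?a + \<epsilon> \<in> ?J" using \<epsilon> by simp
      have "\<bar>y\<bar> + \<bar>?a\<bar> + 1 \<le> ?w / \<epsilon>" using \<epsilon> pos by (simp add: field_simps)
      also have "\<dots> = ?w / (?a + \<epsilon> - ?a)" by simp
      also have "\<dots> \<le> (\<Sum>j<m. w j / (?a + \<epsilon> - a j))"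
        by (rule member_le_sum) (use m w I[OF sJ] in \<open>auto intro!: divide_nonneg_nonneg simp: less_imp_le\<close>)
      finally have lower: "?g (?a + \<epsilon>) \<le> y" using \<epsilon> by linarith
      define T where "T = max (?a + 1) (y + (\<Sum>j<m. w j))"
      have "(\<Sum>j<m. w j / (T - a j)) \<le> (\<Sum>j<m. w j)"
      proof (rule sum_mono)
        fix j assume j: "j \<in> {..<m}"
        have "1 \<le> T - a j" using am[of j] j by (auto simp: T_def)
        then show "w j / (T - a j) \<le> w j" using w j by (simp add: divide_le_eq less_imp_le)
      qed
      then have upper: "y \<le> ?g T" by (simp add: T_def)
      have le: "?a + \<epsilon> \<le> T" using \<epsilon> by (simp add: T_def)
      obtain t where "?a + \<epsilon> \<le> t" "?g t = y"
        using IVT'[of ?g "?a + \<epsilon>" y T, OF lower upper le cont[OF sJ]] by auto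
      then show ?thesis using \<epsilon> by (intro bexI[of _ t]) auto
    qed
    then have "y \<in> ?g ` ?J" for y unfolding image_iff by (simp only: eq_commute[of y])
    then show "?g ` ?J = UNIV" by blast
  qed simp
  then show ?thesis by simp
qed

text \<open>
The function \<open>x - s - \<Sum> w\<^sub>j / (x - a\<^sub>j)\<close> (for real symmetric matrices, the bordering of a diagonal
matrix) has \<open>m + 1\<close> real zeros \<open>x\<close>, and \<open>(s, w)\<close> is exchanged for them. First \<open>s\<close> is
exchanged for the largest zero \<open>t\<close>; dividing the function by \<open>x - t\<close> then leaves
\<open>1 + \<Sum> (w\<^sub>j / (t - a\<^sub>j)) / (x - a\<^sub>j)\<close>, to which \<open>nn_integral_residue_roots\<close> applies.
\<close>
lemma nn_integral_bordered_roots: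
  assumes F [measurable]: "(\<lambda>(s, w). F s w) \<in> borel_measurable (lborel \<Otimes>\<^sub>M lebesgue_pow m)"
    and m: "0 < m" and a: "strict_mono_on {..<m} a"
  shows "(\<integral>\<^sup>+w. \<integral>\<^sup>+s. (if all_pos m w then F s w else 0) \<partial>lborel \<partial>lebesgue_pow m) =
    (\<integral>\<^sup>+x. (if strictly_between m a x then
        F (x m - (\<Sum>j<m. residue_at m x a j)) (\<lambda>j\<in>{..<m}. residue_at m x a j * (x m - a j)) *
        ennreal (vandermonde (Suc m) x / vandermonde m a) else 0) \<partial>lebesgue_pow (Suc m))"
proof -
  have inj: "inj_on a {..<m}" by (rule strict_mono_on_imp_inj_on[OF a])
  have am: "a j \<le> a (m - 1)" if "j < m" for j
    by (rule strict_mono_on_leD[OF a]) (use that in auto)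
  define \<phi> where "\<phi> w t = t - (\<Sum>j<m. w j / (t - a j))" for w :: "nat \<Rightarrow> real" and t
  define \<phi>' where "\<phi>' w t = 1 + (\<Sum>j<m. w j / (t - a j)\<^sup>2)" for w :: "nat \<Rightarrow> real" and t
  have [measurable]: "(\<lambda>x. \<phi> (f x) (g x)) \<in> borel_measurable N" "(\<lambda>x. \<phi>' (f x) (g x)) \<in> borel_measurable N"
    if f: "f \<in> measurable N (lebesgue_pow m)" and [measurable]: "g \<in> borel_measurable N" for f g and N :: "'x measure"
  proof -
    note [measurable] = measurable_coordinate[OF f]
    show "(\<lambda>x. \<phi> (f x) (g x)) \<in> borel_measurable N" unfolding \<phi>_def by measurable
    show "(\<lambda>x. \<phi>' (f x) (g x)) \<in> borel_measurable N" unfolding \<phi>'_def by measurable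
  qed
  have [measurable]: "(\<lambda>x. F (f x) (g x)) \<in> borel_measurable N"
    if [measurable]: "f \<in> borel_measurable N" "g \<in> measurable N (lebesgue_pow m)" for f g and N :: "'x measure"
    using measurable_compose[OF _ F, of "\<lambda>x. (f x, g x)" N] by simp
  let ?I = "{a (m - 1)<..}"
  define H where "H x = (if strictly_between m a x then
        F (x m - (\<Sum>j<m. residue_at m x a j)) (\<lambda>j\<in>{..<m}. residue_at m x a j * (x m - a j)) *
        ennreal (vandermonde (Suc m) x / vandermonde m a) else 0)" for x
  have [measurable]: "H \<in> borel_measurable (lebesgue_pow (Suc m))"
  proof -
    have [measurable]: "(\<lambda>x. residue_at m x a j) \<in> borel_measurable (lebesgue_pow (Suc m))" if "j \<in> {..<m}" for j
      using that by (auto intro!: residue_at_measurable)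
    have [measurable]: "(\<lambda>x. \<lambda>j\<in>{..<m}. residue_at m x a j * (x m - a j)) \<in> measurable (lebesgue_pow (Suc m)) (lebesgue_pow m)"
      by (rule measurable_restrict) measurable
    show ?thesis unfolding H_def by measurable
  qed
  have "(\<integral>\<^sup>+w. \<integral>\<^sup>+s. (if all_pos m w then F s w else 0) \<partial>lborel \<partial>lebesgue_pow m) =
    (\<integral>\<^sup>+w. \<integral>\<^sup>+t. (if all_pos m w then F (\<phi> w t) w * ennreal (\<phi>' w t) * indicator ?I t else 0) \<partial>lborel \<partial>lebesgue_pow m)"
  proof (rule nn_integral_cong)
    fix w assume [measurable]: "w \<in> space (lebesgue_pow m)"
    show "(\<integral>\<^sup>+s. (if all_pos m w then F s w else 0) \<partial>lborel) =
      (\<integral>\<^sup>+t. (if all_pos m w then F (\<phi> w t) w * ennreal (\<phi>' w t) * indicator ?I t else 0) \<partial>lborel)"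
    proof (cases "all_pos m w")
      case True
      then show ?thesis
        using nn_integral_subst_largest_root[of "\<lambda>s. F s w", OF _ m a True]
        by (simp add: \<phi>_def \<phi>'_def)
    qed (simp only: if_False)
  qed
  also have "\<dots> = (\<integral>\<^sup>+t. \<integral>\<^sup>+w. (if all_pos m w then F (\<phi> w t) w * ennreal (\<phi>' w t) * indicator ?I t else 0) \<partial>lebesgue_pow m \<partial>lborel)"
    by (rule nn_integral_swap[OF sigma_finite_lebesgue_pow sigma_finite_lborel]) measurable
  also have "\<dots> = (\<integral>\<^sup>+t. \<integral>\<^sup>+r. H (r(m := t)) \<partial>lebesgue_pow m \<partial>lborel)"
  proof (rule nn_integral_cong)
    fix t :: real
    have ilc: "strictly_between m a (r(m := t)) \<longleftrightarrow> interlaces m r a \<and> t \<in> ?I" for r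
    proof -
      have "interlaces m (r(m := t)) a \<longleftrightarrow> interlaces m r a"
        unfolding interlaces_def by (intro ball_cong refl) auto
      then show ?thesis by (simp add: strictly_between_last[OF m])
    qed
    show "(\<integral>\<^sup>+w. (if all_pos m w then F (\<phi> w t) w * ennreal (\<phi>' w t) * indicator ?I t else 0) \<partial>lebesgue_pow m) =
      (\<integral>\<^sup>+r. H (r(m := t)) \<partial>lebesgue_pow m)"
    proof (cases "t \<in> ?I")
      case False
      then show ?thesis by (simp add: H_def ilc cong: if_cong)
    next
      case True
      define c where "c j = t - a j" for j
      let ?P = "\<Prod>j<m. c j"
      have ta: "a j < t" "c j > 0" if "j < m" for j
        using True am[OF that] by (auto simp: c_def)
      define G where "G v = F (\<phi> (\<lambda>j\<in>{..<m}. c j * v j) t) (\<lambda>j\<in>{..<m}. c j * v j) *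
         ennreal (\<phi>' (\<lambda>j\<in>{..<m}. c j * v j) t) * ennreal ?P" for v
      have [measurable]: "(\<lambda>v. \<lambda>j\<in>{..<m}. c j * v j) \<in> measurable (lebesgue_pow m) (lebesgue_pow m)"
        by (rule measurable_restrict) simp
      have [measurable]: "G \<in> borel_measurable (lebesgue_pow m)"
        unfolding G_def by measurable
      have "(\<integral>\<^sup>+w. (if all_pos m w then F (\<phi> w t) w * ennreal (\<phi>' w t) * indicator ?I t else 0) \<partial>lebesgue_pow m) =
        (\<integral>\<^sup>+w. (if all_pos m w then F (\<phi> w t) w * ennreal (\<phi>' w t) else 0) \<partial>lebesgue_pow m)"
        by (rule nn_integral_cong) (simp only: indicator_simps(1)[OF True] mult_1_right)
      also have "\<dots> = (\<integral>\<^sup>+v. (if all_pos m (\<lambda>j\<in>{..<m}. c j * v j) then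
           F (\<phi> (\<lambda>j\<in>{..<m}. c j * v j) t) (\<lambda>j\<in>{..<m}. c j * v j) * ennreal (\<phi>' (\<lambda>j\<in>{..<m}. c j * v j) t) else 0) * ennreal ?P \<partial>lebesgue_pow m)"
        by (rule nn_integral_lebesgue_pow_scale, measurable) (rule ta)
      also have "\<dots> = (\<integral>\<^sup>+v. (if all_pos m v then G v else 0) \<partial>lebesgue_pow m)"
      proof (rule nn_integral_cong)
        fix v :: "nat \<Rightarrow> real"
        have "all_pos m (\<lambda>j\<in>{..<m}. c j * v j) \<longleftrightarrow> all_pos m v"
          using ta by (intro ball_cong refl) (simp add: zero_less_mult_iff order_less_not_sym)
        then show "(if all_pos m (\<lambda>j\<in>{..<m}. c j * v j) then
           F (\<phi> (\<lambda>j\<in>{..<m}. c j * v j) t) (\<lambda>j\<in>{..<m}. c j * v j) * ennreal (\<phi>' (\<lambda>j\<in>{..<m}. c j * v j) t) else 0) * ennreal ?P =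
           (if all_pos m v then G v else 0)"
          by (simp only: G_def if_distrib[of "\<lambda>x. x * ennreal ?P"] mult_zero_left)
      qed
      also have "\<dots> = (\<integral>\<^sup>+r. (if interlaces m r a then G (\<lambda>j\<in>{..<m}. residue_at m r a j) *
        ennreal (vandermonde m r / vandermonde m a) else 0) \<partial>lebesgue_pow m)"
        by (rule nn_integral_residue_roots[OF _ a]) measurable
      also have "\<dots> = (\<integral>\<^sup>+r. H (r(m := t)) \<partial>lebesgue_pow m)"
      proof (rule nn_integral_cong)
        fix r :: "nat \<Rightarrow> real"
        show "(if interlaces m r a then G (\<lambda>j\<in>{..<m}. residue_at m r a j) * ennreal (vandermonde m r / vandermonde m a) else 0) = H (r(m := t))"
        proof (cases "interlaces m r a")
          case False
          then show ?thesis by (simp add: H_def ilc)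
        next
          case il: True
          let ?r = "r(m := t)" and ?\<rho> = "residue_at m r a"
          let ?v = "\<lambda>j\<in>{..<m}. ?\<rho> j" let ?w = "\<lambda>j\<in>{..<m}. c j * ?v j"
          have res: "residue_at m ?r a j = ?\<rho> j" for j by (rule residue_at_cong) auto
          have pft: "(\<Prod>k<m. t - r k) / (\<Prod>k<m. t - a k) = 1 + (\<Sum>j<m. ?\<rho> j / (t - a j))"
            by (rule partial_fractions[OF inj]) (use ta in force)
          have \<phi>: "\<phi> ?w t = ?r m - (\<Sum>j<m. residue_at m ?r a j)"
            unfolding \<phi>_def fun_upd_same res
            by (intro arg_cong2[of _ _ _ _ minus] sum.cong refl) (use ta in \<open>force simp: c_def\<close>)
          have w: "?w = (\<lambda>j\<in>{..<m}. residue_at m ?r a j * (?r m - a j))"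
            unfolding res by (auto simp: fun_eq_iff c_def)
          have "\<phi>' ?w t = 1 + (\<Sum>j<m. ?\<rho> j / (t - a j))"
            unfolding \<phi>'_def
          proof (intro arg_cong2[of _ _ _ _ plus] sum.cong refl)
            fix j assume "j \<in> {..<m}"
            then show "?w j / (t - a j)\<^sup>2 = ?\<rho> j / (t - a j)"
              using ta(1)[of j] by (simp add: c_def power2_eq_square)
          qed
          then have p: "\<phi>' ?w t = (\<Prod>k<m. t - r k) / ?P" using pft by (simp add: c_def)
          have rt: "r k < t" if "k < m" for k
            using il that ta(1)[of k] by (auto simp: interlaces_def intro: less_trans)
          have pos: "0 < (\<Prod>k<m. t - r k)" "0 < ?P"
            by (intro prod_pos; use rt ta in force)+
          have jac: "\<phi>' ?w t * ?P = (\<Prod>k<m. t - r k)"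
            unfolding p using less_imp_neq[OF pos(2), symmetric] by (rule nonzero_eq_divide_eq[THEN iffD1]) (rule refl)
          have "vandermonde m ?r = vandermonde m r" by (rule vandermonde_cong) auto
          then have vd: "vandermonde (Suc m) ?r / vandermonde m a = \<phi>' ?w t * ?P * (vandermonde m r / vandermonde m a)"
            unfolding jac vandermonde_Suc by (simp add: mult.commute)
          have "0 \<le> \<phi>' ?w t" unfolding p by (intro divide_nonneg_nonneg less_imp_le[OF pos(1)] less_imp_le[OF pos(2)])
          then have "G ?v * ennreal (vandermonde m r / vandermonde m a) =
            F (?r m - (\<Sum>j<m. residue_at m ?r a j)) (\<lambda>j\<in>{..<m}. residue_at m ?r a j * (?r m - a j)) *
            ennreal (vandermonde (Suc m) ?r / vandermonde m a)"
            unfolding G_def \<phi> vd w[symmetric] using pos by (simp only: ennreal_mult' mult_nonneg_nonneg less_imp_le mult.assoc)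
          then show ?thesis using il True by (simp add: H_def ilc)
        qed
      qed
      finally show ?thesis .
    qed
  qed
  also have "\<dots> = (\<integral>\<^sup>+x. H x \<partial>lebesgue_pow (Suc m))"
    by (rule nn_integral_lebesgue_pow_Suc_rev[symmetric]) measurable
  finally show ?thesis unfolding H_def .
qed

section \<open>Roots of a rational function with given poles and weights\<close>

text \<open>
The definition splits off the largest variable; the smallest one is needed where the first pole
plays a special role.
\<close>
lemma vandermonde_split_first:
  "vandermonde (Suc m) x = vandermonde m (\<lambda>j. x (Suc j)) * (\<Prod>j<m. x (Suc j) - x 0)"
proof (induction m)
  case 0
  show ?case by (simp add: vandermonde_def)
next
  case (Suc m)
  have "vandermonde (Suc (Suc m)) x = vandermonde (Suc m) x * (\<Prod>k<Suc m. x (Suc m) - x k)"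
    by (rule vandermonde_Suc)
  also have "(\<Prod>k<Suc m. x (Suc m) - x k) = (x (Suc m) - x 0) * (\<Prod>k<m. x (Suc m) - x (Suc k))"
    by (rule prod.lessThan_Suc_shift)
  finally show ?case
    unfolding Suc vandermonde_Suc[of m "\<lambda>j. x (Suc j)"] by (simp add: mult_ac)
qed

text \<open>
Adds a first coordinate, as opposed to the update at \<open>m\<close>, which adds a last one.
\<close>
definition cons_fun :: "nat \<Rightarrow> real \<Rightarrow> (nat \<Rightarrow> real) \<Rightarrow> nat \<Rightarrow> real" where
  "cons_fun m c v = (\<lambda>j\<in>{..<Suc m}. case j of 0 \<Rightarrow> c | Suc i \<Rightarrow> v i)"

lemma cons_fun_simps [simp]:
  "cons_fun m c v 0 = c" "i < m \<Longrightarrow> cons_fun m c v (Suc i) = v i"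
  by (simp_all add: cons_fun_def)

lemma cons_fun_measurable [measurable (raw)]:
  assumes [measurable]: "f \<in> borel_measurable N" and g: "g \<in> measurable N (lebesgue_pow m)"
  shows "(\<lambda>x. cons_fun m (f x) (g x)) \<in> measurable N (lebesgue_pow (Suc m))"
  unfolding cons_fun_def
proof (rule measurable_restrict)
  fix i assume "i \<in> {..<Suc m}"
  then show "(\<lambda>x. case i of 0 \<Rightarrow> f x | Suc i \<Rightarrow> g x i) \<in> measurable N lborel"
    using measurable_coordinate[OF g] by (cases i) auto
qed

text \<open>
Only the last coordinate can be split off directly, so the first one is reached by commuting it
past the others, one at a time.
\<close>
lemma nn_integral_lebesgue_pow_cons:
  assumes "F \<in> borel_measurable (lebesgue_pow (Suc m))"
  shows "(\<integral>\<^sup>+y. F y \<partial>lebesgue_pow (Suc m)) = (\<integral>\<^sup>+v. \<integral>\<^sup>+c. F (cons_fun m c v) \<partial>lborel \<partial>lebesgue_pow m)"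
  using assms
proof (induction m arbitrary: F)
  case 0
  note [measurable] = 0
  have eq: "(v :: nat \<Rightarrow> real)(0 := c) = cons_fun 0 c v" if "v \<in> space (lebesgue_pow 0)" for v c
    using that by (auto simp: fun_eq_iff cons_fun_def space_PiM)
  have "(\<integral>\<^sup>+y. F y \<partial>lebesgue_pow (Suc 0)) = (\<integral>\<^sup>+v. \<integral>\<^sup>+c. F (v(0 := c)) \<partial>lborel \<partial>lebesgue_pow 0)"
    by (rule nn_integral_lebesgue_pow_Suc) fact
  also have "\<dots> = (\<integral>\<^sup>+v. \<integral>\<^sup>+c. F (cons_fun 0 c v) \<partial>lborel \<partial>lebesgue_pow 0)"
    by (intro nn_integral_cong) (simp only: eq)
  finally show ?case .
next
  case (Suc m)
  note [measurable] = Suc.prems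
  have eq: "(cons_fun m c v)(Suc m := t) = cons_fun (Suc m) c (v(m := t))" for v c t
    by (auto simp: fun_eq_iff cons_fun_def split: nat.split)
  have "(\<integral>\<^sup>+y. F y \<partial>lebesgue_pow (Suc (Suc m))) = (\<integral>\<^sup>+y. \<integral>\<^sup>+t. F (y(Suc m := t)) \<partial>lborel \<partial>lebesgue_pow (Suc m))"
    by (rule nn_integral_lebesgue_pow_Suc) fact
  also have "\<dots> = (\<integral>\<^sup>+v. \<integral>\<^sup>+c. \<integral>\<^sup>+t. F ((cons_fun m c v)(Suc m := t)) \<partial>lborel \<partial>lborel \<partial>lebesgue_pow m)"
    by (rule Suc.IH) measurable
  also have "\<dots> = (\<integral>\<^sup>+v. \<integral>\<^sup>+t. \<integral>\<^sup>+c. F (cons_fun (Suc m) c (v(m := t))) \<partial>lborel \<partial>lborel \<partial>lebesgue_pow m)"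
    unfolding eq
  proof (rule nn_integral_cong)
    fix v assume [measurable]: "v \<in> space (lebesgue_pow m)"
    show "(\<integral>\<^sup>+c. \<integral>\<^sup>+t. F (cons_fun (Suc m) c (v(m := t))) \<partial>lborel \<partial>lborel) = (\<integral>\<^sup>+t. \<integral>\<^sup>+c. F (cons_fun (Suc m) c (v(m := t))) \<partial>lborel \<partial>lborel)"
      by (rule nn_integral_swap[OF sigma_finite_lborel sigma_finite_lborel]) measurable
  qed
  also have "\<dots> = (\<integral>\<^sup>+v. \<integral>\<^sup>+c. F (cons_fun (Suc m) c v) \<partial>lborel \<partial>lebesgue_pow (Suc m))"
    by (rule nn_integral_lebesgue_pow_Suc[symmetric]) measurable
  finally show ?case .
qed

text \<open>
The residue at \<open>x\<^sub>j\<close> of \<open>\<Prod>k<m. (X - r\<^sub>k) / \<Prod>k<m+1. (X - x\<^sub>k)\<close>: for interlacing \<open>r\<close> and \<open>x\<close> these are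
positive numbers with sum \<open>1\<close>, the spectral weights.
\<close>
definition root_ratio :: "nat \<Rightarrow> (nat \<Rightarrow> 'a::field) \<Rightarrow> (nat \<Rightarrow> 'a) \<Rightarrow> nat \<Rightarrow> 'a" where
  "root_ratio m r x j = (\<Prod>k<m. x j - r k) / (\<Prod>k\<in>{..<Suc m} - {j}. x j - x k)"

lemma root_ratio_0: "root_ratio m r x 0 = (\<Prod>k<m. x 0 - r k) / (\<Prod>k<m. x 0 - x (Suc k))"
proof -
  have "{..<Suc m} - {0} = Suc ` {..<m}" by (auto simp: image_iff less_Suc_eq_0_disj)
  then show ?thesis by (simp add: root_ratio_def prod.reindex)
qed

lemma root_ratio_Suc:
  assumes "j < m"
  shows "root_ratio m r x (Suc j) = residue_at m r (\<lambda>i. x (Suc i)) j / (x (Suc j) - x 0)"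
proof -
  have "{..<Suc m} - {Suc j} = insert 0 (Suc ` ({..<m} - {j}))"
    by (auto simp: image_iff less_Suc_eq_0_disj)
  then show ?thesis by (simp add: root_ratio_def residue_at_def prod.reindex mult.commute)
qed

lemma strictly_between_first:
  "strictly_between m r x \<longleftrightarrow> interlaces m r (\<lambda>j. x (Suc j)) \<and> (0 < m \<longrightarrow> x 0 < r 0)"
proof
  assume *: "strictly_between m r x"
  then show "interlaces m r (\<lambda>j. x (Suc j)) \<and> (0 < m \<longrightarrow> x 0 < r 0)"
    by (auto simp: strictly_between_def interlaces_def)
next
  assume *: "interlaces m r (\<lambda>j. x (Suc j)) \<and> (0 < m \<longrightarrow> x 0 < r 0)"
  show "strictly_between m r x"
    unfolding strictly_between_def
  proof
    fix j assume j: "j \<in> {..<m}"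
    then show "x j < r j \<and> r j < x (Suc j)"
      using * by (cases j) (auto simp: interlaces_def)
  qed
qed

text \<open>
Positive weights \<open>y\<close> at fixed poles \<open>x\<^sub>0 < \<dots> < x\<^sub>m\<close> are exchanged for their sum \<open>c\<close> and the \<open>m\<close> zeros
\<open>r\<close> of \<open>\<Sum> y\<^sub>j / (X - x\<^sub>j)\<close>. First \<open>y\<^sub>0\<close> is exchanged for \<open>c\<close>. Then \<open>X - x\<^sub>0\<close> times the function,
divided by \<open>c\<close>, is \<open>1 + \<Sum> v\<^sub>j / (X - a\<^sub>j)\<close> with poles \<open>a\<^sub>j = x\<^sub>j\<^sub>+\<^sub>1\<close> and
\<open>v\<^sub>j = y\<^sub>j\<^sub>+\<^sub>1 (a\<^sub>j - x\<^sub>0) / c\<close>, to which \<open>nn_integral_residue_roots\<close> applies. That lemma leaves the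
smallest root unbounded below, and the remaining condition \<open>0 < y\<^sub>0\<close> is exactly \<open>x\<^sub>0 < r\<^sub>0\<close>.
\<close>
lemma nn_integral_stieltjes_roots:
  assumes F [measurable]: "F \<in> borel_measurable (lebesgue_pow (Suc m))"
    and x: "strict_mono_on {..<Suc m} x"
  shows "(\<integral>\<^sup>+y. (if all_pos (Suc m) y then F y else 0) \<partial>lebesgue_pow (Suc m)) =
    (\<integral>\<^sup>+r. \<integral>\<^sup>+c. (if 0 < c \<and> strictly_between m r x then
        F (\<lambda>j\<in>{..<Suc m}. c * root_ratio m r x j) * ennreal (c ^ m * (vandermonde m r / vandermonde (Suc m) x)) else 0)
      \<partial>lborel \<partial>lebesgue_pow m)"
proof -
  define a where "a j = x (Suc j)" for j
  have a: "strict_mono_on {..<m} a" using x by (auto simp: strict_mono_on_def a_def)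
  have a0: "x 0 < a j" if "j < m" for j using x that by (auto simp: strict_mono_on_def a_def)
  have inj: "inj_on a {..<m}" by (rule strict_mono_on_imp_inj_on[OF a])
  have [measurable]: "(\<lambda>x. \<Sum>j<m. f x j) \<in> borel_measurable N"
    if f: "f \<in> measurable N (lebesgue_pow m)" for f and N :: "'x measure"
    by (intro borel_measurable_sum measurable_coordinate[OF f])
  define H where "H r c = (if 0 < c \<and> strictly_between m r x then
        F (\<lambda>j\<in>{..<Suc m}. c * root_ratio m r x j) * ennreal (c ^ m * (vandermonde m r / vandermonde (Suc m) x)) else 0)" for r c
  have H [measurable]: "(\<lambda>(r, c). H r c) \<in> borel_measurable (lebesgue_pow m \<Otimes>\<^sub>M lborel)"
  proof -
    have [measurable]: "(\<lambda>y. root_ratio m (fst y) x j) \<in> borel_measurable (lebesgue_pow m \<Otimes>\<^sub>M lborel)" for j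
      unfolding root_ratio_def by measurable
    have [measurable]: "(\<lambda>y. \<lambda>j\<in>{..<Suc m}. snd y * root_ratio m (fst y) x j) \<in> measurable (lebesgue_pow m \<Otimes>\<^sub>M lborel) (lebesgue_pow (Suc m))"
      by (rule measurable_restrict) measurable
    have [measurable]: "(\<lambda>x. fst x j) \<in> borel_measurable (lebesgue_pow m \<Otimes>\<^sub>M lborel)" if "j < m" for j
      by (rule measurable_coordinate[OF measurable_fst]) (use that in auto)
    show ?thesis unfolding H_def split_beta by measurable
  qed
  have "(\<integral>\<^sup>+y. (if all_pos (Suc m) y then F y else 0) \<partial>lebesgue_pow (Suc m)) =
    (\<integral>\<^sup>+v. \<integral>\<^sup>+c. (if all_pos (Suc m) (cons_fun m c v) then F (cons_fun m c v) else 0) \<partial>lborel \<partial>lebesgue_pow m)"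
    by (rule nn_integral_lebesgue_pow_cons) measurable
  also have "\<dots> = (\<integral>\<^sup>+v. \<integral>\<^sup>+c. (if all_pos m v \<and> (\<Sum>j<m. v j) < c then F (cons_fun m (c - (\<Sum>j<m. v j)) v) else 0) \<partial>lborel \<partial>lebesgue_pow m)"
  proof (rule nn_integral_cong)
    fix v assume v[measurable]: "v \<in> space (lebesgue_pow m)"
    have pos: "all_pos (Suc m) (cons_fun m c v) \<longleftrightarrow> all_pos m v \<and> 0 < c" for c
      by (auto simp: cons_fun_def split: nat.split)
    have [measurable]: "(\<lambda>c. F (cons_fun m c v)) \<in> borel_measurable borel" by measurable
    show "(\<integral>\<^sup>+c. (if all_pos (Suc m) (cons_fun m c v) then F (cons_fun m c v) else 0) \<partial>lborel) =
      (\<integral>\<^sup>+c. (if all_pos m v \<and> (\<Sum>j<m. v j) < c then F (cons_fun m (c - (\<Sum>j<m. v j)) v) else 0) \<partial>lborel)"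
      unfolding pos
      using nn_integral_real_affine[of "\<lambda>c. (if all_pos m v \<and> 0 < c then F (cons_fun m c v) else 0)" 1 "- (\<Sum>j<m. v j)"]
      by (simp cong: if_cong)
  qed
  also have "\<dots> = (\<integral>\<^sup>+c. \<integral>\<^sup>+v. (if all_pos m v \<and> (\<Sum>j<m. v j) < c then F (cons_fun m (c - (\<Sum>j<m. v j)) v) else 0) \<partial>lebesgue_pow m \<partial>lborel)"
    by (rule nn_integral_swap[OF sigma_finite_lebesgue_pow sigma_finite_lborel]) measurable
  also have "\<dots> = (\<integral>\<^sup>+c. \<integral>\<^sup>+r. H r c \<partial>lebesgue_pow m \<partial>lborel)"
  proof (rule nn_integral_cong)
    fix c :: real
    show "(\<integral>\<^sup>+v. (if all_pos m v \<and> (\<Sum>j<m. v j) < c then F (cons_fun m (c - (\<Sum>j<m. v j)) v) else 0) \<partial>lebesgue_pow m) =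
      (\<integral>\<^sup>+r. H r c \<partial>lebesgue_pow m)"
    proof (cases "0 < c")
      case False
      have "\<not> (all_pos m v \<and> (\<Sum>j<m. v j) < c)" for v :: "nat \<Rightarrow> real"
      proof
        assume "all_pos m v \<and> (\<Sum>j<m. v j) < c"
        then have "0 \<le> (\<Sum>j<m. v j)" "(\<Sum>j<m. v j) < c" by (auto intro!: sum_nonneg simp: less_imp_le)
        then show False using False by simp
      qed
      then show ?thesis using False by (simp only: if_False H_def simp_thms)
    next
      case True
      define b where "b j = c / (a j - x 0)" for j
      let ?P = "\<Prod>j<m. b j"
      have b: "0 < b j" if "j < m" for j using a0[OF that] True by (simp add: b_def)
      have [measurable]: "(\<lambda>v. \<lambda>j\<in>{..<m}. b j * v j) \<in> measurable (lebesgue_pow m) (lebesgue_pow m)"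
        by (rule measurable_restrict) simp
      define G where "G v = (if 0 < 1 + (\<Sum>j<m. v j / (x 0 - a j)) then
          F (cons_fun m (c * (1 + (\<Sum>j<m. v j / (x 0 - a j)))) (\<lambda>j\<in>{..<m}. b j * v j)) * ennreal ?P else 0)" for v
      have [measurable]: "G \<in> borel_measurable (lebesgue_pow m)"
        unfolding G_def by measurable
      have "(\<integral>\<^sup>+v. (if all_pos m v \<and> (\<Sum>j<m. v j) < c then F (cons_fun m (c - (\<Sum>j<m. v j)) v) else 0) \<partial>lebesgue_pow m) =
        (\<integral>\<^sup>+v. (if all_pos m (\<lambda>j\<in>{..<m}. b j * v j) \<and> (\<Sum>i<m. (\<lambda>j\<in>{..<m}. b j * v j) i) < c then
           F (cons_fun m (c - (\<Sum>i<m. (\<lambda>j\<in>{..<m}. b j * v j) i)) (\<lambda>j\<in>{..<m}. b j * v j)) else 0) * ennreal ?P \<partial>lebesgue_pow m)"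
        by (rule nn_integral_lebesgue_pow_scale, measurable) (rule b)
      also have "\<dots> = (\<integral>\<^sup>+v. (if all_pos m v then G v else 0) \<partial>lebesgue_pow m)"
      proof (rule nn_integral_cong)
        fix v :: "nat \<Rightarrow> real"
        have pos: "all_pos m (\<lambda>j\<in>{..<m}. b j * v j) \<longleftrightarrow> all_pos m v"
          using b by (intro ball_cong refl) (simp add: zero_less_mult_iff order_less_not_sym)
        have "(\<Sum>i<m. (\<lambda>j\<in>{..<m}. b j * v j) i) = (\<Sum>j<m. - c * (v j / (x 0 - a j)))"
        proof (rule sum.cong[OF refl])
          fix j assume "j \<in> {..<m}"
          then show "(\<lambda>j\<in>{..<m}. b j * v j) j = - c * (v j / (x 0 - a j))"
            using a0[of j] by (simp add: b_def divide_simps) (simp add: algebra_simps)?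
        qed
        then have sum: "(\<Sum>i<m. (\<lambda>j\<in>{..<m}. b j * v j) i) = - (c * (\<Sum>j<m. v j / (x 0 - a j)))"
          by (simp add: sum_distrib_left sum_negf)
        have lt: "- (c * S) < c \<longleftrightarrow> 0 < 1 + S" for S
          using True mult_less_cancel_left_pos[of c 0 "1 + S"] by (auto simp: distrib_left)
        have diff: "c - - (c * S) = c * (1 + S)" for S by (simp add: distrib_left)
        show "(if all_pos m (\<lambda>j\<in>{..<m}. b j * v j) \<and> (\<Sum>i<m. (\<lambda>j\<in>{..<m}. b j * v j) i) < c then
           F (cons_fun m (c - (\<Sum>i<m. (\<lambda>j\<in>{..<m}. b j * v j) i)) (\<lambda>j\<in>{..<m}. b j * v j)) else 0) * ennreal ?P =
           (if all_pos m v then G v else 0)"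
          unfolding pos sum lt diff G_def by simp
      qed
      also have "\<dots> = (\<integral>\<^sup>+r. (if interlaces m r a then G (\<lambda>j\<in>{..<m}. residue_at m r a j) *
        ennreal (vandermonde m r / vandermonde m a) else 0) \<partial>lebesgue_pow m)"
        by (rule nn_integral_residue_roots[OF _ a]) measurable
      also have "\<dots> = (\<integral>\<^sup>+r. H r c \<partial>lebesgue_pow m)"
      proof (rule nn_integral_cong)
        fix r :: "nat \<Rightarrow> real"
        show "(if interlaces m r a then G (\<lambda>j\<in>{..<m}. residue_at m r a j) * ennreal (vandermonde m r / vandermonde m a) else 0) = H r c"
        proof (cases "interlaces m r a")
          case False
          then show ?thesis by (simp add: H_def strictly_between_first a_def[abs_def])
        next
          case il: True
          let ?\<rho> = "residue_at m r a" let ?v = "\<lambda>j\<in>{..<m}. ?\<rho> j"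
          have pf: "(\<Prod>k<m. x 0 - r k) / (\<Prod>k<m. x 0 - a k) = 1 + (\<Sum>j<m. ?\<rho> j / (x 0 - a j))"
            by (rule partial_fractions[OF inj]) (use a0 in force)
          have S: "1 + (\<Sum>j<m. ?v j / (x 0 - a j)) = root_ratio m r x 0"
            unfolding root_ratio_0 using pf by (simp add: a_def)
          \<comment> \<open>All factors of the ratio but the one with \<open>r 0\<close> are positive by the interlacing.\<close>
          have iff: "0 < root_ratio m r x 0 \<longleftrightarrow> strictly_between m r x"
          proof -
            have rk: "x 0 < r k" if "k < m" "0 < k" for k
            proof -
              have "a (k - 1) < r k" using il that by (auto simp: interlaces_def)
              moreover have "k - 1 < m" using that by simp
              ultimately show ?thesis using a0[of "k - 1"] by linarith
            qed
            have "root_ratio m r x 0 = (\<Prod>k<m. (r k - x 0) / (a k - x 0))"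
            proof -
              have "(x 0 - r k) / (x 0 - a k) = (r k - x 0) / (a k - x 0)" for k
                using minus_divide_divide[of "x 0 - r k" "x 0 - a k"] by simp
              then show ?thesis unfolding root_ratio_0 prod_dividef[symmetric] by (simp add: a_def)
            qed
            also have "0 < \<dots> \<longleftrightarrow> (0 < m \<longrightarrow> x 0 < r 0)"
            proof (cases m)
              case (Suc l)
              have "0 < (\<Prod>k<l. (r (Suc k) - x 0) / (a (Suc k) - x 0))"
                using rk a0 Suc by (intro prod_pos) auto
              then show ?thesis using Suc a0[of 0]
                by (subst Suc, subst prod.lessThan_Suc_shift) (simp add: zero_less_mult_iff zero_less_divide_iff order_less_not_sym)
            qed simp
            finally show ?thesis using il by (simp add: strictly_between_first a_def[abs_def])
          qed
          have cons: "cons_fun m (c * root_ratio m r x 0) (\<lambda>j\<in>{..<m}. b j * ?v j) = (\<lambda>j\<in>{..<Suc m}. c * root_ratio m r x j)"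
          proof
            fix j
            show "cons_fun m (c * root_ratio m r x 0) (\<lambda>j\<in>{..<m}. b j * ?v j) j = (\<lambda>j\<in>{..<Suc m}. c * root_ratio m r x j) j"
            proof (cases j)
              case (Suc i)
              then show ?thesis using root_ratio_Suc[of i m r x]
                by (simp add: cons_fun_def b_def a_def[abs_def])
            qed simp
          qed
          have Ppos: "0 < (\<Prod>j<m. a j - x 0)" by (intro prod_pos) (use a0 in auto)
          have "?P = c ^ m / (\<Prod>j<m. a j - x 0)"
            by (simp add: b_def prod_dividef)
          then have vd: "c ^ m * (vandermonde m r / vandermonde (Suc m) x) = ?P * (vandermonde m r / vandermonde m a)"
            unfolding vandermonde_split_first by (simp add: a_def[abs_def])
          have "0 \<le> ?P" by (intro prod_nonneg) (use b in \<open>auto simp: less_imp_le\<close>)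
          then show ?thesis
            using True il unfolding G_def S iff cons H_def vd
            by (simp add: ennreal_mult' mult.assoc del: restrict_apply times_divide_eq_right)
        qed
      qed
      finally show ?thesis .
    qed
  qed
  also have "\<dots> = (\<integral>\<^sup>+r. \<integral>\<^sup>+c. H r c \<partial>lborel \<partial>lebesgue_pow m)"
    by (rule nn_integral_swap[OF sigma_finite_lebesgue_pow sigma_finite_lborel H, symmetric])
  finally show ?thesis unfolding H_def .
qed

section \<open>One step of the recursion on the real line\<close>

text \<open>
Divide the expansion of \<open>partial_fractions\<close> for the poles \<open>x\<^sub>1, \<dots>, x\<^sub>m\<close> by \<open>X - x\<^sub>0\<close>. Evaluating it at
\<open>x\<^sub>0\<close> itself gives the residue there, and that the residues add up to \<open>1\<close>.
\<close>
lemma root_ratio_expansion: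
  fixes r x :: "nat \<Rightarrow> 'a::field"
  assumes inj: "inj_on x {..<Suc m}"
  shows "(\<Sum>j<Suc m. root_ratio m r x j) = 1"
    and "(\<And>j. j < Suc m \<Longrightarrow> X \<noteq> x j) \<Longrightarrow>
      (\<Prod>k<m. X - r k) / (\<Prod>k<Suc m. X - x k) = (\<Sum>j<Suc m. root_ratio m r x j / (X - x j))"
proof -
  define a where "a j = x (Suc j)" for j
  have a: "inj_on a {..<m}" using inj by (auto simp: inj_on_def a_def)
  have x0: "x 0 \<noteq> a j" if "j < m" for j using inj_onD[OF inj, of 0 "Suc j"] that by (auto simp: a_def)
  let ?\<rho> = "residue_at m r a"
  have \<mu>: "root_ratio m r x (Suc j) = ?\<rho> j / (a j - x 0)" if "j < m" for j
    using root_ratio_Suc[OF that] by (simp add: a_def[abs_def])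
  have "root_ratio m r x 0 = 1 + (\<Sum>j<m. ?\<rho> j / (x 0 - a j))"
    unfolding root_ratio_0 using partial_fractions[OF a x0, of "r"] by (simp add: a_def[abs_def])
  also have "(\<Sum>j<m. ?\<rho> j / (x 0 - a j)) = (\<Sum>j<m. - root_ratio m r x (Suc j))"
    by (rule sum.cong[OF refl]) (simp add: \<mu> minus_divide_right)
  finally have \<mu>0: "root_ratio m r x 0 = 1 - (\<Sum>j<m. root_ratio m r x (Suc j))"
    by (simp add: sum_negf)
  show "(\<Sum>j<Suc m. root_ratio m r x j) = 1"
    unfolding sum.lessThan_Suc_shift \<mu>0 by simp
  assume X: "\<And>j. j < Suc m \<Longrightarrow> X \<noteq> x j"
  have Xa: "X \<noteq> a j" if "j < m" for j using X that by (auto simp: a_def)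
  have X0: "X \<noteq> x 0" using X by auto
  have "(\<Prod>k<m. X - r k) / (\<Prod>k<Suc m. X - x k) = ((\<Prod>k<m. X - r k) / (\<Prod>k<m. X - a k)) / (X - x 0)"
    unfolding prod.lessThan_Suc_shift by (simp add: a_def)
  also have "\<dots> = 1 / (X - x 0) + (\<Sum>j<m. ?\<rho> j / (X - a j) / (X - x 0))"
    by (simp only: partial_fractions[OF a Xa, of r] add_divide_distrib sum_divide_distrib)
  also have "(\<Sum>j<m. ?\<rho> j / (X - a j) / (X - x 0)) =
    (\<Sum>j<m. root_ratio m r x (Suc j) / (X - a j) - root_ratio m r x (Suc j) / (X - x 0))"
  proof (rule sum.cong[OF refl])
    fix j assume j: "j \<in> {..<m}"
    then have ne: "X - a j \<noteq> 0" "X - x 0 \<noteq> 0" "a j - x 0 \<noteq> 0" using Xa X0 x0[of j] by auto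
    have "1 / (X - a j) - 1 / (X - x 0) = (a j - x 0) / ((X - a j) * (X - x 0))"
      using ne by (simp add: divide_simps)
    then have "?\<rho> j / (a j - x 0) * (1 / (X - a j) - 1 / (X - x 0)) = ?\<rho> j / (X - a j) / (X - x 0)"
      using ne by simp
    then show "?\<rho> j / (X - a j) / (X - x 0) = root_ratio m r x (Suc j) / (X - a j) - root_ratio m r x (Suc j) / (X - x 0)"
      using j by (simp add: \<mu> right_diff_distrib)
  qed
  also have "1 / (X - x 0) + \<dots> = root_ratio m r x 0 / (X - x 0) + (\<Sum>j<m. root_ratio m r x (Suc j) / (X - a j))"
    unfolding \<mu>0 by (simp add: sum_subtractf diff_divide_distrib sum_divide_distrib)
  finally show "(\<Prod>k<m. X - r k) / (\<Prod>k<Suc m. X - x k) = (\<Sum>j<Suc m. root_ratio m r x j / (X - x j))"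
    unfolding sum.lessThan_Suc_shift by (simp add: a_def)
qed

lemma root_ratio_of_real:
  "root_ratio m (\<lambda>k. of_real (r k)) (\<lambda>k. of_real (x k)) j = (of_real (root_ratio m r x j) :: complex)"
  by (simp add: root_ratio_def)

lemma residue_at_of_real:
  "residue_at m (\<lambda>k. of_real (r k)) (\<lambda>k. of_real (a k)) j = (of_real (residue_at m r a j) :: complex)"
  by (simp add: residue_at_def)

definition cayley :: "real \<Rightarrow> complex" where
  "cayley x = (of_real x - \<i>) / (of_real x + \<i>)"

text \<open>
The polynomial \<open>p\<close> of a level whose eigenvalues are the Cayley transforms of \<open>x\<close>.
\<close>
definition node_poly :: "nat \<Rightarrow> (nat \<Rightarrow> real) \<Rightarrow> complex \<Rightarrow> complex" where
  "node_poly m x z = (\<Prod>j<m. z - cayley (x j))"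

text \<open>
The polynomial \<open>q\<close> of a level with eigenvalues at the Cayley transforms of \<open>x\<close> and weights \<open>y\<close>, so
that \<open>q / p = \<Sum> y\<^sub>j / (z - z\<^sub>j)\<close>.
\<close>
definition weight_poly :: "nat \<Rightarrow> (nat \<Rightarrow> real) \<Rightarrow> (nat \<Rightarrow> real) \<Rightarrow> complex \<Rightarrow> complex" where
  "weight_poly m x y z = (\<Sum>j<m. of_real (y j) * (\<Prod>k\<in>{..<m} - {j}. z - cayley (x k)))"

lemma weight_poly_eq:
  assumes "\<And>j. j < m \<Longrightarrow> z \<noteq> cayley (x j)"
  shows "weight_poly m x y z = node_poly m x z * (\<Sum>j<m. of_real (y j) / (z - cayley (x j)))"
  unfolding weight_poly_def node_poly_def sum_distrib_left
proof (rule sum.cong[OF refl])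
  fix j assume j: "j \<in> {..<m}"
  then show "of_real (y j) * (\<Prod>k\<in>{..<m} - {j}. z - cayley (x k)) = (\<Prod>j<m. z - cayley (x j)) * (of_real (y j) / (z - cayley (x j)))"
    using assms[of j] by (subst prod.remove[of _ j]) auto
qed

text \<open>
One step of the recursion in the half-plane coordinate \<open>\<zeta> = a + \<i> b\<close> of the coefficient. The second
argument \<open>Q\<close> already contains the factor \<open>b\<close>, see \<open>half_step_disc_step\<close>.
\<close>
definition half_step :: "real \<Rightarrow> real \<Rightarrow> complex \<Rightarrow> complex \<Rightarrow> complex \<Rightarrow> complex \<times> complex" where
  "half_step a b z P Q = (let \<zeta> = Complex a b; A = 1 / (1 + \<i> * cnj \<zeta>) in
     (A * ((1 - \<i> * \<zeta> + (1 + \<i> * \<zeta>) * z) * P + 2 * (z - 1) * z * Q),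
      A * ((1 + \<i> * \<zeta>) * P + 2 * z * Q)))"

text \<open>
Here \<open>y\<close> and \<open>a\<close> are the values that the bordered change of variables attaches to old roots \<open>l\<close> and
new roots \<open>x\<close>. The kernel \<open>(1 + l X) / (l - X)\<close> of the Cayley picture differs from
\<open>(1 + l\<^sup>2) / (l - X)\<close> by the constant \<open>- l\<close>, which explains the weight \<open>1 + l\<^sub>j\<^sup>2\<close> in \<open>y\<close> and
the sum of \<open>y\<^sub>j l\<^sub>j\<close> in \<open>a\<close>.
\<close>
lemma bordered_identity:
  fixes X :: complex
  assumes inj: "inj_on l {..<m}" and X: "\<And>j. j < m \<Longrightarrow> X \<noteq> of_real (l j)"
    and y: "\<And>j. j < m \<Longrightarrow> y j = residue_at m x l j * (x m - l j) / (1 + (l j)\<^sup>2)"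
    and a: "a = (\<Sum>j<m. y j * l j) - (x m - (\<Sum>j<m. residue_at m x l j))"
  shows "X + of_real a + (\<Sum>j<m. of_real (y j) * ((1 + of_real (l j) * X) / (of_real (l j) - X))) =
    (\<Prod>k<Suc m. X - of_real (x k)) / (\<Prod>k<m. X - of_real (l k))"
proof -
  let ?\<rho> = "\<lambda>j. of_real (residue_at m x l j) :: complex"
  have inj': "inj_on (\<lambda>j. of_real (l j) :: complex) {..<m}" using inj by (auto simp: inj_on_def)
  have ne: "1 + (l j)\<^sup>2 \<noteq> 0" for j using zero_le_power2[of "l j"] by linarith
  have "(\<Prod>k<Suc m. X - of_real (x k)) / (\<Prod>k<m. X - of_real (l k)) =
    ((\<Prod>k<m. X - of_real (x k)) / (\<Prod>k<m. X - of_real (l k))) * (X - of_real (x m))"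
    by simp
  also have "\<dots> = (1 + (\<Sum>j<m. ?\<rho> j / (X - of_real (l j)))) * (X - of_real (x m))"
    using partial_fractions[OF inj' X, of "\<lambda>k. of_real (x k)"] by (simp add: residue_at_of_real)
  also have "\<dots> = X - of_real (x m) + (\<Sum>j<m. ?\<rho> j / (X - of_real (l j)) * (X - of_real (x m)))"
    by (simp only: distrib_right sum_distrib_right mult_1_left)
  also have "(\<Sum>j<m. ?\<rho> j / (X - of_real (l j)) * (X - of_real (x m))) =
    (\<Sum>j<m. ?\<rho> j + of_real (y j * l j) + of_real (y j) * ((1 + of_real (l j) * X) / (of_real (l j) - X)))"
  proof (rule sum.cong[OF refl])
    fix j assume j: "j \<in> {..<m}"
    let ?l = "of_real (l j) :: complex" and ?y = "of_real (y j) :: complex"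
    have Xl: "X - ?l \<noteq> 0" "?l - X \<noteq> 0" using X[of j] j by auto
    have "y j * (1 + (l j)\<^sup>2) = residue_at m x l j * (x m - l j)"
      using y[of j] j ne[of j] by simp
    then have yl: "?y * (1 + ?l\<^sup>2) = ?\<rho> j * (of_real (x m) - ?l)"
      by (metis (mono_tags) of_real_1 of_real_add of_real_diff of_real_mult of_real_power)
    have "?y * ?l + ?y * ((1 + ?l * X) / (?l - X)) = ?y * (1 + ?l\<^sup>2) / (?l - X)"
      using Xl by (simp add: divide_simps) (simp add: algebra_simps power2_eq_square)
    also have "\<dots> = ?\<rho> j * ((of_real (x m) - ?l) / (?l - X))" unfolding yl by simp
    also have "(of_real (x m) - ?l) / (?l - X) = (X - of_real (x m)) / (X - ?l) - 1"
      using Xl by (simp add: divide_simps) (simp add: algebra_simps)?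
    finally have E: "?y * ?l + ?y * ((1 + ?l * X) / (?l - X)) = ?\<rho> j * ((X - of_real (x m)) / (X - ?l) - 1)" .
    have gen: "p * d = p + p * (d - 1)" for p d :: complex by (simp add: algebra_simps)
    have "?\<rho> j / (X - ?l) * (X - of_real (x m)) = ?\<rho> j * ((X - of_real (x m)) / (X - ?l))" by simp
    also have "\<dots> = ?\<rho> j + ?\<rho> j * ((X - of_real (x m)) / (X - ?l) - 1)" by (rule gen)
    finally show "?\<rho> j / (X - ?l) * (X - of_real (x m)) = ?\<rho> j + of_real (y j * l j) + ?y * ((1 + ?l * X) / (?l - X))"
      unfolding E[symmetric] by (simp only: of_real_mult add.assoc)
  qed
  also have "X - of_real (x m) + \<dots> = X + of_real a + (\<Sum>j<m. of_real (y j) * ((1 + of_real (l j) * X) / (of_real (l j) - X)))"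
    unfolding a by (simp add: sum.distrib)
  finally show ?thesis ..
qed

lemma of_real_plus_ii_neq [simp]: "of_real x + \<i> \<noteq> 0" "of_real x - \<i> \<noteq> 0" "\<i> - of_real x \<noteq> 0" "\<i> + of_real x \<noteq> 0"
   "- \<i> - of_real x \<noteq> 0"
  by (auto simp: complex_eq_iff)

text \<open>
The recursion carries (old roots, old weights times \<open>b\<close>, coefficient) to (new roots, new
weights). With \<open>M\<close> as in the proof, \<open>X + M\<close> is the rational function of \<open>bordered_identity\<close>; the
two components of \<open>half_step\<close> become multiples of \<open>X + M\<close> and \<open>1 + \<i> M\<close>. Their quotient is
\<open>(\<i> - M) / (X + M)\<close> up to a factor depending on \<open>X\<close> alone, and
\<open>1 / (X + M)\<close> has the new weights as residues. The second claim is the identity at \<open>X = \<i>\<close>, where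
the kernel \<open>(1 + l X) / (l - X)\<close> has the constant value \<open>\<i>\<close>.
\<close>
lemma half_step_identity:
  fixes X z :: complex
  assumes l: "inj_on l {..<m}" and x: "inj_on x {..<Suc m}" and m: "0 < m"
    and lx: "\<And>j k. j < m \<Longrightarrow> k < Suc m \<Longrightarrow> l j \<noteq> x k"
    and X: "X \<notin> \<real>" "X \<noteq> - \<i>" and z: "z = (X - \<i>) / (X + \<i>)"
    and y: "\<And>j. j < m \<Longrightarrow> y j = residue_at m x l j * (x m - l j) / (1 + (l j)\<^sup>2)"
    and a: "a = (\<Sum>j<m. y j * l j) - (x m - (\<Sum>j<m. residue_at m x l j))"
    and b: "b = (\<Sum>j<m. y j)"
  shows "half_step a b z (node_poly m l z) (weight_poly m l y z) =
    (node_poly (Suc m) x z, weight_poly (Suc m) x (root_ratio m l x) z)"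
    and "\<i> + Complex a b = (\<Prod>k<Suc m. \<i> - of_real (x k)) / (\<Prod>k<m. \<i> - of_real (l k))"
proof -
  have Xr: "X \<noteq> of_real t" for t using X by auto
  have Xi: "X + \<i> \<noteq> 0" using X by (metis add_eq_0_iff2)
  have zc: "z - cayley t = 2 * \<i> * (X - of_real t) / ((X + \<i>) * (of_real t + \<i>))" for t
    unfolding z cayley_def using Xi by (simp add: divide_simps) (simp add: algebra_simps)
  have zne: "z \<noteq> cayley t" for t
    using zc[of t] Xr[of t] Xi by auto
  let ?\<zeta> = "Complex a b"
  let ?t = "\<lambda>X j. (1 + of_real (l j) * X) / (of_real (l j) - X)"
  define M where "M = of_real a + (\<Sum>j<m. of_real (y j) * ?t X j)"
  have XM: "X + M = (\<Prod>k<Suc m. X - of_real (x k)) / (\<Prod>k<m. X - of_real (l k))"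
    unfolding M_def using bordered_identity[OF l _ y a, of X] Xr by (simp add: add.assoc)
  have XM0: "X + M \<noteq> 0" unfolding XM using Xr by simp
  \<comment> \<open>The kernel is constant at \<open>\<plusminus>\<i>\<close>, which gives \<open>\<i> + \<zeta>\<close> and its conjugate as products.\<close>
  have ti: "?t \<i> j = \<i>" "?t (- \<i>) j = - \<i>" for j
    by (simp_all add: divide_simps) (simp_all add: algebra_simps complex_eq_iff)
  have \<zeta>: "?\<zeta> = of_real a + \<i> * of_real b" "cnj ?\<zeta> = of_real a - \<i> * of_real b" by (simp_all add: complex_eq_iff)
  have sb: "(\<Sum>j<m. of_real (y j) * \<i>) = \<i> * of_real b" by (simp add: b sum_distrib_left mult.commute)
  have sb': "(\<Sum>j<m. of_real (y j) * (- \<i>)) = - (\<i> * of_real b)" by (simp add: b sum_distrib_left mult.commute sum_negf)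
  have nr: "\<i> \<noteq> of_real t" "- \<i> \<noteq> of_real t" for t by (auto simp: complex_eq_iff)
  show Z: "\<i> + ?\<zeta> = (\<Prod>k<Suc m. \<i> - of_real (x k)) / (\<Prod>k<m. \<i> - of_real (l k))"
    using bordered_identity[OF l nr(1) y a] unfolding ti sb \<zeta> by (simp add: add.assoc)
  have Z': "- \<i> + cnj ?\<zeta> = (\<Prod>k<Suc m. - \<i> - of_real (x k)) / (\<Prod>k<m. - \<i> - of_real (l k))"
  proof -
    have "- \<i> \<noteq> of_real (l j)" if "j < m" for j by (rule nr(2))
    from bordered_identity[OF l this y a] show ?thesis
      unfolding ti sb' \<zeta>(2) by (simp only: add_uminus_conv_diff add_diff_eq)
  qed
  define A where "A = 1 / (1 + \<i> * cnj ?\<zeta>)"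
  have cnjne: "- \<i> + cnj ?\<zeta> \<noteq> 0" unfolding Z' using nr(2) by simp
  have "1 + \<i> * cnj ?\<zeta> = \<i> * (- \<i> + cnj ?\<zeta>)" by (simp add: algebra_simps)
  then have A: "A = 1 / (\<i> * (- \<i> + cnj ?\<zeta>))" by (simp add: A_def)
  let ?P = "node_poly m l z" and ?Q = "weight_poly m l y z"
  have Pne: "?P \<noteq> 0" unfolding node_poly_def using zne by simp
  \<comment> \<open>The Herglotz kernel of the circle is the kernel of the line up to an affine map.\<close>
  have zt: "z / (z - cayley (l j)) = 1/2 + (\<i>/2) * ?t X j" for j
    unfolding zc unfolding z using Xi Xr[of "l j"]
    by (simp add: divide_simps) (simp add: algebra_simps)
  have "z * ?Q = ?P * (\<Sum>j<m. of_real (y j) * (z / (z - cayley (l j))))"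
    unfolding weight_poly_eq[OF zne] by (simp add: sum_distrib_left mult_ac)
  also have "(\<Sum>j<m. of_real (y j) * (z / (z - cayley (l j)))) = of_real b / 2 + (\<i>/2) * (M - of_real a)"
    unfolding zt M_def b by (simp add: distrib_left sum.distrib sum_distrib_left sum_divide_distrib mult_ac)
  finally have zQ: "z * ?Q = ?P * (of_real b / 2 + (\<i>/2) * (M - of_real a))" .
  have z1: "z - 1 = - 2 * \<i> / (X + \<i>)" unfolding z using Xi by (simp add: divide_simps)
  have lin: "1 - \<i> * ?\<zeta> + (1 + \<i> * ?\<zeta>) * z = 2 * (X + ?\<zeta>) / (X + \<i>)"
    unfolding z using Xi by (simp add: divide_simps) (simp add: algebra_simps)
  have E: "(1 - \<i> * ?\<zeta> + (1 + \<i> * ?\<zeta>) * z) * ?P + 2 * (z - 1) * z * ?Q = ?P * (2 * (X + M) / (X + \<i>))"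
  proof -
    have "2 * (z - 1) * z * ?Q = 2 * (z - 1) * (z * ?Q)" by simp
    also have "\<dots> = ?P * (2 * (- \<i> * of_real b + (M - of_real a)) / (X + \<i>))"
    proof -
      have "2 * (- 2 * \<i> / D) * (p * (c / 2 + (\<i>/2) * N)) = p * (2 * (- \<i> * c + N) / D)" for D p c N :: complex
        by (cases "D = 0") (simp_all add: divide_simps, simp_all add: algebra_simps)
      then show ?thesis unfolding zQ z1 .
    qed
    finally have "2 * (z - 1) * z * ?Q = ?P * (2 * (- \<i> * of_real b + (M - of_real a)) / (X + \<i>))" .
    moreover have "2 * (X + (c + \<i> * d)) / e * p + p * (2 * (- \<i> * d + (M - c)) / e) = p * (2 * (X + M) / e)" for c d e p :: complex
      by (cases "e = 0") (simp_all add: divide_simps algebra_simps)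
    ultimately show ?thesis unfolding lin unfolding \<zeta>(1) by (simp only:)
  qed
  \<comment> \<open>The prefactor \<open>A\<close> turns the product over the old nodes into the product over the new ones.\<close>
  have N: "node_poly (Suc m) x z = A * (?P * (2 * (X + M) / (X + \<i>)))"
  proof -
    define q where "q = 2 * \<i> / (X + \<i>)"
    let ?K = "\<lambda>m l. \<Prod>k<m. of_real (l k) + \<i>" and ?N = "\<lambda>m l. \<Prod>k<m. X - of_real (l k)"
    have np: "node_poly m l z = q ^ m * ?N m l / ?K m l" for m and l :: "nat \<Rightarrow> real"
      unfolding node_poly_def zc q_def by (simp add: prod_dividef prod.distrib power_divide power_mult_distrib)
    have neg: "(\<Prod>k<m. - \<i> - of_real (l k)) = (-1) ^ m * ?K m l" for m and l :: "nat \<Rightarrow> real"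
      using prod.distrib[of "\<lambda>_. -1::complex" "\<lambda>k. of_real (l k) + \<i>" "{..<m}"] by (simp add: algebra_simps)
    have ne: "?K m l \<noteq> 0" "?K (Suc m) x \<noteq> 0" "?N m l \<noteq> 0" using Xr by (simp_all del: prod.lessThan_Suc)
    have "A = \<i> * ?K m l / ?K (Suc m) x"
      unfolding A Z' neg using ne by (simp add: divide_simps del: prod.lessThan_Suc)
    then show ?thesis
      unfolding np XM using ne Xi by (simp add: q_def mult_ac del: prod.lessThan_Suc)
  qed
  have 1: "A * ((1 - \<i> * ?\<zeta> + (1 + \<i> * ?\<zeta>) * z) * ?P + 2 * (z - 1) * z * ?Q) = node_poly (Suc m) x z"
    unfolding E N ..
  have inj': "inj_on (\<lambda>j. of_real (x j) :: complex) {..<Suc m}" using x by (auto simp: inj_on_def)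
  let ?\<mu> = "\<lambda>j. of_real (root_ratio m l x j) :: complex"
  have \<mu>1: "(\<Sum>j<Suc m. ?\<mu> j) = 1"
    using root_ratio_expansion(1)[OF inj', of "\<lambda>k. of_real (l k)"] by (simp only: root_ratio_of_real)
  have \<mu>X: "(\<Sum>j<Suc m. ?\<mu> j / (X - of_real (x j))) = 1 / (X + M)"
    using root_ratio_expansion(2)[OF inj' Xr, of "\<lambda>k. of_real (l k)"] unfolding XM root_ratio_of_real by simp
  have "(\<Sum>j<Suc m. ?\<mu> j / (z - cayley (x j))) = (\<Sum>j<Suc m. (X + \<i>) / (2 * \<i>) * ((X + \<i>) * (?\<mu> j / (X - of_real (x j))) - ?\<mu> j))"
  proof (rule sum.cong[OF refl])
    fix j
    have "1 / (z - cayley (x j)) = (X + \<i>) / (2 * \<i>) * ((X + \<i>) / (X - of_real (x j)) - 1)"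
      unfolding zc using Xi Xr[of "x j"] by (simp add: divide_simps) (simp add: algebra_simps)?
    then have "?\<mu> j * (1 / (z - cayley (x j))) = ?\<mu> j * ((X + \<i>) / (2 * \<i>) * ((X + \<i>) / (X - of_real (x j)) - 1))" by simp
    moreover have gen: "c * (d * (m / e) - m) = m * (c * (d / e - 1))" for c d e m :: complex by (simp add: algebra_simps)
    ultimately show "?\<mu> j / (z - cayley (x j)) = (X + \<i>) / (2 * \<i>) * ((X + \<i>) * (?\<mu> j / (X - of_real (x j))) - ?\<mu> j)"
      unfolding gen by (metis mult.right_neutral times_divide_eq_right)
  qed
  also have "\<dots> = (X + \<i>) / (2 * \<i>) * ((X + \<i>) * (1 / (X + M)) - 1)"
    unfolding sum_distrib_left[symmetric] sum_subtractf \<mu>1 \<mu>X ..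
  also have "\<dots> = (X + \<i>) / (2 * \<i>) * ((\<i> - M) / (X + M))"
  proof -
    have "d * (1 / e) - 1 = (d - e) / e" if "e \<noteq> 0" for d e :: complex using that by (simp add: divide_simps)
    from this[OF XM0, of "X + \<i>"] show ?thesis by simp
  qed
  finally have "weight_poly (Suc m) x (root_ratio m l x) z = A * (?P * (2 * (X + M) / (X + \<i>))) * ((X + \<i>) / (2 * \<i>) * ((\<i> - M) / (X + M)))"
    unfolding weight_poly_eq[OF zne] N by simp
  also have "\<dots> = A * (?P * (1 + \<i> * M))"
  proof -
    have "2 * u / v * (v / (2 * \<i>) * (w / u)) = w / \<i>" if "u \<noteq> 0" "v \<noteq> 0" for u v w :: complex using that by simp
    from this[OF XM0 Xi, of "\<i> - M"]
    have "2 * (X + M) / (X + \<i>) * ((X + \<i>) / (2 * \<i>) * ((\<i> - M) / (X + M))) = (\<i> - M) / \<i>" .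
    also have "\<dots> = 1 + \<i> * M" by (simp add: divide_simps) (simp add: algebra_simps)
    finally show ?thesis by (simp only: mult.assoc)
  qed
  also have "?P * (1 + \<i> * M) = (1 + \<i> * ?\<zeta>) * ?P + 2 * z * ?Q"
  proof -
    have "2 * z * ?Q = 2 * (z * ?Q)" by simp
    also have "\<dots> = ?P * (of_real b + \<i> * (M - of_real a))" unfolding zQ by (simp add: distrib_left)
    finally show ?thesis unfolding \<zeta> by (simp add: algebra_simps)
  qed
  finally have 2: "A * ((1 + \<i> * ?\<zeta>) * ?P + 2 * z * ?Q) = weight_poly (Suc m) x (root_ratio m l x) z" by simp
  show "half_step a b z (node_poly m l z) (weight_poly m l y z) =
    (node_poly (Suc m) x z, weight_poly (Suc m) x (root_ratio m l x) z)"
    unfolding half_step_def Let_def A_def[symmetric] 1 2 ..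
qed

section \<open>The Jacobi weight along one step\<close>

text \<open>
For \<open>Re z < 1\<close> the point \<open>1 - z\<close> avoids the cut of the logarithm, so the two powers are complex
conjugate to each other.
\<close>
lemma jacobi_weight_exp:
  assumes "Re z < 1"
  shows "jacobi_weight \<delta> z = exp (2 * Re (cnj \<delta> * Ln (1 - z)))"
proof -
  have z: "1 - z \<noteq> 0" "1 - cnj z \<noteq> 0" using assms by (auto simp: complex_eq_iff)
  have "1 - z \<notin> \<real>\<^sub>\<le>\<^sub>0" using assms by (auto simp: complex_nonpos_Reals_iff)
  then have "Ln (cnj (1 - z)) = cnj (Ln (1 - z))" by (rule cnj_Ln[symmetric])
  then have "(1 - z) powr cnj \<delta> * (1 - cnj z) powr \<delta> = exp (cnj \<delta> * Ln (1 - z) + cnj (cnj \<delta> * Ln (1 - z)))"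
    using z by (simp add: powr_def exp_add)
  also have "\<dots> = exp (of_real (2 * Re (cnj \<delta> * Ln (1 - z))))"
    by (simp add: complex_add_cnj del: complex_cnj_mult)
  also have "\<dots> = of_real (exp (2 * Re (cnj \<delta> * Ln (1 - z))))" by (rule exp_of_real)
  finally show ?thesis by (simp add: jacobi_weight_def)
qed

text \<open>
The principal logarithm of \<open>1 - z\<close> at the point \<open>z\<close> of the circle that corresponds to \<open>x\<close>: its
imaginary part is \<open>arctan x\<close>.
\<close>
definition log_factor :: "real \<Rightarrow> complex" where
  "log_factor x = of_real (ln (2 / sqrt (1 + x\<^sup>2))) + \<i> * of_real (arctan x)"

lemma exp_log_factor: "exp (log_factor x) = 1 - cayley x"
proof -
  let ?s = "sqrt (1 + x\<^sup>2)"
  have s: "0 < ?s" by (simp add: add_pos_nonneg)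
  have ss: "of_real ?s * of_real ?s = (1 + (of_real x)\<^sup>2 :: complex)"
  proof -
    have "?s * ?s = 1 + x\<^sup>2" by simp
    then show ?thesis by (metis of_real_mult of_real_add of_real_1 of_real_power)
  qed
  have "exp (log_factor x) = of_real (2 / ?s) * cis (arctan x)"
    using s by (simp add: log_factor_def exp_add exp_of_real cis_conv_exp del: of_real_divide)
  also have "cis (arctan x) = (1 + \<i> * of_real x) / of_real ?s"
    by (simp add: complex_eq_iff cos_arctan sin_arctan)
  also have "of_real (2 / ?s) * \<dots> = 2 * (1 + \<i> * of_real x) / (of_real ?s * of_real ?s)"
    by simp
  also have "\<dots> = 2 * (1 + \<i> * of_real x) / ((1 + \<i> * of_real x) * (1 - \<i> * of_real x))"
    unfolding ss by (simp add: algebra_simps power2_eq_square)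
  also have "\<dots> = 2 * \<i> / (of_real x + \<i>)"
  proof -
    have "1 + \<i> * of_real x \<noteq> 0" "1 - \<i> * of_real x = (of_real x + \<i>) / \<i>" by (auto simp: complex_eq_iff divide_simps)
    moreover have "2 * u / (u * (d / \<i>)) = 2 * \<i> / d" if "u \<noteq> 0" for u d :: complex
      using that by (cases "d = 0") (auto simp: divide_simps)
    ultimately show ?thesis by metis
  qed
  also have "\<dots> = 1 - cayley x"
    by (simp add: cayley_def divide_simps)
  finally show ?thesis .
qed

lemma Ln_one_minus_cayley: "Ln (1 - cayley x) = log_factor x"
  unfolding exp_log_factor[symmetric]
  using arctan_bounded[of x] by (intro Ln_exp) (auto simp: log_factor_def intro: less_trans[of _ "pi/2"] less_trans[of _ "-(pi/2)"])

lemma Re_cayley_less: "Re (cayley x) < 1"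
proof -
  have "Re (1 - cayley x) = exp (Re (log_factor x)) * cos (arctan x)"
    unfolding exp_log_factor[symmetric] by (simp add: Re_exp log_factor_def)
  also have "\<dots> > 0" using cos_arctan[of x] by (simp add: add_pos_nonneg)
  finally show ?thesis by simp
qed

lemma jacobi_weight_cayley: "jacobi_weight \<delta> (cayley x) = exp (2 * Re (cnj \<delta> * log_factor x))"
  using jacobi_weight_exp[OF Re_cayley_less] by (simp add: Ln_one_minus_cayley)

text \<open>
Pair each \<open>l\<^sub>j\<close> with its left or with its right neighbour: one unpaired arctangent remains, and all
pairs have the same sign.
\<close>
lemma alternating_arctan_bounds:
  assumes "strictly_between m l x"
  shows "\<bar>(\<Sum>k<Suc m. arctan (x k)) - (\<Sum>j<m. arctan (l j))\<bar> < pi / 2"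
proof -
  have b: "x j < l j" "l j < x (Suc j)" if "j < m" for j using assms that by (auto simp: strictly_between_def)
  have "(\<Sum>k<Suc m. arctan (x k)) - (\<Sum>j<m. arctan (l j)) = arctan (x m) + (\<Sum>j<m. arctan (x j) - arctan (l j))"
    by (simp add: sum_subtractf)
  also have "(\<Sum>j<m. arctan (x j) - arctan (l j)) \<le> 0"
    using b(1) by (intro sum_nonpos) (auto simp: arctan_le_iff less_imp_le)
  finally have upper: "(\<Sum>k<Suc m. arctan (x k)) - (\<Sum>j<m. arctan (l j)) < pi / 2"
    using arctan_ubound[of "x m"] by linarith
  have "(\<Sum>k<Suc m. arctan (x k)) - (\<Sum>j<m. arctan (l j)) = arctan (x 0) + (\<Sum>j<m. arctan (x (Suc j)) - arctan (l j))"
    unfolding sum.lessThan_Suc_shift by (simp add: sum_subtractf)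
  moreover have "0 \<le> (\<Sum>j<m. arctan (x (Suc j)) - arctan (l j))"
    using b(2) by (intro sum_nonneg) (auto simp: arctan_le_iff less_imp_le)
  ultimately show ?thesis using upper arctan_lbound[of "x 0"] by linarith
qed

text \<open>
Up to the branch of the logarithm this is \<open>1 - \<gamma> = \<Prod> (1 - z\<^sub>k) / \<Prod> (1 - z'\<^sub>j)\<close>. The sum \<open>S\<close> of the
logarithms on the right has imaginary part between \<open>- \<pi> / 2\<close> and \<open>\<pi> / 2\<close> because of the interlacing, so
it is the principal logarithm of \<open>1 - \<gamma>\<close> and powers with the complex exponent \<open>\<delta>\<close> multiply.
\<close>
lemma jacobi_weight_multiplicative:
  assumes sb: "strictly_between m l x"
    and prod: "\<i> + \<zeta> = (\<Prod>k<Suc m. \<i> - of_real (x k)) / (\<Prod>k<m. \<i> - of_real (l k))"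
    and \<gamma>: "\<gamma> = 1 - 2 / (1 + \<i> * cnj \<zeta>)"
  shows "jacobi_weight \<delta> \<gamma> * (\<Prod>j<m. jacobi_weight \<delta> (cayley (l j))) = (\<Prod>k<Suc m. jacobi_weight \<delta> (cayley (x k)))"
proof -
  define S where "S = (\<Sum>k<Suc m. log_factor (x k)) - (\<Sum>j<m. log_factor (l j))"
  have ImS: "Im S = (\<Sum>k<Suc m. arctan (x k)) - (\<Sum>j<m. arctan (l j))"
    unfolding S_def by (simp add: log_factor_def)
  have bd: "\<bar>Im S\<bar> < pi / 2" unfolding ImS by (rule alternating_arctan_bounds[OF sb])
  have cay: "cnj (1 - cayley t) = 2 * \<i> / (\<i> - of_real t)" for t
    by (simp add: cayley_def divide_simps) (simp add: algebra_simps)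
  have "exp S = (\<Prod>k<Suc m. 1 - cayley (x k)) / (\<Prod>j<m. 1 - cayley (l j))"
    unfolding S_def exp_diff exp_sum[OF finite_lessThan] exp_log_factor ..
  then have "cnj (exp S) = (\<Prod>k<Suc m. 2 * \<i> / (\<i> - of_real (x k))) / (\<Prod>j<m. 2 * \<i> / (\<i> - of_real (l j)))"
    by (simp only: complex_cnj_divide cnj_prod cay)
  also have "\<dots> = 2 * \<i> / (\<i> + \<zeta>)"
    unfolding prod by (simp add: prod_dividef)
  also have "\<dots> = 2 / (1 - \<i> * \<zeta>)"
    using mult_divide_mult_cancel_left[of "- \<i>" "2 * \<i>" "\<i> + \<zeta>"] by (simp add: algebra_simps)
  finally have "exp S = cnj (2 / (1 - \<i> * \<zeta>))" by (metis complex_cnj_cnj)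
  then have e: "exp S = 1 - \<gamma>" by (simp add: \<gamma>)
  have "Ln (1 - \<gamma>) = S" unfolding e[symmetric] using bd pi_gt_zero by (intro Ln_exp) auto
  moreover have "0 < cos (Im S)" using bd by (intro cos_gt_zero_pi) linarith+
  then have "0 < Re (exp S)" by (simp add: Re_exp)
  ultimately have "jacobi_weight \<delta> \<gamma> = exp (2 * Re (cnj \<delta> * S))"
    using jacobi_weight_exp[of \<gamma> \<delta>] e by simp
  moreover have "2 * Re (cnj \<delta> * S) + (\<Sum>j<m. 2 * Re (cnj \<delta> * log_factor (l j))) = (\<Sum>k<Suc m. 2 * Re (cnj \<delta> * log_factor (x k)))"
  proof -
    have "cnj \<delta> * S + (\<Sum>j<m. cnj \<delta> * log_factor (l j)) = (\<Sum>k<Suc m. cnj \<delta> * log_factor (x k))"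
      unfolding S_def sum_distrib_left[symmetric] by (simp add: algebra_simps)
    from arg_cong[OF this, of Re] have "Re (cnj \<delta> * S) + Re (\<Sum>j<m. cnj \<delta> * log_factor (l j)) = Re (\<Sum>k<Suc m. cnj \<delta> * log_factor (x k))"
      by (simp only: plus_complex.sel)
    moreover have g: "(\<Sum>i\<in>A. 2 * Re (f i)) = 2 * Re (\<Sum>i\<in>A. f i)" for A and f :: "nat \<Rightarrow> complex"
      by (simp add: sum_distrib_left)
    ultimately show ?thesis unfolding g by linarith
  qed
  ultimately show ?thesis unfolding jacobi_weight_cayley by (simp only: exp_add[symmetric] exp_sum[OF finite_lessThan, symmetric])
qed

section \<open>Vandermonde products and resultants\<close>

text \<open>
Every unordered pair occurs twice on the left.
\<close>
lemma prod_off_diagonal: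
  assumes "strict_mono_on {..<m} a"
  shows "(\<Prod>j<m. \<Prod>k\<in>{..<m} - {j}. \<bar>a j - a k\<bar>) = (vandermonde m a)\<^sup>2"
  using assms
proof (induction m)
  case 0
  show ?case by (simp add: vandermonde_def)
next
  case (Suc m)
  have a: "strict_mono_on {..<m} a" using Suc.prems by (rule monotone_on_subset) auto
  have lt: "a j < a m" if "j < m" for j using Suc.prems that by (auto simp: strict_mono_on_def)
  have abs: "\<bar>a j - a m\<bar> = a m - a j" "\<bar>a m - a j\<bar> = a m - a j" if "j < m" for j using lt[OF that] by auto
  have e: "{..<Suc m} - {j} = insert m ({..<m} - {j})" if "j < m" for j using that by auto
  have "(\<Prod>j<Suc m. \<Prod>k\<in>{..<Suc m} - {j}. \<bar>a j - a k\<bar>) =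
    (\<Prod>j<m. \<bar>a j - a m\<bar> * (\<Prod>k\<in>{..<m} - {j}. \<bar>a j - a k\<bar>)) * (\<Prod>k\<in>{..<Suc m} - {m}. \<bar>a m - a k\<bar>)"
    using e by (simp add: prod.lessThan_Suc)
  also have "{..<Suc m} - {m} = {..<m}" by auto
  also have "(\<Prod>j<m. \<bar>a j - a m\<bar> * (\<Prod>k\<in>{..<m} - {j}. \<bar>a j - a k\<bar>)) = (\<Prod>j<m. a m - a j) * (vandermonde m a)\<^sup>2"
    unfolding prod.distrib Suc.IH[OF a] by (intro prod.cong arg_cong2[of _ _ _ _ times]) (auto simp: abs)
  also have "(\<Prod>k<m. \<bar>a m - a k\<bar>) = (\<Prod>k<m. a m - a k)"
    by (intro prod.cong) (auto simp: abs)
  finally show ?case unfolding vandermonde_Suc by (simp add: power2_eq_square mult_ac)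
qed

definition resultant :: "nat \<Rightarrow> (nat \<Rightarrow> real) \<Rightarrow> (nat \<Rightarrow> real) \<Rightarrow> real" where
  "resultant m l x = (\<Prod>j<m. \<Prod>k<Suc m. \<bar>l j - x k\<bar>)"

lemma abs_prod_bordered_weights:
  assumes "strict_mono_on {..<m} l"
  shows "\<bar>\<Prod>j<m. residue_at m x l j * (x m - l j)\<bar> = resultant m l x / (vandermonde m l)\<^sup>2"
  unfolding prod_off_diagonal[OF assms, symmetric] resultant_def prod_dividef[symmetric] abs_prod residue_at_def abs_mult
  by (intro prod.cong refl) (simp add: abs_prod abs_minus_commute)

lemma abs_prod_root_ratio:
  assumes "strict_mono_on {..<Suc m} x"
  shows "\<bar>\<Prod>j<Suc m. root_ratio m l x j\<bar> = resultant m l x / (vandermonde (Suc m) x)\<^sup>2"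
proof -
  have "resultant m l x = (\<Prod>k<Suc m. \<Prod>j<m. \<bar>l j - x k\<bar>)"
    unfolding resultant_def by (rule prod.swap)
  then show ?thesis
    unfolding prod_off_diagonal[OF assms, symmetric] prod_dividef[symmetric] abs_prod root_ratio_def
    by (simp only: prod_dividef[symmetric]) (intro prod.cong refl, simp add: abs_prod abs_minus_commute)
qed

section \<open>The disc as a half-plane\<close>

lemma lborel_complex: "lborel = distr (lborel \<Otimes>\<^sub>M lborel) borel (\<lambda>(x, y). Complex x y)"
proof (rule lborel_eqI)
  fix l u :: complex assume le: "\<And>b. b \<in> Basis \<Longrightarrow> l \<bullet> b \<le> u \<bullet> b"
  have lu: "Re l \<le> Re u" "Im l \<le> Im u" using le[of 1] le[of \<i>] by (auto simp: Basis_complex_def)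
  have [measurable]: "(\<lambda>(x, y). Complex x y) \<in> borel_measurable (lborel \<Otimes>\<^sub>M lborel)"
  proof -
    have "(\<lambda>(x, y). Complex x y) = (\<lambda>z. of_real (fst z) + \<i> * of_real (snd z))" by (auto simp: complex_eq_iff)
    then show ?thesis by simp
  qed
  have "(\<lambda>(x, y). Complex x y) -` box l u \<inter> space (lborel \<Otimes>\<^sub>M lborel) = {Re l<..<Re u} \<times> {Im l<..<Im u}"
    by (auto simp: in_box_complex_iff space_pair_measure)
  then have "emeasure (distr (lborel \<Otimes>\<^sub>M lborel) borel (\<lambda>(x, y). Complex x y)) (box l u) = ennreal (Re u - Re l) * ennreal (Im u - Im l)"
    using lu by (subst emeasure_distr) (auto simp: lborel.emeasure_pair_measure_Times)
  also have "\<dots> = ennreal (\<Prod>b\<in>Basis. (u - l) \<bullet> b)"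
    using lu by (simp add: Basis_complex_def ennreal_mult)
  finally show "emeasure (distr (lborel \<Otimes>\<^sub>M lborel) borel (\<lambda>(x, y). Complex x y)) (box l u) = ennreal (\<Prod>b\<in>Basis. (u - l) \<bullet> b)" .
qed simp

lemma Complex_measurable [measurable (raw)]:
  assumes [measurable]: "f \<in> borel_measurable M" "g \<in> borel_measurable M"
  shows "(\<lambda>x. Complex (f x) (g x)) \<in> borel_measurable M"
proof -
  have "(\<lambda>x. Complex (f x) (g x)) = (\<lambda>x. of_real (f x) + \<i> * of_real (g x))" by (auto simp: complex_eq_iff)
  then show ?thesis by simp
qed

lemma nn_integral_complex:
  assumes [measurable]: "f \<in> borel_measurable borel"
  shows "(\<integral>\<^sup>+z. f z \<partial>lborel) = (\<integral>\<^sup>+x. \<integral>\<^sup>+y. f (Complex x y) \<partial>lborel \<partial>lborel)"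
proof -
  have [measurable]: "(\<lambda>(x, y). Complex x y) \<in> borel_measurable (lborel \<Otimes>\<^sub>M lborel)"
    unfolding split_beta by measurable
  show ?thesis
    by (subst lborel_complex, subst nn_integral_distr, measurable)
       (simp add: split_beta lborel.nn_integral_fst[symmetric])
qed

text \<open>
\<open>\<gamma> = 1 - 2 / (1 + \<i> cnj \<zeta>)\<close> maps the upper half-plane \<open>\<zeta> = a + \<i> b\<close>, \<open>b > 0\<close>, onto the disc. The boundary
point \<open>1\<close>, at which the weight may be singular, goes to infinity.
\<close>
definition disc_point :: "real \<Rightarrow> real \<Rightarrow> complex" where
  "disc_point a b = 1 - 2 / (1 + \<i> * cnj (Complex a b))"

lemma disc_point_eq:
  assumes "1 + b \<noteq> 0"
  shows "disc_point a b = Complex (1 - 2 * (1 + b) / ((1 + b)\<^sup>2 + a\<^sup>2)) (2 * a / ((1 + b)\<^sup>2 + a\<^sup>2))"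
proof -
  have "1 + \<i> * cnj (Complex a b) = Complex (1 + b) a" by (simp add: complex_eq_iff)
  then show ?thesis by (simp add: disc_point_def complex_eq_iff Re_divide Im_divide)
qed

lemma disc_point_measurable [measurable (raw)]:
  assumes [measurable]: "f \<in> borel_measurable M" "g \<in> borel_measurable M"
  shows "(\<lambda>x. disc_point (f x) (g x)) \<in> borel_measurable M"
proof -
  have "1 + \<i> * cnj (Complex a b) = Complex (1 + b) a" for a b by (simp add: complex_eq_iff)
  then show ?thesis by (simp add: disc_point_def)
qed

text \<open>
The Jacobian of the Moebius map, obtained by iterated substitutions in one variable. Write
\<open>\<gamma> = 1 - p (1 - \<i> \<tau>)\<close>. For fixed \<open>\<tau>\<close> substitute \<open>p = k \<tau> / B\<close> with \<open>B = 1 + b\<close> and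
\<open>k \<tau> = 2 / (1 + \<tau>\<^sup>2)\<close>, and then \<open>\<tau> = a / B\<close>. The disc is the part \<open>B > 1\<close> of the half-plane
\<open>B > 0\<close>.
\<close>
lemma nn_integral_disc_half_plane:
  assumes [measurable]: "f \<in> borel_measurable borel"
  shows "(\<integral>\<^sup>+z. f z * indicator (ball 0 1) z \<partial>lborel) =
    (\<integral>\<^sup>+b. \<integral>\<^sup>+a. (if 0 < b then f (disc_point a b) * ennreal (4 / ((1 + b)\<^sup>2 + a\<^sup>2)\<^sup>2) else 0) \<partial>lborel \<partial>lborel)"
proof -
  define F where "F u v = f (Complex u v) * indicator {(u, v). u\<^sup>2 + v\<^sup>2 < 1} (u, v)" for u v
  have [measurable]: "(\<lambda>x. F (g x) (h x)) \<in> borel_measurable M"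
    if [measurable]: "g \<in> borel_measurable M" "h \<in> borel_measurable M" for g h and M :: "'x measure"
    unfolding F_def by measurable
  define k where "k \<tau> = 2 / (1 + \<tau>\<^sup>2)" for \<tau> :: real
  have k: "0 < k \<tau>" for \<tau> by (simp add: k_def add_pos_nonneg)
  have [measurable]: "k \<in> borel_measurable borel" unfolding k_def by measurable
  have "(\<integral>\<^sup>+z. f z * indicator (ball 0 1) z \<partial>lborel) = (\<integral>\<^sup>+u. \<integral>\<^sup>+v. F u v \<partial>lborel \<partial>lborel)"
  proof -
    have "indicator (ball 0 1) (Complex u v) = (indicator {(u, v). u\<^sup>2 + v\<^sup>2 < 1} (u, v) :: ennreal)" for u v
      by (auto simp: indicator_def cmod_def)
    moreover have "(\<integral>\<^sup>+z. f z * indicator (ball 0 1) z \<partial>lborel) =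
      (\<integral>\<^sup>+u. \<integral>\<^sup>+v. f (Complex u v) * indicator (ball 0 1) (Complex u v) \<partial>lborel \<partial>lborel)"
    proof (rule nn_integral_complex)
      have [measurable]: "ball (0::complex) 1 \<in> sets borel" by simp
      show "(\<lambda>z. f z * indicator (ball 0 1) z) \<in> borel_measurable borel" by measurable
    qed
    ultimately show ?thesis unfolding F_def by simp
  qed
  also have "\<dots> = (\<integral>\<^sup>+p. \<integral>\<^sup>+v. F (1 - p) v \<partial>lborel \<partial>lborel)"
    using nn_integral_real_affine[of "\<lambda>u. \<integral>\<^sup>+v. F u v \<partial>lborel" "-1" 1] by simp
  also have "\<dots> = (\<integral>\<^sup>+p. \<integral>\<^sup>+\<tau>. (ennreal p * F (1 - p) (p * \<tau>)) * indicator {0<..} p \<partial>lborel \<partial>lborel)"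
  proof (rule nn_integral_cong)
    fix p :: real
    show "(\<integral>\<^sup>+v. F (1 - p) v \<partial>lborel) = (\<integral>\<^sup>+\<tau>. (ennreal p * F (1 - p) (p * \<tau>)) * indicator {0<..} p \<partial>lborel)"
    proof (cases "0 < p")
      case True
      then show ?thesis
        using nn_integral_real_affine[of "\<lambda>v. F (1 - p) v" p 0] by (simp add: nn_integral_cmult)
    next
      case False
      then have "1 \<le> (1 - p)\<^sup>2" using power_mono[of 1 "1 - p" 2] by simp
      then have "F (1 - p) v = 0" for v using zero_le_power2[of v] unfolding F_def by (simp add: not_less add_increasing2)
      then show ?thesis using False by simp
    qed
  qed
  also have "\<dots> = (\<integral>\<^sup>+\<tau>. \<integral>\<^sup>+p. (ennreal p * F (1 - p) (p * \<tau>)) * indicator {0<..} p \<partial>lborel \<partial>lborel)"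
    by (rule nn_integral_swap[OF sigma_finite_lborel sigma_finite_lborel]) measurable
  also have "\<dots> = (\<integral>\<^sup>+\<tau>. \<integral>\<^sup>+B. (ennreal (k \<tau> / B) * F (1 - k \<tau> / B) (k \<tau> / B * \<tau>)) * ennreal (k \<tau> / B\<^sup>2) * indicator {0<..} B \<partial>lborel \<partial>lborel)"
  proof (rule nn_integral_cong)
    fix \<tau> :: real
    have "(\<integral>\<^sup>+p. (ennreal p * F (1 - p) (p * \<tau>)) * indicator {0<..} p \<partial>lborel) =
      (\<integral>\<^sup>+B. (ennreal (k \<tau> / B) * F (1 - k \<tau> / B) (k \<tau> / B * \<tau>)) * ennreal (k \<tau> / B\<^sup>2) * indicator (einterval (ereal 0) \<infinity>) B \<partial>lborel)"
    proof (rule nn_integral_subst_decr)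
      show "((\<lambda>B. k \<tau> / B) has_real_derivative - (k \<tau> / B\<^sup>2)) (at B)" if "B \<in> einterval (ereal 0) \<infinity>" for B
        using that by (auto intro!: derivative_eq_intros simp: power2_eq_square)
      show "continuous_on (einterval (ereal 0) \<infinity>) (\<lambda>B. k \<tau> / B\<^sup>2)"
        by (intro continuous_intros) auto
      show "(\<lambda>B. k \<tau> / B) ` einterval (ereal 0) \<infinity> = {0<..}"
      proof (intro equalityI subsetI)
        fix y :: real assume "y \<in> {0<..}"
        then show "y \<in> (\<lambda>B. k \<tau> / B) ` einterval (ereal 0) \<infinity>"
          using k[of \<tau>] by (intro image_eqI[of _ _ "k \<tau> / y"]) auto
      qed (use k in auto)
    qed (use k in \<open>auto simp: less_imp_le\<close>)
    then show "(\<integral>\<^sup>+p. (ennreal p * F (1 - p) (p * \<tau>)) * indicator {0<..} p \<partial>lborel) =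
      (\<integral>\<^sup>+B. (ennreal (k \<tau> / B) * F (1 - k \<tau> / B) (k \<tau> / B * \<tau>)) * ennreal (k \<tau> / B\<^sup>2) * indicator {0<..} B \<partial>lborel)"
      by simp
  qed
  also have "\<dots> = (\<integral>\<^sup>+B. \<integral>\<^sup>+\<tau>. (ennreal (k \<tau> / B) * F (1 - k \<tau> / B) (k \<tau> / B * \<tau>)) * ennreal (k \<tau> / B\<^sup>2) * indicator {0<..} B \<partial>lborel \<partial>lborel)"
    by (rule nn_integral_swap[OF sigma_finite_lborel sigma_finite_lborel]) measurable
  also have "\<dots> = (\<integral>\<^sup>+B. \<integral>\<^sup>+a. (if 1 < B then f (disc_point a (B - 1)) * ennreal (4 / (B\<^sup>2 + a\<^sup>2)\<^sup>2) else 0) \<partial>lborel \<partial>lborel)"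
  proof (rule nn_integral_cong)
    fix B :: real
    show "(\<integral>\<^sup>+\<tau>. (ennreal (k \<tau> / B) * F (1 - k \<tau> / B) (k \<tau> / B * \<tau>)) * ennreal (k \<tau> / B\<^sup>2) * indicator {0<..} B \<partial>lborel) =
      (\<integral>\<^sup>+a. (if 1 < B then f (disc_point a (B - 1)) * ennreal (4 / (B\<^sup>2 + a\<^sup>2)\<^sup>2) else 0) \<partial>lborel)"
    proof (cases "0 < B")
      case False
      then show ?thesis by simp
    next
      case B: True
      have "(\<integral>\<^sup>+\<tau>. (ennreal (k \<tau> / B) * F (1 - k \<tau> / B) (k \<tau> / B * \<tau>)) * ennreal (k \<tau> / B\<^sup>2) * indicator {0<..} B \<partial>lborel) =
        (\<integral>\<^sup>+a. ennreal (1 / B) * ((ennreal (k (a / B) / B) * F (1 - k (a / B) / B) (k (a / B) / B * (a / B))) * ennreal (k (a / B) / B\<^sup>2)) \<partial>lborel)"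
        using B nn_integral_real_affine[of "\<lambda>\<tau>. (ennreal (k \<tau> / B) * F (1 - k \<tau> / B) (k \<tau> / B * \<tau>)) * ennreal (k \<tau> / B\<^sup>2)" "1 / B" 0]
        by (simp add: nn_integral_cmult)
      also have "\<dots> = (\<integral>\<^sup>+a. (if 1 < B then f (disc_point a (B - 1)) * ennreal (4 / (B\<^sup>2 + a\<^sup>2)\<^sup>2) else 0) \<partial>lborel)"
      proof (rule nn_integral_cong)
        fix a :: real
        define N where "N = B\<^sup>2 + a\<^sup>2"
        have N: "0 < N" using B by (simp add: N_def add_pos_nonneg)
        have k1: "k (a / B) = 2 * B\<^sup>2 / N" using B N by (simp add: k_def N_def field_simps power2_eq_square)
        have p: "k (a / B) / B = 2 * B / N" "k (a / B) / B * (a / B) = 2 * a / N" "k (a / B) / B\<^sup>2 = 2 / N"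
          unfolding k1 using B by (simp_all add: power2_eq_square)
        have pt: "Complex (1 - 2 * B / N) (2 * a / N) = disc_point a (B - 1)"
          using B by (subst disc_point_eq) (simp_all add: N_def)
        have "(1 - 2 * B / N)\<^sup>2 + (2 * a / N)\<^sup>2 = 1 - 4 * B / N + 4 * (B\<^sup>2 + a\<^sup>2) / N\<^sup>2"
          by (simp add: power2_eq_square algebra_simps add_divide_distrib)
        also have "\<dots> = 1 + 4 * (1 - B) / N"
          unfolding N_def[symmetric] using N by (simp add: power2_eq_square field_simps)
        finally have in_disc: "(1 - 2 * B / N)\<^sup>2 + (2 * a / N)\<^sup>2 < 1 \<longleftrightarrow> 1 < B"
          using N by (simp add: divide_less_0_iff)
        have "ennreal (1 / B) * (ennreal (2 * B / N) * ennreal (2 / N)) = ennreal (4 / N\<^sup>2)"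
          using B N by (simp add: ennreal_mult[symmetric] power2_eq_square)
        then show "ennreal (1 / B) * ((ennreal (k (a / B) / B) * F (1 - k (a / B) / B) (k (a / B) / B * (a / B))) * ennreal (k (a / B) / B\<^sup>2)) =
          (if 1 < B then f (disc_point a (B - 1)) * ennreal (4 / (B\<^sup>2 + a\<^sup>2)\<^sup>2) else 0)"
        proof -
          assume c: "ennreal (1 / B) * (ennreal (2 * B / N) * ennreal (2 / N)) = ennreal (4 / N\<^sup>2)"
          have "u * ((v * (w * i)) * t) = (w * i) * (u * (v * t))" for u v w i t :: ennreal by (simp add: mult_ac)
          then show ?thesis
            unfolding p F_def pt N_def[symmetric] using in_disc c pt by (simp add: indicator_def)
        qed
      qed
      finally show ?thesis .
    qed
  qed
  also have "\<dots> = (\<integral>\<^sup>+b. \<integral>\<^sup>+a. (if 0 < b then f (disc_point a b) * ennreal (4 / ((1 + b)\<^sup>2 + a\<^sup>2)\<^sup>2) else 0) \<partial>lborel \<partial>lborel)"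
    using nn_integral_real_affine[of "\<lambda>B. \<integral>\<^sup>+a. (if 1 < B then f (disc_point a (B - 1)) * ennreal (4 / (B\<^sup>2 + a\<^sup>2)\<^sup>2) else 0) \<partial>lborel" 1 1]
    by (simp cong: if_cong)
  finally show ?thesis .
qed

section \<open>The laws of the coefficients\<close>

lemma cis_measurable [measurable]: "cis \<in> borel_measurable borel"
  by (intro borel_measurable_continuous_onI continuous_intros)

lemma jacobi_weight_measurable [measurable]: "jacobi_weight \<delta> \<in> borel_measurable borel"
proof -
  have [measurable]: "cnj \<in> borel_measurable borel"
    by (intro borel_measurable_continuous_onI continuous_intros)
  have "jacobi_weight \<delta> z = Re ((if 1 - z = 0 then 0 else exp (cnj \<delta> * Ln (1 - z))) * (if 1 - cnj z = 0 then 0 else exp (\<delta> * Ln (1 - cnj z))))" for z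
    by (simp add: jacobi_weight_def powr_def)
  then show ?thesis by (subst measurable_cong[where g = "\<lambda>z. Re ((if 1 - z = 0 then 0 else exp (cnj \<delta> * Ln (1 - z))) * (if 1 - cnj z = 0 then 0 else exp (\<delta> * Ln (1 - cnj z))))"]) simp_all
qed

text \<open>
On the line \<open>Re z = 1\<close> the value at \<open>z = 1\<close> is the one of \<open>0 powr _\<close>, which is \<open>0\<close>.
\<close>
lemma jacobi_weight_nonneg:
  assumes "Re z \<le> 1"
  shows "0 \<le> jacobi_weight \<delta> z"
proof (cases "Re z < 1")
  case True
  then show ?thesis by (simp add: jacobi_weight_exp)
next
  case False
  with assms have re: "Re z = 1" by simp
  show ?thesis
  proof (cases "z = 1")
    case True
    then show ?thesis by (simp add: jacobi_weight_def)
  next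
    case neq: False
    then have im: "Im z \<noteq> 0" using re by (simp add: complex_eq_iff)
    then have "1 - z \<notin> \<real>\<^sub>\<le>\<^sub>0" by (auto simp: complex_nonpos_Reals_iff)
    then have "Ln (cnj (1 - z)) = cnj (Ln (1 - z))" by (rule cnj_Ln[symmetric])
    moreover have "1 - z \<noteq> 0" "1 - cnj z \<noteq> 0" using neq by (auto simp: complex_eq_iff)
    ultimately have "(1 - z) powr cnj \<delta> * (1 - cnj z) powr \<delta> = exp (cnj \<delta> * Ln (1 - z)) * cnj (exp (cnj \<delta> * Ln (1 - z)))"
      by (simp add: powr_def exp_cnj)
    then show ?thesis by (simp add: jacobi_weight_def complex_mult_cnj)
  qed
qed

text \<open>
The coefficients numbered from the last one: level \<open>0\<close> is the point on the circle and level \<open>m\<close> has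
disc exponent \<open>\<beta> m / 2 - 1\<close>, so the law of a level does not depend on the size of the matrix.
\<close>
definition level_law :: "complex \<Rightarrow> real \<Rightarrow> nat \<Rightarrow> complex measure" where
  "level_law \<delta> \<beta> m = (if m = 0 then circle_law \<delta> else disc_law (Suc m) \<delta> \<beta> 0)"

lemma disc_weight_level: "k < n - 1 \<Longrightarrow> disc_weight n \<delta> \<beta> k = disc_weight (Suc (n - 1 - k)) \<delta> \<beta> 0"
  by (rule ext) (simp add: disc_weight_def)

lemma eta_law_level_law:
  "eta_law n \<delta> \<beta> = (\<Pi>\<^sub>M k\<in>{..<n}. level_law \<delta> \<beta> (n - 1 - k))"
  unfolding eta_law_def
proof (rule PiM_cong[OF refl])
  fix k assume "k \<in> {..<n}"
  then have "k = n - 1 \<or> k < n - 1" by auto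
  then show "(if k = n - 1 then circle_law \<delta> else disc_law n \<delta> \<beta> k) = level_law \<delta> \<beta> (n - 1 - k)"
  proof
    assume k: "k < n - 1"
    then have "k \<noteq> n - 1" "n - 1 - k \<noteq> 0" by auto
    then show ?thesis by (simp only: level_law_def disc_law_def disc_weight_level[OF k] if_False)
  qed (simp add: level_law_def)
qed

lemma sets_level_law: "sets (level_law \<delta> \<beta> m) = sets (restrict_space borel (if m = 0 then sphere 0 1 else ball 0 1))"
  by (simp add: level_law_def circle_law_def haar_circle_def disc_law_def sets_restrict_space)

lemma space_level_law: "space (level_law \<delta> \<beta> m) = (if m = 0 then sphere 0 1 else ball 0 1)"
  using sets_eq_imp_space_eq[OF sets_level_law] by (simp add: space_restrict_space)

lemma measurable_level_law_borel: "f \<in> borel_measurable borel \<Longrightarrow> f \<in> borel_measurable (level_law \<delta> \<beta> m)"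
  unfolding measurable_cong_sets[OF sets_level_law refl] by (rule measurable_restrict_space1)

lemma id_level_law: "(\<lambda>z. z) \<in> measurable (level_law \<delta> \<beta> m) borel"
  by (rule measurable_level_law_borel) simp

lemma disc_weight_measurable [measurable]: "disc_weight n \<delta> \<beta> k \<in> borel_measurable borel"
  unfolding disc_weight_def by measurable

text \<open>
The densities are finite, and the reference measures are sigma-finite.
\<close>
lemma sigma_finite_level_law: "sigma_finite_measure (level_law \<delta> \<beta> m)"
proof (cases "m = 0")
  case True
  have "prob_space (uniform_measure lborel {0..<2 * pi})"
    by (rule prob_space_uniform_measure) auto
  then have "prob_space haar_circle"
    unfolding haar_circle_def by (rule prob_space.prob_space_distr) (auto intro!: measurable_restrict_space2)
  then interpret prob_space haar_circle .
  have [measurable]: "jacobi_weight \<delta> \<in> borel_measurable haar_circle"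
    by (simp add: haar_circle_def measurable_restrict_space1)
  show ?thesis unfolding level_law_def circle_law_def using True
    by (simp, subst sigma_finite_iff_density_finite) auto
next
  case False
  interpret lebesgue_disc: sigma_finite_measure lebesgue_disc
    by (rule sigma_finite_measure_restrict_space) (auto intro: sigma_finite_lborel)
  have [measurable]: "disc_weight (Suc m) \<delta> \<beta> 0 \<in> borel_measurable lebesgue_disc"
    by (rule measurable_restrict_space1) simp
  show ?thesis unfolding level_law_def disc_law_def using False
    by (simp, subst lebesgue_disc.sigma_finite_iff_density_finite) auto
qed

text \<open>
\<open>1 - |\<gamma>|\<^sup>2 = 4 b / D\<close> with \<open>D = (1 + b)\<^sup>2 + a\<^sup>2\<close>, and the Jacobian is \<open>4 / D\<^sup>2\<close>.
\<close>
lemma disc_law_density_half_plane: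
  assumes b: "0 < b" and e: "e = \<beta> / 2 * real m"
  shows "ennreal (disc_weight (Suc m) \<delta> \<beta> 0 (disc_point a b)) * ennreal (4 / ((1 + b)\<^sup>2 + a\<^sup>2)\<^sup>2) =
    ennreal (4 powr e) * ennreal (b powr (e - 1) * (((1 + b)\<^sup>2 + a\<^sup>2) powr (- e - 1) * jacobi_weight \<delta> (disc_point a b)))"
proof -
  define D where "D = (1 + b)\<^sup>2 + a\<^sup>2"
  have D: "0 < D" using b by (simp add: D_def add_pos_nonneg)
  have pt: "disc_point a b = Complex (1 - 2 * (1 + b) / D) (2 * a / D)"
    using b by (subst disc_point_eq) (simp_all add: D_def)
  have "(1 - 2 * (1 + b) / D)\<^sup>2 + (2 * a / D)\<^sup>2 = 1 - 4 * (1 + b) / D + 4 * ((1 + b)\<^sup>2 + a\<^sup>2) / D\<^sup>2"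
    by (simp add: power2_eq_square algebra_simps add_divide_distrib)
  also have "\<dots> = 1 - 4 * b / D"
    unfolding D_def[symmetric] using D by (simp add: power2_eq_square field_simps)
  finally have "(cmod (disc_point a b))\<^sup>2 = 1 - 4 * b / D" by (simp add: pt cmod_power2)
  then have w: "disc_weight (Suc m) \<delta> \<beta> 0 (disc_point a b) = (4 * b / D) powr (e - 1) * jacobi_weight \<delta> (disc_point a b)"
    by (simp add: disc_weight_def e)
  have K: "0 \<le> jacobi_weight \<delta> (disc_point a b)"
    using b D by (intro jacobi_weight_nonneg) (simp add: pt)
  have p1: "(4 * b / D) powr (e - 1) = 4 powr (e - 1) * b powr (e - 1) * D powr (- (e - 1))"
    using D b by (simp only: powr_divide powr_mult powr_minus_divide) simp
  have p2: "4 / D\<^sup>2 = 4 powr 1 * D powr (-2)" using D by (simp add: powr_minus_divide)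
  have p3: "4 powr (e - 1) * 4 powr 1 = 4 powr e" by (simp only: powr_add[symmetric] diff_add_cancel)
  have p4: "D powr (- (e - 1)) * D powr (-2) = D powr (- e - 1)" unfolding powr_add[symmetric] by (rule arg_cong[where f="(powr) D"]) simp
  have eq: "(4 * b / D) powr (e - 1) * jacobi_weight \<delta> (disc_point a b) * (4 / D\<^sup>2) =
    4 powr e * (b powr (e - 1) * (D powr (- e - 1) * jacobi_weight \<delta> (disc_point a b)))"
    unfolding p1 p2 p3[symmetric] p4[symmetric] by (simp only: mult_ac)
  have "ennreal ((4 * b / D) powr (e - 1) * jacobi_weight \<delta> (disc_point a b)) * ennreal (4 / D\<^sup>2) =
    ennreal (4 powr e * (b powr (e - 1) * (D powr (- e - 1) * jacobi_weight \<delta> (disc_point a b))))"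
    unfolding eq[symmetric] by (rule ennreal_mult''[symmetric]) simp
  also have "\<dots> = ennreal (4 powr e) * ennreal (b powr (e - 1) * (D powr (- e - 1) * jacobi_weight \<delta> (disc_point a b)))"
    by (rule ennreal_mult') simp
  finally show ?thesis unfolding w D_def[symmetric] .
qed

lemma nn_integral_level_law_disc:
  assumes m: "0 < m"
  obtains c where "\<And>f. f \<in> borel_measurable borel \<Longrightarrow>
    (\<integral>\<^sup>+z. f z \<partial>level_law \<delta> \<beta> m) = c * (\<integral>\<^sup>+b. \<integral>\<^sup>+a. (if 0 < b then f (disc_point a b) *
      ennreal (b powr (\<beta> / 2 * real m - 1) * (((1 + b)\<^sup>2 + a\<^sup>2) powr (- (\<beta> / 2 * real m) - 1) * jacobi_weight \<delta> (disc_point a b))) else 0) \<partial>lborel \<partial>lborel)"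
proof
  define N where "N = (\<integral>w. disc_weight (Suc m) \<delta> \<beta> 0 w \<partial>lebesgue_disc)"
  define e where "e = \<beta> / 2 * real m"
  fix f :: "complex \<Rightarrow> ennreal" assume [measurable]: "f \<in> borel_measurable borel"
  have nonneg: "0 \<le> disc_weight (Suc m) \<delta> \<beta> 0 z" if "z \<in> ball 0 1" for z
    using that abs_Re_le_cmod[of z] unfolding disc_weight_def by (intro mult_nonneg_nonneg jacobi_weight_nonneg) auto
  have N0: "0 \<le> N" unfolding N_def
    by (intro integral_nonneg_AE AE_I2 nonneg) (simp add: space_restrict_space)
  have [measurable]: "disc_weight (Suc m) \<delta> \<beta> 0 \<in> borel_measurable lebesgue_disc" "f \<in> borel_measurable lebesgue_disc"
    by (rule measurable_restrict_space1, simp)+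
  have "(\<integral>\<^sup>+z. f z \<partial>level_law \<delta> \<beta> m) = (\<integral>\<^sup>+z. ennreal (disc_weight (Suc m) \<delta> \<beta> 0 z / N) * f z \<partial>lebesgue_disc)"
    using m by (simp add: level_law_def disc_law_def nn_integral_density N_def[symmetric])
  also have "\<dots> = (\<integral>\<^sup>+z. ennreal (1 / N) * (ennreal (disc_weight (Suc m) \<delta> \<beta> 0 z) * f z) \<partial>lebesgue_disc)"
  proof (rule nn_integral_cong)
    fix z assume "z \<in> space lebesgue_disc"
    then have "0 \<le> disc_weight (Suc m) \<delta> \<beta> 0 z" by (intro nonneg) (simp add: space_restrict_space)
    then show "ennreal (disc_weight (Suc m) \<delta> \<beta> 0 z / N) * f z = ennreal (1 / N) * (ennreal (disc_weight (Suc m) \<delta> \<beta> 0 z) * f z)"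
      using N0 ennreal_mult''[of "disc_weight (Suc m) \<delta> \<beta> 0 z" "1 / N"] by (simp add: mult.assoc)
  qed
  also have "\<dots> = ennreal (1 / N) * (\<integral>\<^sup>+z. ennreal (disc_weight (Suc m) \<delta> \<beta> 0 z) * f z \<partial>lebesgue_disc)"
    by (rule nn_integral_cmult) measurable
  also have "(\<integral>\<^sup>+z. ennreal (disc_weight (Suc m) \<delta> \<beta> 0 z) * f z \<partial>lebesgue_disc) =
      (\<integral>\<^sup>+z. (ennreal (disc_weight (Suc m) \<delta> \<beta> 0 z) * f z) * indicator (ball 0 1) z \<partial>lborel)"
    by (rule nn_integral_restrict_space) simp
  also have "\<dots> = (\<integral>\<^sup>+b. \<integral>\<^sup>+a. (if 0 < b then (ennreal (disc_weight (Suc m) \<delta> \<beta> 0 (disc_point a b)) * f (disc_point a b)) * ennreal (4 / ((1 + b)\<^sup>2 + a\<^sup>2)\<^sup>2) else 0) \<partial>lborel \<partial>lborel)"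
    by (rule nn_integral_disc_half_plane) measurable
  also have "\<dots> = (\<integral>\<^sup>+b. \<integral>\<^sup>+a. ennreal (4 powr e) * (if 0 < b then f (disc_point a b) *
      ennreal (b powr (e - 1) * (((1 + b)\<^sup>2 + a\<^sup>2) powr (- e - 1) * jacobi_weight \<delta> (disc_point a b))) else 0) \<partial>lborel \<partial>lborel)"
  proof (intro nn_integral_cong)
    fix a b :: real
    have c: "x * f * q = p * (f * r)" if "x * q = p * r" for x f q p r :: ennreal
    proof -
      have "x * f * q = (x * q) * f" by (simp only: mult_ac)
      also have "\<dots> = p * (f * r)" unfolding that by (simp only: mult_ac)
      finally show ?thesis .
    qed
    show "(if 0 < b then (ennreal (disc_weight (Suc m) \<delta> \<beta> 0 (disc_point a b)) * f (disc_point a b)) * ennreal (4 / ((1 + b)\<^sup>2 + a\<^sup>2)\<^sup>2) else 0) =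
      ennreal (4 powr e) * (if 0 < b then f (disc_point a b) *
      ennreal (b powr (e - 1) * (((1 + b)\<^sup>2 + a\<^sup>2) powr (- e - 1) * jacobi_weight \<delta> (disc_point a b))) else 0)"
    proof (cases "0 < b")
      case True
      show ?thesis
        unfolding if_P[OF True] by (rule c[OF disc_law_density_half_plane[OF True e_def]])
    qed simp
  qed
  also have "\<dots> = (\<integral>\<^sup>+b. ennreal (4 powr e) * (\<integral>\<^sup>+a. (if 0 < b then f (disc_point a b) *
      ennreal (b powr (e - 1) * (((1 + b)\<^sup>2 + a\<^sup>2) powr (- e - 1) * jacobi_weight \<delta> (disc_point a b))) else 0) \<partial>lborel) \<partial>lborel)"
    by (intro nn_integral_cong nn_integral_cmult) measurable
  also have "\<dots> = ennreal (4 powr e) * (\<integral>\<^sup>+b. \<integral>\<^sup>+a. (if 0 < b then f (disc_point a b) *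
      ennreal (b powr (e - 1) * (((1 + b)\<^sup>2 + a\<^sup>2) powr (- e - 1) * jacobi_weight \<delta> (disc_point a b))) else 0) \<partial>lborel \<partial>lborel)"
    by (rule nn_integral_cmult) measurable
  finally show "(\<integral>\<^sup>+z. f z \<partial>level_law \<delta> \<beta> m) = (ennreal (1 / N) * ennreal (4 powr e)) * (\<integral>\<^sup>+b. \<integral>\<^sup>+a. (if 0 < b then f (disc_point a b) *
      ennreal (b powr (\<beta> / 2 * real m - 1) * (((1 + b)\<^sup>2 + a\<^sup>2) powr (- (\<beta> / 2 * real m) - 1) * jacobi_weight \<delta> (disc_point a b))) else 0) \<partial>lborel \<partial>lborel)"
    unfolding e_def by (simp only: mult.assoc)
qed

text \<open>
The argument in \<open>(0, 2 \<pi>)\<close> of the point of the circle that corresponds to \<open>x\<close>.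
\<close>
definition eigen_angle :: "real \<Rightarrow> real" where
  "eigen_angle x = pi + 2 * arctan x"

lemma cis_eigen_angle: "cis (eigen_angle x) = cayley x"
proof -
  let ?s = "sqrt (1 + x\<^sup>2)"
  have c: "cis (arctan x) = (1 + \<i> * of_real x) / of_real ?s"
    by (simp add: complex_eq_iff cos_arctan sin_arctan)
  have "eigen_angle x = pi + (arctan x + arctan x)" by (simp add: eigen_angle_def)
  then have "cis (eigen_angle x) = - (cis (arctan x) * cis (arctan x))"
    by (simp only: cis_mult[symmetric] cis_pi) simp
  also have "\<dots> = - ((1 + \<i> * of_real x) * (1 + \<i> * of_real x)) / (of_real ?s * of_real ?s)"
    unfolding c by simp
  also have "of_real ?s * of_real ?s = ((1 + \<i> * of_real x) * (1 - \<i> * of_real x) :: complex)"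
  proof -
    have "?s * ?s = 1 + x\<^sup>2" by simp
    then have "of_real ?s * of_real ?s = (1 + (of_real x)\<^sup>2 :: complex)" by (metis of_real_mult of_real_add of_real_1 of_real_power)
    then show ?thesis by (simp add: algebra_simps power2_eq_square)
  qed
  also have "- ((1 + \<i> * of_real x) * (1 + \<i> * of_real x)) / ((1 + \<i> * of_real x) * (1 - \<i> * of_real x)) = - (1 + \<i> * of_real x) / (1 - \<i> * of_real x)"
  proof -
    have "- (u * u) / (u * v) = - u / v" if "u \<noteq> 0" for u v :: complex using that by simp
    moreover have "1 + \<i> * of_real x \<noteq> 0" by (auto simp: complex_eq_iff)
    ultimately show ?thesis .
  qed
  also have "\<dots> = cayley x"
  proof -
    have "1 - \<i> * of_real x \<noteq> 0" by (auto simp: complex_eq_iff)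
    then show ?thesis by (simp add: cayley_def divide_simps) (simp add: algebra_simps)
  qed
  finally show ?thesis .
qed

lemma eigen_angle_bounds: "0 < eigen_angle x" "eigen_angle x < 2 * pi"
  using arctan_bounded[of x] by (auto simp: eigen_angle_def)

lemma nn_integral_subst_eigen_angle:
  assumes [measurable]: "f \<in> borel_measurable borel"
  shows "(\<integral>\<^sup>+\<theta>. f \<theta> * indicator {0<..<2 * pi} \<theta> \<partial>lborel) = (\<integral>\<^sup>+x. f (eigen_angle x) * ennreal (2 / (1 + x\<^sup>2)) \<partial>lborel)"
proof -
  have "(\<integral>\<^sup>+\<theta>. f \<theta> * indicator {0<..<2 * pi} \<theta> \<partial>lborel) = (\<integral>\<^sup>+x. f (eigen_angle x) * ennreal (2 / (1 + x\<^sup>2)) * indicator (einterval (-\<infinity>) \<infinity>) x \<partial>lborel)"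
  proof (rule nn_integral_subst_incr)
    show "(eigen_angle has_real_derivative 2 / (1 + x\<^sup>2)) (at x)" for x
      unfolding eigen_angle_def by (auto intro!: derivative_eq_intros simp: divide_inverse)
    have "1 + x\<^sup>2 \<noteq> 0" for x :: real using zero_le_power2[of x] by linarith
    then show "continuous_on (einterval (-\<infinity>) \<infinity>) (\<lambda>x. 2 / (1 + x\<^sup>2) :: real)"
      by (intro continuous_intros) auto
    show "eigen_angle ` einterval (-\<infinity>) \<infinity> = {0<..<2 * pi}"
    proof (intro equalityI subsetI)
      fix \<theta> assume "\<theta> \<in> {0<..<2 * pi}"
      then have "\<theta> = eigen_angle (tan ((\<theta> - pi) / 2))"
        unfolding eigen_angle_def by (subst arctan_tan) (auto simp: diff_divide_distrib)
      then show "\<theta> \<in> eigen_angle ` einterval (-\<infinity>) \<infinity>" by (rule image_eqI) simp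
    qed (use eigen_angle_bounds in auto)
  qed (auto simp: add_nonneg_nonneg)
  then show ?thesis by simp
qed

lemma nn_integral_level_law_circle:
  obtains c where "\<And>f. f \<in> borel_measurable borel \<Longrightarrow>
    (\<integral>\<^sup>+z. f z \<partial>level_law \<delta> \<beta> 0) = c * (\<integral>\<^sup>+x. f (cayley x) * ennreal (jacobi_weight \<delta> (cayley x) * (1 / (1 + x\<^sup>2))) \<partial>lborel)"
proof
  define R where "R = Re (Gamma (1 + \<delta>) * Gamma (1 + cnj \<delta>) / Gamma (1 + \<delta> + cnj \<delta>))"
  fix f :: "complex \<Rightarrow> ennreal" assume [measurable]: "f \<in> borel_measurable borel"
  have haar: "g \<in> borel_measurable haar_circle" if "g \<in> borel_measurable borel" for g :: "complex \<Rightarrow> 'x::topological_space"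
    using that by (simp add: haar_circle_def measurable_restrict_space1)
  have [measurable]: "jacobi_weight \<delta> \<in> borel_measurable haar_circle" "f \<in> borel_measurable haar_circle"
    by (rule haar, measurable)+
  let ?w = "jacobi_weight \<delta>"
  have nn: "0 \<le> ?w (cis \<theta>)" for \<theta> by (rule jacobi_weight_nonneg) simp
  have "(\<integral>\<^sup>+z. f z \<partial>level_law \<delta> \<beta> 0) = (\<integral>\<^sup>+z. ennreal (R * ?w z) * f z \<partial>haar_circle)"
    by (simp add: level_law_def circle_law_def nn_integral_density R_def[symmetric])
  also have "\<dots> = (\<integral>\<^sup>+\<theta>. ennreal (R * ?w (cis \<theta>)) * f (cis \<theta>) \<partial>uniform_measure lborel {0..<2 * pi})"
    unfolding haar_circle_def
  proof (rule nn_integral_distr)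
    show "cis \<in> measurable (uniform_measure lborel {0..<2 * pi}) (restrict_space borel (sphere 0 1))"
      by (intro measurable_restrict_space2) auto
    show "(\<lambda>z. ennreal (R * ?w z) * f z) \<in> borel_measurable (distr (uniform_measure lborel {0..<2 * pi}) (restrict_space borel (sphere 0 1)) cis)"
      unfolding measurable_distr_eq1 by (rule measurable_restrict_space1) measurable
  qed
  also have "\<dots> = (\<integral>\<^sup>+\<theta>. (ennreal (R * ?w (cis \<theta>)) * f (cis \<theta>)) * indicator {0..<2 * pi} \<theta> \<partial>lborel) / emeasure lborel {0..<2 * pi}"
    by (rule nn_integral_uniform_measure) measurable
  also have "(\<integral>\<^sup>+\<theta>. (ennreal (R * ?w (cis \<theta>)) * f (cis \<theta>)) * indicator {0..<2 * pi} \<theta> \<partial>lborel) =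
    (\<integral>\<^sup>+\<theta>. (ennreal R * (ennreal (?w (cis \<theta>)) * f (cis \<theta>))) * indicator {0<..<2 * pi} \<theta> \<partial>lborel)"
  proof (rule nn_integral_cong_AE)
    have "AE \<theta> in lborel. \<theta> \<noteq> (0::real)" by (rule AE_lborel_singleton)
    then show "AE \<theta> in lborel. (ennreal (R * ?w (cis \<theta>)) * f (cis \<theta>)) * indicator {0..<2 * pi} \<theta> =
       (ennreal R * (ennreal (?w (cis \<theta>)) * f (cis \<theta>))) * indicator {0<..<2 * pi} \<theta>"
      by eventually_elim (use nn in \<open>auto simp: indicator_def ennreal_mult'' mult.assoc\<close>)
  qed
  also have "\<dots> = (\<integral>\<^sup>+x. (ennreal R * (ennreal (?w (cis (eigen_angle x))) * f (cis (eigen_angle x)))) * ennreal (2 / (1 + x\<^sup>2)) \<partial>lborel)"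
    by (rule nn_integral_subst_eigen_angle) measurable
  also have "\<dots> = (\<integral>\<^sup>+x. (ennreal R * ennreal 2) * (f (cayley x) * ennreal (?w (cayley x) * (1 / (1 + x\<^sup>2)))) \<partial>lborel)"
  proof (rule nn_integral_cong)
    fix x :: real
    have h: "ennreal (2 / (1 + x\<^sup>2)) = ennreal 2 * ennreal (1 / (1 + x\<^sup>2))"
      using ennreal_mult'[of 2 "1 / (1 + x\<^sup>2)"] by simp
    have w: "ennreal (?w (cayley x) * (1 / (1 + x\<^sup>2))) = ennreal (?w (cayley x)) * ennreal (1 / (1 + x\<^sup>2))"
      by (rule ennreal_mult'') simp
    show "(ennreal R * (ennreal (?w (cis (eigen_angle x))) * f (cis (eigen_angle x)))) * ennreal (2 / (1 + x\<^sup>2)) =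
      (ennreal R * ennreal 2) * (f (cayley x) * ennreal (?w (cayley x) * (1 / (1 + x\<^sup>2))))"
      unfolding cis_eigen_angle h w by (simp only: mult_ac)
  qed
  also have "\<dots> = (ennreal R * ennreal 2) * (\<integral>\<^sup>+x. f (cayley x) * ennreal (?w (cayley x) * (1 / (1 + x\<^sup>2))) \<partial>lborel)"
  proof (rule nn_integral_cmult)
    have [measurable]: "cayley \<in> borel_measurable borel" unfolding cayley_def by measurable
    show "(\<lambda>x. f (cayley x) * ennreal (?w (cayley x) * (1 / (1 + x\<^sup>2)))) \<in> borel_measurable lborel" by measurable
  qed
  finally show "(\<integral>\<^sup>+z. f z \<partial>level_law \<delta> \<beta> 0) = (ennreal R * ennreal 2 / emeasure lborel {0..<2 * pi}) * (\<integral>\<^sup>+x. f (cayley x) * ennreal (?w (cayley x) * (1 / (1 + x\<^sup>2))) \<partial>lborel)"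
    unfolding divide_ennreal_def by (simp only: mult_ac)
qed

section \<open>Densities on interlacing configurations\<close>

text \<open>
Sample points for polynomials: infinitely many of them, so that values determine the polynomial,
and none in the closed unit disc, so that they differ from all eigenvalues.
\<close>
definition node_at :: "nat \<Rightarrow> complex" where "node_at k = of_nat (k + 2)"

text \<open>
Polynomials are represented by their sequences of values at the sample points. This space carries
the product topology and is the same for all degrees.
\<close>
abbreviation complex_seq :: "(nat \<Rightarrow> complex) measure" where
  "complex_seq \<equiv> \<Pi>\<^sub>M k\<in>UNIV. borel"

lemma measurable_complex_seqI:
  assumes "\<And>k. (\<lambda>x. f x k) \<in> borel_measurable M"
  shows "f \<in> measurable M complex_seq"
  by (rule measurable_into_PiM) (use assms in auto)

lemma measurable_complex_seqD [measurable (raw)]: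
  assumes "f \<in> measurable M complex_seq"
  shows "(\<lambda>x. f x k) \<in> borel_measurable M"
  using measurable_compose[OF assms measurable_component_singleton[of k UNIV]] by simp

definition increasing :: "nat \<Rightarrow> (nat \<Rightarrow> real) \<Rightarrow> bool" where
  "increasing m x \<longleftrightarrow> strict_mono_on {..<m} x"

lemma strictly_between_increasing:
  assumes "strictly_between m l x"
  shows "increasing (Suc m) x" "increasing m l"
proof -
  have x: "x j < x (Suc j)" if "j < m" for j
    using assms that by (auto simp: strictly_between_def intro: less_trans)
  have l: "l j < l (Suc j)" if "Suc j < m" for j
    using assms that by (auto simp: strictly_between_def intro!: less_trans[of "l j" "x (Suc j)" "l (Suc j)"])
  have lift: "f i < f (i + Suc d)" if "i + Suc d < N" "\<And>j. Suc j < N \<Longrightarrow> f j < f (Suc j)" for f :: "nat \<Rightarrow> real" and i d N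
    using that(1)
  proof (induction d)
    case 0
    then show ?case using that(2)[of i] by simp
  next
    case (Suc d)
    then have "f i < f (i + Suc d)" by simp
    also have "\<dots> < f (Suc (i + Suc d))" using Suc.prems by (intro that(2)) simp
    finally show ?case by simp
  qed
  have mono: "strict_mono_on {..<N} f" if "\<And>j. Suc j < N \<Longrightarrow> f j < f (Suc j)" for f :: "nat \<Rightarrow> real" and N
    unfolding strict_mono_on_def
  proof (intro allI impI)
    fix r s assume rs: "r \<in> {..<N} \<and> s \<in> {..<N} \<and> r < s"
    then obtain d where "s = r + Suc d" by (auto dest: less_imp_Suc_add)
    then show "f r < f s" using rs lift[of r d N f] that by auto
  qed
  show "increasing (Suc m) x" "increasing m l" unfolding increasing_def using x l by (auto intro!: mono)
qed

lemma increasing_measurable [measurable]: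
  assumes "\<And>j. j < m \<Longrightarrow> (\<lambda>y. x y j) \<in> borel_measurable M"
  shows "Measurable.pred M (\<lambda>y. increasing m (x y))"
proof -
  have [measurable]: "(\<lambda>y. x y j) \<in> borel_measurable M" if "j \<in> {..<m}" for j using that assms by auto
  have "increasing m (x y) \<longleftrightarrow> (\<forall>i\<in>{..<m}. \<forall>j\<in>{..<m}. i < j \<longrightarrow> x y i < x y j)" for y
    by (auto simp: increasing_def strict_mono_on_def)
  then show ?thesis by simp
qed

text \<open>
The circular Jacobi density on increasing sequences, in the line coordinates and up to a constant;
see \<open>circ_jacobi_weight_eigen_angle\<close>.
\<close>
definition point_weight :: "complex \<Rightarrow> real \<Rightarrow> nat \<Rightarrow> (nat \<Rightarrow> real) \<Rightarrow> real" where
  "point_weight \<delta> \<beta> n x = vandermonde n x powr \<beta> *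
     (\<Prod>j<n. jacobi_weight \<delta> (cayley (x j)) * (1 + (x j)\<^sup>2) powr (- (\<beta> / 2 * real (n - 1)) - 1))"

text \<open>
The joint density of the eigenvalues \<open>l\<close> and \<open>x\<close> of two consecutive levels.
\<close>
definition step_weight :: "complex \<Rightarrow> real \<Rightarrow> nat \<Rightarrow> (nat \<Rightarrow> real) \<Rightarrow> (nat \<Rightarrow> real) \<Rightarrow> real" where
  "step_weight \<delta> \<beta> m l x = vandermonde (Suc m) x * vandermonde m l * resultant m l x powr (\<beta> / 2 - 1) *
     (\<Prod>k<Suc m. jacobi_weight \<delta> (cayley (x k)) * (1 + (x k)\<^sup>2) powr (- (\<beta> / 2 * real m) - 1))"

lemma resultant_pos:
  assumes "strictly_between m l x"
  shows "0 < resultant m l x"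
proof -
  have "l j \<noteq> x k" if "j < m" "k < Suc m" for j k
  proof -
    have x: "strict_mono_on {..<Suc m} x" using strictly_between_increasing[OF assms] by (simp add: increasing_def)
    have b: "x j < l j" "l j < x (Suc j)" using assms that by (auto simp: strictly_between_def)
    show ?thesis
    proof (cases "k \<le> j")
      case True
      then have "x k \<le> x j" using that by (intro strict_mono_on_leD[OF x]) auto
      then show ?thesis using b by simp
    next
      case False
      then have "x (Suc j) \<le> x k" using that by (intro strict_mono_on_leD[OF x]) auto
      then show ?thesis using b by simp
    qed
  qed
  then show ?thesis unfolding resultant_def by (intro prod_pos) auto
qed

lemma prod_powr_distrib: "(\<And>i. i \<in> A \<Longrightarrow> 0 \<le> f i) \<Longrightarrow> (\<Prod>i\<in>A. f i) powr (s::real) = (\<Prod>i\<in>A. f i powr s)"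
proof (induction A rule: infinite_finite_induct)
  case (insert a A)
  then show ?case by (simp add: powr_mult prod_nonneg)
qed auto

text \<open>
Exchanging the scaled weights \<open>c w\<^sub>j\<close> at \<open>x\<close> for \<open>l\<close> and \<open>c\<close> turns their density into the joint
density times the density of the scale. The product of the weights is a resultant divided by the
square of a Vandermonde product, so the exponent \<open>\<beta>\<close> of \<open>vandermonde (Suc m) x\<close> drops to \<open>1\<close>.
\<close>
lemma upper_density_identity:
  assumes sb: "strictly_between m l x" and c: "0 < c"
  shows "point_weight \<delta> \<beta> (Suc m) x * (\<bar>\<Prod>j<Suc m. c * root_ratio m l x j\<bar> powr (\<beta> / 2 - 1) * (c ^ m * (vandermonde m l / vandermonde (Suc m) x))) =
    step_weight \<delta> \<beta> m l x * c powr (\<beta> / 2 * real (Suc m) - 1)"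
proof -
  have x: "strict_mono_on {..<Suc m} x" and l: "strict_mono_on {..<m} l"
    using strictly_between_increasing[OF sb] by (auto simp: increasing_def)
  let ?R = "resultant m l x" and ?V = "vandermonde (Suc m) x"
  define B where "B = (\<Prod>k<Suc m. jacobi_weight \<delta> (cayley (x k)) * (1 + (x k)\<^sup>2) powr (- (\<beta> / 2 * real m) - 1))"
  have V: "0 < ?V" and R: "0 < ?R" using vandermonde_pos[OF x] resultant_pos[OF sb] .
  have p1: "\<bar>\<Prod>j<Suc m. c * root_ratio m l x j\<bar> = c ^ Suc m * (?R / ?V\<^sup>2)"
    unfolding prod.distrib abs_mult abs_prod_root_ratio[OF x] using c by (simp add: abs_mult)
  have p2: "(c ^ Suc m * (?R / ?V\<^sup>2)) powr (\<beta> / 2 - 1) = c powr (real (Suc m) * (\<beta> / 2 - 1)) * (?R powr (\<beta> / 2 - 1) * ?V powr (- \<beta> + 2))"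
  proof -
    have "(?V\<^sup>2) powr (\<beta> / 2 - 1) = ?V powr (\<beta> - 2)"
      using V by (simp add: powr_realpow[symmetric] powr_powr algebra_simps del: powr_realpow powr_numeral)
    moreover have "(c ^ Suc m) powr (\<beta> / 2 - 1) = c powr (real (Suc m) * (\<beta> / 2 - 1))"
      using c by (simp only: powr_realpow[symmetric] powr_powr)
    moreover have "?V powr (- \<beta> + 2) = 1 / ?V powr (\<beta> - 2)"
      using powr_minus_divide[of ?V "\<beta> - 2"] by simp
    moreover have "(A * (B / C)) powr t = A powr t * (B powr t / C powr t)" if "0 < A" "0 < B" "0 < C" for A B C t :: real
      using that by (simp add: powr_mult powr_divide)
    from this[of "c ^ Suc m" ?R "?V\<^sup>2"]
    have "(c ^ Suc m * (?R / ?V\<^sup>2)) powr (\<beta> / 2 - 1) = (c ^ Suc m) powr (\<beta> / 2 - 1) * (?R powr (\<beta> / 2 - 1) / (?V\<^sup>2) powr (\<beta> / 2 - 1))"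
      using c V R by (simp del: power_Suc)
    ultimately show ?thesis by (simp only: times_divide_eq_right mult_1_right)
  qed
  have p3: "c powr (real (Suc m) * (\<beta> / 2 - 1)) * c ^ m = c powr (\<beta> / 2 * real (Suc m) - 1)"
    using c by (simp add: powr_realpow[symmetric] powr_add[symmetric] algebra_simps)
  have p4: "?V powr \<beta> * ?V powr (- \<beta> + 2) / ?V = ?V"
    using V by (simp add: powr_add[symmetric] power2_eq_square)
  have "point_weight \<delta> \<beta> (Suc m) x * ((c ^ Suc m * (?R / ?V\<^sup>2)) powr (\<beta> / 2 - 1) * (c ^ m * (vandermonde m l / ?V))) =
     (?V powr \<beta> * ?V powr (- \<beta> + 2) / ?V) * vandermonde m l * ?R powr (\<beta> / 2 - 1) * B * (c powr (real (Suc m) * (\<beta> / 2 - 1)) * c ^ m)"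
    unfolding p2 point_weight_def B_def diff_Suc_1 by (simp only: times_divide_eq_right times_divide_eq_left mult_ac)
  also have "\<dots> = step_weight \<delta> \<beta> m l x * c powr (\<beta> / 2 * real (Suc m) - 1)"
    unfolding p3 p4 step_weight_def B_def ..
  finally show ?thesis unfolding p1 .
qed

text \<open>
The same joint density from below. The product of the weights \<open>y\<close> again lowers the exponent of
the Vandermonde product of \<open>l\<close> from \<open>\<beta>\<close> to \<open>1\<close>. As
\<open>(1 + b)\<^sup>2 + a\<^sup>2 = |\<i> + \<zeta>|\<^sup>2\<close> is the quotient of the products of \<open>1 + x\<^sub>k\<^sup>2\<close> and of \<open>1 + l\<^sub>j\<^sup>2\<close>, the power
of this factor in the disc density moves all powers of \<open>1 + l\<^sub>j\<^sup>2\<close> to powers of \<open>1 + x\<^sub>k\<^sup>2\<close>.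
\<close>
lemma lower_density_identity:
  assumes sb: "strictly_between m l x" and m: "0 < m"
    and y: "\<And>j. j < m \<Longrightarrow> y j = residue_at m x l j * (x m - l j) / (1 + (l j)\<^sup>2)"
    and ab: "\<i> + Complex a b = (\<Prod>k<Suc m. \<i> - of_real (x k)) / (\<Prod>k<m. \<i> - of_real (l k))"
  shows "point_weight \<delta> \<beta> m l * (\<bar>\<Prod>j<m. y j\<bar> powr (\<beta> / 2 - 1) * (\<Prod>j<m. 1 / (1 + (l j)\<^sup>2)) *
      (((1 + b)\<^sup>2 + a\<^sup>2) powr (- (\<beta> / 2 * real m) - 1) * jacobi_weight \<delta> (disc_point a b)) *
      (vandermonde (Suc m) x / vandermonde m l)) = step_weight \<delta> \<beta> m l x"
proof -
  have x: "strict_mono_on {..<Suc m} x" and l: "strict_mono_on {..<m} l"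
    using strictly_between_increasing[OF sb] by (auto simp: increasing_def)
  let ?R = "resultant m l x" and ?V = "vandermonde m l"
  let ?J = "\<lambda>m x. \<Prod>k<m. jacobi_weight \<delta> (cayley (x k))" and ?q = "\<lambda>m x. \<Prod>k<m. 1 + (x k)\<^sup>2"
  define s where "s = \<beta> / 2 * real m + 1"
  have V: "0 < ?V" and R: "0 < ?R" using vandermonde_pos[OF l] resultant_pos[OF sb] .
  have q: "0 < ?q n z" for n and z :: "nat \<Rightarrow> real" by (intro prod_pos) (simp add: add_pos_nonneg)
  have J: "jacobi_weight \<delta> (disc_point a b) * ?J m l = ?J (Suc m) x"
    by (rule jacobi_weight_multiplicative[OF sb ab]) (simp add: disc_point_def)
  have Jl: "?J m l \<noteq> 0" by (simp add: jacobi_weight_cayley)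
  have "(cmod (\<i> + Complex a b))\<^sup>2 = ?q (Suc m) x / ?q m l"
  proof -
    have c: "(cmod (\<i> - of_real t))\<^sup>2 = 1 + t\<^sup>2" for t by (simp add: cmod_power2)
    show ?thesis unfolding ab norm_divide power_divide prod_norm[symmetric] prod_power_distrib c ..
  qed
  then have N: "(1 + b)\<^sup>2 + a\<^sup>2 = ?q (Suc m) x / ?q m l" by (simp add: cmod_power2 add.commute)
  have Y: "\<bar>\<Prod>j<m. y j\<bar> = ?R / ?V\<^sup>2 / ?q m l"
  proof -
    have "(\<Prod>j<m. y j) = (\<Prod>j<m. residue_at m x l j * (x m - l j)) / ?q m l"
      unfolding prod_dividef[symmetric] using y by (intro prod.cong) auto
    then show ?thesis using abs_prod_bordered_weights[OF l, of x] q[of l m] by (simp add: abs_divide)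
  qed
  have Yp: "(?R / ?V\<^sup>2 / ?q m l) powr (\<beta> / 2 - 1) = ?R powr (\<beta> / 2 - 1) * ?V powr (2 - \<beta>) * ?q m l powr (1 - \<beta> / 2)"
  proof -
    have "(?V\<^sup>2) powr (\<beta> / 2 - 1) = ?V powr (\<beta> - 2)"
      using V by (simp add: powr_realpow[symmetric] powr_powr algebra_simps del: powr_realpow powr_numeral)
    moreover have "?V powr (2 - \<beta>) = inverse (?V powr (\<beta> - 2))" "?q m l powr (1 - \<beta> / 2) = inverse (?q m l powr (\<beta> / 2 - 1))"
      using powr_minus[of ?V "\<beta> - 2"] powr_minus[of "?q m l" "\<beta> / 2 - 1"] by simp_all
    moreover have "(A / B / C) powr t = A powr t / B powr t / C powr t" if "0 < A" "0 < B" "0 < C" for A B C t :: real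
      using that by (simp add: powr_divide powr_mult)
    from this[OF R zero_less_power[OF V] q]
    have "(?R / ?V\<^sup>2 / ?q m l) powr (\<beta> / 2 - 1) = ?R powr (\<beta> / 2 - 1) / (?V\<^sup>2) powr (\<beta> / 2 - 1) / ?q m l powr (\<beta> / 2 - 1)"
      .
    ultimately show ?thesis by (simp only: divide_inverse)
  qed
  have Np: "(?q (Suc m) x / ?q m l) powr (- s) = ?q (Suc m) x powr (- s) * ?q m l powr s"
    using powr_divide[of "?q (Suc m) x" "?q m l" "- s"] q[of x "Suc m"] q[of l m]
    by (simp add: powr_minus_divide less_imp_le del: prod.lessThan_Suc)
  have Vp: "?V powr \<beta> * ?V powr (2 - \<beta>) / ?V = ?V"
    using V by (simp add: powr_add[symmetric] power2_eq_square)
  define e where "e = - (\<beta> / 2 * real (m - 1)) - 1"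
  have W: "point_weight \<delta> \<beta> m l = ?V powr \<beta> * (?J m l * ?q m l powr e)"
    unfolding point_weight_def e_def prod.distrib by (subst prod_powr_distrib) (auto simp: add_nonneg_nonneg)
  have inv: "(\<Prod>j<m. 1 / (1 + (l j)\<^sup>2)) = ?q m l powr (- 1)"
    using q[of l m] by (simp add: prod_dividef powr_minus_divide)
  have exps: "?q m l powr e * ?q m l powr (1 - \<beta> / 2) * ?q m l powr (- 1) * ?q m l powr s = 1"
  proof -
    \<comment> \<open>The exponents of \<open>1 + l\<^sub>j\<^sup>2\<close>: point weight, weights, rescaling of the weights, disc density.\<close>
    have "e + (1 - \<beta> / 2) + (- 1) + s = 0" using m by (cases m) (simp_all add: e_def s_def field_simps)
    then show ?thesis
      using less_imp_neq[OF q[of l m], symmetric] by (simp only: powr_add[symmetric] powr_zero_eq_one if_False)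
  qed
  have S: "step_weight \<delta> \<beta> m l x = vandermonde (Suc m) x * ?V * ?R powr (\<beta> / 2 - 1) * (?J (Suc m) x * ?q (Suc m) x powr (- s))"
    unfolding step_weight_def s_def prod.distrib minus_add_distrib
    by (subst prod_powr_distrib) (auto simp: add_nonneg_nonneg simp del: prod.lessThan_Suc)
  have ms: "- (\<beta> / 2 * real m) - 1 = - s" by (simp add: s_def)
  have "point_weight \<delta> \<beta> m l * (\<bar>\<Prod>j<m. y j\<bar> powr (\<beta> / 2 - 1) * (\<Prod>j<m. 1 / (1 + (l j)\<^sup>2)) *
      (((1 + b)\<^sup>2 + a\<^sup>2) powr (- (\<beta> / 2 * real m) - 1) * jacobi_weight \<delta> (disc_point a b)) *
      (vandermonde (Suc m) x / vandermonde m l)) =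
      (?V powr \<beta> * ?V powr (2 - \<beta>) / ?V) * (?q m l powr e * ?q m l powr (1 - \<beta> / 2) * ?q m l powr (- 1) * ?q m l powr s) *
      (vandermonde (Suc m) x * ?R powr (\<beta> / 2 - 1) * ((jacobi_weight \<delta> (disc_point a b) * ?J m l) * ?q (Suc m) x powr (- s)))"
    unfolding W Y Yp inv N ms Np by (simp only: times_divide_eq_right times_divide_eq_left mult_ac)
  also have "\<dots> = step_weight \<delta> \<beta> m l x"
    unfolding Vp exps J S by (simp only: mult_1_right mult_ac)
  finally show ?thesis .
qed

section \<open>The recursion for polynomial values\<close>

text \<open>
Multiplying \<open>1 \<oplus> V\<close> from the left by \<open>\<Xi>(\<gamma>)\<close> acts in this way on \<open>det (z - V)\<close> and the \<open>(0,0)\<close> cofactor of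
\<open>z - V\<close>; see \<open>shift_pair_step\<close>.
\<close>
definition disc_step :: "complex \<Rightarrow> complex \<Rightarrow> complex \<times> complex \<Rightarrow> complex \<times> complex" where
  "disc_step \<gamma> z pq = (let e = (1 - \<gamma>) / (1 - cnj \<gamma>); \<kappa> = (1 - of_real ((cmod \<gamma>)\<^sup>2)) / (1 - cnj \<gamma>) in
     (e * (1 - cnj \<gamma> * z) * fst pq + \<kappa> * (z - 1) * z * snd pq,
      - cnj \<gamma> * e * fst pq + \<kappa> * z * snd pq))"

text \<open>
The coefficients are numbered by level, as in \<open>level_law\<close>: the last factor of the matrix product has
index \<open>0\<close>.
\<close>
primrec char_pair :: "nat \<Rightarrow> (nat \<Rightarrow> complex) \<Rightarrow> complex \<Rightarrow> complex \<times> complex" where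
  "char_pair 0 \<gamma> z = (z - \<gamma> 0, 1)"
| "char_pair (Suc m) \<gamma> z = disc_step (\<gamma> (Suc m)) z (char_pair m \<gamma> z)"

lemma char_pair_cong: "(\<And>k. k \<le> m \<Longrightarrow> \<gamma> k = \<gamma>' k) \<Longrightarrow> char_pair m \<gamma> z = char_pair m \<gamma>' z"
  by (induction m) auto

text \<open>
In half-plane coordinates the quantity \<open>1 - |\<gamma>|\<^sup>2\<close> contributes the factor \<open>b\<close>, which is absorbed into
the weights. This is why the scale of the weights of one level is the height \<open>b\<close> of the next
coefficient.
\<close>
lemma half_step_disc_step:
  assumes b: "0 < b"
  shows "disc_step (disc_point a b) z (P, Q) = half_step a b z P (of_real b * Q)"
proof -
  define u where "u = 1 + \<i> * cnj (Complex a b)"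
  define v where "v = 1 - \<i> * Complex a b"
  have uC: "u = Complex (1 + b) a" and vC: "v = Complex (1 + b) (- a)" by (simp_all add: u_def v_def complex_eq_iff)
  have ne: "u \<noteq> 0" "v \<noteq> 0" using b by (auto simp: uC vC complex_eq_iff)
  have cu: "cnj u = v" "cnj v = u" by (simp_all add: uC vC complex_eq_iff)
  let ?g = "disc_point a b"
  have g: "1 - ?g = 2 / u" "1 - cnj ?g = 2 / v" "cnj ?g = 1 - 2 / v"
    by (simp_all add: disc_point_def u_def[symmetric] cu)
  have e: "(1 - ?g) / (1 - cnj ?g) = v / u" unfolding g using ne by simp
  have "of_real ((cmod ?g)\<^sup>2) = ?g * cnj ?g" by (rule complex_norm_square)
  also have "\<dots> = (1 - 2 / u) * (1 - 2 / v)" unfolding g(3) by (simp add: disc_point_def u_def)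
  finally have "1 - of_real ((cmod ?g)\<^sup>2) = 1 - (1 - 2 / u) * (1 - 2 / v)" by simp
  also have "\<dots> = 2 * (u + v - 2) / (u * v)" using ne by (simp add: field_simps)
  also have "u + v - 2 = of_real (2 * b)" by (simp add: uC vC complex_eq_iff)
  finally have k: "(1 - of_real ((cmod ?g)\<^sup>2)) / (1 - cnj ?g) = 2 * of_real b / u"
    unfolding g using ne by (simp add: field_simps)
  have lin: "1 + \<i> * Complex a b = 2 - v" by (simp add: v_def)
  have n1: "- cnj ?g * (v / u) = (2 - v) / u" unfolding g(3) using ne by (simp add: field_simps)
  have n2: "v / u * (1 - cnj ?g * z) = (v + (2 - v) * z) / u"
  proof -
    have "v / u * (1 - cnj ?g * z) = v / u + (- cnj ?g * (v / u)) * z" by (simp add: algebra_simps)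
    then show ?thesis unfolding n1 by (simp add: add_divide_distrib)
  qed
  show ?thesis
    unfolding disc_step_def half_step_def Let_def fst_conv snd_conv e k lin u_def[symmetric] v_def[symmetric] n1 n2
    by (simp add: add_divide_distrib diff_divide_distrib algebra_simps)
qed

lemma snd_half_step_measurable [measurable (raw)]:
  assumes [measurable]: "a \<in> borel_measurable M" "b \<in> borel_measurable M" "P \<in> borel_measurable M" "Q \<in> borel_measurable M"
  shows "(\<lambda>x. snd (half_step (a x) (b x) z (P x) (Q x))) \<in> borel_measurable M"
    "(\<lambda>x. fst (half_step (a x) (b x) z (P x) (Q x))) \<in> borel_measurable M"
  unfolding half_step_def Let_def complex_cnj fst_conv snd_conv by measurable

lemma cayley_measurable [measurable]: "cayley \<in> borel_measurable borel"
  unfolding cayley_def by measurable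

text \<open>
The sample points lie outside the closed disc, that is, they come from a point of the lower
half-plane under the Cayley transform.
\<close>
lemma node_at_half_plane:
  obtains X where "X \<notin> \<real>" "X \<noteq> - \<i>" "node_at k = (X - \<i>) / (X + \<i>)"
proof
  \<comment> \<open>\<open>X = - \<i> (z + 1) / (z - 1)\<close> at \<open>z = k + 2\<close> solves \<open>z = (X - \<i>) / (X + \<i>)\<close>.\<close>
  define X where "X = - \<i> * of_real (real (k + 3) / real (k + 1))"
  show "X \<notin> \<real>" by (auto simp: X_def complex_is_Real_iff)
  show "X \<noteq> - \<i>" by (auto simp: X_def complex_eq_iff divide_simps)
  then have "X + \<i> \<noteq> 0" by (metis add_eq_0_iff2)
  moreover have "node_at k * (X + \<i>) = X - \<i>"
    by (simp add: node_at_def X_def complex_eq_iff field_simps)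
  ultimately show "node_at k = (X - \<i>) / (X + \<i>)" by (simp add: eq_divide_eq)
qed

definition node_seq :: "nat \<Rightarrow> (nat \<Rightarrow> real) \<Rightarrow> nat \<Rightarrow> complex" where
  "node_seq n x = (\<lambda>k. node_poly n x (node_at k))"

definition weight_seq :: "nat \<Rightarrow> (nat \<Rightarrow> real) \<Rightarrow> (nat \<Rightarrow> real) \<Rightarrow> nat \<Rightarrow> complex" where
  "weight_seq n x y = (\<lambda>k. weight_poly n x y (node_at k))"

lemma node_seq_measurable [measurable (raw)]:
  assumes x: "x \<in> measurable M (lebesgue_pow n)"
  shows "(\<lambda>t. node_seq n (x t)) \<in> measurable M complex_seq"
proof (rule measurable_complex_seqI)
  note [measurable] = measurable_coordinate[OF x]
  show "(\<lambda>t. node_seq n (x t) k) \<in> borel_measurable M" for k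
    unfolding node_seq_def node_poly_def by measurable
qed

lemma weight_seq_measurable [measurable (raw)]:
  assumes x: "x \<in> measurable M (lebesgue_pow n)" and y: "y \<in> measurable M (lebesgue_pow n)"
  shows "(\<lambda>t. weight_seq n (x t) (y t)) \<in> measurable M complex_seq"
proof (rule measurable_complex_seqI)
  note [measurable] = measurable_coordinate[OF x] measurable_coordinate[OF y]
  have [measurable]: "(\<lambda>t. x t i) \<in> borel_measurable M" if "i \<in> {..<n} - {j}" for i j
    using that measurable_coordinate[OF x] by auto
  show "(\<lambda>t. weight_seq n (x t) (y t) k) \<in> borel_measurable M" for k
    unfolding weight_seq_def weight_poly_def by measurable
qed

lemma weight_seq_scale: "(\<lambda>k. of_real c * weight_seq n x y k) = weight_seq n x (\<lambda>j\<in>{..<n}. c * y j)"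
  unfolding weight_seq_def weight_poly_def fun_eq_iff by (auto simp: sum_distrib_left mult.assoc intro!: sum.cong)

section \<open>Two ways to integrate over a pair of levels\<close>

text \<open>
The conditional integral of a test function \<open>H\<close> of (values of \<open>p\<close>, values of \<open>q\<close>, scale) given the
eigenvalues \<open>x\<close>, when the scaled weights have the product density on the orthant.
\<close>
definition upper_integral where
  "upper_integral \<delta> \<beta> n H x = (\<integral>\<^sup>+y. (if all_pos n y then
      H (node_seq n x) (weight_seq n x y) (\<Sum>j<n. y j) * ennreal (\<bar>\<Prod>j<n. y j\<bar> powr (\<beta> / 2 - 1)) else 0) \<partial>lebesgue_pow n)"

text \<open>
The integral over the scale alone, when the pair \<open>(P, Q)\<close> with weights of sum \<open>1\<close> is given.
\<close>
definition scale_integral where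
  "scale_integral \<beta> n H P Q = (\<integral>\<^sup>+c. (if 0 < c then H P (\<lambda>k. of_real c * Q k) c * ennreal (c powr (\<beta> / 2 * real n - 1)) else 0) \<partial>lborel)"

lemma measurable_triple:
  assumes H: "(\<lambda>(P, Q, c). H P Q c) \<in> borel_measurable (complex_seq \<Otimes>\<^sub>M complex_seq \<Otimes>\<^sub>M lborel)"
    and [measurable]: "P \<in> measurable M complex_seq" "Q \<in> measurable M complex_seq" "c \<in> borel_measurable M"
  shows "(\<lambda>t. H (P t) (Q t) (c t)) \<in> borel_measurable M"
  using measurable_compose[OF _ H, of "\<lambda>t. (P t, Q t, c t)" M] by simp

lemma scale_integral_measurable:
  assumes H: "(\<lambda>(P, Q, c). H P Q c) \<in> borel_measurable (complex_seq \<Otimes>\<^sub>M complex_seq \<Otimes>\<^sub>M lborel)"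
    and [measurable]: "P \<in> measurable M complex_seq" "Q \<in> measurable M complex_seq"
  shows "(\<lambda>t. scale_integral \<beta> n H (P t) (Q t)) \<in> borel_measurable M"
proof -
  note [measurable] = measurable_triple[OF H]
  have [measurable]: "(\<lambda>y k. of_real (snd y) * Q (fst y) k) \<in> measurable (M \<Otimes>\<^sub>M lborel) complex_seq"
    by (rule measurable_complex_seqI) measurable
  show ?thesis unfolding scale_integral_def
    by (rule lborel.borel_measurable_nn_integral) (unfold split_beta, measurable)
qed

text \<open>
Integrates a test function of the next level over its scale and over the real part \<open>a\<close> of the
coefficient, the imaginary part \<open>b\<close> being the scale of the present level. The result is a test
function of the present level, which makes the induction close up.
\<close>
definition half_plane_integral where
  "half_plane_integral \<delta> \<beta> m H P Q b = (\<integral>\<^sup>+a.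
     scale_integral \<beta> (Suc m) H (\<lambda>k. fst (half_step a b (node_at k) (P k) (Q k))) (\<lambda>k. snd (half_step a b (node_at k) (P k) (Q k))) *
     ennreal (((1 + b)\<^sup>2 + a\<^sup>2) powr (- (\<beta> / 2 * real m) - 1) * jacobi_weight \<delta> (disc_point a b)) \<partial>lborel)"

lemma half_plane_integrand_measurable:
  assumes H: "(\<lambda>(P, Q, c). H P Q c) \<in> borel_measurable (complex_seq \<Otimes>\<^sub>M complex_seq \<Otimes>\<^sub>M lborel)"
    and [measurable]: "P \<in> measurable M complex_seq" "Q \<in> measurable M complex_seq" "a \<in> borel_measurable M" "b \<in> borel_measurable M"
  shows "(\<lambda>t. scale_integral \<beta> n H (\<lambda>k. fst (half_step (a t) (b t) (node_at k) (P t k) (Q t k)))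
     (\<lambda>k. snd (half_step (a t) (b t) (node_at k) (P t k) (Q t k)))) \<in> borel_measurable M"
  by (intro scale_integral_measurable[OF H] measurable_complex_seqI) measurable

lemma half_plane_integral_measurable:
  assumes H: "(\<lambda>(P, Q, c). H P Q c) \<in> borel_measurable (complex_seq \<Otimes>\<^sub>M complex_seq \<Otimes>\<^sub>M lborel)"
  shows "(\<lambda>(P, Q, b). half_plane_integral \<delta> \<beta> m H P Q b) \<in> borel_measurable (complex_seq \<Otimes>\<^sub>M complex_seq \<Otimes>\<^sub>M lborel)"
proof -
  note [measurable] = half_plane_integrand_measurable[OF H]
  show ?thesis unfolding half_plane_integral_def split_beta
    by (rule lborel.borel_measurable_nn_integral) (unfold split_beta, measurable)
qed

text \<open>
Decomposes the weights at \<open>x\<close> into their sum and the roots \<open>l\<close> below.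
\<close>
lemma upper_integral_split:
  assumes H: "(\<lambda>(P, Q, c). H P Q c) \<in> borel_measurable (complex_seq \<Otimes>\<^sub>M complex_seq \<Otimes>\<^sub>M lborel)"
    and x: "increasing (Suc m) x" and xs: "x \<in> space (lebesgue_pow (Suc m))"
  shows "ennreal (point_weight \<delta> \<beta> (Suc m) x) * upper_integral \<delta> \<beta> (Suc m) H x =
    (\<integral>\<^sup>+l. (if strictly_between m l x then
        ennreal (step_weight \<delta> \<beta> m l x) * scale_integral \<beta> (Suc m) H (node_seq (Suc m) x) (weight_seq (Suc m) x (root_ratio m l x)) else 0) \<partial>lebesgue_pow m)"
proof -
  have x': "strict_mono_on {..<Suc m} x" using x by (simp add: increasing_def)
  note [measurable] = measurable_triple[OF H]
  note [measurable] = xs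
  let ?F = "\<lambda>y. H (node_seq (Suc m) x) (weight_seq (Suc m) x y) (\<Sum>j<Suc m. y j) * ennreal (\<bar>\<Prod>j<Suc m. y j\<bar> powr (\<beta> / 2 - 1))"
  have F: "?F \<in> borel_measurable (lebesgue_pow (Suc m))" by measurable
  have pw: "0 \<le> point_weight \<delta> \<beta> (Suc m) x"
    unfolding point_weight_def by (intro mult_nonneg_nonneg prod_nonneg) (auto simp: jacobi_weight_cayley)
  let ?K = "\<lambda>l c. (if 0 < c \<and> strictly_between m l x then
        ?F (\<lambda>j\<in>{..<Suc m}. c * root_ratio m l x j) * ennreal (c ^ m * (vandermonde m l / vandermonde (Suc m) x)) else 0)"
  have "ennreal (point_weight \<delta> \<beta> (Suc m) x) * upper_integral \<delta> \<beta> (Suc m) H x =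
    ennreal (point_weight \<delta> \<beta> (Suc m) x) * (\<integral>\<^sup>+l. \<integral>\<^sup>+c. ?K l c \<partial>lborel \<partial>lebesgue_pow m)"
    unfolding upper_integral_def by (subst nn_integral_stieltjes_roots[OF F x']) simp
  also have "\<dots> = (\<integral>\<^sup>+l. ennreal (point_weight \<delta> \<beta> (Suc m) x) * (\<integral>\<^sup>+c. ?K l c \<partial>lborel) \<partial>lebesgue_pow m)"
  proof (rule nn_integral_cmult[symmetric])
    have [measurable]: "(\<lambda>y. root_ratio m (fst y) x j) \<in> borel_measurable (lebesgue_pow m \<Otimes>\<^sub>M lborel)" for j
      unfolding root_ratio_def by measurable
    have [measurable]: "(\<lambda>y. \<lambda>j\<in>{..<Suc m}. snd y * root_ratio m (fst y) x j) \<in> measurable (lebesgue_pow m \<Otimes>\<^sub>M lborel) (lebesgue_pow (Suc m))"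
      by (rule measurable_restrict) measurable
    have [measurable]: "(\<lambda>x. fst x j) \<in> borel_measurable (lebesgue_pow m \<Otimes>\<^sub>M lborel)" if "j < m" for j
      by (rule measurable_coordinate[OF measurable_fst]) (use that in auto)
    note F[measurable]
    have "(\<lambda>(l, c). ?K l c) \<in> borel_measurable (lebesgue_pow m \<Otimes>\<^sub>M lborel)"
      unfolding split_beta by (intro measurable_If borel_measurable_times measurable_compose[OF _ F]) measurable
    then show "(\<lambda>l. \<integral>\<^sup>+c. ?K l c \<partial>lborel) \<in> borel_measurable (lebesgue_pow m)"
      by (rule lborel.borel_measurable_nn_integral)
  qed
  also have "\<dots> = (\<integral>\<^sup>+l. (if strictly_between m l x then
        ennreal (step_weight \<delta> \<beta> m l x) * scale_integral \<beta> (Suc m) H (node_seq (Suc m) x) (weight_seq (Suc m) x (root_ratio m l x)) else 0) \<partial>lebesgue_pow m)"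
  proof (rule nn_integral_cong)
    fix l assume "l \<in> space (lebesgue_pow m)"
    show "ennreal (point_weight \<delta> \<beta> (Suc m) x) * (\<integral>\<^sup>+c. ?K l c \<partial>lborel) = (if strictly_between m l x then
        ennreal (step_weight \<delta> \<beta> m l x) * scale_integral \<beta> (Suc m) H (node_seq (Suc m) x) (weight_seq (Suc m) x (root_ratio m l x)) else 0)"
    proof (cases "strictly_between m l x")
      case False
      then show ?thesis by simp
    next
      case sb: True
      let ?\<mu> = "root_ratio m l x"
      let ?r = "\<lambda>c. \<lambda>j\<in>{..<Suc m}. c * ?\<mu> j"
      have inj: "inj_on x {..<Suc m}" by (rule strict_mono_on_imp_inj_on[OF x'])
      have [measurable]: "weight_seq (Suc m) x ?\<mu> \<in> space complex_seq" "node_seq (Suc m) x \<in> space complex_seq"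
        by (simp_all add: space_PiM)
      have mc [measurable]: "(\<lambda>c. \<lambda>k. of_real c * weight_seq (Suc m) x ?\<mu> k) \<in> measurable lborel complex_seq"
        by (rule measurable_complex_seqI) measurable
      have sw: "0 \<le> step_weight \<delta> \<beta> m l x"
        using strictly_between_increasing[OF sb] vandermonde_pos resultant_pos[OF sb] unfolding step_weight_def increasing_def
        by (intro mult_nonneg_nonneg prod_nonneg) (auto simp: jacobi_weight_cayley less_imp_le)
      have "ennreal (point_weight \<delta> \<beta> (Suc m) x) * (\<integral>\<^sup>+c. ?K l c \<partial>lborel) = (\<integral>\<^sup>+c. ennreal (point_weight \<delta> \<beta> (Suc m) x) * ?K l c \<partial>lborel)"
      proof (rule nn_integral_cmult[symmetric])
        have "(\<lambda>c. ?r c) \<in> measurable lborel (lebesgue_pow (Suc m))" by (rule measurable_restrict) measurable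
        from measurable_compose[OF this F] have G: "(\<lambda>c. ?F (?r c)) \<in> borel_measurable lborel" .
        show "?K l \<in> borel_measurable lborel"
          by (rule measurable_If[OF borel_measurable_times_ennreal[OF G]]) measurable
      qed
      also have "\<dots> = (\<integral>\<^sup>+c. ennreal (step_weight \<delta> \<beta> m l x) * (if 0 < c then H (node_seq (Suc m) x) (\<lambda>k. of_real c * weight_seq (Suc m) x ?\<mu> k) c * ennreal (c powr (\<beta> / 2 * real (Suc m) - 1)) else 0) \<partial>lborel)"
      proof (rule nn_integral_cong)
        fix c :: real
        show "ennreal (point_weight \<delta> \<beta> (Suc m) x) * ?K l c =
          ennreal (step_weight \<delta> \<beta> m l x) * (if 0 < c then H (node_seq (Suc m) x) (\<lambda>k. of_real c * weight_seq (Suc m) x ?\<mu> k) c * ennreal (c powr (\<beta> / 2 * real (Suc m) - 1)) else 0)"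
        proof (cases "0 < c")
          case c: True
          have s: "(\<Sum>j<Suc m. ?r c j) = c"
            using root_ratio_expansion(1)[OF inj, of l] by (simp add: sum_distrib_left[symmetric] del: sum.lessThan_Suc)
          have w: "weight_seq (Suc m) x (?r c) = (\<lambda>k. of_real c * weight_seq (Suc m) x ?\<mu> k)" by (rule weight_seq_scale[symmetric])
          have p: "(\<Prod>j<Suc m. ?r c j) = (\<Prod>j<Suc m. c * ?\<mu> j)" by (intro prod.cong) auto
          let ?h = "H (node_seq (Suc m) x) (\<lambda>k. of_real c * weight_seq (Suc m) x ?\<mu> k) c"
          let ?u = "\<bar>\<Prod>j<Suc m. c * ?\<mu> j\<bar> powr (\<beta> / 2 - 1)" and ?v = "c ^ m * (vandermonde m l / vandermonde (Suc m) x)"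
          have "0 \<le> ?v" using c strictly_between_increasing[OF sb] vandermonde_pos[of m l] vandermonde_pos[of "Suc m" x]
            by (intro mult_nonneg_nonneg divide_nonneg_nonneg) (auto simp: increasing_def less_imp_le)
          then have "ennreal (point_weight \<delta> \<beta> (Suc m) x) * (ennreal ?u * ennreal ?v) = ennreal (point_weight \<delta> \<beta> (Suc m) x * (?u * ?v))"
            by (simp only: ennreal_mult'[OF pw] ennreal_mult'')
          also have "\<dots> = ennreal (step_weight \<delta> \<beta> m l x) * ennreal (c powr (\<beta> / 2 * real (Suc m) - 1))"
            unfolding upper_density_identity[OF sb c] using sw by (simp add: ennreal_mult)
          finally have d: "ennreal (point_weight \<delta> \<beta> (Suc m) x) * (ennreal ?u * ennreal ?v) = ennreal (step_weight \<delta> \<beta> m l x) * ennreal (c powr (\<beta> / 2 * real (Suc m) - 1))" .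
          have g: "A * (h * U * V) = D * (h * E)" if "A * (U * V) = D * E" for A U V D E h :: ennreal
          proof -
            have "A * (h * U * V) = (A * (U * V)) * h" by (simp only: mult_ac)
            then show ?thesis unfolding that by (simp only: mult_ac)
          qed
          have cc: "0 < c \<and> strictly_between m l x" using c sb by simp
          show ?thesis unfolding if_P[OF c] if_P[OF cc] s w p by (rule g[OF d])
        qed simp
      qed
      also have "\<dots> = ennreal (step_weight \<delta> \<beta> m l x) * scale_integral \<beta> (Suc m) H (node_seq (Suc m) x) (weight_seq (Suc m) x ?\<mu>)"
        unfolding scale_integral_def by (rule nn_integral_cmult) measurable
      finally show ?thesis using sb by simp
    qed
  qed
  finally show ?thesis .
qed

text \<open>
Integrates over the weights at \<open>l\<close> and the coefficient of the next step in terms of the eigenvalues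
\<open>x\<close> above. The weights are first multiplied by \<open>1 + l\<^sub>j\<^sup>2\<close>, and \<open>a\<close> is replaced by the shift \<open>s\<close>,
to reach the variables of \<open>nn_integral_bordered_roots\<close>.
\<close>
lemma lower_integral_split:
  assumes H: "(\<lambda>(P, Q, c). H P Q c) \<in> borel_measurable (complex_seq \<Otimes>\<^sub>M complex_seq \<Otimes>\<^sub>M lborel)"
    and m: "0 < m" and l: "increasing m l" and ls: "l \<in> space (lebesgue_pow m)"
  shows "ennreal (point_weight \<delta> \<beta> m l) * upper_integral \<delta> \<beta> m (half_plane_integral \<delta> \<beta> m H) l =
    (\<integral>\<^sup>+x. (if strictly_between m l x then
        ennreal (step_weight \<delta> \<beta> m l x) * scale_integral \<beta> (Suc m) H (node_seq (Suc m) x) (weight_seq (Suc m) x (root_ratio m l x)) else 0) \<partial>lebesgue_pow (Suc m))"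
proof -
  have l': "strict_mono_on {..<m} l" using l by (simp add: increasing_def)
  note [measurable] = ls measurable_triple[OF half_plane_integral_measurable[OF H]] half_plane_integrand_measurable[OF H]
  have lsq: "0 < 1 + (l j)\<^sup>2" for j by (simp add: add_pos_nonneg)
  define c where "c j = 1 / (1 + (l j)\<^sup>2)" for j
  have c: "0 < c j" for j using lsq by (simp add: c_def)
  let ?C = "\<Prod>j<m. c j"
  let ?Y = "\<lambda>w. \<lambda>j\<in>{..<m}. c j * w j"
  let ?pw = "point_weight \<delta> \<beta> m l"
  have pw: "0 \<le> ?pw"
    unfolding point_weight_def by (intro mult_nonneg_nonneg prod_nonneg) (auto simp: jacobi_weight_cayley)
  have Y [measurable]: "?Y \<in> measurable (lebesgue_pow m) (lebesgue_pow m)"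
    by (rule measurable_restrict) simp
  define g where "g a b = ((1 + b)\<^sup>2 + a\<^sup>2) powr (- (\<beta> / 2 * real m) - 1) * jacobi_weight \<delta> (disc_point a b)" for a b
  have [measurable]: "(\<lambda>t. g (a t) (b t)) \<in> borel_measurable M" if [measurable]: "a \<in> borel_measurable M" "b \<in> borel_measurable M" for a b and M :: "'z measure"
    unfolding g_def by measurable
  define T where "T a w = scale_integral \<beta> (Suc m) H
      (\<lambda>k. fst (half_step a (\<Sum>j<m. ?Y w j) (node_at k) (node_seq m l k) (weight_seq m l (?Y w) k)))
      (\<lambda>k. snd (half_step a (\<Sum>j<m. ?Y w j) (node_at k) (node_seq m l k) (weight_seq m l (?Y w) k)))" for a w
  have sumY [measurable]: "(\<lambda>t. \<Sum>j<m. ?Y (w t) j) \<in> borel_measurable M"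
      "(\<lambda>t. \<Prod>j<m. ?Y (w t) j) \<in> borel_measurable M" "(\<lambda>t. \<Sum>j<m. ?Y (w t) j * l j) \<in> borel_measurable M"
    if w [measurable]: "w \<in> measurable M (lebesgue_pow m)" for w and M :: "'z measure"
  proof -
    have "(\<lambda>t. ?Y (w t) j) \<in> borel_measurable M" if "j \<in> {..<m}" for j
      using measurable_coordinate[OF measurable_compose[OF w Y] that] .
    then show "(\<lambda>t. \<Sum>j<m. ?Y (w t) j) \<in> borel_measurable M"
      "(\<lambda>t. \<Prod>j<m. ?Y (w t) j) \<in> borel_measurable M" "(\<lambda>t. \<Sum>j<m. ?Y (w t) j * l j) \<in> borel_measurable M"
      by (intro borel_measurable_sum borel_measurable_prod borel_measurable_times borel_measurable_const; simp)+
  qed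
  have [measurable]: "(\<lambda>t. T (a t) (w t)) \<in> borel_measurable M" if [measurable]: "a \<in> borel_measurable M" "w \<in> measurable M (lebesgue_pow m)" for a w and M :: "'z measure"
    unfolding T_def by (rule half_plane_integrand_measurable[OF H]) measurable
  define D where "D w = ennreal ?pw * (ennreal (\<bar>\<Prod>j<m. ?Y w j\<bar> powr (\<beta> / 2 - 1)) * ennreal ?C)" for w
  have [measurable]: "(\<lambda>t. D (w t)) \<in> borel_measurable M" if [measurable]: "w \<in> measurable M (lebesgue_pow m)" for w and M :: "'z measure"
    unfolding D_def by measurable
  define F where "F s w = D w * (T ((\<Sum>j<m. ?Y w j * l j) - s) w * ennreal (g ((\<Sum>j<m. ?Y w j * l j) - s) (\<Sum>j<m. ?Y w j)))" for s w
  have F: "(\<lambda>(s, w). F s w) \<in> borel_measurable (lborel \<Otimes>\<^sub>M lebesgue_pow m)"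
    unfolding F_def split_beta by measurable
  let ?U = "\<lambda>y. half_plane_integral \<delta> \<beta> m H (node_seq m l) (weight_seq m l y) (\<Sum>j<m. y j) * ennreal (\<bar>\<Prod>j<m. y j\<bar> powr (\<beta> / 2 - 1))"
  have "upper_integral \<delta> \<beta> m (half_plane_integral \<delta> \<beta> m H) l =
    (\<integral>\<^sup>+w. (if all_pos m (?Y w) then ?U (?Y w) else 0) * ennreal ?C \<partial>lebesgue_pow m)"
    unfolding upper_integral_def by (rule nn_integral_lebesgue_pow_scale, measurable) (rule c)
  also have "\<dots> = (\<integral>\<^sup>+w. (if all_pos m w then ?U (?Y w) * ennreal ?C else 0) \<partial>lebesgue_pow m)"
  proof (rule nn_integral_cong)
    fix w :: "nat \<Rightarrow> real"
    have "all_pos m (?Y w) \<longleftrightarrow> all_pos m w"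
      using c by (intro ball_cong refl) (simp add: zero_less_mult_iff order_less_not_sym)
    then show "(if all_pos m (?Y w) then ?U (?Y w) else 0) * ennreal ?C = (if all_pos m w then ?U (?Y w) * ennreal ?C else 0)"
      by (simp only: if_distrib[of "\<lambda>x. x * ennreal ?C"] mult_zero_left)
  qed
  finally have "ennreal ?pw * upper_integral \<delta> \<beta> m (half_plane_integral \<delta> \<beta> m H) l =
    (\<integral>\<^sup>+w. ennreal ?pw * (if all_pos m w then ?U (?Y w) * ennreal ?C else 0) \<partial>lebesgue_pow m)"
    by (simp only:) (rule nn_integral_cmult[symmetric], measurable)
  also have "\<dots> = (\<integral>\<^sup>+w. \<integral>\<^sup>+s. (if all_pos m w then F s w else 0) \<partial>lborel \<partial>lebesgue_pow m)"
  proof (rule nn_integral_cong)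
    fix w assume w [measurable]: "w \<in> space (lebesgue_pow m)"
    have Yw [measurable]: "?Y w \<in> space (lebesgue_pow m)" by (simp add: space_PiM)
    show "ennreal ?pw * (if all_pos m w then ?U (?Y w) * ennreal ?C else 0) = (\<integral>\<^sup>+s. (if all_pos m w then F s w else 0) \<partial>lborel)"
    proof (cases "all_pos m w")
      case True
      have "ennreal ?pw * (?U (?Y w) * ennreal ?C) = D w * (\<integral>\<^sup>+a. T a w * ennreal (g a (\<Sum>j<m. ?Y w j)) \<partial>lborel)"
        unfolding half_plane_integral_def T_def g_def D_def by (simp only: mult_ac)
      also have "(\<integral>\<^sup>+a. T a w * ennreal (g a (\<Sum>j<m. ?Y w j)) \<partial>lborel) =
         (\<integral>\<^sup>+s. T ((\<Sum>j<m. ?Y w j * l j) - s) w * ennreal (g ((\<Sum>j<m. ?Y w j * l j) - s) (\<Sum>j<m. ?Y w j)) \<partial>lborel)"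
        using nn_integral_real_affine[of "\<lambda>a. T a w * ennreal (g a (\<Sum>j<m. ?Y w j))" "-1" "\<Sum>j<m. ?Y w j * l j"]
        by simp
      also have "D w * \<dots> = (\<integral>\<^sup>+s. F s w \<partial>lborel)"
        unfolding F_def by (rule nn_integral_cmult[symmetric]) measurable
      finally show ?thesis unfolding if_P[OF True] .
    qed (simp only: if_False nn_integral_const mult_zero_left mult_zero_right)
  qed
  also have "\<dots> = (\<integral>\<^sup>+x. (if strictly_between m l x then
        F (x m - (\<Sum>j<m. residue_at m x l j)) (\<lambda>j\<in>{..<m}. residue_at m x l j * (x m - l j)) *
        ennreal (vandermonde (Suc m) x / vandermonde m l) else 0) \<partial>lebesgue_pow (Suc m))"
    by (rule nn_integral_bordered_roots[OF F m l'])
  also have "\<dots> = (\<integral>\<^sup>+x. (if strictly_between m l x then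
        ennreal (step_weight \<delta> \<beta> m l x) * scale_integral \<beta> (Suc m) H (node_seq (Suc m) x) (weight_seq (Suc m) x (root_ratio m l x)) else 0) \<partial>lebesgue_pow (Suc m))"
  proof (rule nn_integral_cong)
    fix x :: "nat \<Rightarrow> real"
    show "(if strictly_between m l x then
        F (x m - (\<Sum>j<m. residue_at m x l j)) (\<lambda>j\<in>{..<m}. residue_at m x l j * (x m - l j)) *
        ennreal (vandermonde (Suc m) x / vandermonde m l) else 0) =
        (if strictly_between m l x then
        ennreal (step_weight \<delta> \<beta> m l x) * scale_integral \<beta> (Suc m) H (node_seq (Suc m) x) (weight_seq (Suc m) x (root_ratio m l x)) else 0)"
    proof (cases "strictly_between m l x")
      case sb: True
      have x': "strict_mono_on {..<Suc m} x" using strictly_between_increasing[OF sb] by (simp add: increasing_def)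
      let ?w = "\<lambda>j\<in>{..<m}. residue_at m x l j * (x m - l j)" and ?s = "x m - (\<Sum>j<m. residue_at m x l j)"
      let ?y = "?Y ?w"
      define a where "a = (\<Sum>j<m. ?y j * l j) - ?s"
      define b where "b = (\<Sum>j<m. ?y j)"
      have y: "?y j = residue_at m x l j * (x m - l j) / (1 + (l j)\<^sup>2)" if "j < m" for j
        using that by (simp add: c_def)
      have neq: "l j \<noteq> x k" if "j < m" "k < Suc m" for j k
      proof -
        have "(\<Prod>j<m. \<Prod>k<Suc m. \<bar>l j - x k\<bar>) \<noteq> 0"
          using less_imp_neq[OF resultant_pos[OF sb, unfolded resultant_def]] by (rule not_sym)
        then show ?thesis using that by (auto simp: prod_zero_iff simp del: prod.lessThan_Suc)
      qed
      have inj: "inj_on l {..<m}" "inj_on x {..<Suc m}" using strict_mono_on_imp_inj_on l' x' by auto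
      have ident: "half_step a b (node_at k) (node_seq m l k) (weight_seq m l ?y k) =
         (node_seq (Suc m) x k, weight_seq (Suc m) x (root_ratio m l x) k)" for k
      proof -
        obtain X where X: "X \<notin> \<real>" "X \<noteq> - \<i>" "node_at k = (X - \<i>) / (X + \<i>)" by (rule node_at_half_plane)
        show ?thesis unfolding node_seq_def weight_seq_def
          by (rule half_step_identity(1)[OF inj m neq X y]) (simp_all only: a_def b_def)
      qed
      have ab: "\<i> + Complex a b = (\<Prod>k<Suc m. \<i> - of_real (x k)) / (\<Prod>k<m. \<i> - of_real (l k))"
      proof -
        obtain X where X: "X \<notin> \<real>" "X \<noteq> - \<i>" "node_at 0 = (X - \<i>) / (X + \<i>)" by (rule node_at_half_plane)
        show ?thesis by (rule half_step_identity(2)[OF inj m neq X y]) (simp_all only: a_def b_def)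
      qed
      have T: "T a ?w = scale_integral \<beta> (Suc m) H (node_seq (Suc m) x) (weight_seq (Suc m) x (root_ratio m l x))"
        unfolding T_def b_def[symmetric] ident fst_conv snd_conv ..
      let ?V = "vandermonde (Suc m) x / vandermonde m l" and ?u = "\<bar>\<Prod>j<m. ?y j\<bar> powr (\<beta> / 2 - 1)"
      have V: "0 \<le> ?V" using vandermonde_pos[OF x'] vandermonde_pos[OF l'] by simp
      have jw: "0 \<le> jacobi_weight \<delta> (disc_point a b)"
      proof -
        have "jacobi_weight \<delta> (disc_point a b) * (\<Prod>j<m. jacobi_weight \<delta> (cayley (l j))) = (\<Prod>k<Suc m. jacobi_weight \<delta> (cayley (x k)))"
          by (rule jacobi_weight_multiplicative[OF sb ab]) (simp add: disc_point_def)
        moreover have "0 < (\<Prod>j<m. jacobi_weight \<delta> (cayley (l j)))" "0 < (\<Prod>k<Suc m. jacobi_weight \<delta> (cayley (x k)))"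
          by (intro prod_pos; simp add: jacobi_weight_cayley)+
        ultimately show ?thesis by (metis less_imp_le zero_less_mult_pos2)
      qed
      have g0: "0 \<le> g a b" unfolding g_def using jw by simp
      have C0: "0 \<le> ?C" using c by (intro prod_nonneg) (auto simp: less_imp_le)
      have dens: "ennreal ?pw * (ennreal ?u * ennreal ?C) * ennreal (g a b) * ennreal ?V = ennreal (step_weight \<delta> \<beta> m l x)"
      proof -
        have "?pw * (?u * ?C * g a b * ?V) = step_weight \<delta> \<beta> m l x"
          unfolding g_def c_def[abs_def] by (rule lower_density_identity[OF sb m y ab, unfolded c_def[abs_def]])
        moreover have "ennreal (?pw * (?u * ?C * g a b * ?V)) = ennreal ?pw * (ennreal ?u * ennreal ?C) * ennreal (g a b) * ennreal ?V"
          by (simp only: ennreal_mult'[OF pw] ennreal_mult'[OF powr_ge_zero] ennreal_mult'[OF C0] ennreal_mult'[OF g0] mult.assoc)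
        ultimately show ?thesis by simp
      qed
      have "F ?s ?w * ennreal ?V = (ennreal ?pw * (ennreal ?u * ennreal ?C) * ennreal (g a b) * ennreal ?V) * T a ?w"
        unfolding F_def D_def a_def[symmetric] b_def[symmetric] by (simp only: mult_ac)
      then show ?thesis unfolding if_P[OF sb] dens T .
    qed simp
  qed
  finally show ?thesis .
qed

section \<open>Induction over the levels\<close>

lemma disc_step_measurable [measurable (raw)]:
  assumes [measurable]: "g \<in> borel_measurable M" "(\<lambda>x. fst (p x)) \<in> borel_measurable M" "(\<lambda>x. snd (p x)) \<in> borel_measurable M"
  shows "(\<lambda>x. fst (disc_step (g x) z (p x))) \<in> borel_measurable M" "(\<lambda>x. snd (disc_step (g x) z (p x))) \<in> borel_measurable M"
proof -
  have "cnj \<in> borel_measurable borel"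
    by (intro borel_measurable_continuous_onI continuous_intros)
  from measurable_compose[OF assms(1) this] have [measurable]: "(\<lambda>x. cnj (g x)) \<in> borel_measurable M" .
  show "(\<lambda>x. fst (disc_step (g x) z (p x))) \<in> borel_measurable M" "(\<lambda>x. snd (disc_step (g x) z (p x))) \<in> borel_measurable M"
    unfolding disc_step_def Let_def fst_conv snd_conv by measurable
qed

lemma char_pair_measurable:
  assumes "\<And>j. j \<le> m \<Longrightarrow> (\<lambda>x. g x j) \<in> borel_measurable M"
  shows "(\<lambda>x. fst (char_pair m (g x) z)) \<in> borel_measurable M \<and> (\<lambda>x. snd (char_pair m (g x) z)) \<in> borel_measurable M"
  using assms
proof (induction m)
  case 0
  from 0[of 0] have [measurable]: "(\<lambda>x. g x 0) \<in> borel_measurable M" by simp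
  show ?case by simp
next
  case (Suc m)
  then have "(\<lambda>x. g x (Suc m)) \<in> borel_measurable M" "(\<lambda>x. fst (char_pair m (g x) z)) \<in> borel_measurable M"
    "(\<lambda>x. snd (char_pair m (g x) z)) \<in> borel_measurable M" by simp_all
  then show ?case unfolding char_pair.simps by (intro conjI disc_step_measurable)
qed

lemma level_law_coordinate_measurable:
  "j < n \<Longrightarrow> (\<lambda>\<gamma>. \<gamma> j) \<in> borel_measurable (\<Pi>\<^sub>M k\<in>{..<n}. level_law \<delta> \<beta> (h k))"
  using measurable_compose[OF measurable_component_singleton[of j "{..<n}" "\<lambda>k. level_law \<delta> \<beta> (h k)"] id_level_law] by simp

text \<open>
The values of the characteristic polynomial of level \<open>m\<close> at the sample points.
\<close>
definition fst_seq :: "nat \<Rightarrow> (nat \<Rightarrow> complex) \<Rightarrow> nat \<Rightarrow> complex" where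
  "fst_seq m \<gamma> = (\<lambda>k. fst (char_pair m \<gamma> (node_at k)))"

definition snd_seq :: "nat \<Rightarrow> (nat \<Rightarrow> complex) \<Rightarrow> nat \<Rightarrow> complex" where
  "snd_seq m \<gamma> = (\<lambda>k. snd (char_pair m \<gamma> (node_at k)))"

lemma fst_seq_measurable:
  assumes "\<And>j. j \<le> m \<Longrightarrow> (\<lambda>x. g x j) \<in> borel_measurable M"
  shows "(\<lambda>x. fst_seq m (g x)) \<in> measurable M complex_seq" "(\<lambda>x. snd_seq m (g x)) \<in> measurable M complex_seq"
  using char_pair_measurable[of m g M] assms
  by (auto intro!: measurable_complex_seqI simp: fst_seq_def snd_seq_def)

text \<open>
The claimed law of a level: eigenvalues with density \<open>point_weight\<close>, and independent weights.
\<close>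
definition line_integral where
  "line_integral \<delta> \<beta> n H = (\<integral>\<^sup>+x. (if increasing n x then ennreal (point_weight \<delta> \<beta> n x) * upper_integral \<delta> \<beta> n H x else 0) \<partial>lebesgue_pow n)"

text \<open>
Both sides are the integral of the same function against the joint density of \<open>(l, x)\<close>, in the two
orders of integration.
\<close>
lemma line_integral_step:
  assumes H: "(\<lambda>(P, Q, c). H P Q c) \<in> borel_measurable (complex_seq \<Otimes>\<^sub>M complex_seq \<Otimes>\<^sub>M lborel)"
    and m: "0 < m"
  shows "line_integral \<delta> \<beta> m (half_plane_integral \<delta> \<beta> m H) = line_integral \<delta> \<beta> (Suc m) H"
proof -
  define G where "G l x = (if strictly_between m l x then
        ennreal (step_weight \<delta> \<beta> m l x) * scale_integral \<beta> (Suc m) H (node_seq (Suc m) x) (weight_seq (Suc m) x (root_ratio m l x)) else 0)" for l x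
  let ?M = "lebesgue_pow m \<Otimes>\<^sub>M lebesgue_pow (Suc m)"
  have 1: "(\<lambda>t. fst t j) \<in> borel_measurable ?M" if "j < m" for j
    by (rule measurable_coordinate[OF measurable_fst]) (use that in auto)
  have 2: "(\<lambda>t. snd t j) \<in> borel_measurable ?M" if "j < Suc m" for j
    by (rule measurable_coordinate[OF measurable_snd]) (use that in auto)
  have G: "(\<lambda>(l, x). G l x) \<in> borel_measurable ?M"
  proof -
    have [measurable]: "Measurable.pred ?M (\<lambda>t. strictly_between m (fst t) (snd t))"
      by (rule strictly_between_measurable[OF 1 2])
    have [measurable]: "(\<lambda>t. resultant m (fst t) (snd t)) \<in> borel_measurable ?M"
      unfolding resultant_def by (intro borel_measurable_prod borel_measurable_abs borel_measurable_diff 1 2) auto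
    have [measurable]: "(\<lambda>t. vandermonde m (fst t)) \<in> borel_measurable ?M" "(\<lambda>t. vandermonde (Suc m) (snd t)) \<in> borel_measurable ?M"
      by (intro vandermonde_measurable 1 2; simp)+
    have s [measurable]: "(\<lambda>t. snd t j) \<in> borel_measurable ?M" if "j \<in> {..<Suc m}" for j using that 2 by auto
    have [measurable]: "(\<lambda>t. step_weight \<delta> \<beta> m (fst t) (snd t)) \<in> borel_measurable ?M"
      unfolding step_weight_def by measurable
    have rr: "(\<lambda>t. root_ratio m (fst t) (snd t) j) \<in> borel_measurable ?M" if "j \<in> {..<Suc m}" for j
      unfolding root_ratio_def using that by (intro borel_measurable_divide borel_measurable_prod borel_measurable_diff 1 2) auto
    have ws: "weight_seq (Suc m) x y = weight_seq (Suc m) x (\<lambda>j\<in>{..<Suc m}. y j)" for x y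
      unfolding weight_seq_def weight_poly_def by simp
    have rest [measurable]: "(\<lambda>t. \<lambda>j\<in>{..<Suc m}. root_ratio m (fst t) (snd t) j) \<in> measurable ?M (lebesgue_pow (Suc m))"
      by (rule measurable_restrict) (use rr in simp)
    have "(\<lambda>t. scale_integral \<beta> (Suc m) H (node_seq (Suc m) (snd t)) (weight_seq (Suc m) (snd t) (root_ratio m (fst t) (snd t)))) \<in> borel_measurable ?M"
      by (subst ws) (intro scale_integral_measurable[OF H] node_seq_measurable weight_seq_measurable measurable_snd rest)
    then show ?thesis unfolding G_def split_beta by measurable
  qed
  have "line_integral \<delta> \<beta> m (half_plane_integral \<delta> \<beta> m H) = (\<integral>\<^sup>+l. \<integral>\<^sup>+x. G l x \<partial>lebesgue_pow (Suc m) \<partial>lebesgue_pow m)"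
    unfolding line_integral_def
  proof (rule nn_integral_cong)
    fix l assume l: "l \<in> space (lebesgue_pow m)"
    show "(if increasing m l then ennreal (point_weight \<delta> \<beta> m l) * upper_integral \<delta> \<beta> m (half_plane_integral \<delta> \<beta> m H) l else 0) = (\<integral>\<^sup>+x. G l x \<partial>lebesgue_pow (Suc m))"
    proof (cases "increasing m l")
      case True
      then show ?thesis using lower_integral_split[OF H m True l, of \<delta> \<beta>] by (simp add: G_def)
    next
      case False
      then have "G l x = 0" for x using strictly_between_increasing(2) by (auto simp: G_def)
      then show ?thesis using False by simp
    qed
  qed
  also have "\<dots> = (\<integral>\<^sup>+x. \<integral>\<^sup>+l. G l x \<partial>lebesgue_pow m \<partial>lebesgue_pow (Suc m))"
    by (rule nn_integral_swap[OF sigma_finite_lebesgue_pow sigma_finite_lebesgue_pow G])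
  also have "\<dots> = line_integral \<delta> \<beta> (Suc m) H"
    unfolding line_integral_def
  proof (rule nn_integral_cong)
    fix x assume x: "x \<in> space (lebesgue_pow (Suc m))"
    show "(\<integral>\<^sup>+l. G l x \<partial>lebesgue_pow m) = (if increasing (Suc m) x then ennreal (point_weight \<delta> \<beta> (Suc m) x) * upper_integral \<delta> \<beta> (Suc m) H x else 0)"
    proof (cases "increasing (Suc m) x")
      case True
      then show ?thesis using upper_integral_split[OF H True x, of \<delta> \<beta>] by (simp add: G_def)
    next
      case False
      then have "G l x = 0" for l using strictly_between_increasing(1) by (auto simp: G_def)
      then show ?thesis using False by simp
    qed
  qed
  finally show ?thesis .
qed

text \<open>
The density of \<open>b\<close> in the half-plane form of the disc law is the density of the scale of the level
below: integrating out the coefficient of the new level amounts to integrating the old level with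
its scale.
\<close>
lemma scale_integral_level_law:
  assumes H: "(\<lambda>(P, Q, c). H P Q c) \<in> borel_measurable (complex_seq \<Otimes>\<^sub>M complex_seq \<Otimes>\<^sub>M lborel)"
    and K: "\<And>f. f \<in> borel_measurable borel \<Longrightarrow>
      (\<integral>\<^sup>+z. f z \<partial>level_law \<delta> \<beta> (Suc m)) = c * (\<integral>\<^sup>+b. \<integral>\<^sup>+a. (if 0 < b then f (disc_point a b) *
      ennreal (b powr (\<beta> / 2 * real (Suc m) - 1) * (((1 + b)\<^sup>2 + a\<^sup>2) powr (- (\<beta> / 2 * real (Suc m)) - 1) * jacobi_weight \<delta> (disc_point a b))) else 0) \<partial>lborel \<partial>lborel)"
  shows "(\<integral>\<^sup>+z. scale_integral \<beta> (Suc (Suc m)) H (fst_seq (Suc m) (\<gamma>(Suc m := z))) (snd_seq (Suc m) (\<gamma>(Suc m := z))) \<partial>level_law \<delta> \<beta> (Suc m)) =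
    c * scale_integral \<beta> (Suc m) (half_plane_integral \<delta> \<beta> (Suc m) H) (fst_seq m \<gamma>) (snd_seq m \<gamma>)"
proof -
  let ?f = "\<lambda>z. scale_integral \<beta> (Suc (Suc m)) H (fst_seq (Suc m) (\<gamma>(Suc m := z))) (snd_seq (Suc m) (\<gamma>(Suc m := z)))"
  have f: "?f \<in> borel_measurable borel"
    by (intro scale_integral_measurable[OF H] fst_seq_measurable) (auto simp: fun_upd_def intro: measurable_If)
  let ?g = "\<lambda>a b. ((1 + b)\<^sup>2 + a\<^sup>2) powr (- (\<beta> / 2 * real (Suc m)) - 1) * jacobi_weight \<delta> (disc_point a b)"
  have [measurable]: "fst_seq m \<gamma> \<in> space complex_seq" "snd_seq m \<gamma> \<in> space complex_seq" by (simp_all add: space_PiM)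
  have "(\<integral>\<^sup>+a. (if 0 < b then ?f (disc_point a b) * ennreal (b powr (\<beta> / 2 * real (Suc m) - 1) * ?g a b) else 0) \<partial>lborel) =
    (if 0 < b then half_plane_integral \<delta> \<beta> (Suc m) H (fst_seq m \<gamma>) (\<lambda>k. of_real b * snd_seq m \<gamma> k) b * ennreal (b powr (\<beta> / 2 * real (Suc m) - 1)) else 0)" for b
  proof (cases "0 < b")
    case b: True
    have pair: "char_pair (Suc m) (\<gamma>(Suc m := disc_point a b)) z = half_step a b z (fst (char_pair m \<gamma> z)) (of_real b * snd (char_pair m \<gamma> z))" for a z
    proof -
      have "char_pair m (\<gamma>(Suc m := disc_point a b)) z = char_pair m \<gamma> z" by (rule char_pair_cong) auto
      then show ?thesis using half_step_disc_step[OF b, of a z "fst (char_pair m \<gamma> z)" "snd (char_pair m \<gamma> z)"] by simp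
    qed
    define S where "S a = scale_integral \<beta> (Suc (Suc m)) H (\<lambda>k. fst (half_step a b (node_at k) (fst_seq m \<gamma> k) (of_real b * snd_seq m \<gamma> k)))
       (\<lambda>k. snd (half_step a b (node_at k) (fst_seq m \<gamma> k) (of_real b * snd_seq m \<gamma> k)))" for a
    have S: "?f (disc_point a b) = S a" for a
      unfolding S_def fst_seq_def snd_seq_def pair ..
    have [measurable]: "(\<lambda>k. of_real b * snd_seq m \<gamma> k) \<in> space complex_seq" by (simp add: space_PiM)
    have [measurable]: "S \<in> borel_measurable lborel"
      unfolding S_def by (rule half_plane_integrand_measurable[OF H]) measurable
    have "(\<integral>\<^sup>+a. ?f (disc_point a b) * ennreal (b powr (\<beta> / 2 * real (Suc m) - 1) * ?g a b) \<partial>lborel) =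
      (\<integral>\<^sup>+a. (S a * ennreal (?g a b)) * ennreal (b powr (\<beta> / 2 * real (Suc m) - 1)) \<partial>lborel)"
      unfolding S ennreal_mult'[OF powr_ge_zero] by (simp only: mult_ac)
    also have "\<dots> = half_plane_integral \<delta> \<beta> (Suc m) H (fst_seq m \<gamma>) (\<lambda>k. of_real b * snd_seq m \<gamma> k) b * ennreal (b powr (\<beta> / 2 * real (Suc m) - 1))"
      unfolding half_plane_integral_def S_def[symmetric] by (rule nn_integral_multc) measurable
    finally show ?thesis using b by simp
  qed simp
  then show ?thesis unfolding K[OF f] scale_integral_def[of \<beta> "Suc m" "half_plane_integral \<delta> \<beta> (Suc m) H"] by simp
qed

lemma nn_integral_coordinate_one:
  assumes "f \<in> borel_measurable borel"
  shows "(\<integral>\<^sup>+x. f (x 0) \<partial>lebesgue_pow (Suc 0)) = (\<integral>\<^sup>+t. f t \<partial>lborel)"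
proof -
  have "{..<Suc 0} = {0}" by auto
  then show ?thesis using lebesgue_pow.product_nn_integral_singleton[of f 0] assms by simp
qed

lemma upper_integral_one:
  assumes H: "(\<lambda>(P, Q, c). H P Q c) \<in> borel_measurable (complex_seq \<Otimes>\<^sub>M complex_seq \<Otimes>\<^sub>M lborel)"
  shows "upper_integral \<delta> \<beta> (Suc 0) H x = scale_integral \<beta> (Suc 0) H (\<lambda>k. node_at k - cayley (x 0)) (\<lambda>k. 1)"
proof -
  have n: "node_seq (Suc 0) x = (\<lambda>k. node_at k - cayley (x 0))" by (simp add: node_seq_def node_poly_def)
  have w: "weight_seq (Suc 0) x y = (\<lambda>k. of_real (y 0) * 1)" for y by (simp add: weight_seq_def weight_poly_def lessThan_Suc)
  let ?f = "\<lambda>c. (if 0 < c then H (\<lambda>k. node_at k - cayley (x 0)) (\<lambda>k. of_real c * 1) c * ennreal (c powr (\<beta> / 2 * real (Suc 0) - 1)) else 0)"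
  have [measurable]: "(\<lambda>k. node_at k - cayley (x 0)) \<in> space complex_seq" by (simp add: space_PiM)
  have [measurable]: "(\<lambda>c k. of_real c * 1 :: complex) \<in> measurable borel complex_seq" by (rule measurable_complex_seqI) simp
  have "upper_integral \<delta> \<beta> (Suc 0) H x = (\<integral>\<^sup>+y. ?f (y 0) \<partial>lebesgue_pow (Suc 0))"
    unfolding upper_integral_def n w by (rule nn_integral_cong) simp
  also have "\<dots> = (\<integral>\<^sup>+c. ?f c \<partial>lborel)"
  proof (rule nn_integral_coordinate_one)
    note [measurable] = measurable_triple[OF H]
    show "?f \<in> borel_measurable borel" by measurable
  qed
  finally show ?thesis unfolding scale_integral_def .
qed

text \<open>
The recursively generated pairs have, up to a constant, the law with independent eigenvalues and
weights. The factor \<open>C\<close> collects the normalising constants of all levels.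
\<close>
lemma level_law_line_integral:
  "\<exists>C. \<forall>H. (\<lambda>(P, Q, c). H P Q c) \<in> borel_measurable (complex_seq \<Otimes>\<^sub>M complex_seq \<Otimes>\<^sub>M lborel) \<longrightarrow>
    (\<integral>\<^sup>+\<gamma>. scale_integral \<beta> (Suc m) H (fst_seq m \<gamma>) (snd_seq m \<gamma>) \<partial>(\<Pi>\<^sub>M k\<in>{..<Suc m}. level_law \<delta> \<beta> k)) =
    C * line_integral \<delta> \<beta> (Suc m) H"
proof (induction m)
  case 0
  obtain c where c: "\<And>f. f \<in> borel_measurable borel \<Longrightarrow>
    (\<integral>\<^sup>+z. f z \<partial>level_law \<delta> \<beta> 0) = c * (\<integral>\<^sup>+x. f (cayley x) * ennreal (jacobi_weight \<delta> (cayley x) * (1 / (1 + x\<^sup>2))) \<partial>lborel)"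
    using nn_integral_level_law_circle[of \<delta> \<beta>] by auto
  interpret product_sigma_finite "level_law \<delta> \<beta>" by standard (rule sigma_finite_level_law[THEN sigma_finite_measure.sigma_finite_countable])
  have one: "{..<Suc 0} = {0}" by auto
  show ?case
  proof (intro exI[of _ c] allI impI)
    fix H :: "(nat \<Rightarrow> complex) \<Rightarrow> (nat \<Rightarrow> complex) \<Rightarrow> real \<Rightarrow> ennreal"
    assume H: "(\<lambda>(P, Q, c). H P Q c) \<in> borel_measurable (complex_seq \<Otimes>\<^sub>M complex_seq \<Otimes>\<^sub>M lborel)"
    let ?f = "\<lambda>z. scale_integral \<beta> (Suc 0) H (\<lambda>k. node_at k - z) (\<lambda>k. 1)"
    have f: "?f \<in> borel_measurable borel"
      by (intro scale_integral_measurable[OF H] measurable_complex_seqI) measurable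
    have "(\<integral>\<^sup>+\<gamma>. scale_integral \<beta> (Suc 0) H (fst_seq 0 \<gamma>) (snd_seq 0 \<gamma>) \<partial>(\<Pi>\<^sub>M k\<in>{..<Suc 0}. level_law \<delta> \<beta> k)) =
      (\<integral>\<^sup>+\<gamma>. ?f (\<gamma> 0) \<partial>(\<Pi>\<^sub>M k\<in>{0}. level_law \<delta> \<beta> k))"
      unfolding one by (simp add: fst_seq_def snd_seq_def)
    also have "\<dots> = (\<integral>\<^sup>+z. ?f z \<partial>level_law \<delta> \<beta> 0)"
      by (rule product_nn_integral_singleton) (rule measurable_level_law_borel[OF f])
    also have "\<dots> = c * (\<integral>\<^sup>+x. ?f (cayley x) * ennreal (jacobi_weight \<delta> (cayley x) * (1 / (1 + x\<^sup>2))) \<partial>lborel)"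
      by (rule c[OF f])
    also have "(\<integral>\<^sup>+x. ?f (cayley x) * ennreal (jacobi_weight \<delta> (cayley x) * (1 / (1 + x\<^sup>2))) \<partial>lborel) =
       (\<integral>\<^sup>+x. ?f (cayley (x 0)) * ennreal (jacobi_weight \<delta> (cayley (x 0)) * (1 / (1 + (x 0)\<^sup>2))) \<partial>lebesgue_pow (Suc 0))"
    proof (rule nn_integral_coordinate_one[symmetric])
      note [measurable] = measurable_compose[OF cayley_measurable f]
      show "(\<lambda>x. ?f (cayley x) * ennreal (jacobi_weight \<delta> (cayley x) * (1 / (1 + x\<^sup>2)))) \<in> borel_measurable borel" by measurable
    qed
    also have "\<dots> = line_integral \<delta> \<beta> (Suc 0) H"
      unfolding line_integral_def
    proof (rule nn_integral_cong)
      fix x :: "nat \<Rightarrow> real"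
      have "increasing (Suc 0) x" by (auto simp: increasing_def strict_mono_on_def)
      moreover have "point_weight \<delta> \<beta> (Suc 0) x = jacobi_weight \<delta> (cayley (x 0)) * (1 / (1 + (x 0)\<^sup>2))"
      proof -
        have "(1 + (x 0)\<^sup>2) powr (- 1) = 1 / (1 + (x 0)\<^sup>2)" by (simp add: powr_minus_divide add_pos_nonneg)
        then show ?thesis by (simp add: point_weight_def vandermonde_def)
      qed
      ultimately show "?f (cayley (x 0)) * ennreal (jacobi_weight \<delta> (cayley (x 0)) * (1 / (1 + (x 0)\<^sup>2))) =
        (if increasing (Suc 0) x then ennreal (point_weight \<delta> \<beta> (Suc 0) x) * upper_integral \<delta> \<beta> (Suc 0) H x else 0)"
        unfolding upper_integral_one[OF H] by (simp add: mult.commute)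
    qed
    finally show "(\<integral>\<^sup>+\<gamma>. scale_integral \<beta> (Suc 0) H (fst_seq 0 \<gamma>) (snd_seq 0 \<gamma>) \<partial>(\<Pi>\<^sub>M k\<in>{..<Suc 0}. level_law \<delta> \<beta> k)) =
      c * line_integral \<delta> \<beta> (Suc 0) H" .
  qed
next
  case (Suc m)
  then obtain C where C: "\<And>H. (\<lambda>(P, Q, c). H P Q c) \<in> borel_measurable (complex_seq \<Otimes>\<^sub>M complex_seq \<Otimes>\<^sub>M lborel) \<Longrightarrow>
    (\<integral>\<^sup>+\<gamma>. scale_integral \<beta> (Suc m) H (fst_seq m \<gamma>) (snd_seq m \<gamma>) \<partial>(\<Pi>\<^sub>M k\<in>{..<Suc m}. level_law \<delta> \<beta> k)) =
    C * line_integral \<delta> \<beta> (Suc m) H" by blast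
  obtain c where c: "\<And>f. f \<in> borel_measurable borel \<Longrightarrow>
    (\<integral>\<^sup>+z. f z \<partial>level_law \<delta> \<beta> (Suc m)) = c * (\<integral>\<^sup>+b. \<integral>\<^sup>+a. (if 0 < b then f (disc_point a b) *
      ennreal (b powr (\<beta> / 2 * real (Suc m) - 1) * (((1 + b)\<^sup>2 + a\<^sup>2) powr (- (\<beta> / 2 * real (Suc m)) - 1) * jacobi_weight \<delta> (disc_point a b))) else 0) \<partial>lborel \<partial>lborel)"
    using nn_integral_level_law_disc[of "Suc m" \<delta> \<beta>] by auto
  interpret product_sigma_finite "level_law \<delta> \<beta>" by standard (rule sigma_finite_level_law[THEN sigma_finite_measure.sigma_finite_countable])
  show ?case
  proof (intro exI[of _ "c * C"] allI impI)
    fix H :: "(nat \<Rightarrow> complex) \<Rightarrow> (nat \<Rightarrow> complex) \<Rightarrow> real \<Rightarrow> ennreal"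
    assume H: "(\<lambda>(P, Q, c). H P Q c) \<in> borel_measurable (complex_seq \<Otimes>\<^sub>M complex_seq \<Otimes>\<^sub>M lborel)"
    let ?H = "half_plane_integral \<delta> \<beta> (Suc m) H"
    have H': "(\<lambda>(P, Q, c). ?H P Q c) \<in> borel_measurable (complex_seq \<Otimes>\<^sub>M complex_seq \<Otimes>\<^sub>M lborel)"
      by (rule half_plane_integral_measurable[OF H])
    have "(\<integral>\<^sup>+\<gamma>. scale_integral \<beta> (Suc (Suc m)) H (fst_seq (Suc m) \<gamma>) (snd_seq (Suc m) \<gamma>) \<partial>(\<Pi>\<^sub>M k\<in>insert (Suc m) {..<Suc m}. level_law \<delta> \<beta> k)) =
      (\<integral>\<^sup>+\<gamma>. \<integral>\<^sup>+z. scale_integral \<beta> (Suc (Suc m)) H (fst_seq (Suc m) (\<gamma>(Suc m := z))) (snd_seq (Suc m) (\<gamma>(Suc m := z))) \<partial>level_law \<delta> \<beta> (Suc m)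
        \<partial>(\<Pi>\<^sub>M k\<in>{..<Suc m}. level_law \<delta> \<beta> k))"
    proof (rule product_nn_integral_insert)
      show "(\<lambda>\<gamma>. scale_integral \<beta> (Suc (Suc m)) H (fst_seq (Suc m) \<gamma>) (snd_seq (Suc m) \<gamma>)) \<in>
        borel_measurable (\<Pi>\<^sub>M k\<in>insert (Suc m) {..<Suc m}. level_law \<delta> \<beta> k)"
        unfolding lessThan_Suc[symmetric]
        by (intro scale_integral_measurable[OF H] fst_seq_measurable level_law_coordinate_measurable) auto
    qed auto
    also have "\<dots> = (\<integral>\<^sup>+\<gamma>. c * scale_integral \<beta> (Suc m) ?H (fst_seq m \<gamma>) (snd_seq m \<gamma>) \<partial>(\<Pi>\<^sub>M k\<in>{..<Suc m}. level_law \<delta> \<beta> k))"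
      by (rule nn_integral_cong) (rule scale_integral_level_law[OF H c])
    also have "\<dots> = c * (\<integral>\<^sup>+\<gamma>. scale_integral \<beta> (Suc m) ?H (fst_seq m \<gamma>) (snd_seq m \<gamma>) \<partial>(\<Pi>\<^sub>M k\<in>{..<Suc m}. level_law \<delta> \<beta> k))"
      by (intro nn_integral_cmult scale_integral_measurable[OF H'] fst_seq_measurable level_law_coordinate_measurable) auto
    also have "\<dots> = c * (C * line_integral \<delta> \<beta> (Suc (Suc m)) H)"
      unfolding C[OF H'] line_integral_step[OF H zero_less_Suc] ..
    finally show "(\<integral>\<^sup>+\<gamma>. scale_integral \<beta> (Suc (Suc m)) H (fst_seq (Suc m) \<gamma>) (snd_seq (Suc m) \<gamma>) \<partial>(\<Pi>\<^sub>M k\<in>{..<Suc (Suc m)}. level_law \<delta> \<beta> k)) =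
      c * C * line_integral \<delta> \<beta> (Suc (Suc m)) H"
      unfolding lessThan_Suc[of "Suc m"] by (simp only: mult.assoc)
  qed
qed

section \<open>Characteristic polynomials of the matrix product\<close>

definition shift_mat :: "complex mat \<Rightarrow> complex \<Rightarrow> complex mat" where
  "shift_mat A z = mat (dim_row A) (dim_row A) (\<lambda>(i, j). (if i = j then z else 0) - A $$ (i, j))"

lemma poly_char_poly_shift_mat:
  assumes A: "A \<in> carrier_mat n n"
  shows "poly (char_poly A) z = det (shift_mat A z)"
proof -
  have "- (char_matrix A z) = shift_mat A z"
    using A by (intro eq_matI) (auto simp: char_matrix_def shift_mat_def)
  then show ?thesis using char_poly_matrix[OF A, of z] by simp
qed

text \<open>
\<open>1 \<oplus> V\<close>.
\<close>
definition one_block :: "complex mat \<Rightarrow> complex mat" where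
  "one_block V = four_block_mat (1\<^sub>m 1) (0\<^sub>m 1 (dim_col V)) (0\<^sub>m (dim_row V) 1) V"

lemma one_block_carrier: "V \<in> carrier_mat m m \<Longrightarrow> one_block V \<in> carrier_mat (Suc m) (Suc m)"
  by (rule carrier_matI) (simp_all add: one_block_def)

lemma one_block_mult:
  assumes "V \<in> carrier_mat m m" "W \<in> carrier_mat m m"
  shows "one_block V * one_block W = one_block (V * W)"
proof -
  have "one_block V * one_block W = four_block_mat (1\<^sub>m 1 * 1\<^sub>m 1 + 0\<^sub>m 1 m * 0\<^sub>m m 1) (1\<^sub>m 1 * 0\<^sub>m 1 m + 0\<^sub>m 1 m * W)
     (0\<^sub>m m 1 * 1\<^sub>m 1 + V * 0\<^sub>m m 1) (0\<^sub>m m 1 * 0\<^sub>m 1 m + V * W)"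
    using assms unfolding one_block_def by (subst mult_four_block_mat) (auto simp: carrier_matD)
  also have "\<dots> = one_block (V * W)" using assms unfolding one_block_def by simp
  finally show ?thesis .
qed

lemma one_block_one: "one_block (1\<^sub>m m) = 1\<^sub>m (Suc m)"
  unfolding one_block_def by (intro eq_matI) auto

lemma one_block_diag:
  assumes "V \<in> carrier_mat m m"
  shows "four_block_mat (1\<^sub>m (Suc k)) (0\<^sub>m (Suc k) m) (0\<^sub>m m (Suc k)) V =
    one_block (four_block_mat (1\<^sub>m k) (0\<^sub>m k m) (0\<^sub>m m k) V)"
proof (rule eq_matI)
  fix i j assume "i < dim_row (one_block (four_block_mat (1\<^sub>m k) (0\<^sub>m k m) (0\<^sub>m m k) V))"
    "j < dim_col (one_block (four_block_mat (1\<^sub>m k) (0\<^sub>m k m) (0\<^sub>m m k) V))"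
  then have "i < Suc (k + m)" "j < Suc (k + m)" using assms by (simp_all add: one_block_def)
  then show "four_block_mat (1\<^sub>m (Suc k)) (0\<^sub>m (Suc k) m) (0\<^sub>m m (Suc k)) V $$ (i, j) =
    one_block (four_block_mat (1\<^sub>m k) (0\<^sub>m k m) (0\<^sub>m m k) V) $$ (i, j)"
    using assms unfolding one_block_def by (cases i; cases j) simp_all
qed (use assms in \<open>simp_all add: one_block_def\<close>)

lemma Xi_carrier: "Xi g \<in> carrier_mat 2 2"
  by (rule carrier_matI) (simp_all add: Xi_def Let_def mat_of_rows_list_def)

lemma four_block_mat_empty:
  "A \<in> carrier_mat nr nc \<Longrightarrow> four_block_mat A (0\<^sub>m nr 0) (0\<^sub>m 0 nc) (0\<^sub>m 0 0) = A"
  by (intro eq_matI) auto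

lemma Xi_embed_carrier:
  assumes "k < n" shows "Xi_embed n k g \<in> carrier_mat n n"
proof (cases "k = n - 1")
  case True
  then show ?thesis using assms by (intro carrier_matI) (auto simp: Xi_embed_def dim_diag_block_mat mat_of_rows_list_def)
next
  case False
  then show ?thesis using assms carrier_matD[OF Xi_carrier, of g]
    by (intro carrier_matI) (auto simp: Xi_embed_def dim_diag_block_mat)
qed

text \<open>
All factors but the first act trivially on the first basis vector.
\<close>
lemma Xi_embed_Suc:
  assumes "k < m"
  shows "Xi_embed (Suc m) (Suc k) g = one_block (Xi_embed m k g)"
proof (cases "k = m - 1")
  case True
  let ?G = "mat_of_rows_list 1 [[g]]"
  have G: "?G \<in> carrier_mat 1 1" by (simp add: mat_of_rows_list_def)
  from True assms have m: "m = Suc k" by simp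
  have "Xi_embed (Suc m) (Suc k) g = four_block_mat (1\<^sub>m (Suc k)) (0\<^sub>m (Suc k) 1) (0\<^sub>m 1 (Suc k)) ?G"
    using m carrier_matD[OF G] four_block_mat_empty[OF G] by (simp add: Xi_embed_def Let_def)
  also have "\<dots> = one_block (four_block_mat (1\<^sub>m k) (0\<^sub>m k 1) (0\<^sub>m 1 k) ?G)" by (rule one_block_diag[OF G])
  also have "four_block_mat (1\<^sub>m k) (0\<^sub>m k 1) (0\<^sub>m 1 k) ?G = Xi_embed m k g"
    using m carrier_matD[OF G] four_block_mat_empty[OF G] by (simp add: Xi_embed_def Let_def)
  finally show ?thesis .
next
  case False
  define V where "V = diag_block_mat [Xi g, 1\<^sub>m (m - k - 2)]"
  have V: "V \<in> carrier_mat (m - k) (m - k)"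
    using False assms carrier_matD[OF Xi_carrier, of g] by (intro carrier_matI) (auto simp: V_def dim_diag_block_mat)
  have e1: "Xi_embed (Suc m) (Suc k) g = four_block_mat (1\<^sub>m (Suc k)) (0\<^sub>m (Suc k) (m - k)) (0\<^sub>m (m - k) (Suc k)) V"
  proof -
    have "Xi_embed (Suc m) (Suc k) g = diag_block_mat (1\<^sub>m (Suc k) # [Xi g, 1\<^sub>m (m - k - 2)])"
    proof -
      have "Suc k \<noteq> m" using False assms by auto
      then show ?thesis by (simp add: Xi_embed_def del: diag_block_mat.simps)
    qed
    then show ?thesis unfolding diag_block_mat.simps(2)[of "1\<^sub>m (Suc k)"] V_def[symmetric] Let_def
      using carrier_matD[OF V] by (simp only: index_one_mat)
  qed
  have e2: "Xi_embed m k g = four_block_mat (1\<^sub>m k) (0\<^sub>m k (m - k)) (0\<^sub>m (m - k) k) V"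
  proof -
    have "Xi_embed m k g = diag_block_mat (1\<^sub>m k # [Xi g, 1\<^sub>m (m - k - 2)])"
      using False assms by (simp add: Xi_embed_def del: diag_block_mat.simps)
    then show ?thesis unfolding diag_block_mat.simps(2)[of "1\<^sub>m k"] V_def[symmetric] Let_def
      using carrier_matD[OF V] by (simp only: index_one_mat)
  qed
  show ?thesis unfolding e1 e2 by (rule one_block_diag[OF V])
qed

lemma foldr_mat_carrier:
  assumes "\<And>A. A \<in> set As \<Longrightarrow> A \<in> carrier_mat n n"
  shows "foldr (*) As (1\<^sub>m n) \<in> carrier_mat n n"
  using assms by (induction As) (auto intro!: mult_carrier_mat[of _ n n])

lemma Xi_product_carrier: "Xi_product n \<gamma> \<in> carrier_mat n n"
  unfolding Xi_product_def by (rule foldr_mat_carrier) (auto intro: Xi_embed_carrier)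

lemma foldr_one_block:
  assumes "\<And>A. A \<in> set As \<Longrightarrow> A \<in> carrier_mat m m"
  shows "foldr (*) (map one_block As) (1\<^sub>m (Suc m)) = one_block (foldr (*) As (1\<^sub>m m))"
  using assms
proof (induction As)
  case (Cons A As)
  have "foldr (*) As (1\<^sub>m m) \<in> carrier_mat m m" using Cons.prems by (intro foldr_mat_carrier) auto
  then show ?case using Cons one_block_mult[of A m "foldr (*) As (1\<^sub>m m)"] by simp
qed (simp add: one_block_one)

lemma Xi_product_Suc:
  "Xi_product (Suc m) \<gamma> = Xi_embed (Suc m) 0 (\<gamma> 0) * one_block (Xi_product m (\<lambda>k. \<gamma> (Suc k)))"
proof -
  have "[0..<Suc m] = 0 # map Suc [0..<m]" by (simp add: map_Suc_upt upt_conv_Cons del: upt_Suc)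
  then have "Xi_product (Suc m) \<gamma> = Xi_embed (Suc m) 0 (\<gamma> 0) *
    foldr (*) (map (\<lambda>k. Xi_embed (Suc m) (Suc k) (\<gamma> (Suc k))) [0..<m]) (1\<^sub>m (Suc m))"
    by (simp add: Xi_product_def comp_def del: upt_Suc)
  also have "map (\<lambda>k. Xi_embed (Suc m) (Suc k) (\<gamma> (Suc k))) [0..<m] = map one_block (map (\<lambda>k. Xi_embed m k (\<gamma> (Suc k))) [0..<m])"
    by (auto simp: Xi_embed_Suc)
  also have "foldr (*) \<dots> (1\<^sub>m (Suc m)) = one_block (Xi_product m (\<lambda>k. \<gamma> (Suc k)))"
    unfolding Xi_product_def by (rule foldr_one_block) (auto intro: Xi_embed_carrier)
  finally show ?thesis .
qed

lemma Xi_embed_0_entries: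
  assumes m: "0 < m" and i: "i < Suc m" and k: "k < Suc m"
  shows "Xi_embed (Suc m) 0 g $$ (i, k) = (if i < 2 \<and> k < 2 then Xi g $$ (i, k) else if i = k then 1 else 0)"
proof -
  have e: "Xi_embed (Suc m) 0 g = four_block_mat (1\<^sub>m 0) (0\<^sub>m 0 (Suc m)) (0\<^sub>m (Suc m) 0)
     (four_block_mat (Xi g) (0\<^sub>m 2 (m - 1)) (0\<^sub>m (m - 1) 2) (1\<^sub>m (m - 1)))"
    using m carrier_matD[OF Xi_carrier, of g] by (simp add: Xi_embed_def Let_def four_block_mat_empty[OF one_carrier_mat])
  show ?thesis unfolding e using m i k carrier_matD[OF Xi_carrier, of g] by auto
qed

lemma Xi_step_entries:
  fixes g :: complex
  assumes m: "0 < m" and V: "V \<in> carrier_mat m m" and i: "i < Suc m" and j: "j < Suc m"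
  defines "\<rho> \<equiv> complex_of_real (sqrt (1 - (cmod g)\<^sup>2))" and "e \<equiv> (1 - g) / (1 - cnj g)"
  shows "(Xi_embed (Suc m) 0 g * one_block V) $$ (i, j) =
    (if i = 0 then (if j = 0 then g else \<rho> * e * V $$ (0, j - 1))
     else if i = 1 then (if j = 0 then \<rho> else - cnj g * e * V $$ (0, j - 1))
     else if j = 0 then 0 else V $$ (i - 1, j - 1))"
proof -
  let ?E = "Xi_embed (Suc m) 0 g" and ?B = "one_block V"
  have E: "?E \<in> carrier_mat (Suc m) (Suc m)" by (rule Xi_embed_carrier) simp
  have B: "?B \<in> carrier_mat (Suc m) (Suc m)" by (rule one_block_carrier[OF V])
  have Xi: "Xi g $$ (0, 0) = g" "Xi g $$ (0, 1) = \<rho> * e" "Xi g $$ (1, 0) = \<rho>" "Xi g $$ (1, 1) = - cnj g * e"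
    unfolding Xi_def Let_def mat_of_rows_list_def \<rho>_def e_def by simp_all
  have Be: "?B $$ (k, j) = (if k = 0 then (if j = 0 then 1 else 0) else if j = 0 then 0 else V $$ (k - 1, j - 1))"
    if "k < Suc m" for k using that j V unfolding one_block_def by auto
  have "(?E * ?B) $$ (i, j) = (\<Sum>k<Suc m. ?E $$ (i, k) * ?B $$ (k, j))"
    using E B i j by (simp add: scalar_prod_def atLeast0LessThan)
  also have "\<dots> = (if i < 2 then ?E $$ (i, 0) * ?B $$ (0, j) + ?E $$ (i, 1) * ?B $$ (1, j) else ?B $$ (i, j))"
  proof (cases "i < 2")
    case True
    have "(\<Sum>k<Suc m. ?E $$ (i, k) * ?B $$ (k, j)) = (\<Sum>k\<in>{0, 1}. ?E $$ (i, k) * ?B $$ (k, j))"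
      using m i True by (intro sum.mono_neutral_right) (auto simp: Xi_embed_0_entries)
    then show ?thesis using True by simp
  next
    case False
    have "(\<Sum>k<Suc m. ?E $$ (i, k) * ?B $$ (k, j)) = (\<Sum>k\<in>{i}. ?E $$ (i, k) * ?B $$ (k, j))"
      using m i False by (intro sum.mono_neutral_right) (auto simp: Xi_embed_0_entries)
    then show ?thesis using False m i by (simp add: Xi_embed_0_entries)
  qed
  finally show ?thesis
    using m i j by (auto simp: Be Xi_embed_0_entries Xi[unfolded One_nat_def] less_2_cases_iff)
qed

text \<open>
The cofactor is that of the \<open>(0,0)\<close> entry, so the quotient of the two components is the resolvent at the
first basis vector.
\<close>
definition shift_pair :: "complex mat \<Rightarrow> complex \<Rightarrow> complex \<times> complex" where
  "shift_pair A z = (det (shift_mat A z), cofactor (shift_mat A z) 0 0)"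

text \<open>
Laplace expansion for a matrix that agrees with \<open>N\<close> outside the first row: only the entries of that
row differ, the cofactors are those of \<open>N\<close>.
\<close>
lemma det_first_row:
  fixes A N :: "complex mat"
  assumes "A \<in> carrier_mat m m" "N \<in> carrier_mat m m" "0 < m"
    and "\<And>i j. 0 < i \<Longrightarrow> i < m \<Longrightarrow> j < m \<Longrightarrow> A $$ (i, j) = N $$ (i, j)"
  shows "det A = (\<Sum>j<m. A $$ (0, j) * cofactor N 0 j)"
proof -
  have "mat_delete A 0 j = mat_delete N 0 j" if "j < m" for j
    unfolding mat_delete_def using assms that by (intro eq_matI) (auto split: if_splits)
  then have "cofactor A 0 j = cofactor N 0 j" if "j < m" for j using that by (simp add: cofactor_def)
  then show ?thesis using laplace_expansion_row[OF assms(1,3)] by simp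
qed

text \<open>
The first column of \<open>U = \<Xi>(g) (1 \<oplus> V)\<close> has only the entries \<open>g\<close> and \<open>\<rho>\<close>, and the remaining rows of
\<open>z - U\<close> below the second are those of \<open>z - V\<close>. Expanding along this column, and the minors along
their first rows, everything is expressed by \<open>det (z - V)\<close>, its \<open>(0,0)\<close> cofactor \<open>c\<^sub>0\<close> and the sum \<open>S\<close>,
which is \<open>z c\<^sub>0 - det (z - V)\<close>. The two expressions \<open>1 + cnj g e\<close> and \<open>g + e\<close> for \<open>\<kappa>\<close> then produce
the factor \<open>z - 1\<close>; this is where the phase \<open>e\<close> of the block is used.
\<close>
lemma shift_pair_step:
  assumes m: "0 < m" and V: "V \<in> carrier_mat m m" and g: "cmod g < 1"
  shows "shift_pair (Xi_embed (Suc m) 0 g * one_block V) z = disc_step g z (shift_pair V z)"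
proof -
  define \<rho> where "\<rho> = complex_of_real (sqrt (1 - (cmod g)\<^sup>2))"
  define e where "e = (1 - g) / (1 - cnj g)"
  define U where "U = Xi_embed (Suc m) 0 g * one_block V"
  have U: "U \<in> carrier_mat (Suc m) (Suc m)"
    unfolding U_def using Xi_embed_carrier[of 0 "Suc m" g] one_block_carrier[OF V] by simp
  have Ue: "U $$ (i, j) = (if i = 0 then (if j = 0 then g else \<rho> * e * V $$ (0, j - 1))
     else if i = 1 then (if j = 0 then \<rho> else - cnj g * e * V $$ (0, j - 1))
     else if j = 0 then 0 else V $$ (i - 1, j - 1))" if "i < Suc m" "j < Suc m" for i j
    unfolding U_def \<rho>_def e_def using Xi_step_entries[OF m V that] .
  define M where "M = shift_mat U z"
  define N where "N = shift_mat V z"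
  have M: "M \<in> carrier_mat (Suc m) (Suc m)" using U by (simp add: M_def shift_mat_def)
  have N: "N \<in> carrier_mat m m" using V by (simp add: N_def shift_mat_def)
  have Me: "M $$ (i, j) = (if i = j then z else 0) - U $$ (i, j)" if "i < Suc m" "j < Suc m" for i j
    using that U by (simp add: M_def shift_mat_def)
  have Ne: "N $$ (i, j) = (if i = j then z else 0) - V $$ (i, j)" if "i < m" "j < m" for i j
    using that V by (simp add: N_def shift_mat_def)
  define c where "c j = cofactor N 0 j" for j
  define S where "S = (\<Sum>j<m. V $$ (0, j) * c j)"
  have z0: "(\<Sum>j<m. (if 0 = j then z else 0) * c j) = z * c 0"
    using m by (subst sum.mono_neutral_right[of _ "{0}"]) auto
  have p: "det N = z * c 0 - S"
  proof -
    have "det N = (\<Sum>j<m. N $$ (0, j) * c j)" unfolding c_def by (rule laplace_expansion_row[OF N m])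
    also have "\<dots> = (\<Sum>j<m. (if 0 = j then z else 0) * c j - V $$ (0, j) * c j)"
      using m by (intro sum.cong) (auto simp: Ne left_diff_distrib)
    finally show ?thesis unfolding sum_subtractf z0 S_def .
  qed
  have d0: "det (mat_delete M 0 0) = z * c 0 - (- cnj g * e) * S"
  proof -
    have "det (mat_delete M 0 0) = (\<Sum>j<m. mat_delete M 0 0 $$ (0, j) * cofactor N 0 j)"
    proof (rule det_first_row[OF _ N m])
      show "mat_delete M 0 0 \<in> carrier_mat m m" using mat_delete_carrier[OF M] by simp
      show "mat_delete M 0 0 $$ (i, j) = N $$ (i, j)" if "0 < i" "i < m" "j < m" for i j
        using that M by (simp add: mat_delete_def Me Ne Ue)
    qed
    also have "\<dots> = (\<Sum>j<m. (if 0 = j then z else 0) * c j - (- cnj g * e) * (V $$ (0, j) * c j))"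
      unfolding c_def[symmetric] using m M
      by (intro sum.cong) (auto simp: mat_delete_def Me Ue algebra_simps)
    finally show ?thesis unfolding sum_subtractf z0 S_def sum_distrib_left .
  qed
  have d1: "det (mat_delete M 1 0) = - (\<rho> * e * S)"
  proof -
    have "det (mat_delete M 1 0) = (\<Sum>j<m. mat_delete M 1 0 $$ (0, j) * cofactor N 0 j)"
    proof (rule det_first_row[OF _ N m])
      show "mat_delete M 1 0 \<in> carrier_mat m m" using mat_delete_carrier[OF M] by simp
      show "mat_delete M 1 0 $$ (i, j) = N $$ (i, j)" if "0 < i" "i < m" "j < m" for i j
        using that M by (simp add: mat_delete_def Me Ne Ue)
    qed
    also have "\<dots> = (\<Sum>j<m. - (\<rho> * e * (V $$ (0, j) * c j)))"
      unfolding c_def[symmetric] using m M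
      by (intro sum.cong) (auto simp: mat_delete_def Me Ue)
    finally show ?thesis unfolding S_def sum_distrib_left sum_negf .
  qed
  have "det M = (\<Sum>i<Suc m. M $$ (i, 0) * cofactor M i 0)" by (rule laplace_expansion_column[OF M]) simp
  also have "\<dots> = (\<Sum>i\<in>{0, 1}. M $$ (i, 0) * cofactor M i 0)"
    using m by (intro sum.mono_neutral_right) (auto simp: Me Ue)
  also have "\<dots> = (z - g) * det (mat_delete M 0 0) + \<rho> * det (mat_delete M 1 0)"
    using m by (simp add: Me Ue cofactor_def)
  finally have dM: "det M = (z - g) * (z * c 0 - (- cnj g * e) * S) - \<rho> * \<rho> * e * S"
    unfolding d0 d1 by (simp add: algebra_simps)
  have q: "cofactor M 0 0 = z * c 0 - (- cnj g * e) * S" by (simp add: cofactor_def d0)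
  have gn: "g \<noteq> 1" "1 - cnj g \<noteq> 0"
  proof -
    show "g \<noteq> 1" using g by auto
    then show "1 - cnj g \<noteq> 0" by (metis complex_cnj_cnj complex_cnj_one eq_iff_diff_eq_0)
  qed
  define \<kappa> where "\<kappa> = (1 - of_real ((cmod g)\<^sup>2)) / (1 - cnj g)"
  have gg: "of_real ((cmod g)\<^sup>2) = g * cnj g" by (rule complex_norm_square)
  have rr: "\<rho> * \<rho> = 1 - g * cnj g"
  proof -
    have "(cmod g)\<^sup>2 \<le> 1" using g by (simp add: power_le_one)
    then have "\<rho> * \<rho> = of_real (1 - (cmod g)\<^sup>2)" unfolding \<rho>_def by (simp flip: of_real_mult)
    then show ?thesis using gg by simp
  qed
  \<comment> \<open>Both equalities use the particular value of the phase \<open>e\<close>.\<close>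
  have k1: "\<kappa> = 1 + cnj g * e" unfolding \<kappa>_def e_def gg using gn by (simp add: field_simps)
  have k2: "\<kappa> = g + e" unfolding \<kappa>_def e_def gg using gn by (simp add: field_simps)
  have S: "S = z * c 0 - det N" using p by simp
  have "det M = e * (1 - cnj g * z) * det N + \<kappa> * (z - 1) * z * c 0"
  proof -
    have "det M = e * (1 - cnj g * z) * det N + ((1 + cnj g * e) * z - (g + e)) * z * c 0"
      unfolding dM rr S by (simp add: algebra_simps)
    also have "(1 + cnj g * e) * z - (g + e) = \<kappa> * (z - 1)"
      unfolding k1[symmetric] k2[symmetric] by (simp add: algebra_simps)
    finally show ?thesis .
  qed
  moreover have "cofactor M 0 0 = - cnj g * e * det N + \<kappa> * z * c 0"
    unfolding q k1 S by (simp add: algebra_simps)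
  ultimately show ?thesis
    unfolding shift_pair_def disc_step_def Let_def e_def[symmetric] \<kappa>_def[symmetric] U_def[symmetric] M_def[symmetric] N_def[symmetric] c_def fst_conv snd_conv
    by simp
qed

lemma shift_pair_Xi_product:
  assumes "\<And>k. k < m \<Longrightarrow> cmod (\<gamma> k) < 1"
  shows "shift_pair (Xi_product (Suc m) \<gamma>) z = char_pair m (\<lambda>k. \<gamma> (m - k)) z"
  using assms
proof (induction m arbitrary: \<gamma>)
  case 0
  have "Xi_product (Suc 0) \<gamma> = mat_of_rows_list 1 [[\<gamma> 0]]"
    by (intro eq_matI) (auto simp: Xi_product_def Xi_embed_def mat_of_rows_list_def Let_def)
  then have e: "shift_mat (Xi_product (Suc 0) \<gamma>) z = mat 1 1 (\<lambda>_. z - \<gamma> 0)"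
    by (intro eq_matI) (auto simp: shift_mat_def mat_of_rows_list_def)
  have "mat_delete (mat 1 1 (\<lambda>_. z - \<gamma> 0)) 0 0 \<in> carrier_mat 0 0"
    using mat_delete_carrier[of "mat 1 1 (\<lambda>_. z - \<gamma> 0)" 1 1 0 0] by simp
  then show ?case unfolding shift_pair_def e by (simp add: det_single cofactor_def)
next
  case (Suc m)
  have IH: "shift_pair (Xi_product (Suc m) (\<lambda>k. \<gamma> (Suc k))) z = char_pair m (\<lambda>k. \<gamma> (Suc (m - k))) z"
    by (rule Suc.IH) (use Suc.prems in auto)
  have "shift_pair (Xi_product (Suc (Suc m)) \<gamma>) z = disc_step (\<gamma> 0) z (shift_pair (Xi_product (Suc m) (\<lambda>k. \<gamma> (Suc k))) z)"
    unfolding Xi_product_Suc[of "Suc m"] by (rule shift_pair_step) (use Suc.prems in \<open>auto simp: Xi_product_carrier\<close>)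
  also have "char_pair m (\<lambda>k. \<gamma> (Suc (m - k))) z = char_pair m (\<lambda>k. \<gamma> (Suc m - k)) z"
    by (rule char_pair_cong) (simp add: Suc_diff_le)
  then have "shift_pair (Xi_product (Suc m) (\<lambda>k. \<gamma> (Suc k))) z = char_pair m (\<lambda>k. \<gamma> (Suc m - k)) z" using IH by simp
  finally show ?case by simp
qed

lemma poly_char_poly_Xi_product:
  assumes "\<And>k. k < m \<Longrightarrow> cmod (\<gamma> k) < 1"
  shows "poly (char_poly (Xi_product (Suc m) \<gamma>)) z = fst (char_pair m (\<lambda>k. \<gamma> (m - k)) z)"
  using arg_cong[OF shift_pair_Xi_product[OF assms, where z=z], where f=fst]
  by (simp add: shift_pair_def poly_char_poly_shift_mat[OF Xi_product_carrier])

section \<open>Eigenangles as Borel functions of polynomial values\<close>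

definition poly_angles :: "complex poly \<Rightarrow> real list" where
  "poly_angles p = sorted_list_of_multiset (image_mset Arg2pi (proots p))"

definition monic_of_degree :: "nat \<Rightarrow> complex poly \<Rightarrow> bool" where
  "monic_of_degree n p \<longleftrightarrow> degree p = n \<and> lead_coeff p = 1"

definition value_seq :: "complex poly \<Rightarrow> nat \<Rightarrow> complex" where
  "value_seq p = (\<lambda>k. poly p (node_at k))"

lemma value_seq_inj: "value_seq p = value_seq q \<Longrightarrow> p = q"
proof (rule ccontr)
  assume e: "value_seq p = value_seq q" and "p \<noteq> q"
  then have "finite {z. poly (p - q) z = 0}" by (intro poly_roots_finite) simp
  moreover have "range node_at \<subseteq> {z. poly (p - q) z = 0}"
    using e by (auto simp: value_seq_def fun_eq_iff)
  moreover have "inj node_at" by (auto simp: inj_def node_at_def)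
  ultimately show False using finite_subset range_inj_infinite by blast
qed

text \<open>
The \<open>i\<close>-th smallest argument of the roots, as a function of the values of the polynomial; \<open>0\<close> is a
dummy value on sequences that do not come from a monic polynomial of degree \<open>n\<close>.
\<close>
definition seq_angle :: "nat \<Rightarrow> nat \<Rightarrow> (nat \<Rightarrow> complex) \<Rightarrow> real" where
  "seq_angle n i P = (if \<exists>p. monic_of_degree n p \<and> P = value_seq p
     then poly_angles (THE p. P = value_seq p) ! i else 0)"

lemma seq_angle_value_seq:
  assumes "monic_of_degree n p"
  shows "seq_angle n i (value_seq p) = poly_angles p ! i"
proof -
  have "(THE q. value_seq p = value_seq q) = p" by (rule the_equality) (auto dest: value_seq_inj)
  then show ?thesis using assms by (auto simp: seq_angle_def)
qed

definition root_poly :: "complex list \<Rightarrow> complex poly" where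
  "root_poly zs = (\<Prod>z\<leftarrow>zs. [:- z, 1:])"

lemma root_poly_Cons: "root_poly (z # zs) = [:- z, 1:] * root_poly zs"
  by (simp add: root_poly_def)

lemma root_poly_props: "root_poly zs \<noteq> 0" "degree (root_poly zs) = length zs" "lead_coeff (root_poly zs) = 1" "proots (root_poly zs) = mset zs"
proof -
  have "root_poly zs \<noteq> 0 \<and> degree (root_poly zs) = length zs \<and> lead_coeff (root_poly zs) = 1 \<and> proots (root_poly zs) = mset zs"
  proof (induction zs)
    case Nil
    then show ?case by (simp add: root_poly_def)
  next
    case (Cons z zs)
    have "lead_coeff ([:- z, 1:] * root_poly zs) = 1"
    proof -
      have "coeff (root_poly zs) (length zs) = 1" using Cons by metis
      then show ?thesis unfolding lead_coeff_mult using Cons by simp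
    qed
    then show ?case unfolding root_poly_Cons using Cons
      by (simp add: degree_mult_eq proots_mult del: mult_pCons_left)
  qed
  then show "root_poly zs \<noteq> 0" "degree (root_poly zs) = length zs" "lead_coeff (root_poly zs) = 1" "proots (root_poly zs) = mset zs" by auto
qed

lemma monic_root_poly: "monic_of_degree (length zs) (root_poly zs)"
  using root_poly_props by (simp add: monic_of_degree_def)

lemma monic_poly_roots:
  assumes p: "monic_of_degree n p" and zs: "mset zs = proots p"
  shows "p = root_poly zs" "length zs = n"
proof -
  show len: "length zs = n"
    using arg_cong[OF zs, of size] p by (simp add: size_proots_complex monic_of_degree_def)
  have "p = (\<Prod>z\<in>#mset zs. [:- z, 1:])"
  proof -
    have l: "lead_coeff p = 1" using p by (auto simp: monic_of_degree_def)
    show ?thesis using complex_poly_decompose_multiset[of p] unfolding l smult_1_left zs by (rule sym)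
  qed
  also have "\<dots> = root_poly zs" by (simp add: root_poly_def flip: prod_mset_prod_list)
  finally show "p = root_poly zs" .
qed

text \<open>
The value sequences of all products \<open>\<Prod> (z - z\<^sub>j)\<close> with \<open>z\<^sub>j\<close> in the \<open>j\<close>-th set.
\<close>
fun factor_values :: "complex set list \<Rightarrow> (nat \<Rightarrow> complex) set" where
  "factor_values [] = {\<lambda>_. 1}"
| "factor_values (S # Ss) = (\<lambda>(P, z) k. P k * (node_at k - z)) ` (factor_values Ss \<times> S)"

text \<open>
A continuous image of a product of compact sets. Compactness makes the set of value sequences
closed without any statement on the continuity of roots.
\<close>
lemma compact_factor_values:
  assumes "\<And>S. S \<in> set Ss \<Longrightarrow> compact S"
  shows "compact (factor_values Ss)"
  using assms
proof (induction Ss)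
  case (Cons S Ss)
  have "continuous_on (factor_values Ss \<times> S) (\<lambda>(P, z) k. P k * (node_at k - z))"
    unfolding split_beta
    by (intro continuous_on_coordinatewise_then_product continuous_intros
        continuous_on_compose2[OF continuous_on_product_coordinates continuous_on_fst]) auto
  then show ?case using Cons by (auto intro!: compact_continuous_image compact_Times)
qed simp

lemma mem_factor_values:
  "P \<in> factor_values Ss \<longleftrightarrow> (\<exists>zs. list_all2 (\<in>) zs Ss \<and> P = value_seq (root_poly zs))"
proof (induction Ss arbitrary: P)
  case Nil
  then show ?case by (auto simp: value_seq_def root_poly_def)
next
  case (Cons S Ss)
  show ?case
  proof
    assume "P \<in> factor_values (S # Ss)"
    then obtain Q z where Q: "Q \<in> factor_values Ss" "z \<in> S" "P = (\<lambda>k. Q k * (node_at k - z))" by auto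
    then obtain zs where "list_all2 (\<in>) zs Ss" "Q = value_seq (root_poly zs)" using Cons by blast
    then show "\<exists>zs. list_all2 (\<in>) zs (S # Ss) \<and> P = value_seq (root_poly zs)"
      using Q by (intro exI[of _ "z # zs"]) (auto simp: value_seq_def root_poly_Cons algebra_simps)
  next
    assume "\<exists>zs. list_all2 (\<in>) zs (S # Ss) \<and> P = value_seq (root_poly zs)"
    then obtain z zs where z: "z \<in> S" "list_all2 (\<in>) zs Ss" "P = value_seq (root_poly (z # zs))"
      by (auto simp: list_all2_Cons2)
    then have "value_seq (root_poly zs) \<in> factor_values Ss" using Cons by blast
    moreover have "P = (\<lambda>k. value_seq (root_poly zs) k * (node_at k - z))"
      using z by (auto simp: value_seq_def root_poly_Cons algebra_simps)
    ultimately show "P \<in> factor_values (S # Ss)" using z by auto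
  qed
qed

lemma factor_values_borel:
  assumes "\<And>S. S \<in> set Ss \<Longrightarrow> compact S"
  shows "factor_values Ss \<in> sets complex_seq"
proof -
  have "closed (factor_values Ss)" by (intro compact_imp_closed compact_factor_values assms)
  then have "factor_values Ss \<in> sets borel" by simp
  then show ?thesis by (simp only: sets_PiM_equal_borel)
qed

text \<open>
Compact exhaustion of the set of points with argument at most \<open>t\<close>. The origin belongs to it, in
agreement with the convention that its argument is \<open>0\<close>.
\<close>
definition sector :: "real \<Rightarrow> nat \<Rightarrow> complex set" where
  "sector t R = (\<lambda>(r, \<theta>). of_real r * cis \<theta>) ` ({0..real R} \<times> {0..t})"

lemma compact_sector: "compact (sector t R)"
  unfolding sector_def by (intro compact_continuous_image compact_Times compact_Icc)
    (auto simp: split_beta intro!: continuous_intros)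

lemma mem_sector:
  assumes "0 \<le> t" "t < 2 * pi"
  shows "z \<in> sector t R \<longleftrightarrow> cmod z \<le> real R \<and> Arg2pi z \<le> t"
proof
  assume "z \<in> sector t R"
  then obtain r \<theta> where r: "0 \<le> r" "r \<le> real R" "0 \<le> \<theta>" "\<theta> \<le> t" "z = of_real r * cis \<theta>" by (auto simp: sector_def)
  have "Arg2pi z \<le> t"
  proof (cases "r = 0")
    case True
    then show ?thesis using r assms by (simp add: Arg2pi_def)
  next
    case False
    then have "Arg2pi z = \<theta>" using r assms
      by (intro Arg2pi_unique[of r]) (auto simp: cis_conv_exp)
    then show ?thesis using r by simp
  qed
  then show "cmod z \<le> real R \<and> Arg2pi z \<le> t" using r by (simp add: norm_mult)
next
  assume z: "cmod z \<le> real R \<and> Arg2pi z \<le> t"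
  have "z = of_real (cmod z) * cis (Arg2pi z)" using Arg2pi_eq[of z] by (simp add: cis_conv_exp)
  then show "z \<in> sector t R" unfolding sector_def using z Arg2pi_ge_0[of z]
    by (intro image_eqI[of _ _ "(cmod z, Arg2pi z)"]) auto
qed

lemma nth_sorted_le_iff:
  fixes L :: "real list"
  assumes "sorted L" "i < length L"
  shows "L ! i \<le> t \<longleftrightarrow> i < length (filter (\<lambda>x. x \<le> t) L)"
  using assms
proof (induction L arbitrary: i)
  case (Cons x L)
  show ?case
  proof (cases "x \<le> t")
    case True
    then show ?thesis using Cons by (cases i) auto
  next
    case False
    then have "filter (\<lambda>x. x \<le> t) (x # L) = []" using Cons.prems by (auto simp: filter_empty_conv)
    moreover have "\<not> (x # L) ! i \<le> t" using False Cons.prems nth_mem[of i "x # L"] by fastforce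
    ultimately show ?thesis by simp
  qed
qed simp

text \<open>
The \<open>i\<close>-th smallest argument is at most \<open>t\<close> exactly if \<open>i + 1\<close> of the roots can be taken in the sector.
So the sublevel sets are countable unions of compact sets.
\<close>
lemma seq_angle_le_iff:
  assumes i: "i < n" and t: "0 \<le> t" "t < 2 * pi"
  shows "(\<exists>p. monic_of_degree n p \<and> P = value_seq p \<and> poly_angles p ! i \<le> t) \<longleftrightarrow>
    (\<exists>R. P \<in> factor_values (replicate (Suc i) (sector t R) @ replicate (n - Suc i) (cball 0 (real R))))"
proof
  assume "\<exists>p. monic_of_degree n p \<and> P = value_seq p \<and> poly_angles p ! i \<le> t"
  then obtain p where p: "monic_of_degree n p" "P = value_seq p" "poly_angles p ! i \<le> t" by blast
  obtain ws where ws: "mset ws = proots p" using ex_mset by blast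
  define zs where "zs = sort_key Arg2pi ws"
  have zs: "mset zs = proots p" "sorted (map Arg2pi zs)" by (simp_all add: zs_def ws)
  have pz: "p = root_poly zs" "length zs = n" using monic_poly_roots[OF p(1) zs(1)] .
  have ang: "poly_angles p = map Arg2pi zs"
  proof -
    have "image_mset Arg2pi (proots p) = mset (map Arg2pi zs)" by (simp add: zs(1)[symmetric])
    then show ?thesis
      unfolding poly_angles_def using zs(2) by (simp only: sorted_list_of_multiset_mset sorted_sort_id)
  qed
  obtain R :: nat where R: "\<And>z. z \<in> set zs \<Longrightarrow> cmod z \<le> real R"
  proof -
    obtain R :: nat where "Max (insert 0 (cmod ` set zs)) \<le> real R" using real_arch_simple by blast
    then show ?thesis using that by auto
  qed
  have "list_all2 (\<in>) zs (replicate (Suc i) (sector t R) @ replicate (n - Suc i) (cball 0 (real R)))"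
  proof (rule list_all2_all_nthI)
    show "length zs = length (replicate (Suc i) (sector t R) @ replicate (n - Suc i) (cball 0 (real R)))" using pz i by simp
    fix k assume k: "k < length zs"
    show "zs ! k \<in> (replicate (Suc i) (sector t R) @ replicate (n - Suc i) (cball 0 (real R))) ! k"
    proof (cases "k \<le> i")
      case True
      then have "Arg2pi (zs ! k) \<le> Arg2pi (zs ! i)"
        using sorted_nth_mono[OF zs(2), of k i] pz i k by simp
      also have "\<dots> \<le> t" using p(3)[unfolded ang] i pz by simp
      finally have "zs ! k \<in> sector t R" using R[of "zs ! k"] k by (simp add: mem_sector[OF t])
      then show ?thesis using True by (simp add: nth_append del: replicate_Suc)
    next
      case False
      then show ?thesis using R[of "zs ! k"] k pz by (simp add: nth_append del: replicate_Suc)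
    qed
  qed
  then show "\<exists>R. P \<in> factor_values (replicate (Suc i) (sector t R) @ replicate (n - Suc i) (cball 0 (real R)))"
    unfolding mem_factor_values using p(2) pz(1) by blast
next
  assume "\<exists>R. P \<in> factor_values (replicate (Suc i) (sector t R) @ replicate (n - Suc i) (cball 0 (real R)))"
  then obtain R zs where zs: "list_all2 (\<in>) zs (replicate (Suc i) (sector t R) @ replicate (n - Suc i) (cball 0 (real R)))"
    "P = value_seq (root_poly zs)" unfolding mem_factor_values by blast
  then have len: "length zs = n" using i by (auto dest: list_all2_lengthD)
  have "Arg2pi (zs ! k) \<le> t" if "k \<le> i" for k
    using list_all2_nthD[OF zs(1), of k] that i len by (simp add: nth_append mem_sector[OF t] del: replicate_Suc)
  then have "{..i} \<subseteq> {k. k < length (map Arg2pi zs) \<and> map Arg2pi zs ! k \<le> t}" using i len by auto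
  then have "card {..i} \<le> card {k. k < length (map Arg2pi zs) \<and> map Arg2pi zs ! k \<le> t}" by (intro card_mono) auto
  then have "i < length (filter (\<lambda>x. x \<le> t) (map Arg2pi zs))" unfolding length_filter_conv_card by simp
  moreover have "mset (poly_angles (root_poly zs)) = mset (map Arg2pi zs)"
    unfolding poly_angles_def root_poly_props(4) by simp
  then have "length (filter (\<lambda>x. x \<le> t) (poly_angles (root_poly zs))) = length (filter (\<lambda>x. x \<le> t) (map Arg2pi zs))"
     "length (poly_angles (root_poly zs)) = n"
    using len by (metis mset_filter size_mset, metis length_map size_mset)
  moreover have "sorted (poly_angles (root_poly zs))" by (simp add: poly_angles_def)
  ultimately have "poly_angles (root_poly zs) ! i \<le> t" using nth_sorted_le_iff i by auto
  then show "\<exists>p. monic_of_degree n p \<and> P = value_seq p \<and> poly_angles p ! i \<le> t"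
    using zs(2) monic_root_poly[of zs] len by blast
qed

lemma value_seq_monic_iff:
  "(\<exists>p. monic_of_degree n p \<and> P = value_seq p) \<longleftrightarrow> (\<exists>R. P \<in> factor_values (replicate n (cball 0 (real R))))"
proof
  assume "\<exists>p. monic_of_degree n p \<and> P = value_seq p"
  then obtain p where p: "monic_of_degree n p" "P = value_seq p" by blast
  obtain zs where zs: "mset zs = proots p" using ex_mset by blast
  have pz: "p = root_poly zs" "length zs = n" using monic_poly_roots[OF p(1) zs] .
  obtain R :: nat where "Max (insert 0 (cmod ` set zs)) \<le> real R" using real_arch_simple by blast
  then have "list_all2 (\<in>) zs (replicate n (cball 0 (real R)))"
    using pz(2) by (auto simp: list_all2_conv_all_nth)
  then show "\<exists>R. P \<in> factor_values (replicate n (cball 0 (real R)))"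
    unfolding mem_factor_values using p(2) pz(1) by blast
next
  assume "\<exists>R. P \<in> factor_values (replicate n (cball 0 (real R)))"
  then obtain R zs where zs: "list_all2 (\<in>) zs (replicate n (cball 0 (real R)))" "P = value_seq (root_poly zs)"
    unfolding mem_factor_values by blast
  then have "length zs = n" by (auto dest: list_all2_lengthD)
  then show "\<exists>p. monic_of_degree n p \<and> P = value_seq p" using zs(2) monic_root_poly[of zs] by blast
qed

lemma poly_angles_bounds:
  assumes "monic_of_degree n p" "i < n"
  shows "0 \<le> poly_angles p ! i" "poly_angles p ! i < 2 * pi"
proof -
  have "length (poly_angles p) = n"
    using assms(1) by (simp add: poly_angles_def size_proots_complex monic_of_degree_def flip: size_mset)
  then have "poly_angles p ! i \<in> set (poly_angles p)" using assms(2) by simp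
  then show "0 \<le> poly_angles p ! i" "poly_angles p ! i < 2 * pi"
    by (auto simp: poly_angles_def Arg2pi_ge_0 Arg2pi_lt_2pi)
qed

lemma seq_angle_measurable:
  assumes i: "i < n"
  shows "seq_angle n i \<in> borel_measurable complex_seq"
  unfolding borel_measurable_iff_le
proof
  fix t :: real
  let ?D = "{P. \<exists>p. monic_of_degree n p \<and> P = value_seq p}"
  have sp: "space complex_seq = UNIV" by (simp add: space_PiM)
  have D: "?D \<in> sets complex_seq"
  proof -
    have "?D = (\<Union>R. factor_values (replicate n (cball 0 (real R))))" using value_seq_monic_iff by auto
    moreover have "factor_values (replicate n (cball 0 (real R))) \<in> sets complex_seq" for R
      by (rule factor_values_borel) simp
    ultimately show ?thesis by auto
  qed
  have iff: "seq_angle n i P \<le> t \<longleftrightarrow> (\<exists>p. monic_of_degree n p \<and> P = value_seq p \<and> poly_angles p ! i \<le> t) \<or> (P \<notin> ?D \<and> 0 \<le> t)" for P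
  proof (cases "P \<in> ?D")
    case True
    then obtain p where p: "monic_of_degree n p" "P = value_seq p" by blast
    then show ?thesis using seq_angle_value_seq[OF p(1)] value_seq_inj by auto
  next
    case False
    then show ?thesis by (auto simp: seq_angle_def)
  qed
  consider "t < 0" | "0 \<le> t" "t < 2 * pi" | "2 * pi \<le> t" by linarith
  then show "{P \<in> space complex_seq. seq_angle n i P \<le> t} \<in> sets complex_seq"
  proof cases
    case 1
    then have "{P \<in> space complex_seq. seq_angle n i P \<le> t} = {}"
      using poly_angles_bounds(1)[OF _ i] unfolding iff by force
    then show ?thesis by (simp only: sets.empty_sets)
  next
    case 2
    let ?F = "\<lambda>R. factor_values (replicate (Suc i) (sector t R) @ replicate (n - Suc i) (cball 0 (real R)))"
    have "{P \<in> space complex_seq. seq_angle n i P \<le> t} = (\<Union>R. ?F R) \<union> (space complex_seq - ?D)"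
      unfolding iff seq_angle_le_iff[OF i 2] sp using 2 by blast
    moreover have "?F R \<in> sets complex_seq" for R
      by (rule factor_values_borel) (auto simp: compact_sector)
    ultimately show ?thesis using D by auto
  next
    case 3
    have "seq_angle n i P \<le> t" for P
    proof (cases "P \<in> ?D")
      case True
      then obtain p where "monic_of_degree n p" "P = value_seq p" by blast
      then show ?thesis using 3 seq_angle_value_seq[of n p i] poly_angles_bounds(2)[OF _ i, of p] by simp
    next
      case False
      moreover have "0 \<le> t" using 3 pi_gt_zero by linarith
      ultimately show ?thesis unfolding iff by blast
    qed
    then have "{P \<in> space complex_seq. seq_angle n i P \<le> t} = space complex_seq" by simp
    then show ?thesis by (simp only: sets.top)
  qed
qed

section \<open>The law of the characteristic polynomial\<close>

text \<open>
Both measures agree on boxes. It serves to reverse the numbering of the coefficients and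
to permute the angles.
\<close>
lemma distr_PiM_reindex_finite:
  assumes L: "\<And>i. sigma_finite_measure (L i)" and I: "finite I" and f: "bij_betw f I K"
  shows "distr (Pi\<^sub>M K L) (\<Pi>\<^sub>M i\<in>I. L (f i)) (\<lambda>\<omega>. \<lambda>i\<in>I. \<omega> (f i)) = (\<Pi>\<^sub>M i\<in>I. L (f i))"
proof -
  interpret R: product_sigma_finite "\<lambda>i. L (f i)" by (simp add: product_sigma_finite_def L)
  interpret L: product_sigma_finite L by (simp add: product_sigma_finite_def L)
  have K: "finite K" "f ` I = K" "inj_on f I" using f I by (auto simp: bij_betw_def)
  have fK: "f i \<in> K" if "i \<in> I" for i using that K by auto
  have meas: "(\<lambda>\<omega>. \<lambda>i\<in>I. \<omega> (f i)) \<in> measurable (Pi\<^sub>M K L) (\<Pi>\<^sub>M i\<in>I. L (f i))"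
    by (rule measurable_restrict) (intro measurable_component_singleton fK)
  show ?thesis
  proof (rule R.PiM_eqI[OF I])
    fix A assume A: "\<And>i. i \<in> I \<Longrightarrow> A i \<in> sets (L (f i))"
    define B where "B k = A (the_inv_into I f k)" for k
    have B: "B (f i) = A i" if "i \<in> I" for i using that K by (simp add: B_def the_inv_into_f_f)
    have BL: "B k \<in> sets (L k)" if "k \<in> K" for k using that A B K(2) by force
    have "(\<lambda>\<omega>. \<lambda>i\<in>I. \<omega> (f i)) -` Pi\<^sub>E I A \<inter> space (Pi\<^sub>M K L) = Pi\<^sub>E K B"
    proof (intro equalityI subsetI)
      fix \<omega> assume w: "\<omega> \<in> (\<lambda>\<omega>. \<lambda>i\<in>I. \<omega> (f i)) -` Pi\<^sub>E I A \<inter> space (Pi\<^sub>M K L)"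
      then have "\<omega> (f i) \<in> B (f i)" if "i \<in> I" for i using that B by (auto simp: PiE_iff)
      then show "\<omega> \<in> Pi\<^sub>E K B" using w K(2) by (auto simp: space_PiM PiE_iff)
    next
      fix \<omega> assume w: "\<omega> \<in> Pi\<^sub>E K B"
      then have "\<omega> (f i) \<in> A i" if "i \<in> I" for i using that B fK by (auto simp: PiE_iff)
      then show "\<omega> \<in> (\<lambda>\<omega>. \<lambda>i\<in>I. \<omega> (f i)) -` Pi\<^sub>E I A \<inter> space (Pi\<^sub>M K L)"
        using w BL sets.sets_into_space by (fastforce simp: space_PiM PiE_iff)
    qed
    then have "emeasure (distr (Pi\<^sub>M K L) (\<Pi>\<^sub>M i\<in>I. L (f i)) (\<lambda>\<omega>. \<lambda>i\<in>I. \<omega> (f i))) (Pi\<^sub>E I A) = emeasure (Pi\<^sub>M K L) (Pi\<^sub>E K B)"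
      using A I by (subst emeasure_distr[OF meas]) (auto intro!: sets_PiM_I_finite)
    also have "\<dots> = (\<Prod>k\<in>K. emeasure (L k) (B k))" by (rule L.emeasure_PiM[OF K(1) BL])
    also have "\<dots> = (\<Prod>i\<in>I. emeasure (L (f i)) (A i))"
      unfolding K(2)[symmetric] using K(3) B by (subst prod.reindex) auto
    finally show "emeasure (distr (Pi\<^sub>M K L) (\<Pi>\<^sub>M i\<in>I. L (f i)) (\<lambda>\<omega>. \<lambda>i\<in>I. \<omega> (f i))) (Pi\<^sub>E I A) = (\<Prod>i\<in>I. emeasure (L (f i)) (A i))" .
  qed simp
qed

lemma nn_integral_PiM_reindex:
  assumes L: "\<And>i. sigma_finite_measure (L i)" and I: "finite I" and f: "bij_betw f I K"
    and F: "F \<in> borel_measurable (\<Pi>\<^sub>M i\<in>I. L (f i))"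
  shows "(\<integral>\<^sup>+x. F x \<partial>(\<Pi>\<^sub>M i\<in>I. L (f i))) = (\<integral>\<^sup>+\<omega>. F (\<lambda>i\<in>I. \<omega> (f i)) \<partial>Pi\<^sub>M K L)"
proof -
  have fK: "f i \<in> K" if "i \<in> I" for i using f that by (auto simp: bij_betw_def)
  have meas: "(\<lambda>\<omega>. \<lambda>i\<in>I. \<omega> (f i)) \<in> measurable (Pi\<^sub>M K L) (\<Pi>\<^sub>M i\<in>I. L (f i))"
    by (rule measurable_restrict) (intro measurable_component_singleton fK)
  show ?thesis
    by (subst distr_PiM_reindex_finite[OF L I f, symmetric]) (rule nn_integral_distr[OF meas], simp add: F)
qed

text \<open>
Forget the weights: take a test function that depends on \<open>p\<close> and is cut off to scales in \<open>[1, 2]\<close>.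
The integral over the scale is then a factor \<open>k\<close> that is neither \<open>0\<close> nor \<open>\<infinity>\<close>, by which one can divide.
\<close>
lemma eta_law_line_integral:
  assumes n: "n = Suc m"
  obtains C where "\<And>g. g \<in> borel_measurable complex_seq \<Longrightarrow>
    (\<integral>\<^sup>+\<gamma>. g (fst_seq m (\<lambda>k. \<gamma> (m - k))) \<partial>eta_law n \<delta> \<beta>) =
    C * (\<integral>\<^sup>+x. (if increasing n x then ennreal (point_weight \<delta> \<beta> n x) * g (node_seq n x) else 0) \<partial>lebesgue_pow n)"
proof -
  obtain C where C: "\<And>H. (\<lambda>(P, Q, c). H P Q c) \<in> borel_measurable (complex_seq \<Otimes>\<^sub>M complex_seq \<Otimes>\<^sub>M lborel) \<Longrightarrow>
    (\<integral>\<^sup>+\<gamma>. scale_integral \<beta> (Suc m) H (fst_seq m \<gamma>) (snd_seq m \<gamma>) \<partial>(\<Pi>\<^sub>M k\<in>{..<Suc m}. level_law \<delta> \<beta> k)) =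
    C * line_integral \<delta> \<beta> (Suc m) H"
    using level_law_line_integral[where \<beta> = \<beta> and m = m and \<delta> = \<delta>] by blast
  define k where "k = (\<integral>\<^sup>+c. (if 0 < c then indicator {1..2} c * ennreal (c powr (\<beta> / 2 * real n - 1)) else 0) \<partial>lborel)"
  define D where "D = (\<integral>\<^sup>+y. (if all_pos n y then indicator {1..2} (\<Sum>j<n. y j) * ennreal (\<bar>\<Prod>j<n. y j\<bar> powr (\<beta> / 2 - 1)) else 0) \<partial>lebesgue_pow n)"
  have k0: "k \<noteq> 0"
  proof
    assume "k = 0"
    then have "AE c in lborel. (if 0 < c then indicator {1..2} c * ennreal (c powr (\<beta> / 2 * real n - 1)) else 0 :: ennreal) = 0"
      unfolding k_def by (subst (asm) nn_integral_0_iff_AE) auto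
    then have "AE c in lborel. c \<notin> {1..2::real}"
      by eventually_elim (auto simp: indicator_def split: if_splits)
    then have "emeasure lborel {x. 1 \<le> x \<and> x \<le> (2::real)} = 0" by (subst (asm) AE_iff_measurable[OF _ refl]) auto
    moreover have "{x. 1 \<le> x \<and> x \<le> 2} = {1..2::real}" by auto
    ultimately show False by simp
  qed
  have ktop: "k \<noteq> \<infinity>"
  proof -
    define e where "e = \<beta> / 2 * real n - 1"
    have bound: "c powr e \<le> max 1 (2 powr e)" if "c \<in> {1..2}" for c
    proof (cases "0 \<le> e")
      case True
      then show ?thesis using that powr_mono2[of e c 2] by auto
    next
      case False
      then show ?thesis using that powr_mono2'[of e 1 c] by auto
    qed
    have "k \<le> (\<integral>\<^sup>+c. ennreal (max 1 (2 powr e)) * indicator {1..2::real} c \<partial>lborel)"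
      unfolding k_def e_def[symmetric]
    proof (rule nn_integral_mono)
      fix c :: real
      show "(if 0 < c then indicator {1..2} c * ennreal (c powr e) else 0) \<le> ennreal (max 1 (2 powr e)) * indicator {1..2} c"
        using bound[of c] by (auto simp: indicator_def intro!: ennreal_leI)
    qed
    also have "\<dots> = ennreal (max 1 (2 powr e)) * emeasure lborel {1..2::real}"
      by (rule nn_integral_cmult_indicator) simp
    also have "\<dots> = ennreal (max 1 (2 powr e))" by simp
    also have "\<dots> < \<infinity>" by simp
    finally show ?thesis by simp
  qed
  have main: "(\<integral>\<^sup>+\<gamma>. g (fst_seq m (\<lambda>k. \<gamma> (m - k))) \<partial>eta_law n \<delta> \<beta>) * k =
    (C * D) * (\<integral>\<^sup>+x. (if increasing n x then ennreal (point_weight \<delta> \<beta> n x) * g (node_seq n x) else 0) \<partial>lebesgue_pow n)"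
    if g [measurable]: "g \<in> borel_measurable complex_seq" for g
  proof -
    \<comment> \<open>The third argument is the scale, because the weights before scaling have sum \<open>1\<close>.\<close>
    define H where "H P Q c = g P * indicator {1..2} c" for P and Q :: "nat \<Rightarrow> complex" and c :: real
    have H: "(\<lambda>(P, Q, c). H P Q c) \<in> borel_measurable (complex_seq \<Otimes>\<^sub>M complex_seq \<Otimes>\<^sub>M lborel)"
      unfolding H_def split_beta by measurable
    have sc: "scale_integral \<beta> n H P Q = g P * k" for P Q
    proof -
      have "scale_integral \<beta> n H P Q = (\<integral>\<^sup>+c. g P * (if 0 < c then indicator {1..2} c * ennreal (c powr (\<beta> / 2 * real n - 1)) else 0) \<partial>lborel)"
        unfolding scale_integral_def H_def by (intro nn_integral_cong) (simp add: mult.assoc)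
      also have "\<dots> = g P * k" unfolding k_def by (rule nn_integral_cmult) measurable
      finally show ?thesis .
    qed
    have up: "upper_integral \<delta> \<beta> n H x = g (node_seq n x) * D" for x
    proof -
      have "upper_integral \<delta> \<beta> n H x = (\<integral>\<^sup>+y. g (node_seq n x) * (if all_pos n y then indicator {1..2} (\<Sum>j<n. y j) * ennreal (\<bar>\<Prod>j<n. y j\<bar> powr (\<beta> / 2 - 1)) else 0) \<partial>lebesgue_pow n)"
        unfolding upper_integral_def H_def
      proof (rule nn_integral_cong)
        fix y :: "nat \<Rightarrow> real"
        show "(if all_pos n y then g (node_seq n x) * indicator {1..2} (sum y {..<n}) * ennreal (\<bar>prod y {..<n}\<bar> powr (\<beta> / 2 - 1)) else 0) =
           g (node_seq n x) * (if all_pos n y then indicator {1..2} (sum y {..<n}) * ennreal (\<bar>prod y {..<n}\<bar> powr (\<beta> / 2 - 1)) else 0)"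
          by (simp only: if_distrib[of "(*) (g (node_seq n x))"] mult_zero_right mult.assoc)
      qed
      also have "\<dots> = g (node_seq n x) * D" unfolding D_def by (rule nn_integral_cmult) measurable
      finally show ?thesis .
    qed
    have fm: "(\<lambda>\<gamma>. fst_seq m (\<lambda>k. \<gamma> (m - k))) \<in> measurable (eta_law n \<delta> \<beta>) complex_seq"
      unfolding eta_law_level_law by (rule fst_seq_measurable) (rule level_law_coordinate_measurable, simp add: n)
    have "(\<integral>\<^sup>+\<gamma>. g (fst_seq m (\<lambda>k. \<gamma> (m - k))) \<partial>eta_law n \<delta> \<beta>) * k = (\<integral>\<^sup>+\<gamma>. g (fst_seq m (\<lambda>k. \<gamma> (m - k))) * k \<partial>eta_law n \<delta> \<beta>)"
      by (rule nn_integral_multc[symmetric]) (rule measurable_compose[OF fm g])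
    also have "\<dots> = (\<integral>\<^sup>+\<gamma>. g (fst_seq m (\<lambda>k. \<gamma> (m - k))) * k \<partial>(\<Pi>\<^sub>M k\<in>{..<n}. level_law \<delta> \<beta> (m - k)))"
      unfolding eta_law_level_law n by simp
    also have "\<dots> = (\<integral>\<^sup>+\<omega>. g (fst_seq m (\<lambda>k. (\<lambda>i\<in>{..<n}. \<omega> (m - i)) (m - k))) * k \<partial>(\<Pi>\<^sub>M k\<in>{..<n}. level_law \<delta> \<beta> k))"
    proof (rule nn_integral_PiM_reindex[OF sigma_finite_level_law])
      show "bij_betw (\<lambda>k. m - k) {..<n} {..<n}"
        by (rule bij_betw_byWitness[where f' = "\<lambda>k. m - k"]) (auto simp: n)
      have "(\<lambda>\<gamma>. fst_seq m (\<lambda>k. \<gamma> (m - k))) \<in> measurable (\<Pi>\<^sub>M k\<in>{..<n}. level_law \<delta> \<beta> (m - k)) complex_seq"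
        by (rule fst_seq_measurable) (rule level_law_coordinate_measurable, simp add: n)
      from measurable_compose[OF this g]
      show "(\<lambda>\<gamma>. g (fst_seq m (\<lambda>k. \<gamma> (m - k))) * k) \<in> borel_measurable (\<Pi>\<^sub>M k\<in>{..<n}. level_law \<delta> \<beta> (m - k))"
        by (intro borel_measurable_times_ennreal) auto
    qed simp
    also have "\<dots> = (\<integral>\<^sup>+\<omega>. scale_integral \<beta> (Suc m) H (fst_seq m \<omega>) (snd_seq m \<omega>) \<partial>(\<Pi>\<^sub>M k\<in>{..<Suc m}. level_law \<delta> \<beta> k))"
    proof -
      have "fst_seq m (\<lambda>k. (\<lambda>i\<in>{..<n}. \<omega> (m - i)) (m - k)) = fst_seq m \<omega>" for \<omega>
        unfolding fst_seq_def by (intro ext arg_cong[where f = fst] char_pair_cong) (auto simp: n)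
      then show ?thesis unfolding n[symmetric] sc by simp
    qed
    also have "\<dots> = C * line_integral \<delta> \<beta> (Suc m) H" by (rule C[OF H])
    also have "line_integral \<delta> \<beta> (Suc m) H = (\<integral>\<^sup>+x. (if increasing n x then ennreal (point_weight \<delta> \<beta> n x) * g (node_seq n x) else 0) * D \<partial>lebesgue_pow n)"
      unfolding line_integral_def n[symmetric] up by (intro nn_integral_cong) (simp add: mult.assoc)
    also have "\<dots> = (\<integral>\<^sup>+x. (if increasing n x then ennreal (point_weight \<delta> \<beta> n x) * g (node_seq n x) else 0) \<partial>lebesgue_pow n) * D"
    proof (rule nn_integral_multc)
      have 1: "(\<lambda>x. x j) \<in> borel_measurable (lebesgue_pow n)" if "j < n" for j using that by simp
      have [measurable]: "Measurable.pred (lebesgue_pow n) (increasing n)" "vandermonde n \<in> borel_measurable (lebesgue_pow n)"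
        using increasing_measurable[OF 1, of n "\<lambda>x. x"] vandermonde_measurable[OF 1, of n "\<lambda>x. x"] by simp_all
      have [measurable]: "point_weight \<delta> \<beta> n \<in> borel_measurable (lebesgue_pow n)" unfolding point_weight_def by measurable
      have "node_seq n \<in> measurable (lebesgue_pow n) complex_seq" using node_seq_measurable[of "\<lambda>x. x" "lebesgue_pow n" n] by simp
      from measurable_compose[OF this g] have [measurable]: "(\<lambda>x. g (node_seq n x)) \<in> borel_measurable (lebesgue_pow n)" .
      show "(\<lambda>x. if increasing n x then ennreal (point_weight \<delta> \<beta> n x) * g (node_seq n x) else 0) \<in> borel_measurable (lebesgue_pow n)" by measurable
    qed
    finally show ?thesis by (simp only: mult_ac)
  qed
  show thesis
  proof (rule that)
    fix g :: "(nat \<Rightarrow> complex) \<Rightarrow> ennreal" assume g: "g \<in> borel_measurable complex_seq"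
    let ?A = "\<integral>\<^sup>+\<gamma>. g (fst_seq m (\<lambda>k. \<gamma> (m - k))) \<partial>eta_law n \<delta> \<beta>"
    have "?A = ?A * (k / k)" using k0 ktop by (simp add: ennreal_divide_self less_top)
    also have "\<dots> = (?A * k) / k" by (rule ennreal_times_divide)
    also have "\<dots> = C * D / k * (\<integral>\<^sup>+x. (if increasing n x then ennreal (point_weight \<delta> \<beta> n x) * g (node_seq n x) else 0) \<partial>lebesgue_pow n)"
      unfolding main[OF g] divide_ennreal_def by (simp only: mult_ac)
    finally show "?A = C * D / k * (\<integral>\<^sup>+x. (if increasing n x then ennreal (point_weight \<delta> \<beta> n x) * g (node_seq n x) else 0) \<partial>lebesgue_pow n)" .
  qed
qed

section \<open>Back to the circle\<close>

lemma eigen_angle_strict_mono: "strict_mono eigen_angle"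
  by (auto simp: eigen_angle_def arctan_less_iff intro!: strict_monoI)

lemma Arg2pi_cayley: "Arg2pi (cayley x) = eigen_angle x"
  using eigen_angle_bounds[of x]
  by (intro Arg2pi_unique[of 1]) (simp_all add: cis_eigen_angle[symmetric] cis_conv_exp)

lemma seq_angle_node_seq:
  assumes x: "increasing n x" and i: "i < n"
  shows "seq_angle n i (node_seq n x) = eigen_angle (x i)"
proof -
  let ?zs = "map (\<lambda>j. cayley (x j)) [0..<n]" and ?as = "map (\<lambda>j. eigen_angle (x j)) [0..<n]"
  have "poly (root_poly zs) z = (\<Prod>w\<leftarrow>zs. z - w)" for zs z
    by (induction zs) (simp_all add: root_poly_Cons root_poly_def algebra_simps)
  then have "node_seq n x = value_seq (root_poly ?zs)"
    by (simp add: node_seq_def node_poly_def value_seq_def comp_def atLeast0LessThan flip: prod.distinct_set_conv_list)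
  moreover have "monic_of_degree n (root_poly ?zs)" using monic_root_poly[of ?zs] by simp
  ultimately have "seq_angle n i (node_seq n x) = poly_angles (root_poly ?zs) ! i" by (simp add: seq_angle_value_seq)
  also have "poly_angles (root_poly ?zs) = ?as"
  proof -
    have "image_mset Arg2pi (proots (root_poly ?zs)) = mset ?as"
      unfolding root_poly_props(4) mset_map[symmetric] map_map by (simp add: comp_def Arg2pi_cayley)
    moreover have "sorted ?as"
      using x by (auto simp: sorted_iff_nth_mono_less increasing_def strict_mono_on_def strict_mono_less[OF eigen_angle_strict_mono] intro: less_imp_le)
    ultimately show ?thesis
      unfolding poly_angles_def by (simp only: sorted_list_of_multiset_mset sorted_sort_id)
  qed
  finally show ?thesis using i by simp
qed

text \<open>
\<open>nn_integral_subst_eigen_angle\<close> in each coordinate.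
\<close>
lemma nn_integral_eigen_angle_pow:
  assumes [measurable]: "F \<in> borel_measurable (lebesgue_pow n)"
  shows "(\<integral>\<^sup>+\<theta>. (if \<forall>j\<in>{..<n}. 0 < \<theta> j \<and> \<theta> j < 2 * pi then F \<theta> else 0) \<partial>lebesgue_pow n) =
    (\<integral>\<^sup>+x. F (\<lambda>j\<in>{..<n}. eigen_angle (x j)) * ennreal (\<Prod>j<n. 2 / (1 + (x j)\<^sup>2)) \<partial>lebesgue_pow n)"
  using assms
proof (induction n arbitrary: F)
  case 0
  show ?case by (simp add: PiM_empty nn_integral_count_space_finite)
next
  case (Suc n)
  note [measurable] = Suc.prems(1)
  have ea [measurable]: "eigen_angle \<in> borel_measurable borel" unfolding eigen_angle_def by measurable
  have rest [measurable]: "(\<lambda>x. \<lambda>j\<in>{..<m}. eigen_angle (x j)) \<in> measurable (lebesgue_pow m) (lebesgue_pow m)" for m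
    by (rule measurable_restrict) measurable
  let ?in = "\<lambda>n \<theta>. \<forall>j\<in>{..<n}. 0 < \<theta> j \<and> \<theta> j < 2 * pi" and ?q = "\<lambda>x::real. 2 / (1 + x\<^sup>2)"
  let ?G = "\<lambda>w. \<integral>\<^sup>+x. F (w(n := eigen_angle x)) * ennreal (?q x) \<partial>lborel"
  have q: "0 \<le> ?q x" for x by (simp add: add_nonneg_nonneg)
  have "(\<integral>\<^sup>+\<theta>. (if ?in (Suc n) \<theta> then F \<theta> else 0) \<partial>lebesgue_pow (Suc n)) =
      (\<integral>\<^sup>+w. \<integral>\<^sup>+t. (if ?in (Suc n) (w(n := t)) then F (w(n := t)) else 0) \<partial>lborel \<partial>lebesgue_pow n)"
    by (rule nn_integral_lebesgue_pow_Suc) measurable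
  also have "\<dots> = (\<integral>\<^sup>+w. (if ?in n w then ?G w else 0) \<partial>lebesgue_pow n)"
  proof (rule nn_integral_cong)
    fix w assume [measurable]: "w \<in> space (lebesgue_pow n)"
    have "?in (Suc n) (w(n := t)) \<longleftrightarrow> ?in n w \<and> t \<in> {0<..<2 * pi}" for t
      by (auto simp: less_Suc_eq)
    then have "(\<integral>\<^sup>+t. (if ?in (Suc n) (w(n := t)) then F (w(n := t)) else 0) \<partial>lborel) =
      (\<integral>\<^sup>+t. (if ?in n w then F (w(n := t)) * indicator {0<..<2 * pi} t else 0) \<partial>lborel)"
      by (intro nn_integral_cong) (auto simp: indicator_def)
    also have "\<dots> = (if ?in n w then ?G w else 0)"
    proof (cases "?in n w")
      case True
      have "(\<lambda>t. F (w(n := t))) \<in> borel_measurable borel" by measurable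
      from nn_integral_subst_eigen_angle[OF this] show ?thesis unfolding if_P[OF True] .
    next
      case False
      show ?thesis unfolding if_not_P[OF False] by simp
    qed
    finally show "(\<integral>\<^sup>+t. (if ?in (Suc n) (w(n := t)) then F (w(n := t)) else 0) \<partial>lborel) = (if ?in n w then ?G w else 0)" .
  qed
  also have "\<dots> = (\<integral>\<^sup>+x. ?G (\<lambda>j\<in>{..<n}. eigen_angle (x j)) * ennreal (\<Prod>j<n. ?q (x j)) \<partial>lebesgue_pow n)"
    by (rule Suc.IH) measurable
  also have "\<dots> = (\<integral>\<^sup>+x. \<integral>\<^sup>+t. F (\<lambda>j\<in>{..<Suc n}. eigen_angle ((x(n := t)) j)) * ennreal (\<Prod>j<Suc n. ?q ((x(n := t)) j)) \<partial>lborel \<partial>lebesgue_pow n)"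
  proof (rule nn_integral_cong)
    fix x assume [measurable]: "x \<in> space (lebesgue_pow n)"
    have [measurable]: "(\<lambda>j\<in>{..<n}. eigen_angle (x j)) \<in> space (lebesgue_pow n)" by (simp add: space_PiM)
    have e: "(\<lambda>j\<in>{..<Suc n}. eigen_angle ((x(n := t)) j)) = (\<lambda>j\<in>{..<n}. eigen_angle (x j))(n := eigen_angle t)" for t
      by (auto simp: fun_eq_iff)
    have p: "ennreal (\<Prod>j<Suc n. ?q ((x(n := t)) j)) = ennreal (?q t) * ennreal (\<Prod>j<n. ?q (x j))" for t
      by (subst ennreal_mult[symmetric]) (auto intro!: prod_nonneg q simp: mult.commute)
    show "?G (\<lambda>j\<in>{..<n}. eigen_angle (x j)) * ennreal (\<Prod>j<n. ?q (x j)) =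
      (\<integral>\<^sup>+t. F (\<lambda>j\<in>{..<Suc n}. eigen_angle ((x(n := t)) j)) * ennreal (\<Prod>j<Suc n. ?q ((x(n := t)) j)) \<partial>lborel)"
      unfolding e p mult.assoc[symmetric] by (rule nn_integral_multc[symmetric]) measurable
  qed
  also have "\<dots> = (\<integral>\<^sup>+x. F (\<lambda>j\<in>{..<Suc n}. eigen_angle (x j)) * ennreal (\<Prod>j<Suc n. ?q (x j)) \<partial>lebesgue_pow (Suc n))"
    by (rule nn_integral_lebesgue_pow_Suc[symmetric]) measurable
  finally show ?case .
qed

lemma cmod_cayley_diff:
  "cmod (cayley a - cayley b) = 2 * \<bar>a - b\<bar> / (sqrt (1 + a\<^sup>2) * sqrt (1 + b\<^sup>2))"
proof -
  have n: "of_real t + \<i> \<noteq> 0" "cmod (of_real t + \<i>) = sqrt (1 + t\<^sup>2)" for t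
    by (simp_all add: complex_eq_iff cmod_def add.commute)
  have "cayley a - cayley b = 2 * \<i> * of_real (a - b) / ((of_real a + \<i>) * (of_real b + \<i>))"
    unfolding cayley_def using n(1) by (simp add: divide_simps) (simp add: algebra_simps)
  then show ?thesis by (simp only: norm_divide norm_mult n(2)) (simp del: of_real_diff)
qed

text \<open>
Each chord is \<open>2 |x\<^sub>k - x\<^sub>l|\<close> divided by \<open>sqrt (1 + x\<^sub>k\<^sup>2) sqrt (1 + x\<^sub>l\<^sup>2)\<close>, and every index occurs in
\<open>n - 1\<close> chords. There are \<open>\<Sum>k<n. k\<close> chords.
\<close>
lemma chord_vandermonde:
  assumes "strict_mono_on {..<n} x"
  shows "(\<Prod>k<n. \<Prod>l\<in>{k<..<n}. cmod (cayley (x k) - cayley (x l))) * (\<Prod>j<n. sqrt (1 + (x j)\<^sup>2) ^ (n - 1)) =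
    2 ^ (\<Sum>k<n. k) * vandermonde n x"
  using assms
proof (induction n)
  case 0
  show ?case by (simp add: vandermonde_def)
next
  case (Suc n)
  let ?s = "\<lambda>j. sqrt (1 + (x j)\<^sup>2)" and ?d = "\<lambda>k l. cmod (cayley (x k) - cayley (x l))"
  have s: "?s j \<noteq> 0" for j using add_pos_nonneg[of 1 "(x j)\<^sup>2"] by simp
  have "{k<..<Suc n} = insert n {k<..<n}" if "k < n" for k using that by auto
  moreover have "{n<..<Suc n} = {}" by auto
  ultimately have D: "(\<Prod>k<Suc n. \<Prod>l\<in>{k<..<Suc n}. ?d k l) = (\<Prod>k<n. \<Prod>l\<in>{k<..<n}. ?d k l) * (\<Prod>k<n. ?d k n)"
    by (simp add: prod.distrib mult.commute)
  have "?d k n * ?s k * ?s n = 2 * (x n - x k)" if "k < n" for k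
    using that Suc.prems s unfolding cmod_cayley_diff by (auto simp: strict_mono_on_def abs_if)
  then have "(\<Prod>k<n. ?d k n * ?s k * ?s n) = (\<Prod>k<n. 2 * (x n - x k))" by (intro prod.cong) auto
  then have E: "(\<Prod>k<n. ?d k n) * (\<Prod>k<n. ?s k) * ?s n ^ n = 2 ^ n * (\<Prod>k<n. x n - x k)"
    by (simp only: prod.distrib prod_constant card_lessThan)
  have S: "(\<Prod>j<Suc n. ?s j ^ (Suc n - 1)) = (\<Prod>j<n. ?s j ^ (n - 1)) * (\<Prod>k<n. ?s k) * ?s n ^ n"
  proof (cases "n = 0")
    case False
    then have "?s j ^ n = ?s j ^ (n - 1) * ?s j" for j using power_minus_mult[of n "?s j"] by simp
    then have "(\<Prod>j<n. ?s j ^ n) = (\<Prod>j<n. ?s j ^ (n - 1)) * (\<Prod>k<n. ?s k)" by (simp only: prod.distrib)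
    then show ?thesis by (simp only: diff_Suc_1 prod.lessThan_Suc)
  qed simp
  have IH: "(\<Prod>k<n. \<Prod>l\<in>{k<..<n}. ?d k l) * (\<Prod>j<n. ?s j ^ (n - 1)) = 2 ^ (\<Sum>k<n. k) * vandermonde n x"
    by (rule Suc.IH) (rule monotone_on_subset[OF Suc.prems], auto)
  have "(\<Prod>k<Suc n. \<Prod>l\<in>{k<..<Suc n}. ?d k l) * (\<Prod>j<Suc n. ?s j ^ (Suc n - 1)) =
    ((\<Prod>k<n. \<Prod>l\<in>{k<..<n}. ?d k l) * (\<Prod>j<n. ?s j ^ (n - 1))) * ((\<Prod>k<n. ?d k n) * (\<Prod>k<n. ?s k) * ?s n ^ n)"
    unfolding D S by (simp only: mult_ac)
  also have "\<dots> = 2 ^ (\<Sum>k<Suc n. k) * vandermonde (Suc n) x"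
    unfolding IH E vandermonde_Suc by (simp add: power_add)
  finally show ?case .
qed

lemma circ_jacobi_weight_eigen_angle:
  assumes x: "increasing n x"
  shows "circ_jacobi_weight n \<delta> \<beta> (\<lambda>j\<in>{..<n}. eigen_angle (x j)) * (\<Prod>j<n. 2 / (1 + (x j)\<^sup>2)) =
    (2 ^ (\<Sum>k<n. k)) powr \<beta> * 2 ^ n * point_weight \<delta> \<beta> n x"
proof -
  let ?s = "\<lambda>j. sqrt (1 + (x j)\<^sup>2)" and ?d = "\<lambda>k l. cmod (cayley (x k) - cayley (x l))"
  let ?D = "\<Prod>k<n. \<Prod>l\<in>{k<..<n}. ?d k l" and ?J = "\<Prod>j<n. jacobi_weight \<delta> (cayley (x j))"
  let ?S = "\<Prod>j<n. ?s j ^ (n - 1)" and ?q = "\<lambda>j. 1 + (x j)\<^sup>2"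
  have q: "0 < ?q j" for j by (simp add: add_pos_nonneg)
  have xs: "strict_mono_on {..<n} x" using x by (simp add: increasing_def)
  have "circ_jacobi_weight n \<delta> \<beta> (\<lambda>j\<in>{..<n}. eigen_angle (x j)) = (\<Prod>k<n. \<Prod>l\<in>{k<..<n}. ?d k l powr \<beta>) * ?J"
    unfolding circ_jacobi_weight_def using eigen_angle_bounds
    by (auto simp: cis_eigen_angle intro!: arg_cong2[where f = "(*)"] prod.cong)
  also have "(\<Prod>k<n. \<Prod>l\<in>{k<..<n}. ?d k l powr \<beta>) = ?D powr \<beta>"
    by (simp add: prod_powr_distrib prod_nonneg)
  finally have W: "circ_jacobi_weight n \<delta> \<beta> (\<lambda>j\<in>{..<n}. eigen_angle (x j)) = ?D powr \<beta> * ?J" .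
  have S: "0 < ?S" by (intro prod_pos) (simp add: q)
  have "?D = 2 ^ (\<Sum>k<n. k) * vandermonde n x / ?S"
    by (rule eq_divide_imp) (use S in linarith, rule chord_vandermonde[OF xs])
  then have "?D powr \<beta> = (2 ^ (\<Sum>k<n. k)) powr \<beta> * vandermonde n x powr \<beta> * ?S powr (- \<beta>)"
    using S vandermonde_pos[OF xs] by (simp add: powr_mult powr_divide powr_minus_divide)
  also have "?S powr (- \<beta>) = (\<Prod>j<n. ?q j powr (- (\<beta> / 2 * real (n - 1))))"
  proof -
    have "(?s j ^ (n - 1)) powr (- \<beta>) = ?q j powr (- (\<beta> / 2 * real (n - 1)))" for j
      using q[of j] by (simp add: powr_half_sqrt[symmetric] powr_realpow[symmetric] powr_powr mult.commute)
    then show ?thesis using q by (subst prod_powr_distrib) (auto intro: zero_le_power less_imp_le)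
  qed
  finally have D: "?D powr \<beta> = (2 ^ (\<Sum>k<n. k)) powr \<beta> * vandermonde n x powr \<beta> * (\<Prod>j<n. ?q j powr (- (\<beta> / 2 * real (n - 1))))" .
  have "(\<Prod>j<n. 2 / ?q j) = 2 ^ n * (\<Prod>j<n. ?q j powr (-1))"
    by (simp add: powr_minus_divide prod_dividef less_imp_le[OF q])
  then show ?thesis
    unfolding W D point_weight_def
    by (simp add: powr_diff prod.distrib prod_dividef powr_minus_divide less_imp_le[OF q] mult_ac)
qed

section \<open>Symmetrisation over the random order\<close>

lemma circ_jacobi_weight_nonneg: "0 \<le> circ_jacobi_weight n \<delta> \<beta> \<theta>"
  unfolding circ_jacobi_weight_def
  by (auto intro!: mult_nonneg_nonneg prod_nonneg jacobi_weight_nonneg)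

lemma circ_jacobi_weight_measurable [measurable]: "circ_jacobi_weight n \<delta> \<beta> \<in> borel_measurable (lebesgue_pow n)"
proof -
  have 1 [measurable]: "(\<lambda>\<theta>. \<theta> j) \<in> borel_measurable (lebesgue_pow n)" if "j < n" for j using that by simp
  have "Measurable.pred (lebesgue_pow n) (\<lambda>\<theta>. \<forall>j\<in>{..<n}. 0 < \<theta> j \<and> \<theta> j < 2 * pi)" by measurable
  then have [measurable]: "Measurable.pred (lebesgue_pow n) (\<lambda>\<theta>. \<forall>j<n. 0 < \<theta> j \<and> \<theta> j < 2 * pi)"
    by (simp add: Ball_def)
  have "(\<lambda>\<theta>. \<Prod>k<n. \<Prod>l\<in>{k<..<n}. cmod (cis (\<theta> k) - cis (\<theta> l)) powr \<beta>) \<in> borel_measurable (lebesgue_pow n)"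
    by (intro borel_measurable_prod) measurable
  moreover have "(\<lambda>\<theta>. \<Prod>j<n. jacobi_weight \<delta> (cis (\<theta> j))) \<in> borel_measurable (lebesgue_pow n)"
    by (intro borel_measurable_prod measurable_compose[OF _ jacobi_weight_measurable] measurable_compose[OF 1 cis_measurable]) auto
  ultimately show ?thesis unfolding circ_jacobi_weight_def by measurable
qed

text \<open>
The triangular product over ordered pairs is not visibly symmetric; its square, the product over
all pairs of different indices, is.
\<close>
lemma prod_triangle_square:
  fixes g :: "nat \<Rightarrow> nat \<Rightarrow> real"
  assumes "\<And>k l. g k l = g l k"
  shows "(\<Prod>k<n. \<Prod>l\<in>{k<..<n}. g k l)\<^sup>2 = (\<Prod>k<n. \<Prod>l\<in>{..<n} - {k}. g k l)"
proof -
  have "(\<Prod>k<n. \<Prod>l\<in>{k<..<n}. g k l) = (\<Prod>k<n. \<Prod>l<k. g k l)"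
  proof -
    have "(\<Prod>k<n. \<Prod>l\<in>{k<..<n}. g k l) = (\<Prod>(k, l)\<in>(SIGMA k:{..<n}. {k<..<n}). g k l)" by (simp add: prod.Sigma)
    also have "\<dots> = (\<Prod>(k, l)\<in>(SIGMA k:{..<n}. {..<k}). g k l)"
      by (rule prod.reindex_bij_witness[of _ prod.swap prod.swap]) (auto simp: assms)
    also have "\<dots> = (\<Prod>k<n. \<Prod>l<k. g k l)" by (simp add: prod.Sigma)
    finally show ?thesis .
  qed
  moreover have "(\<Prod>l\<in>{..<n} - {k}. g k l) = (\<Prod>l\<in>{k<..<n}. g k l) * (\<Prod>l<k. g k l)" if "k < n" for k
  proof -
    have "{..<n} - {k} = {k<..<n} \<union> {..<k}" "{k<..<n} \<inter> {..<k} = {}" using that by auto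
    then show ?thesis by (simp add: prod.union_disjoint)
  qed
  ultimately show ?thesis by (simp add: prod.distrib power2_eq_square)
qed

text \<open>
By \<open>prod_triangle_square\<close> the square of the interaction term is symmetric, and the term itself is
nonnegative.
\<close>
lemma circ_jacobi_weight_permute:
  assumes p: "\<sigma> permutes {..<n}" and \<phi>: "\<And>j. j < n \<Longrightarrow> \<phi> j = \<theta> (\<sigma> j)"
  shows "circ_jacobi_weight n \<delta> \<beta> \<phi> = circ_jacobi_weight n \<delta> \<beta> \<theta>"
proof -
  let ?g = "\<lambda>\<theta> k l. cmod (cis (\<theta> k) - cis (\<theta> l)) powr \<beta>"
  let ?T = "\<lambda>\<theta>. \<Prod>k<n. \<Prod>l\<in>{k<..<n}. ?g \<theta> k l"
  have sq: "(?T \<theta>)\<^sup>2 = (\<Prod>k<n. \<Prod>l\<in>{..<n} - {k}. ?g \<theta> k l)" for \<theta> :: "nat \<Rightarrow> real"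
    by (rule prod_triangle_square) (simp add: norm_minus_commute)
  have "(?T \<phi>)\<^sup>2 = (\<Prod>k<n. \<Prod>l\<in>{..<n} - {k}. ?g \<theta> (\<sigma> k) (\<sigma> l))"
    unfolding sq by (intro prod.cong refl) (simp add: \<phi>)
  also have "\<dots> = (\<Prod>k<n. \<Prod>l\<in>{..<n} - {\<sigma> k}. ?g \<theta> (\<sigma> k) l)"
  proof (rule prod.cong[OF refl])
    fix k assume "k \<in> {..<n}"
    have "\<sigma> ` ({..<n} - {k}) = {..<n} - {\<sigma> k}"
      using permutes_inj[OF p] permutes_image[OF p] by (simp add: image_set_diff)
    then show "(\<Prod>l\<in>{..<n} - {k}. ?g \<theta> (\<sigma> k) (\<sigma> l)) = (\<Prod>l\<in>{..<n} - {\<sigma> k}. ?g \<theta> (\<sigma> k) l)"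
      using prod.reindex[OF inj_on_subset[OF permutes_inj[OF p] subset_UNIV], of "?g \<theta> (\<sigma> k)" "{..<n} - {k}"] by (simp add: comp_def)
  qed
  also have "\<dots> = (?T \<theta>)\<^sup>2"
    unfolding sq using prod.permute[OF p, of "\<lambda>k. \<Prod>l\<in>{..<n} - {k}. ?g \<theta> k l"] by (simp add: comp_def)
  finally have T: "?T \<phi> = ?T \<theta>" by (simp add: prod_nonneg)
  have J: "(\<Prod>j<n. jacobi_weight \<delta> (cis (\<phi> j))) = (\<Prod>j<n. jacobi_weight \<delta> (cis (\<theta> j)))"
    using prod.permute[OF p, of "\<lambda>j. jacobi_weight \<delta> (cis (\<theta> j))"] \<phi> by (simp add: comp_def)
  have "(\<forall>j<n. 0 < \<phi> j \<and> \<phi> j < 2 * pi) \<longleftrightarrow> (\<forall>j\<in>\<sigma> ` {..<n}. 0 < \<theta> j \<and> \<theta> j < 2 * pi)" using \<phi> by auto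
  then have "(\<forall>j<n. 0 < \<phi> j \<and> \<phi> j < 2 * pi) \<longleftrightarrow> (\<forall>j<n. 0 < \<theta> j \<and> \<theta> j < 2 * pi)"
    unfolding permutes_image[OF p] by auto
  then show ?thesis unfolding circ_jacobi_weight_def T J by simp
qed

text \<open>
Two coinciding angles give a factor \<open>0 powr \<beta> = 0\<close>. So the sequences that cannot be sorted
strictly drop out of the symmetrisation.
\<close>
lemma circ_jacobi_weight_not_inj:
  assumes "\<not> inj_on \<theta> {..<n}"
  shows "circ_jacobi_weight n \<delta> \<beta> \<theta> = 0"
proof -
  obtain k l where "k < n" "l < n" "k < l" "\<theta> k = \<theta> l"
    using assms unfolding inj_on_def by (metis lessThan_iff linorder_neqE_nat)
  then have "(\<Prod>k<n. \<Prod>l\<in>{k<..<n}. cmod (cis (\<theta> k) - cis (\<theta> l)) powr \<beta>) = 0"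
    by (intro prod_zero bexI[of _ k] bexI[of _ l]) auto
  then show ?thesis by (simp add: circ_jacobi_weight_def)
qed

lemma sorting_permutation_unique:
  assumes \<theta>: "inj_on \<theta> {..<n}"
  shows "card {\<sigma>. \<sigma> permutes {..<n} \<and> increasing n (\<lambda>j. \<theta> (\<sigma> j))} = 1"
proof -
  define L where "L = sorted_list_of_set (\<theta> ` {..<n})"
  have L: "sorted L" "distinct L" "set L = \<theta> ` {..<n}" "length L = n"
    using card_image[OF \<theta>] by (simp_all add: L_def)
  have L_unique: "map (\<lambda>j. \<theta> (\<sigma> j)) [0..<n] = L" if "\<sigma> permutes {..<n}" "increasing n (\<lambda>j. \<theta> (\<sigma> j))" for \<sigma>
  proof (rule sorted_distinct_set_unique)
    show "sorted (map (\<lambda>j. \<theta> (\<sigma> j)) [0..<n])"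
      using that(2) by (auto simp: sorted_iff_nth_mono_less increasing_def strict_mono_on_def intro: less_imp_le)
    show "distinct (map (\<lambda>j. \<theta> (\<sigma> j)) [0..<n])"
      using strict_mono_on_imp_inj_on[OF that(2)[unfolded increasing_def]] by (simp add: distinct_map atLeast0LessThan)
    show "set (map (\<lambda>j. \<theta> (\<sigma> j)) [0..<n]) = set L"
      using permutes_image[OF that(1)] by (simp add: L atLeast0LessThan image_image[symmetric, of \<theta> \<sigma>])
  qed (use L in auto)
  define \<tau> where "\<tau> j = (if j < n then the_inv_into {..<n} \<theta> (L ! j) else j)" for j
  have bL: "bij_betw (\<lambda>j. L ! j) {..<n} (\<theta> ` {..<n})" using bij_betw_nth[OF L(2), of "{..<n}" "\<theta> ` {..<n}"] L by simp
  have "bij_betw (\<lambda>j. the_inv_into {..<n} \<theta> (L ! j)) {..<n} {..<n}"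
    using bij_betw_trans[OF bL bij_betw_the_inv_into[of \<theta> "{..<n}" "\<theta> ` {..<n}"]] \<theta> by (simp add: comp_def bij_betw_def)
  then have "bij_betw \<tau> {..<n} {..<n}" by (subst bij_betw_cong[of _ \<tau>]) (auto simp: \<tau>_def)
  then have \<tau>: "\<tau> permutes {..<n}" by (rule bij_imp_permutes) (simp add: \<tau>_def)
  have \<theta>\<tau>: "\<theta> (\<tau> j) = L ! j" if "j < n" for j
  proof -
    have "L ! j \<in> \<theta> ` {..<n}" unfolding L(3)[symmetric] using that L(4) by simp
    then show ?thesis using f_the_inv_into_f[OF \<theta>] that by (simp add: \<tau>_def)
  qed
  have "increasing n (\<lambda>j. \<theta> (\<tau> j))"
  proof -
    have "sorted_wrt (<) L" using L by (simp add: strict_sorted_iff)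
    then show ?thesis using L(4) \<theta>\<tau> sorted_wrt_nth_less[of "(<)" L] by (simp add: increasing_def strict_mono_on_def)
  qed
  moreover have "\<sigma> = \<tau>" if s: "\<sigma> permutes {..<n}" "increasing n (\<lambda>j. \<theta> (\<sigma> j))" for \<sigma>
  proof
    fix j
    show "\<sigma> j = \<tau> j"
    proof (cases "j < n")
      case True
      have "\<theta> (\<sigma> j) = map (\<lambda>j. \<theta> (\<sigma> j)) [0..<n] ! j" using True by simp
      also have "\<dots> = \<theta> (\<tau> j)" unfolding L_unique[OF s] using \<theta>\<tau> True by simp
      finally show ?thesis using inj_onD[OF \<theta>, of "\<sigma> j" "\<tau> j"] True permutes_in_image[OF s(1)] permutes_in_image[OF \<tau>] by simp
    next
      case False
      then show ?thesis using permutes_not_in[OF s(1)] permutes_not_in[OF \<tau>] by simp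
    qed
  qed
  ultimately have "{\<sigma>. \<sigma> permutes {..<n} \<and> increasing n (\<lambda>j. \<theta> (\<sigma> j))} = {\<tau>}" using \<tau> by blast
  then show ?thesis by simp
qed

text \<open>
Moving the permutation from the test function to the domain of integration turns the sum into an
integral over all sequences, each of which is counted once: by its unique sorting permutation.
\<close>
lemma nn_integral_symmetrize:
  assumes [measurable]: "E \<in> borel_measurable (lebesgue_pow n)"
  shows "(\<integral>\<^sup>+\<theta>. (if increasing n \<theta> then ennreal (circ_jacobi_weight n \<delta> \<beta> \<theta>) *
      (\<Sum>\<sigma> | \<sigma> permutes {..<n}. E (\<lambda>j\<in>{..<n}. \<theta> (\<sigma> j))) else 0) \<partial>lebesgue_pow n) =
    (\<integral>\<^sup>+\<theta>. ennreal (circ_jacobi_weight n \<delta> \<beta> \<theta>) * E \<theta> \<partial>lebesgue_pow n)"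
proof -
  let ?S = "{\<sigma>. \<sigma> permutes {..<n}}" and ?w = "circ_jacobi_weight n \<delta> \<beta>"
  let ?G = "\<lambda>\<sigma> \<theta>. if increasing n \<theta> then ennreal (?w \<theta>) * E (\<lambda>j\<in>{..<n}. \<theta> (\<sigma> j)) else 0"
  have S: "finite ?S" by (rule finite_permutations) simp
  have 1: "(\<lambda>x. x j) \<in> borel_measurable (lebesgue_pow n)" if "j < n" for j using that by simp
  have [measurable]: "Measurable.pred (lebesgue_pow n) (increasing n)"
    using increasing_measurable[OF 1, of n "\<lambda>x. x"] by simp
  have rest: "(\<lambda>\<theta>. \<lambda>j\<in>{..<n}. \<theta> (\<sigma> j)) \<in> measurable (lebesgue_pow n) (lebesgue_pow n)" if "\<sigma> permutes {..<n}" for \<sigma>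
    by (rule measurable_restrict) (use permutes_in_image[OF that] in simp)
  have G: "?G \<sigma> \<in> borel_measurable (lebesgue_pow n)" if "\<sigma> \<in> ?S" for \<sigma>
  proof -
    have [measurable]: "(\<lambda>\<theta>. E (\<lambda>j\<in>{..<n}. \<theta> (\<sigma> j))) \<in> borel_measurable (lebesgue_pow n)"
      by (rule measurable_compose[OF rest assms]) (use that in simp)
    show ?thesis by measurable
  qed
  have inc: "increasing n (\<lambda>j\<in>{..<n}. f j) \<longleftrightarrow> increasing n f" for f :: "nat \<Rightarrow> real"
    by (simp add: increasing_def strict_mono_on_def)
  have shift: "(\<integral>\<^sup>+\<theta>. ?G \<sigma> \<theta> \<partial>lebesgue_pow n) =
      (\<integral>\<^sup>+\<theta>. (if increasing n (\<lambda>j. \<theta> (inv_into UNIV \<sigma> j)) then ennreal (?w \<theta>) * E \<theta> else 0) \<partial>lebesgue_pow n)" if "\<sigma> \<in> ?S" for \<sigma>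
  proof -
    have \<sigma>: "\<sigma> permutes {..<n}" and i: "inv_into UNIV \<sigma> permutes {..<n}" using that permutes_inv by auto
    have "(\<integral>\<^sup>+\<theta>. ?G \<sigma> \<theta> \<partial>lebesgue_pow n) = (\<integral>\<^sup>+\<theta>. ?G \<sigma> (\<lambda>j\<in>{..<n}. \<theta> (inv_into UNIV \<sigma> j)) \<partial>lebesgue_pow n)"
      using nn_integral_PiM_reindex[of "\<lambda>_. lborel" "{..<n}" "inv_into UNIV \<sigma>" "{..<n}" "?G \<sigma>"] permutes_imp_bij[OF i] G[OF that]
      by (simp add: sigma_finite_lborel)
    also have "\<dots> = (\<integral>\<^sup>+\<theta>. (if increasing n (\<lambda>j. \<theta> (inv_into UNIV \<sigma> j)) then ennreal (?w \<theta>) * E \<theta> else 0) \<partial>lebesgue_pow n)"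
    proof (rule nn_integral_cong)
      fix \<theta> assume \<theta>: "\<theta> \<in> space (lebesgue_pow n)"
      have "(\<lambda>j\<in>{..<n}. (\<lambda>j\<in>{..<n}. \<theta> (inv_into UNIV \<sigma> j)) (\<sigma> j)) = \<theta>"
      proof
        fix j
        show "(\<lambda>j\<in>{..<n}. (\<lambda>j\<in>{..<n}. \<theta> (inv_into UNIV \<sigma> j)) (\<sigma> j)) j = \<theta> j"
        proof (cases "j < n")
          case True
          then have "\<sigma> j < n" using permutes_in_image[OF \<sigma>, of j] by simp
          then show ?thesis using True permutes_inverses(2)[OF \<sigma>, of j] by simp
        next
          case False
          then show ?thesis using \<theta> PiE_arb[of \<theta> "{..<n}" "\<lambda>_. UNIV" j] by (simp add: space_PiM)
        qed
      qed
      moreover have "?w (\<lambda>j\<in>{..<n}. \<theta> (inv_into UNIV \<sigma> j)) = ?w \<theta>" by (rule circ_jacobi_weight_permute[OF i]) simp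
      ultimately show "?G \<sigma> (\<lambda>j\<in>{..<n}. \<theta> (inv_into UNIV \<sigma> j)) = (if increasing n (\<lambda>j. \<theta> (inv_into UNIV \<sigma> j)) then ennreal (?w \<theta>) * E \<theta> else 0)"
        unfolding inc by simp
    qed
    finally show ?thesis .
  qed
  have "(\<integral>\<^sup>+\<theta>. (if increasing n \<theta> then ennreal (?w \<theta>) * (\<Sum>\<sigma>\<in>?S. E (\<lambda>j\<in>{..<n}. \<theta> (\<sigma> j))) else 0) \<partial>lebesgue_pow n) =
      (\<integral>\<^sup>+\<theta>. (\<Sum>\<sigma>\<in>?S. ?G \<sigma> \<theta>) \<partial>lebesgue_pow n)"
    by (intro nn_integral_cong) (simp add: sum_distrib_left)
  also have "\<dots> = (\<Sum>\<sigma>\<in>?S. \<integral>\<^sup>+\<theta>. ?G \<sigma> \<theta> \<partial>lebesgue_pow n)" by (rule nn_integral_sum[OF G])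
  also have "\<dots> = (\<Sum>\<sigma>\<in>?S. \<integral>\<^sup>+\<theta>. (if increasing n (\<lambda>j. \<theta> (inv_into UNIV \<sigma> j)) then ennreal (?w \<theta>) * E \<theta> else 0) \<partial>lebesgue_pow n)"
    by (rule sum.cong[OF refl shift])
  also have "\<dots> = (\<Sum>\<sigma>\<in>?S. \<integral>\<^sup>+\<theta>. (if increasing n (\<lambda>j. \<theta> (\<sigma> j)) then ennreal (?w \<theta>) * E \<theta> else 0) \<partial>lebesgue_pow n)"
    by (rule sum_permutations_inverse[symmetric])
  also have "\<dots> = (\<integral>\<^sup>+\<theta>. (\<Sum>\<sigma>\<in>?S. (if increasing n (\<lambda>j. \<theta> (\<sigma> j)) then ennreal (?w \<theta>) * E \<theta> else 0)) \<partial>lebesgue_pow n)"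
  proof (rule nn_integral_sum[symmetric])
    fix \<sigma> assume "\<sigma> \<in> ?S"
    then have [measurable]: "Measurable.pred (lebesgue_pow n) (\<lambda>\<theta>. increasing n (\<lambda>j. \<theta> (\<sigma> j)))"
      by (intro increasing_measurable) (use permutes_in_image in fastforce)
    show "(\<lambda>\<theta>. if increasing n (\<lambda>j. \<theta> (\<sigma> j)) then ennreal (?w \<theta>) * E \<theta> else 0) \<in> borel_measurable (lebesgue_pow n)" by measurable
  qed
  also have "\<dots> = (\<integral>\<^sup>+\<theta>. ennreal (?w \<theta>) * E \<theta> \<partial>lebesgue_pow n)"
  proof (rule nn_integral_cong)
    fix \<theta> :: "nat \<Rightarrow> real"
    have "(\<Sum>\<sigma>\<in>?S. (if increasing n (\<lambda>j. \<theta> (\<sigma> j)) then a else 0)) = of_nat (card {\<sigma>. \<sigma> permutes {..<n} \<and> increasing n (\<lambda>j. \<theta> (\<sigma> j))}) * a" for a :: ennreal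
      unfolding sum.inter_filter[OF S, symmetric] by simp
    then show "(\<Sum>\<sigma>\<in>?S. (if increasing n (\<lambda>j. \<theta> (\<sigma> j)) then ennreal (?w \<theta>) * E \<theta> else 0)) = ennreal (?w \<theta>) * E \<theta>"
      using sorting_permutation_unique[of \<theta> n] circ_jacobi_weight_not_inj[of \<theta> n \<delta> \<beta>] by (cases "inj_on \<theta> {..<n}") auto
  qed
  finally show ?thesis .
qed

section \<open>The circular Jacobi density\<close>

text \<open>
The first \<open>m\<close> coefficients lie in the open disc, so the recursion for the characteristic polynomial is
available at every point of the space.
\<close>
lemma eigenangles_Xi_product:
  assumes \<gamma>: "\<gamma> \<in> space (eta_law (Suc m) \<delta> \<beta>)"
  shows "eigenangles (Xi_product (Suc m) \<gamma>) ! i = seq_angle (Suc m) i (fst_seq m (\<lambda>k. \<gamma> (m - k)))"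
proof -
  let ?p = "char_poly (Xi_product (Suc m) \<gamma>)"
  have "cmod (\<gamma> k) < 1" if "k < m" for k
    using PiE_mem[OF \<gamma>[unfolded eta_law_level_law space_PiM], of k] that by (simp add: space_level_law)
  then have "value_seq ?p = fst_seq m (\<lambda>k. \<gamma> (m - k))"
    unfolding value_seq_def fst_seq_def by (simp add: poly_char_poly_Xi_product)
  moreover have "monic_of_degree (Suc m) ?p"
    using degree_monic_char_poly[OF Xi_product_carrier[of "Suc m" \<gamma>]] by (simp add: monic_of_degree_def)
  ultimately show ?thesis
    using seq_angle_value_seq[of "Suc m" ?p i] by (simp add: eigenangles_def poly_angles_def)
qed

text \<open>
Substitute \<open>\<theta> = eigen_angle x\<close> in \<open>eta_law_line_integral\<close>: the sorted angles are a function of the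
polynomial values, and the Jacobian turns \<open>point_weight\<close> into the circular weight.
\<close>
lemma increasing_eigenangle_integral:
  obtains C where "\<And>g. g \<in> borel_measurable (lebesgue_pow (Suc m)) \<Longrightarrow>
    (\<integral>\<^sup>+\<gamma>. g (\<lambda>j\<in>{..<Suc m}. eigenangles (Xi_product (Suc m) \<gamma>) ! j) \<partial>eta_law (Suc m) \<delta> \<beta>) =
    C * (\<integral>\<^sup>+\<theta>. (if increasing (Suc m) \<theta> then ennreal (circ_jacobi_weight (Suc m) \<delta> \<beta> \<theta>) * g \<theta> else 0) \<partial>lebesgue_pow (Suc m))"
proof -
  define n where "n = Suc m"
  let ?w = "circ_jacobi_weight n \<delta> \<beta>"
  obtain C where C: "\<And>g. g \<in> borel_measurable complex_seq \<Longrightarrow>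
    (\<integral>\<^sup>+\<gamma>. g (fst_seq m (\<lambda>k. \<gamma> (m - k))) \<partial>eta_law n \<delta> \<beta>) =
    C * (\<integral>\<^sup>+x. (if increasing n x then ennreal (point_weight \<delta> \<beta> n x) * g (node_seq n x) else 0) \<partial>lebesgue_pow n)"
    using eta_law_line_integral[OF n_def] by blast
  define K where "K = (2 ^ (\<Sum>k<n. k)) powr \<beta> * (2 :: real) ^ n"
  have K: "0 < K" by (simp add: K_def)
  have 1: "(\<lambda>x. x j) \<in> borel_measurable (lebesgue_pow n)" if "j < n" for j using that by simp
  have inc [measurable]: "Measurable.pred (lebesgue_pow n) (increasing n)"
    using increasing_measurable[OF 1, of n "\<lambda>x. x"] by simp
  have ea [measurable]: "eigen_angle \<in> borel_measurable borel" unfolding eigen_angle_def by measurable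
  have rest [measurable]: "(\<lambda>x. \<lambda>j\<in>{..<n}. eigen_angle (x j)) \<in> measurable (lebesgue_pow n) (lebesgue_pow n)"
    by (rule measurable_restrict) measurable
  have pw: "K * point_weight \<delta> \<beta> n x = ?w (\<lambda>j\<in>{..<n}. eigen_angle (x j)) * (\<Prod>j<n. 2 / (1 + (x j)\<^sup>2))" if "increasing n x" for x
    unfolding K_def by (rule circ_jacobi_weight_eigen_angle[OF that, symmetric])
  have inc_angle: "increasing n (\<lambda>j\<in>{..<n}. eigen_angle (x j)) \<longleftrightarrow> increasing n x" for x
    by (simp add: increasing_def strict_mono_on_def strict_mono_less[OF eigen_angle_strict_mono])
  have "(\<integral>\<^sup>+\<gamma>. g (\<lambda>j\<in>{..<n}. eigenangles (Xi_product n \<gamma>) ! j) \<partial>eta_law n \<delta> \<beta>) =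
    C / ennreal K * (\<integral>\<^sup>+\<theta>. (if increasing n \<theta> then ennreal (?w \<theta>) * g \<theta> else 0) \<partial>lebesgue_pow n)"
    if g [measurable]: "g \<in> borel_measurable (lebesgue_pow n)" for g
  proof -
    let ?G = "\<lambda>P. g (\<lambda>j\<in>{..<n}. seq_angle n j P)"
    have G: "?G \<in> borel_measurable complex_seq"
      by (rule measurable_compose[OF _ g]) (rule measurable_restrict, simp add: seq_angle_measurable)
    let ?F = "\<lambda>\<theta>. if increasing n \<theta> then ennreal (?w \<theta>) * g \<theta> else 0"
    have F: "?F \<in> borel_measurable (lebesgue_pow n)" by measurable
    have "(\<integral>\<^sup>+\<gamma>. g (\<lambda>j\<in>{..<n}. eigenangles (Xi_product n \<gamma>) ! j) \<partial>eta_law n \<delta> \<beta>) =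
      (\<integral>\<^sup>+\<gamma>. ?G (fst_seq m (\<lambda>k. \<gamma> (m - k))) \<partial>eta_law n \<delta> \<beta>)"
      unfolding n_def by (intro nn_integral_cong) (simp add: eigenangles_Xi_product cong: restrict_cong)
    also have "\<dots> = C * (\<integral>\<^sup>+x. (if increasing n x then ennreal (point_weight \<delta> \<beta> n x) * ?G (node_seq n x) else 0) \<partial>lebesgue_pow n)"
      by (rule C[OF G])
    also have "(\<integral>\<^sup>+x. (if increasing n x then ennreal (point_weight \<delta> \<beta> n x) * ?G (node_seq n x) else 0) \<partial>lebesgue_pow n) =
      (\<integral>\<^sup>+x. inverse (ennreal K) * (?F (\<lambda>j\<in>{..<n}. eigen_angle (x j)) * ennreal (\<Prod>j<n. 2 / (1 + (x j)\<^sup>2))) \<partial>lebesgue_pow n)"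
    proof (rule nn_integral_cong)
      fix x :: "nat \<Rightarrow> real"
      show "(if increasing n x then ennreal (point_weight \<delta> \<beta> n x) * ?G (node_seq n x) else 0) =
        inverse (ennreal K) * (?F (\<lambda>j\<in>{..<n}. eigen_angle (x j)) * ennreal (\<Prod>j<n. 2 / (1 + (x j)\<^sup>2)))"
      proof (cases "increasing n x")
        case True
        have "(\<lambda>j\<in>{..<n}. seq_angle n j (node_seq n x)) = (\<lambda>j\<in>{..<n}. eigen_angle (x j))"
          by (rule restrict_ext) (simp add: seq_angle_node_seq[OF True])
        moreover have "ennreal (point_weight \<delta> \<beta> n x) = inverse (ennreal K) * (ennreal (?w (\<lambda>j\<in>{..<n}. eigen_angle (x j))) * ennreal (\<Prod>j<n. 2 / (1 + (x j)\<^sup>2)))"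
        proof -
          have "ennreal (?w (\<lambda>j\<in>{..<n}. eigen_angle (x j))) * ennreal (\<Prod>j<n. 2 / (1 + (x j)\<^sup>2)) = ennreal (K * point_weight \<delta> \<beta> n x)"
            unfolding pw[OF True] by (rule ennreal_mult'[symmetric, OF circ_jacobi_weight_nonneg])
          moreover have "inverse (ennreal K) * ennreal (K * point_weight \<delta> \<beta> n x) = ennreal (point_weight \<delta> \<beta> n x)"
            using K by (simp add: inverse_ennreal ennreal_mult'[symmetric] field_simps)
          ultimately show ?thesis by simp
        qed
        ultimately show ?thesis using True unfolding inc_angle by (simp only: if_True mult_ac)
      qed (simp add: inc_angle)
    qed
    also have "\<dots> = inverse (ennreal K) * (\<integral>\<^sup>+x. ?F (\<lambda>j\<in>{..<n}. eigen_angle (x j)) * ennreal (\<Prod>j<n. 2 / (1 + (x j)\<^sup>2)) \<partial>lebesgue_pow n)"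
      by (rule nn_integral_cmult) (intro borel_measurable_times_ennreal measurable_compose[OF rest F], measurable)
    also have "(\<integral>\<^sup>+x. ?F (\<lambda>j\<in>{..<n}. eigen_angle (x j)) * ennreal (\<Prod>j<n. 2 / (1 + (x j)\<^sup>2)) \<partial>lebesgue_pow n) =
      (\<integral>\<^sup>+\<theta>. (if \<forall>j\<in>{..<n}. 0 < \<theta> j \<and> \<theta> j < 2 * pi then ?F \<theta> else 0) \<partial>lebesgue_pow n)"
      by (rule nn_integral_eigen_angle_pow[OF F, symmetric])
    also have "\<dots> = (\<integral>\<^sup>+\<theta>. ?F \<theta> \<partial>lebesgue_pow n)"
    proof (rule nn_integral_cong)
      fix \<theta> :: "nat \<Rightarrow> real"
      have w0: "?w \<theta> = 0" if "\<not> (\<forall>j\<in>{..<n}. 0 < \<theta> j \<and> \<theta> j < 2 * pi)"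
        using that by (auto simp: circ_jacobi_weight_def)
      show "(if \<forall>j\<in>{..<n}. 0 < \<theta> j \<and> \<theta> j < 2 * pi then ?F \<theta> else 0) = ?F \<theta>"
      proof (cases "\<forall>j\<in>{..<n}. 0 < \<theta> j \<and> \<theta> j < 2 * pi")
        case True
        show ?thesis unfolding if_P[OF True] ..
      next
        case False
        show ?thesis unfolding if_not_P[OF False] w0[OF False] by simp
      qed
    qed
    finally show ?thesis by (simp only: divide_ennreal_def mult.assoc)
  qed
  then show thesis using that unfolding n_def by blast
qed

theorem theorem4p1:
  fixes M :: "'a measure" and \<Gamma> :: "'a \<Rightarrow> nat \<Rightarrow> complex"
    and n :: nat and \<delta> :: complex and \<beta> :: real
  assumes "n \<ge> 1" and "Re \<delta> > - 1 / 2" and "\<beta> > 0"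
    and "prob_space M"
    and "\<Gamma> \<in> measurable M (eta_law n \<delta> \<beta>)"
    and "distr M (eta_law n \<delta> \<beta>) \<Gamma> = eta_law n \<delta> \<beta>"
  shows "has_eigenangle_density n M (\<lambda>\<omega>. Xi_product n (\<Gamma> \<omega>)) (circ_jacobi_density n \<delta> \<beta>)"
proof -
  note \<Gamma> = assms(5) and law = assms(6)
  interpret M: prob_space M by fact
  obtain m where m: "n = Suc m" using assms(1) by (cases n) auto
  let ?w = "circ_jacobi_weight n \<delta> \<beta>" and ?S = "{\<sigma>. \<sigma> permutes {..<n}}"
  let ?U = "uniform_count_measure ?S"
  let ?A = "\<lambda>\<gamma>. \<lambda>j\<in>{..<n}. eigenangles (Xi_product n \<gamma>) ! j"
  have S: "finite ?S" "?S \<noteq> {}" using finite_permutations[of "{..<n}"] permutes_id by blast+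
  interpret U: prob_space ?U by (rule prob_space_uniform_count_measure[OF S])
  interpret MU: pair_prob_space M ?U ..
  have angle: "(\<lambda>\<gamma>. eigenangles (Xi_product n \<gamma>) ! i) \<in> borel_measurable (eta_law n \<delta> \<beta>)" if "i < n" for i
  proof -
    have "(\<lambda>\<gamma>. fst_seq m (\<lambda>k. \<gamma> (m - k))) \<in> measurable (eta_law n \<delta> \<beta>) complex_seq"
      unfolding eta_law_level_law by (rule fst_seq_measurable) (rule level_law_coordinate_measurable, simp add: m)
    from measurable_compose[OF this seq_angle_measurable[OF that]]
    show ?thesis unfolding m by (subst measurable_cong[OF eigenangles_Xi_product])
  qed
  have \<sigma>_coord: "(\<lambda>\<sigma>. \<sigma> j) \<in> measurable ?U (count_space {..<n})" if "j < n" for j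
  proof -
    have "sets ?U = sets (count_space ?S)" by (simp add: sets_uniform_count_measure)
    moreover have "(\<lambda>\<sigma>. \<sigma> j) \<in> measurable (count_space ?S) (count_space {..<n})"
      using that permutes_in_image[of _ "{..<n}" j] by auto
    ultimately show ?thesis using measurable_cong_sets[of ?U "count_space ?S"] by blast
  qed
  define X where "X = (\<lambda>(\<omega>, \<sigma>). \<lambda>j\<in>{..<n}. eigenangles (Xi_product n (\<Gamma> \<omega>)) ! \<sigma> j)"
  have X: "X \<in> measurable (M \<Otimes>\<^sub>M ?U) (lebesgue_pow n)"
    unfolding X_def split_beta
  proof (rule measurable_restrict)
    fix j assume j: "j \<in> {..<n}"
    have "(\<lambda>z. eigenangles (Xi_product n (\<Gamma> (fst z))) ! snd z j) \<in> borel_measurable (M \<Otimes>\<^sub>M ?U)"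
    proof (rule measurable_compose_countable'[where g = "\<lambda>z. snd z j" and I = "{..<n}"])
      show "(\<lambda>z. eigenangles (Xi_product n (\<Gamma> (fst z))) ! i) \<in> borel_measurable (M \<Otimes>\<^sub>M ?U)" if "i \<in> {..<n}" for i
        using measurable_compose[OF measurable_compose[OF measurable_fst \<Gamma>] angle] that by simp
      show "(\<lambda>z. snd z j) \<in> measurable (M \<Otimes>\<^sub>M ?U) (count_space {..<n})"
        using measurable_compose[OF measurable_snd \<sigma>_coord] j by simp
    qed simp
    then show "(\<lambda>z. eigenangles (Xi_product n (\<Gamma> (fst z))) ! snd z j) \<in> measurable (M \<Otimes>\<^sub>M ?U) lborel" by simp
  qed
  interpret D: prob_space "distr (M \<Otimes>\<^sub>M ?U) (lebesgue_pow n) X" by (rule MU.prob_space_distr[OF X])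
  obtain C where C: "\<And>g. g \<in> borel_measurable (lebesgue_pow n) \<Longrightarrow> (\<integral>\<^sup>+\<gamma>. g (?A \<gamma>) \<partial>eta_law n \<delta> \<beta>) =
      C * (\<integral>\<^sup>+\<theta>. (if increasing n \<theta> then ennreal (?w \<theta>) * g \<theta> else 0) \<partial>lebesgue_pow n)"
    using increasing_eigenangle_integral[of m \<delta> \<beta>] unfolding m by blast
  \<comment> \<open>The constant \<open>c\<close> is identified below from the total mass of a probability measure.\<close>
  define c where "c = C * ennreal (1 / card ?S)"
  have em: "emeasure (distr (M \<Otimes>\<^sub>M ?U) (lebesgue_pow n) X) E = c * (\<integral>\<^sup>+\<theta>. ennreal (?w \<theta>) * indicator E \<theta> \<partial>lebesgue_pow n)"
    if E [measurable]: "E \<in> sets (lebesgue_pow n)" for E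
  proof -
    let ?g = "\<lambda>\<theta>. ennreal (1 / card ?S) * (\<Sum>\<sigma>\<in>?S. indicator E (\<lambda>j\<in>{..<n}. \<theta> (\<sigma> j)) :: ennreal)"
    have rest: "(\<lambda>\<theta>. \<lambda>j\<in>{..<n}. \<theta> (\<sigma> j)) \<in> measurable (lebesgue_pow n) (lebesgue_pow n)" if "\<sigma> permutes {..<n}" for \<sigma>
      by (rule measurable_restrict) (use permutes_in_image[OF that] in simp)
    have s: "(\<lambda>\<theta>. \<Sum>\<sigma>\<in>?S. indicator E (\<lambda>j\<in>{..<n}. \<theta> (\<sigma> j)) :: ennreal) \<in> borel_measurable (lebesgue_pow n)"
      by (intro borel_measurable_sum measurable_compose[OF rest borel_measurable_indicator[OF E]]) simp
    have g: "?g \<in> borel_measurable (lebesgue_pow n)" by (intro borel_measurable_times_ennreal s) simp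
    have A: "?A \<in> measurable (eta_law n \<delta> \<beta>) (lebesgue_pow n)"
      by (rule measurable_restrict) (simp add: angle)
    have "emeasure (distr (M \<Otimes>\<^sub>M ?U) (lebesgue_pow n) X) E = (\<integral>\<^sup>+\<theta>. indicator E \<theta> \<partial>distr (M \<Otimes>\<^sub>M ?U) (lebesgue_pow n) X)"
      by (rule nn_integral_indicator[symmetric]) simp
    also have "\<dots> = (\<integral>\<^sup>+z. indicator E (X z) \<partial>(M \<Otimes>\<^sub>M ?U))"
      by (rule nn_integral_distr[OF X]) simp
    also have "\<dots> = (\<integral>\<^sup>+\<omega>. \<integral>\<^sup>+\<sigma>. indicator E (X (\<omega>, \<sigma>)) \<partial>?U \<partial>M)"
      by (rule U.nn_integral_fst[symmetric]) (rule measurable_compose[OF X borel_measurable_indicator[OF E]])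
    also have "\<dots> = (\<integral>\<^sup>+\<omega>. ?g (?A (\<Gamma> \<omega>)) \<partial>M)"
    proof (rule nn_integral_cong)
      fix \<omega>
      have "X (\<omega>, \<sigma>) = (\<lambda>j\<in>{..<n}. ?A (\<Gamma> \<omega>) (\<sigma> j))" if "\<sigma> \<in> ?S" for \<sigma>
        unfolding X_def prod.case by (rule restrict_ext) (use permutes_in_image that in fastforce)
      then show "(\<integral>\<^sup>+\<sigma>. indicator E (X (\<omega>, \<sigma>)) \<partial>?U) = ?g (?A (\<Gamma> \<omega>))"
        unfolding uniform_count_measure_def using S(1)
        by (simp add: nn_integral_point_measure_finite sum_distrib_left)
    qed
    also have "\<dots> = (\<integral>\<^sup>+\<gamma>. ?g (?A \<gamma>) \<partial>distr M (eta_law n \<delta> \<beta>) \<Gamma>)"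
      by (rule nn_integral_distr[OF \<Gamma>, symmetric]) (simp only: measurable_distr_eq1 measurable_compose[OF A g])
    also have "\<dots> = C * (\<integral>\<^sup>+\<theta>. (if increasing n \<theta> then ennreal (?w \<theta>) * ?g \<theta> else 0) \<partial>lebesgue_pow n)"
      unfolding law by (rule C[OF g])
    also have "(\<integral>\<^sup>+\<theta>. (if increasing n \<theta> then ennreal (?w \<theta>) * ?g \<theta> else 0) \<partial>lebesgue_pow n) =
      (\<integral>\<^sup>+\<theta>. ennreal (1 / card ?S) * (if increasing n \<theta> then ennreal (?w \<theta>) * (\<Sum>\<sigma>\<in>?S. indicator E (\<lambda>j\<in>{..<n}. \<theta> (\<sigma> j))) else 0) \<partial>lebesgue_pow n)"
      by (intro nn_integral_cong) (auto simp: mult_ac)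
    also have "\<dots> = ennreal (1 / card ?S) * (\<integral>\<^sup>+\<theta>. (if increasing n \<theta> then ennreal (?w \<theta>) * (\<Sum>\<sigma>\<in>?S. indicator E (\<lambda>j\<in>{..<n}. \<theta> (\<sigma> j))) else 0) \<partial>lebesgue_pow n)"
    proof (rule nn_integral_cmult)
      have 1: "(\<lambda>x. x j) \<in> borel_measurable (lebesgue_pow n)" if "j < n" for j using that by simp
      have [measurable]: "Measurable.pred (lebesgue_pow n) (increasing n)"
        using increasing_measurable[OF 1, of n "\<lambda>x. x"] by simp
      note [measurable] = s
      show "(\<lambda>\<theta>. if increasing n \<theta> then ennreal (?w \<theta>) * (\<Sum>\<sigma>\<in>?S. indicator E (\<lambda>j\<in>{..<n}. \<theta> (\<sigma> j))) else 0) \<in> borel_measurable (lebesgue_pow n)"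
        by measurable
    qed
    also have "(\<integral>\<^sup>+\<theta>. (if increasing n \<theta> then ennreal (?w \<theta>) * (\<Sum>\<sigma>\<in>?S. indicator E (\<lambda>j\<in>{..<n}. \<theta> (\<sigma> j))) else 0) \<partial>lebesgue_pow n) =
      (\<integral>\<^sup>+\<theta>. ennreal (?w \<theta>) * indicator E \<theta> \<partial>lebesgue_pow n)"
      by (rule nn_integral_symmetrize) measurable
    finally show ?thesis unfolding c_def by (simp only: mult.assoc)
  qed
  define Z where "Z = (\<integral>\<^sup>+\<theta>. ennreal (?w \<theta>) \<partial>lebesgue_pow n)"
  have cZ: "c * Z = 1"
  proof -
    have "c * Z = c * (\<integral>\<^sup>+\<theta>. ennreal (?w \<theta>) * indicator (space (lebesgue_pow n)) \<theta> \<partial>lebesgue_pow n)"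
      unfolding Z_def by (intro arg_cong[where f = "(*) c"] nn_integral_cong) simp
    also have "\<dots> = 1" using em[OF sets.top] D.emeasure_space_1 by simp
    finally show ?thesis .
  qed
  \<comment> \<open>Total mass \<open>1\<close> forces the weight to be integrable with positive integral, so the Bochner integral
    in the definition of the density is \<open>Z\<close>.\<close>
  have Z: "Z \<noteq> 0" "Z \<noteq> \<top>" using cZ by (auto simp: ennreal_mult_top split: if_splits)
  then obtain z where z: "Z = ennreal z" "0 < z" by (cases Z) (auto simp: less_le)
  have "(\<integral>\<phi>. ?w \<phi> \<partial>lebesgue_pow n) = z"
    using z by (subst integral_eq_nn_integral) (auto simp: Z_def[symmetric] circ_jacobi_weight_nonneg)
  then have f: "ennreal (circ_jacobi_density n \<delta> \<beta> \<theta>) = ennreal (?w \<theta>) / Z" for \<theta>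
    unfolding circ_jacobi_density_def using z by (simp add: divide_ennreal circ_jacobi_weight_nonneg)
  have c: "c = 1 / Z"
  proof -
    have "c = c * (Z / Z)" using Z by (simp add: ennreal_divide_self less_top)
    also have "\<dots> = 1 / Z" unfolding ennreal_times_divide cZ ..
    finally show ?thesis .
  qed
  have "distr (M \<Otimes>\<^sub>M ?U) (lebesgue_pow n) X = density (lebesgue_pow n) (\<lambda>\<theta>. ennreal (circ_jacobi_density n \<delta> \<beta> \<theta>))"
    unfolding f
  proof (rule measure_eqI)
    fix E assume "E \<in> sets (distr (M \<Otimes>\<^sub>M ?U) (lebesgue_pow n) X)"
    then have E [measurable]: "E \<in> sets (lebesgue_pow n)" by simp
    have "emeasure (density (lebesgue_pow n) (\<lambda>\<theta>. ennreal (?w \<theta>) / Z)) E = (\<integral>\<^sup>+\<theta>. ennreal (?w \<theta>) / Z * indicator E \<theta> \<partial>lebesgue_pow n)"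
      by (rule emeasure_density) measurable
    also have "\<dots> = (\<integral>\<^sup>+\<theta>. c * (ennreal (?w \<theta>) * indicator E \<theta>) \<partial>lebesgue_pow n)"
      unfolding c divide_ennreal_def by (simp only: mult_ac mult_1_left)
    also have "\<dots> = emeasure (distr (M \<Otimes>\<^sub>M ?U) (lebesgue_pow n) X) E"
      unfolding em[OF E] by (rule nn_integral_cmult) measurable
    finally show "emeasure (distr (M \<Otimes>\<^sub>M ?U) (lebesgue_pow n) X) E = emeasure (density (lebesgue_pow n) (\<lambda>\<theta>. ennreal (?w \<theta>) / Z)) E" ..
  qed simp
  moreover have "(\<lambda>\<theta>. ennreal (circ_jacobi_density n \<delta> \<beta> \<theta>)) \<in> borel_measurable (lebesgue_pow n)"
    unfolding f by measurable
  ultimately show ?thesis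
    unfolding has_eigenangle_density_def distributed_def using X unfolding X_def by blast
qed

end
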